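(* Let $n\ge1$, $\mathrm s\in(0,n)$, $\gamma\ge0$, $\alpha>0$, $\mathrm g_{\mathrm s}(u,x)=|x-u|^{-\mathrm s}$ and $V(x)=|x|^\alpha$ for $u,x\in\mathbb R^n$. Consider the Gibbs measure on $(\mathbb R^n)^N$ $$\mathbb P_N[d\mathbf x]=\frac1{\mathrm Z_N^{(V)}}\exp\Big(-\beta\sum_{1\le i<j\le N}\mathrm g_{\mathrm s}(x_i,x_j)-\sum_{j=1}^NV(x_j)\Big)dx_1\cdots dx_N .$$ For any $\upsilon\in\mathbb S^{n-1}$, let $\psi\in SO(n)$ be such that $\psi(e_1)=\upsilon$ and set $$\varphi_N(x)=\eta_N\big(\upsilon+\alpha^{-1}\eta_N^{-\alpha}\psi(x)\big),\qquad \eta_N=(\log N)^{1/\alpha}\Big(1-\frac{n(\alpha-1)}{\alpha^2}\frac{\log\log N}{\log N}-\frac{\log(\alpha^n\mathrm L_\gamma)}{\alpha\log N}\Big).$$ Then, under $\mathbb P_N$, the point process $\Xi_N=\sum_{j=1}^N\boldsymbol\delta_{\varphi_N^{-1}(x_j)}$ converges in distribution, as $N\beta\to\gamma$ and $N\to+\infty$, to a Poisson point process on $\mathbb R^n$ with intensity $\theta(x)=e^{-e_1\cdot x}$.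
   Context: Here $\beta=\beta_N>0$ may depend on $N$, $\mathrm Z_N^{(V)}$ is the normalizing constant, $|\cdot|$ is the Euclidean norm, and $e_1$ is the first vector of the canonical basis of $\mathbb R^n$. The constant $\mathrm L_\gamma>0$: let $\mathcal M(\mathbb R^n)$ be the Borel probability measures on $\mathbb R^n$, $\mu_0$ the probability measure proportional to $e^{-V(x)}dx$, $\mathrm H(\mu|\mu_0)=\int\log\frac{d\mu}{d\mu_0}d\mu$ if $\mu\ll\mu_0$ and $+\infty$ otherwise, and $\mathscr F_\gamma(\mu)=\frac\gamma2\iint\mathrm g_{\mathrm s}(x,z)\mu(dz)\mu(dx)+\mathrm H(\mu|\mu_0)$. The functional $\mathscr F_\gamma$ has a unique minimizer $\mu_\gamma\in\mathcal M(\mathbb R^n)$, whose Lebesgue density satisfies $\mu_\gamma(x)=\mathrm L_\gamma^{-1}e^{-\gamma\mathscr U^{\mu_\gamma}(x)-V(x)}$ with $\mathscr U^{\mu_\gamma}(x)=\int\mathrm g_{\mathrm s}(x,z)\mu_\gamma(dz)$; thus $\mathrm L_\gamma=\int e^{-\gamma\mathscr U^{\mu_\gamma}(x)-V(x)}dx$. A sequence $\Xi_N$ of point processes on $\mathbb R^n$ converges in distribution to $\Xi$ if $\mathbb E[e^{-\Xi_N(f)}]\to\mathbb E[e^{-\Xi(f)}]$ for every continuous compactly supported $f:\mathbb R^n\to[0,+\infty)$. A Poisson point process with intensity $\theta$ has $\mathbb E[e^{-\Xi(f)}]=\exp\big(\int(e^{-f(x)}-1)\theta(x)dx\big)$. 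*)

theory Defs
  imports "HOL-Probability.Probability"
begin

section \<open>Interaction, confinement and the Gibbs measure\<close>

text \<open>The Riesz kernel takes the value \<open>\<infinity>\<close> on the diagonal; the library's \<open>0 powr (-s) = 0\<close> would
  make atoms free of self-interaction.\<close>

definition riesz :: "real \<Rightarrow> real ^ 'n \<Rightarrow> real ^ 'n \<Rightarrow> ennreal" where
  "riesz s u x = (if x = u then \<infinity> else ennreal (norm (x - u) powr (- s)))"

definition confine :: "real \<Rightarrow> real ^ 'n \<Rightarrow> ennreal" where
  "confine \<alpha> x = ennreal (norm x powr \<alpha>)"

text \<open>The function \<open>u \<mapsto> exp (- u)\<close> on \<open>[0, \<infinity>]\<close>.\<close>

definition exp_neg :: "ennreal \<Rightarrow> ennreal" where
  "exp_neg u = (if u = \<infinity> then 0 else ennreal (exp (- enn2real u)))"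

definition boltzmann :: "real \<Rightarrow> real \<Rightarrow> real \<Rightarrow> nat \<Rightarrow> (nat \<Rightarrow> real ^ 'n) \<Rightarrow> ennreal" where
  "boltzmann s \<alpha> \<beta> N x =
     exp_neg (ennreal \<beta> * (\<Sum>j<N. \<Sum>i<j. riesz s (x i) (x j)) + (\<Sum>j<N. confine \<alpha> (x j)))"

text \<open>A configuration is a function on the index set \<open>{..<N}\<close>, so that the indices \<open>1, \<dots>, N\<close> are
  shifted to \<open>0, \<dots>, N - 1\<close>.\<close>

abbreviation lebesgue_config :: "nat \<Rightarrow> (nat \<Rightarrow> real ^ 'n) measure" where
  "lebesgue_config N \<equiv> \<Pi>\<^sub>M j\<in>{..<N}. lborel"

definition gibbs_Z :: "'n::finite itself \<Rightarrow> real \<Rightarrow> real \<Rightarrow> real \<Rightarrow> nat \<Rightarrow> ennreal" where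
  "gibbs_Z TYPE('n) s \<alpha> \<beta> N =
     (\<integral>\<^sup>+ x. boltzmann s \<alpha> \<beta> N x \<partial>(lebesgue_config N :: (nat \<Rightarrow> real ^ 'n) measure))"

definition gibbs :: "real \<Rightarrow> real \<Rightarrow> real \<Rightarrow> nat \<Rightarrow> (nat \<Rightarrow> real ^ 'n) measure" where
  "gibbs s \<alpha> \<beta> N =
     density (lebesgue_config N) (\<lambda>x. boltzmann s \<alpha> \<beta> N x / gibbs_Z TYPE('n) s \<alpha> \<beta> N)"

section \<open>The free energy and the constant \<open>L\<^sub>\<gamma>\<close>\<close>

definition borel_prob_measures :: "(real ^ 'n) measure set" where
  "borel_prob_measures = {\<mu>. prob_space \<mu> \<and> sets \<mu> = sets borel}"

definition mu0 :: "real \<Rightarrow> (real ^ 'n) measure" where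
  "mu0 \<alpha> = density lborel
     (\<lambda>x. exp_neg (confine \<alpha> x) / (\<integral>\<^sup>+ y. exp_neg (confine \<alpha> (y :: real ^ 'n)) \<partial>lborel))"

text \<open>\<^const>\<open>KL_divergence\<close> is a Bochner integral, hence \<open>0\<close> for a non-integrable log-density. For
  probability measures the negative part of the log-density is always \<open>\<mu>\<close>-integrable (its
  integral is at most \<open>1/e\<close>), so non-integrability means that the integral is \<open>+\<infinity>\<close>.\<close>

definition rel_entropy :: "'a measure \<Rightarrow> 'a measure \<Rightarrow> ereal" where
  "rel_entropy \<mu> \<nu> =
     (if absolutely_continuous \<nu> \<mu> \<and> integrable \<mu> (entropy_density (exp 1) \<nu> \<mu>)
      then ereal (KL_divergence (exp 1) \<nu> \<mu>) else \<infinity>)"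

definition potential :: "real \<Rightarrow> (real ^ 'n) measure \<Rightarrow> real ^ 'n \<Rightarrow> ennreal" where
  "potential s \<mu> x = (\<integral>\<^sup>+ z. riesz s x z \<partial>\<mu>)"

text \<open>For \<open>\<gamma> = 0\<close> the convention \<open>0 * \<infinity> = 0\<close> applies and only the entropy remains.\<close>

definition free_energy :: "real \<Rightarrow> real \<Rightarrow> real \<Rightarrow> (real ^ 'n) measure \<Rightarrow> ereal" where
  "free_energy s \<alpha> \<gamma> \<mu> =
     ereal (\<gamma> / 2) * enn2ereal (\<integral>\<^sup>+ x. (\<integral>\<^sup>+ z. riesz s x z \<partial>\<mu>) \<partial>\<mu>) + rel_entropy \<mu> (mu0 \<alpha>)"

definition mu_min :: "real \<Rightarrow> real \<Rightarrow> real \<Rightarrow> (real ^ 'n) measure" where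
  "mu_min s \<alpha> \<gamma> =
     (THE \<mu>. is_arg_min (free_energy s \<alpha> \<gamma>) (\<lambda>\<mu>. \<mu> \<in> borel_prob_measures) \<mu>)"

definition L_const :: "'n::finite itself \<Rightarrow> real \<Rightarrow> real \<Rightarrow> real \<Rightarrow> real" where
  "L_const TYPE('n) s \<alpha> \<gamma> =
     enn2real (\<integral>\<^sup>+ x. exp_neg (ennreal \<gamma> * potential s (mu_min s \<alpha> \<gamma>) x
                             + confine \<alpha> (x :: real ^ 'n)) \<partial>lborel)"

section \<open>Point processes\<close>

text \<open>The second condition says that realizations are locally finite and integer-valued, i.e.
  locally finite sums of Dirac masses.\<close>

definition point_process :: "'w measure \<Rightarrow> ('w \<Rightarrow> (real ^ 'n) measure) \<Rightarrow> bool" where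
  "point_process M \<Xi> \<longleftrightarrow> prob_space M \<and>
     (\<forall>\<omega>\<in>space M. sets (\<Xi> \<omega>) = sets borel \<and>
        (\<forall>A\<in>sets borel. bounded A \<longrightarrow> emeasure (\<Xi> \<omega>) A \<in> \<nat>)) \<and>
     (\<forall>A\<in>sets borel. (\<lambda>\<omega>. emeasure (\<Xi> \<omega>) A) \<in> borel_measurable M)"

definition test_functions :: "(real ^ 'n \<Rightarrow> real) set" where
  "test_functions =
     {f. continuous_on UNIV f \<and> compact (closure {x. f x \<noteq> 0}) \<and> (\<forall>x. 0 \<le> f x)}"

definition laplace_functional ::
  "'w measure \<Rightarrow> ('w \<Rightarrow> (real ^ 'n) measure) \<Rightarrow> (real ^ 'n \<Rightarrow> real) \<Rightarrow> real" where
  "laplace_functional M \<Xi> f = (\<integral>\<omega>. exp (- (\<integral>x. f x \<partial>(\<Xi> \<omega>))) \<partial>M)"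

definition converges_in_distribution ::
  "(nat \<Rightarrow> 'v measure) \<Rightarrow> (nat \<Rightarrow> 'v \<Rightarrow> (real ^ 'n) measure)
    \<Rightarrow> 'w measure \<Rightarrow> ('w \<Rightarrow> (real ^ 'n) measure) \<Rightarrow> bool" where
  "converges_in_distribution M \<Xi> M' \<Xi>' \<longleftrightarrow>
     (\<forall>f\<in>test_functions.
        (\<lambda>N. laplace_functional (M N) (\<Xi> N) f) \<longlonglongrightarrow> laplace_functional M' \<Xi>' f)"

definition poisson_process ::
  "'w measure \<Rightarrow> ('w \<Rightarrow> (real ^ 'n) measure) \<Rightarrow> (real ^ 'n \<Rightarrow> real) \<Rightarrow> bool" where
  "poisson_process M \<Xi> \<theta> \<longleftrightarrow> point_process M \<Xi> \<and>
     (\<forall>f\<in>test_functions.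
        laplace_functional M \<Xi> f = exp (\<integral>x. (exp (- f x) - 1) * \<theta> x \<partial>lborel))"

section \<open>The rescaling\<close>

definition eta :: "real \<Rightarrow> real \<Rightarrow> nat \<Rightarrow> nat \<Rightarrow> real" where
  "eta \<alpha> L n N = ln (real N) powr (1 / \<alpha>) *
     (1 - real n * (\<alpha> - 1) / \<alpha>\<^sup>2 * (ln (ln (real N)) / ln (real N))
        - ln (\<alpha> ^ n * L) / (\<alpha> * ln (real N)))"

definition rescaling :: "real \<Rightarrow> real \<Rightarrow> real ^ 'n \<Rightarrow> real ^ 'n ^ 'n \<Rightarrow> real ^ 'n \<Rightarrow> real ^ 'n" where
  "rescaling \<alpha> \<eta> \<upsilon> \<psi> x = \<eta> *\<^sub>R (\<upsilon> + (inverse \<alpha> * \<eta> powr (- \<alpha>)) *\<^sub>R (\<psi> *v x))"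

text \<open>The counting measure on \<open>{..<N}\<close> pushed forward by \<open>j \<mapsto> y j\<close> is the sum of the Dirac
  masses at the \<open>y j\<close>, with multiplicity.\<close>

definition sum_dirac :: "nat \<Rightarrow> (nat \<Rightarrow> real ^ 'n) \<Rightarrow> (real ^ 'n) measure" where
  "sum_dirac N y = distr (count_space {..<N}) borel y"

end

theory Submission
  imports Defs "HOL-Real_Asymp.Real_Asymp"
begin

text \<open>
  Write the Gibbs measure as a density with respect to the product of \<open>N\<close> copies of the equilibrium measure
  \<open>\<mu> = \<mu>\<^sub>\<gamma>\<close>. Because \<open>\<mu>\<close> has Lebesgue density \<open>exp (- \<gamma> U - V) / L\<close>, the weight becomes
  \<open>exp (\<gamma> \<Sum> U (x\<^sub>i) - \<beta> W)\<close> with \<open>W\<close> the pair energy. The Riesz kernel is a superposition of Gaussian kernels,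
  hence positive semidefinite; this and Jensen's inequality show that
  consecutive partition functions have ratio tending to 1, the first-order interaction terms cancelling between
  \<open>\<gamma> U\<close> and \<open>\<beta> W\<close>. The rescaling window escapes to infinity, where \<open>U\<close> vanishes, so each particle in it is seen by
  the remaining gas only through a negligible correction: inserting particles one after the other, the factorial moments
  converge to the powers of \<open>\<integral>(1 - e\<^sup>-\<^sup>f) \<theta>\<close>, and expanding \<open>\<Prod>(1 - h (x\<^sub>i))\<close> gives the Laplace functional of
  the Poisson process.

  The equilibrium density is a fixed point of \<open>q \<mapsto> exp (- \<gamma> G q) / norm_const q\<close>. A damped iteration converges to it, since
  monotonicity of the logarithm turns positive semidefiniteness of \<open>G\<close> into a contraction in the energy norm; positive
  semidefiniteness and Gibbs' inequality then identify it as the unique minimizer of the free energy.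
\<close>

section \<open>Mean-field gases\<close>

text \<open>The window sees only boundedly many of the \<open>N\<close> particles, so partition
  function ratios are needed up to a factor \<open>1 + o(1)\<close>. Jensen bounds them from both
  sides, but in terms of Gibbs means of the potential and of the pair energy, which are themselves
  unknown.

  These means are found by testing positive semidefiniteness on the particles minus a background of
  charge \<open>c\<close> per particle spread over \<open>M\<close>, with \<open>c\<close> left
  free. Together with an entropy-type upper bound for the energy this gives an inequality linear in
  the mean potential and an equality at \<open>c = 1\<close>; dividing by \<open>c - 1\<close> from
  both sides of 1 identifies the limit.

  The obstacle is the infinite self-energy of point masses. Positive semidefiniteness is therefore
  used for a truncated kernel, made of the wide Gaussians only. Its diagonal costs a constant per
  particle, negligible after multiplication by a coupling of order \<open>1 / N\<close>, and since
  \<open>s\<close> is below the dimension the potential of the omitted narrow Gaussians against a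
  bounded density is uniformly small.\<close>

locale mean_field = prob_space M for M :: "'a measure" +
  fixes g :: "'a \<Rightarrow> 'a \<Rightarrow> real" and C \<gamma> :: real
  assumes space_M: "space M = UNIV"
    and g_meas: "(\<lambda>p. g (fst p) (snd p)) \<in> borel_measurable (M \<Otimes>\<^sub>M M)"
    and g_nonneg: "0 \<le> g x y" and g_sym: "g x y = g y x"
    and g_int: "integrable M (g x)" and g_bound: "(\<integral>y. g x y \<partial>M) \<le> C"
    and gam_nonneg: "0 \<le> \<gamma>"
begin

text \<open>The weight \<open>wt\<close> is the Gibbs density relative to a product of copies of \<open>M\<close>, up to normalization: the factor
  \<open>exp (\<gamma> U)\<close> compensates for the factor \<open>exp (- \<gamma> U)\<close> in the density of the equilibrium measure \<open>M\<close>.\<close>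

definition U :: "'a \<Rightarrow> real" where "U x = (\<integral>y. g x y \<partial>M)"
definition I0 :: real where "I0 = (\<integral>x. U x \<partial>M)"
definition W :: "nat set \<Rightarrow> (nat \<Rightarrow> 'a) \<Rightarrow> real" where
  "W I x = (\<Sum>i\<in>I. \<Sum>j\<in>I-{i}. g (x i) (x j)) / 2"
definition wt :: "real \<Rightarrow> nat set \<Rightarrow> (nat \<Rightarrow> 'a) \<Rightarrow> real" where
  "wt b I x = exp (\<gamma> * (\<Sum>i\<in>I. U (x i)) - b * W I x)"
text \<open>Unnormalized Gibbs moment in which the particles of \<open>J\<close> are marked by
  \<open>h\<close>. Arbitrary index sets let any particle be added or removed before relabelling;
  \<open>Ew_eq_emom\<close> restores the standard labels.\<close>

definition Ew :: "('a \<Rightarrow> real) \<Rightarrow> real \<Rightarrow> nat set \<Rightarrow> nat set \<Rightarrow> real" where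
  "Ew h b I J = (\<integral>x. wt b I x * (\<Prod>j\<in>J. h (x j)) \<partial>(PiM I (\<lambda>_. M)))"

abbreviation "MI I \<equiv> PiM I (\<lambda>_::nat. M)"

sublocale pp: product_prob_space "\<lambda>_::nat. M" UNIV
  by unfold_locales

lemma prob_MI: "prob_space (MI I)"
  by (intro prob_space_PiM prob_space_axioms)

lemma g_meas2[measurable]: "(\<lambda>p. g (fst p) (snd p)) \<in> borel_measurable (M \<Otimes>\<^sub>M M)"
  by (fact g_meas)

lemma g_measurable_compose[measurable (raw)]:
  assumes "f1 \<in> measurable N M" "f2 \<in> measurable N M"
  shows "(\<lambda>p. g (f1 p) (f2 p)) \<in> borel_measurable N"
  using measurable_compose[OF measurable_Pair[OF assms] g_meas] by simp

lemma U_meas[measurable]: "U \<in> borel_measurable M"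
  unfolding U_def by measurable

lemma U_nonneg: "0 \<le> U x" unfolding U_def by (intro integral_nonneg_AE) (simp add: g_nonneg)
lemma U_le: "U x \<le> C" unfolding U_def by (rule g_bound)
lemma C_nonneg: "0 \<le> C" using U_nonneg U_le order_trans by blast
lemma U_int: "integrable M U"
  by (rule integrable_const_bound[of _ C]) (auto simp: U_nonneg U_le)

lemma I0_nonneg: "0 \<le> I0" unfolding I0_def by (intro integral_nonneg_AE) (simp add: U_nonneg)
lemma W_meas[measurable]: "W I \<in> borel_measurable (MI I)"
  unfolding W_def by measurable

lemma W_nonneg: "0 \<le> W I x" unfolding W_def by (intro divide_nonneg_nonneg sum_nonneg) (auto simp: g_nonneg)

lemma sum_U_bounds: "0 \<le> (\<Sum>i\<in>I. U (x i))" "(\<Sum>i\<in>I. U (x i)) \<le> card I * C"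
  using sum_bounded_above[of I "\<lambda>i. U (x i)" C] by (auto intro: sum_nonneg simp: U_nonneg U_le)

lemma wt_meas[measurable]: "wt b I \<in> borel_measurable (MI I)"
  unfolding wt_def by measurable

lemma wt_pos: "0 < wt b I x" by (simp add: wt_def)

text \<open>Repulsion only lowers the weight, so even a singular kernel gives a bounded
  weight.\<close>

lemma wt_le: assumes "0 \<le> b" shows "wt b I x \<le> exp (\<gamma> * (card I * C))"
  unfolding wt_def using sum_U_bounds[where I=I and x=x] mult_nonneg_nonneg[OF assms W_nonneg[of I x]]
    mult_left_mono[OF sum_U_bounds(2)[where I=I and x=x] gam_nonneg] by simp

section \<open>Adding one particle, and exchangeability\<close>

lemma W_insert:
  assumes "finite I" "k \<notin> I"
  shows "W (insert k I) (x(k:=y)) = W I x + (\<Sum>i\<in>I. g (x i) y)"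
proof -
  let ?x = "x(k:=y)"
  have ne: "?x i = x i" if "i \<in> I" for i using that assms by auto
  have a: "(\<Sum>i\<in>I. \<Sum>j\<in>insert k I-{i}. g (?x i) (?x j)) = (\<Sum>i\<in>I. (\<Sum>j\<in>I-{i}. g (x i) (x j)) + g (x i) y)"
  proof (rule sum.cong[OF refl])
    fix i assume i: "i \<in> I"
    have "insert k I - {i} = insert k (I - {i})" using i assms by auto
    then have "(\<Sum>j\<in>insert k I-{i}. g (?x i) (?x j)) = g (?x i) (?x k) + (\<Sum>j\<in>I-{i}. g (?x i) (?x j))"
      using assms by simp
    also have "(\<Sum>j\<in>I-{i}. g (?x i) (?x j)) = (\<Sum>j\<in>I-{i}. g (x i) (x j))"
      by (rule sum.cong[OF refl]) (use ne i in simp)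
    finally show "(\<Sum>j\<in>insert k I-{i}. g (?x i) (?x j)) = (\<Sum>j\<in>I-{i}. g (x i) (x j)) + g (x i) y"
      by (simp only: ne[OF i] fun_upd_same add.commute)
  qed
  have "insert k I - {k} = I" using assms by auto
  then have b: "(\<Sum>j\<in>insert k I - {k}. g (?x k) (?x j)) = (\<Sum>i\<in>I. g (x i) y)"
    by (intro sum.cong) (simp_all only: ne fun_upd_same g_sym[of y])
  show ?thesis unfolding W_def
    by (subst sum.insert[OF assms]) (simp only: a b sum.distrib, simp add: field_simps)
qed

text \<open>The new particle interacts with the old ones only. The factor on the right is the
  insertion factor behind every recursion in the particle number.\<close>

lemma wt_insert:
  assumes "finite I" "k \<notin> I"
  shows "wt b (insert k I) (x(k:=y)) = wt b I x * exp (\<gamma> * U y - b * (\<Sum>i\<in>I. g (x i) y))"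
proof -
  have "(\<Sum>i\<in>insert k I. U ((x(k:=y)) i)) = U y + (\<Sum>i\<in>I. U (x i))"
    unfolding sum.insert[OF assms] fun_upd_same
    by (rule arg_cong2[of _ _ _ _ "(+)"], rule refl, rule sum.cong[OF refl]) (use assms in auto)
  then show ?thesis unfolding wt_def W_insert[OF assms] by (simp add: exp_add[symmetric] algebra_simps)
qed

lemma integrable_PiM_bounded:
  assumes "f \<in> borel_measurable (MI I)" "\<And>x. \<bar>f x\<bar> \<le> B"
  shows "integrable (MI I) (f :: _ \<Rightarrow> real)"
proof -
  interpret P: prob_space "MI I" by (rule prob_MI)
  show ?thesis by (rule P.integrable_const_bound[of _ B]) (use assms in auto)
qed

lemma prod_unit_interval:
  fixes h :: "'a \<Rightarrow> real" and x :: "nat \<Rightarrow> 'a"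
  shows "(\<And>x. 0 \<le> h x) \<Longrightarrow> (\<And>x. h x \<le> 1) \<Longrightarrow> 0 \<le> (\<Prod>j\<in>J. h (x j)) \<and> (\<Prod>j\<in>J. h (x j)) \<le> 1"
  by (auto intro: prod_nonneg prod_le_1)

lemma wt_prod_bound:
  assumes "0 \<le> b" "\<And>x. 0 \<le> h x" "\<And>x. h x \<le> (1::real)"
  shows "\<bar>wt b I x * (\<Prod>j\<in>J. h (x j))\<bar> \<le> exp (\<gamma> * (card I * C))"
proof -
  have "wt b I x * (\<Prod>j\<in>J. h (x j)) \<le> exp (\<gamma> * (card I * C)) * 1"
    using prod_unit_interval[of h x J, OF assms(2,3)] wt_le[OF assms(1), of I x] wt_pos[of b I x]
    by (intro mult_mono) auto
  then show ?thesis using prod_unit_interval[of h x J, OF assms(2,3)] wt_pos[of b I x] by (simp add: abs_mult)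
qed

lemma wt_prod_meas:
  assumes "h \<in> borel_measurable M" "J \<subseteq> I"
  shows "(\<lambda>x. wt b I x * (\<Prod>j\<in>J. h (x j))) \<in> borel_measurable (MI I)"
proof -
  have [measurable]: "(\<lambda>x. h (x j)) \<in> borel_measurable (MI I)" if "j \<in> J" for j
    by (rule measurable_compose[OF _ assms(1)]) (use that assms(2) in \<open>auto intro!: measurable_component_singleton\<close>)
  show ?thesis by measurable
qed

lemma wt_prod_int:
  assumes "0 \<le> b" "\<And>x. 0 \<le> h x" "\<And>x. h x \<le> (1::real)" "h \<in> borel_measurable M" "J \<subseteq> I"
  shows "integrable (MI I) (\<lambda>x. wt b I x * (\<Prod>j\<in>J. h (x j)))"
  by (rule integrable_PiM_bounded[OF wt_prod_meas wt_prod_bound]) (use assms in auto)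

lemma Ew_nonneg: "(\<And>x. 0 \<le> h x) \<Longrightarrow> 0 \<le> Ew h b I J"
  unfolding Ew_def by (intro integral_nonneg_AE AE_I2 mult_nonneg_nonneg prod_nonneg) (auto simp: wt_pos less_imp_le)

lemma Ew_one_pos: "0 \<le> b \<Longrightarrow> 0 < Ew (\<lambda>_. 1) b I {}"
proof -
  assume b: "0 \<le> b"
  interpret P: prob_space "MI I" by (rule prob_MI)
  have i: "integrable (MI I) (wt b I)" using wt_prod_int[OF b, of "\<lambda>_. 1" "{}" I] by simp
  have "0 \<le> Ew (\<lambda>_. 1) b I {}" by (rule Ew_nonneg) simp
  moreover have "Ew (\<lambda>_. 1) b I {} \<noteq> 0"
  proof
    assume "Ew (\<lambda>_. 1) b I {} = 0"
    then have "integral\<^sup>L (MI I) (wt b I) = 0" by (simp add: Ew_def)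
    then have "AE x in MI I. wt b I x = 0"
      using integral_nonneg_eq_0_iff_AE[OF i] by (auto simp: wt_pos less_imp_le)
    then have "AE x in MI I. False" by eventually_elim (use wt_pos in \<open>auto simp: less_le\<close>)
    then show False by simp
  qed
  ultimately show ?thesis by simp
qed

text \<open>Fubini for the added particle. It carries its own function \<open>p\<close>, so that
  observables of a single particle other than \<open>h\<close> can be integrated out as well (see
  \<open>wt_tilted_potential_le\<close>).\<close>

lemma wt_insert_integral:
  assumes I: "finite I" "k \<notin> I" "J \<subseteq> I" and b: "0 \<le> b"
    and h: "\<And>x. 0 \<le> h x" "\<And>x. h x \<le> (1::real)" "h \<in> borel_measurable M"
    and p: "\<And>x. 0 \<le> p x" "\<And>x. p x \<le> (1::real)" "p \<in> borel_measurable M"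
  shows "(\<integral>x. wt b (insert k I) x * ((\<Prod>j\<in>J. h (x j)) * p (x k)) \<partial>(MI (insert k I))) =
   (\<integral>x. wt b I x * (\<Prod>j\<in>J. h (x j)) * (\<integral>y. p y * exp (\<gamma> * U y - b * (\<Sum>i\<in>I. g (x i) y)) \<partial>M) \<partial>(MI I))"
proof -
  have [measurable]: "(\<lambda>x. h (x j)) \<in> borel_measurable (MI (insert k I))" if "j \<in> J" for j
    by (rule measurable_compose[OF _ h(3)]) (use that I(3) in \<open>auto intro!: measurable_component_singleton\<close>)
  have [measurable]: "(\<lambda>x. p (x k)) \<in> borel_measurable (MI (insert k I))"
    by (rule measurable_compose[OF _ p(3)]) (auto intro!: measurable_component_singleton)
  have i: "integrable (MI (insert k I)) (\<lambda>x. wt b (insert k I) x * ((\<Prod>j\<in>J. h (x j)) * p (x k)))"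
  proof (rule integrable_PiM_bounded[where B="exp (\<gamma> * (card (insert k I) * C))"])
    show "(\<lambda>x. wt b (insert k I) x * ((\<Prod>j\<in>J. h (x j)) * p (x k))) \<in> borel_measurable (MI (insert k I))"
      by measurable
    fix x
    have "\<bar>wt b (insert k I) x * ((\<Prod>j\<in>J. h (x j)) * p (x k))\<bar> = \<bar>wt b (insert k I) x * (\<Prod>j\<in>J. h (x j))\<bar> * p (x k)"
      using p(1) by (simp add: abs_mult)
    also have "\<dots> \<le> exp (\<gamma> * (card (insert k I) * C)) * 1"
      by (intro mult_mono wt_prod_bound b h p) auto
    finally show "\<bar>wt b (insert k I) x * ((\<Prod>j\<in>J. h (x j)) * p (x k))\<bar> \<le> exp (\<gamma> * (card (insert k I) * C))" by simp
  qed
  have pr: "(\<Prod>j\<in>J. h ((x(k:=y)) j)) = (\<Prod>j\<in>J. h (x j))" for x y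
    using I by (intro prod.cong) auto
  have eq: "wt b (insert k I) (x(k:=y)) * ((\<Prod>j\<in>J. h ((x(k:=y)) j)) * p ((x(k:=y)) k)) =
    wt b I x * (\<Prod>j\<in>J. h (x j)) * (p y * exp (\<gamma> * U y - b * (\<Sum>i\<in>I. g (x i) y)))" for x y
    unfolding wt_insert[OF I(1,2)] pr by simp
  show ?thesis
    unfolding pp.product_integral_insert[OF I(1,2) i] eq
    by (simp only: integral_mult_right_zero)
qed

lemma Ew_reindex:
  assumes f: "inj_on f I" and J: "J \<subseteq> I" and h: "h \<in> borel_measurable M" 
  shows "Ew h b (f ` I) (f ` J) = Ew h b I J"
proof -
  let ?t = "\<lambda>\<omega>. \<lambda>n\<in>I. \<omega> (f n)"
  have d: "distr (MI (f ` I)) (MI I) ?t = MI I"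
    using distr_PiM_reindex[of "f`I" "\<lambda>_. M" f I] f by (simp add: prob_space_axioms)
  have t[measurable]: "?t \<in> measurable (MI (f`I)) (MI I)"
    by (rule measurable_restrict) (auto intro: measurable_component_singleton)
  have fJ: "inj_on f J" using f J inj_on_subset by blast
  have W: "W (f`I) x = W I (?t x)" for x
  proof -
    have "(\<Sum>i\<in>f`I. \<Sum>j\<in>f`I-{i}. g (x i) (x j)) = (\<Sum>i\<in>I. \<Sum>j\<in>f`I-{f i}. g (x (f i)) (x j))"
      by (simp add: sum.reindex[OF f])
    also have "\<dots> = (\<Sum>i\<in>I. \<Sum>j\<in>I-{i}. g (?t x i) (?t x j))"
    proof (rule sum.cong[OF refl])
      fix i assume i: "i \<in> I"
      then have "f`I-{f i} = f`(I-{i})" using f by (auto simp: inj_on_def)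
      then show "(\<Sum>j\<in>f`I-{f i}. g (x (f i)) (x j)) = (\<Sum>j\<in>I-{i}. g (?t x i) (?t x j))"
        using i inj_on_subset[OF f, of "I-{i}"] by (auto simp: sum.reindex intro!: sum.cong)
    qed
    finally show ?thesis unfolding W_def by simp
  qed
  have "Ew h b I J = (\<integral>x. wt b I x * (\<Prod>j\<in>J. h (x j)) \<partial>distr (MI (f ` I)) (MI I) ?t)"
    by (simp add: d Ew_def)
  also have "\<dots> = (\<integral>x. wt b I (?t x) * (\<Prod>j\<in>J. h (?t x j)) \<partial>MI (f ` I))"
    by (rule integral_distr[OF t wt_prod_meas[OF h J]])
  also have "\<dots> = Ew h b (f`I) (f`J)" unfolding Ew_def
  proof (rule Bochner_Integration.integral_cong[OF refl])
    fix x
    have "(\<Sum>i\<in>I. U (?t x i)) = (\<Sum>i\<in>f`I. U (x i))" by (simp add: sum.reindex[OF f])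
    moreover have "(\<Prod>j\<in>J. h (?t x j)) = (\<Prod>j\<in>f`J. h (x j))" using J by (auto simp: prod.reindex[OF fJ] intro!: prod.cong)
    ultimately show "wt b I (?t x) * (\<Prod>j\<in>J. h (?t x j)) = wt b (f`I) x * (\<Prod>j\<in>f`J. h (x j))"
      by (simp only: wt_def W)
  qed
  finally show ?thesis by simp
qed

text \<open>Divided by \<open>zpart b n\<close> this is the mean of a product over \<open>k\<close>
  given particles. For an indicator \<open>h\<close>, multiplying by the falling factorial of
  \<open>n\<close> gives the \<open>k\<close>-th factorial moment of the number of particles in the
  set.\<close>

definition emom :: "('a \<Rightarrow> real) \<Rightarrow> real \<Rightarrow> nat \<Rightarrow> nat \<Rightarrow> real" where "emom h b n k = Ew h b {..<n} {..<k}"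
definition zpart :: "real \<Rightarrow> nat \<Rightarrow> real" where "zpart b n = emom (\<lambda>_. 1) b n 0"

text \<open>Exchangeability: a bijection sending \<open>J\<close> to an initial segment and
  \<open>I - J\<close> to the labels after it shows that only the two cardinalities matter.\<close>

lemma Ew_eq_emom:
  assumes "finite I" "J \<subseteq> I" "h \<in> borel_measurable M"
  shows "Ew h b I J = emom h b (card I) (card J)"
proof -
  have fJ: "finite J" using assms finite_subset by auto
  obtain f1 where f1: "bij_betw f1 J {..<card J}" 
    using fJ by (metis atLeast0LessThan ex_bij_betw_finite_nat)
  have "card (I - J) = card {card J..<card I}" using assms fJ by (simp add: card_Diff_subset)
  then obtain f2 where f2: "bij_betw f2 (I - J) {card J..<card I}"
    using finite_same_card_bij[of "I - J" "{card J..<card I}"] assms by auto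
  define f where "f i = (if i \<in> J then f1 i else f2 i)" for i
  have 1: "bij_betw f J {..<card J}" using f1 by (subst bij_betw_cong[of J f f1]) (auto simp: f_def)
  have 2: "bij_betw f (I-J) {card J..<card I}" using f2 by (subst bij_betw_cong[of "I-J" f f2]) (auto simp: f_def)
  have "bij_betw f (J \<union> (I-J)) ({..<card J} \<union> {card J..<card I})" by (rule bij_betw_combine[OF 1 2]) auto
  moreover have "J \<union> (I-J) = I" using assms by auto
  moreover have "{..<card J} \<union> {card J..<card I} = {..<card I}" using card_mono[OF assms(1,2)] by auto
  ultimately have 3: "bij_betw f I {..<card I}" by simp
  have "Ew h b I J = Ew h b (f`I) (f`J)" using Ew_reindex[of f I J h b] 3 assms by (auto simp: bij_betw_def)
  then show ?thesis using 3 1 by (simp add: emom_def bij_betw_def)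
qed

lemma Ew_empty_eq_zpart: "finite I \<Longrightarrow> Ew h b I {} = zpart b (card I)"
proof -
  assume I: "finite I"
  have "Ew h b I {} = Ew (\<lambda>_. 1) b I {}" by (simp add: Ew_def)
  also have "\<dots> = zpart b (card I)" using Ew_eq_emom[OF I, of "{}" "\<lambda>_. 1"] by (simp add: zpart_def)
  finally show ?thesis .
qed

lemma zpart_pos: "0 \<le> b \<Longrightarrow> 0 < zpart b n"
  using Ew_one_pos[of b "{..<n}"] by (simp add: zpart_def emom_def)

end

section \<open>Fixed points of the Gibbs map\<close>

text \<open>The derivative of \<open>ln\<close> is at least \<open>1 / c\<close> up to
  \<open>c\<close>. This strong monotonicity is what makes the iteration below contract.\<close>

lemma ln_diff_two_point:
  fixes x y c :: real
  assumes "0 < x" "0 < y" "x \<le> c" "y \<le> c"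
  shows "(x - y)\<^sup>2 / c \<le> (x - y) * (ln x - ln y)"
proof -
  have *: "(x - y)\<^sup>2 / c \<le> (x - y) * (ln x - ln y)" if "0 < y" "y \<le> x" "x \<le> c" for x y :: real
  proof -
    have "ln (y / x) \<le> y / x - 1" by (rule ln_le_minus_one) (use that in auto)
    then have "(x - y) / x \<le> ln x - ln y" using that by (simp add: ln_div diff_divide_distrib)
    moreover have "(x - y) / c \<le> (x - y) / x" using that by (intro divide_left_mono) auto
    ultimately have "(x - y) * ((x - y) / c) \<le> (x - y) * (ln x - ln y)" using that by (intro mult_left_mono) auto
    then show ?thesis by (simp add: power2_eq_square)
  qed
  show ?thesis
  proof (cases "y \<le> x")
    case True then show ?thesis using *[of y x] assms by auto
  next
    case False
    then have "(y - x)\<^sup>2 / c \<le> (y - x) * (ln y - ln x)" using *[of x y] assms by auto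
    then show ?thesis by (simp add: power2_commute[of y x] algebra_simps)
  qed
qed

section \<open>The integral operator and the energy form of the kernel\<close>

context mean_field begin

definition G :: "('a \<Rightarrow> real) \<Rightarrow> 'a \<Rightarrow> real" where "G a x = (\<integral>y. g x y * a y \<partial>M)"
definition bil :: "('a \<Rightarrow> real) \<Rightarrow> ('a \<Rightarrow> real) \<Rightarrow> real" where "bil a b = (\<integral>x. a x * G b x \<partial>M)"
text \<open>The class on which \<open>G\<close> and \<open>bil\<close> are studied: the uniform
  bound \<open>C\<close> makes it stable under \<open>G\<close>, and all integrals over it
  converge.\<close>

definition bd :: "('a \<Rightarrow> real) \<Rightarrow> bool" where "bd a \<longleftrightarrow> a \<in> borel_measurable M \<and> (\<exists>B. \<forall>x. \<bar>a x\<bar> \<le> B)"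

lemma bdI: "a \<in> borel_measurable M \<Longrightarrow> (\<And>x. \<bar>a x\<bar> \<le> B) \<Longrightarrow> bd a" unfolding bd_def by blast
lemma bd_meas: "bd a \<Longrightarrow> a \<in> borel_measurable M" by (simp add: bd_def)
lemma bd_int: "bd a \<Longrightarrow> integrable M a" unfolding bd_def using integrable_const_bound[of a] by auto

lemma bd_add: assumes "bd a" "bd b" shows "bd (\<lambda>x. a x + b x)"
proof -
  obtain A B where "\<And>x. \<bar>a x\<bar> \<le> A" "\<And>x. \<bar>b x\<bar> \<le> B" using assms unfolding bd_def by blast
  then show ?thesis using assms by (intro bdI[where B="A + B"] order_trans[OF abs_triangle_ineq] add_mono) (auto simp: bd_def)
qed
lemma bd_mult: assumes "bd a" "bd b" shows "bd (\<lambda>x. a x * b x)"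
proof -
  obtain A B where AB: "\<And>x. \<bar>a x\<bar> \<le> A" "\<And>x. \<bar>b x\<bar> \<le> B" using assms unfolding bd_def by blast
  have A0: "0 \<le> A" using order_trans[OF abs_ge_zero AB(1)] .
  show ?thesis
  proof (rule bdI)
    show "(\<lambda>x. a x * b x) \<in> borel_measurable M" using bd_meas[OF assms(1)] bd_meas[OF assms(2)] by measurable
    show "\<bar>a x * b x\<bar> \<le> A * B" for x unfolding abs_mult using A0 by (intro mult_mono AB) auto
  qed
qed
lemma bd_const: "bd (\<lambda>_. c)" by (rule bdI[where B="\<bar>c\<bar>"]) auto
lemma bd_diff: assumes "bd a" "bd b" shows "bd (\<lambda>x. a x - b x)"
  using bd_add[OF assms(1) bd_mult[OF bd_const[of "-1"] assms(2)]] by simp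

lemma g_bd_int: assumes "bd a" shows "integrable M (\<lambda>y. g x y * a y)"
proof -
  obtain B where B: "\<And>x. \<bar>a x\<bar> \<le> B" using assms unfolding bd_def by blast
  have "norm (g x y * a y) \<le> norm (g x y * B)" for y
    using B[of y] g_nonneg[of x y] order_trans[OF abs_ge_zero B[of y]] by (simp add: abs_mult mult_left_mono)
  then show ?thesis
    using bd_meas[OF assms] borel_measurable_integrable[OF g_int[of x]]
    by (intro Bochner_Integration.integrable_bound[OF integrable_mult_left[OF g_int[of x], of B]] borel_measurable_times) auto
qed

lemma bd_G: assumes "bd a" shows "bd (G a)"
proof -
  obtain B where B: "\<And>x. \<bar>a x\<bar> \<le> B" using assms unfolding bd_def by blast
  note bd_meas[OF assms, measurable]
  have "G a \<in> borel_measurable M"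
    unfolding G_def by (rule borel_measurable_lebesgue_integral) measurable
  moreover have "\<bar>G a x\<bar> \<le> C * B" for x
  proof -
    have B0: "0 \<le> B" using order_trans[OF abs_ge_zero B] .
    have "\<bar>G a x\<bar> \<le> (\<integral>y. \<bar>g x y * a y\<bar> \<partial>M)" unfolding G_def using integral_norm_bound[of M "\<lambda>y. g x y * a y"] by simp
    also have "\<dots> \<le> (\<integral>y. g x y * B \<partial>M)"
      using g_bd_int[OF assms] B g_nonneg by (intro integral_mono integrable_abs integrable_mult_left g_int) (auto simp: abs_mult intro: mult_left_mono)
    also have "\<dots> \<le> C * B" using g_bound[of x] B0 by (simp add: mult_right_mono)
    finally show ?thesis .
  qed
  ultimately show ?thesis by (rule bdI)
qed

lemma G_add: "bd a \<Longrightarrow> bd b \<Longrightarrow> G (\<lambda>x. a x + b x) x = G a x + G b x"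
  unfolding G_def by (simp add: distrib_left g_bd_int)
lemma G_cmult: "G (\<lambda>x. c * a x) x = c * G a x"
  unfolding G_def by (simp add: mult.left_commute)
lemma G_diff: "bd a \<Longrightarrow> bd b \<Longrightarrow> G (\<lambda>x. a x - b x) x = G a x - G b x"
  unfolding G_def by (simp add: right_diff_distrib g_bd_int)

lemma bil_sym: assumes "bd a" "bd b" shows "bil a b = bil b a"
proof -
  interpret MM: pair_sigma_finite M M by standard
  note bd_meas[OF assms(1), measurable] bd_meas[OF assms(2), measurable]
  obtain A B where AB: "\<And>x. \<bar>a x\<bar> \<le> A" "\<And>x. \<bar>b x\<bar> \<le> B" using assms unfolding bd_def by blast
  have A0: "0 \<le> A" "0 \<le> B" using order_trans[OF abs_ge_zero AB(1)] order_trans[OF abs_ge_zero AB(2)] by auto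
  have i: "integrable (M \<Otimes>\<^sub>M M) (\<lambda>(x,y). a x * (g x y * b y))"
  proof (rule integrableI_bounded)
    show "(\<lambda>(x,y). a x * (g x y * b y)) \<in> borel_measurable (M \<Otimes>\<^sub>M M)" by measurable
    have "(\<integral>\<^sup>+p. ennreal (norm (case p of (x,y) \<Rightarrow> a x * (g x y * b y))) \<partial>(M \<Otimes>\<^sub>M M)) \<le> (\<integral>\<^sup>+p. ennreal (A * B * g (fst p) (snd p)) \<partial>(M \<Otimes>\<^sub>M M))"
    proof (rule nn_integral_mono, clarsimp)
      fix x y
      have "\<bar>a x\<bar> * (g x y * \<bar>b y\<bar>) \<le> A * (g x y * B)"
        by (intro mult_mono AB) (use g_nonneg A0 in auto)
      then show "ennreal \<bar>a x * (g x y * b y)\<bar> \<le> ennreal (A * B * g x y)" using g_nonneg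
        by (intro ennreal_leI) (simp add: abs_mult mult_ac)
    qed
    also have "\<dots> = (\<integral>\<^sup>+x. \<integral>\<^sup>+y. ennreal (A * B * g x y) \<partial>M \<partial>M)"
      by (subst nn_integral_fst[symmetric]) auto
    also have "\<dots> \<le> (\<integral>\<^sup>+x. ennreal (A * B * C) \<partial>M)"
    proof (rule nn_integral_mono)
      fix x
      have "(\<integral>\<^sup>+y. ennreal (A * B * g x y) \<partial>M) = ennreal (\<integral>y. A * B * g x y \<partial>M)"
        by (rule nn_integral_eq_integral) (use g_int g_nonneg A0 in auto)
      also have "\<dots> \<le> ennreal (A * B * C)" using g_bound[of x] A0 by (intro ennreal_leI) (simp add: mult_left_mono)
      finally show "(\<integral>\<^sup>+y. ennreal (A * B * g x y) \<partial>M) \<le> ennreal (A * B * C)" .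
    qed
    also have "\<dots> < \<infinity>" by (simp add: emeasure_space_1)
    finally show "(\<integral>\<^sup>+p. ennreal (norm (case p of (x,y) \<Rightarrow> a x * (g x y * b y))) \<partial>(M \<Otimes>\<^sub>M M)) < \<infinity>" .
  qed
  have "bil a b = (\<integral>x. \<integral>y. a x * (g x y * b y) \<partial>M \<partial>M)" unfolding bil_def G_def by simp
  also have "\<dots> = (\<integral>y. \<integral>x. a x * (g x y * b y) \<partial>M \<partial>M)" by (rule MM.Fubini_integral[OF i, symmetric])
  also have "\<dots> = (\<integral>y. b y * (\<integral>x. g y x * a x \<partial>M) \<partial>M)"
    by (simp add: g_sym mult_ac flip: integral_mult_right_zero)
  finally show ?thesis unfolding bil_def G_def .
qed

lemma bil_int: "bd a \<Longrightarrow> bd b \<Longrightarrow> integrable M (\<lambda>x. a x * G b x)"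
  by (intro bd_int bd_mult bd_G)

lemma bil_comb:
  assumes a: "bd a" and b: "bd b"
  shows "bil (\<lambda>x. s * a x + t * b x) (\<lambda>x. s * a x + t * b x) = s\<^sup>2 * bil a a + 2 * s * t * bil b a + t\<^sup>2 * bil b b"
proof -
  have "G (\<lambda>x. s * a x + t * b x) x = s * G a x + t * G b x" for x
    using G_add[OF bd_mult[OF bd_const[of s] a] bd_mult[OF bd_const[of t] b]] by (simp add: G_cmult)
  then have "bil (\<lambda>x. s * a x + t * b x) (\<lambda>x. s * a x + t * b x)
    = (\<integral>x. s\<^sup>2 * (a x * G a x) + s * t * (b x * G a x) + (s * t * (a x * G b x) + t\<^sup>2 * (b x * G b x)) \<partial>M)"
    unfolding bil_def by (intro Bochner_Integration.integral_cong refl) (simp add: algebra_simps power2_eq_square)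
  also have "\<dots> = s\<^sup>2 * bil a a + s * t * bil b a + (s * t * bil a b + t\<^sup>2 * bil b b)"
    unfolding bil_def by (simp add: bil_int a b)
  finally show ?thesis using bil_sym[OF a b] by simp
qed

text \<open>Schur's test: twice the product \<open>e x * e y\<close> is at most the sum of the
  squares, and every row of the kernel integrates to at most \<open>C\<close>.\<close>

lemma bil_schur: assumes e: "bd e" shows "bil e e \<le> C * (\<integral>x. (e x)\<^sup>2 \<partial>M)"
proof -
  have e2: "bd (\<lambda>x. (e x)\<^sup>2)" unfolding power2_eq_square by (intro bd_mult e)
  have "bil e e \<le> (\<integral>x. (((e x)\<^sup>2 * G (\<lambda>_. 1) x) + (1 * G (\<lambda>x. (e x)\<^sup>2) x)) / 2 \<partial>M)"
    unfolding bil_def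
  proof (rule integral_mono)
    show "integrable M (\<lambda>x. e x * G e x)" by (rule bil_int[OF e e])
    show "integrable M (\<lambda>x. (((e x)\<^sup>2 * G (\<lambda>_. 1) x) + (1 * G (\<lambda>x. (e x)\<^sup>2) x)) / 2)"
      by (intro integrable_divide Bochner_Integration.integrable_add bil_int e2 bd_const)
    fix x
    have "e x * G e x = (\<integral>y. e x * (g x y * e y) \<partial>M)" unfolding G_def by simp
    also have "\<dots> \<le> (\<integral>y. (((e x)\<^sup>2 * (g x y * 1)) + (g x y * (e y)\<^sup>2)) / 2 \<partial>M)"
    proof (rule integral_mono)
      show "integrable M (\<lambda>y. e x * (g x y * e y))" by (intro integrable_mult_right g_bd_int e)
      show "integrable M (\<lambda>y. (((e x)\<^sup>2 * (g x y * 1)) + (g x y * (e y)\<^sup>2)) / 2)"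
        by (intro integrable_divide Bochner_Integration.integrable_add integrable_mult_right g_bd_int e2 bd_const)
      fix y
      have "g x y * (2 * (e x * e y)) \<le> g x y * ((e x)\<^sup>2 + (e y)\<^sup>2)"
        using sum_squares_bound[of "e x" "e y"] by (intro mult_left_mono g_nonneg) simp
      then show "e x * (g x y * e y) \<le> (((e x)\<^sup>2 * (g x y * 1)) + (g x y * (e y)\<^sup>2)) / 2" by (simp add: algebra_simps)
    qed
    also have "\<dots> = (((e x)\<^sup>2 * G (\<lambda>_. 1) x) + (1 * G (\<lambda>x. (e x)\<^sup>2) x)) / 2"
    proof -
      have "integrable M (\<lambda>y. (e x)\<^sup>2 * (g x y * 1))" by (intro integrable_mult_right g_bd_int bd_const)
      moreover have "integrable M (\<lambda>y. g x y * (e y)\<^sup>2)" by (intro g_bd_int e2)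
      ultimately show ?thesis unfolding G_def by simp
    qed
    finally show "e x * G e x \<le> (((e x)\<^sup>2 * G (\<lambda>_. 1) x) + (1 * G (\<lambda>x. (e x)\<^sup>2) x)) / 2" .
  qed
  also have "\<dots> = (bil (\<lambda>x. (e x)\<^sup>2) (\<lambda>_. 1) + bil (\<lambda>_. 1) (\<lambda>x. (e x)\<^sup>2)) / 2"
    using bil_int[OF e2 bd_const[of 1]] bil_int[OF bd_const[of 1] e2] unfolding bil_def by simp
  also have "\<dots> = bil (\<lambda>x. (e x)\<^sup>2) (\<lambda>_. 1)" using bil_sym[OF e2 bd_const[of 1]] by simp
  also have "\<dots> \<le> (\<integral>x. C * (e x)\<^sup>2 \<partial>M)" unfolding bil_def
  proof (rule integral_mono[OF bil_int[OF e2 bd_const[of 1]]])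
    fix x show "(e x)\<^sup>2 * G (\<lambda>_. 1) x \<le> C * (e x)\<^sup>2"
      using g_bound[of x] unfolding G_def by (simp add: mult.commute mult_right_mono mult_left_mono)
  qed (use bd_int[OF e2] in auto)
  finally show ?thesis by simp
qed

section \<open>The Gibbs map on bounded densities\<close>

definition norm_const :: "('a \<Rightarrow> real) \<Rightarrow> real" where "norm_const q = (\<integral>x. exp (- \<gamma> * G q x) \<partial>M)"
definition gibbs_map :: "('a \<Rightarrow> real) \<Rightarrow> 'a \<Rightarrow> real" where "gibbs_map q x = exp (- \<gamma> * G q x) / norm_const q"
text \<open>The bound \<open>exp (\<gamma> * C)\<close> is the one \<open>gibbs_map\<close> produces
  by itself: its numerator is at most 1 and \<open>norm_const\<close> is at least
  \<open>exp (- \<gamma> * C)\<close>. This makes the set invariant.\<close>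

definition bounded_densities :: "('a \<Rightarrow> real) set" where
  "bounded_densities = {q. q \<in> borel_measurable M \<and> (\<forall>x. 0 \<le> q x \<and> q x \<le> exp (\<gamma> * C)) \<and> (\<integral>x. q x \<partial>M) = 1}"

lemma bounded_densities_bd: "q \<in> bounded_densities \<Longrightarrow> bd q"
  by (rule bdI[where B="exp (\<gamma> * C)"]) (auto simp: bounded_densities_def)

lemma G_nonneg: "q \<in> bounded_densities \<Longrightarrow> 0 \<le> G q x"
  unfolding G_def by (intro integral_nonneg_AE AE_I2 mult_nonneg_nonneg g_nonneg) (auto simp: bounded_densities_def)

lemma bd_expG: assumes "bd q" shows "bd (\<lambda>x. exp (- \<gamma> * G q x))"
proof -
  obtain B where B: "\<And>x. \<bar>G q x\<bar> \<le> B" using bd_G[OF assms] unfolding bd_def by blast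
  note bd_meas[OF bd_G[OF assms], measurable]
  show ?thesis
  proof (rule bdI[where B="exp (\<gamma> * B)"])
    fix x
    have "- \<gamma> * G q x \<le> \<gamma> * \<bar>G q x\<bar>" using gam_nonneg by (metis abs_ge_minus_self minus_mult_commute mult_left_mono)
    also have "\<dots> \<le> \<gamma> * B" by (rule mult_left_mono[OF B gam_nonneg])
    finally show "\<bar>exp (- \<gamma> * G q x)\<bar> \<le> exp (\<gamma> * B)" by simp
  qed measurable
qed

text \<open>Jensen's inequality for \<open>exp\<close> at the mean exponent \<open>m\<close>. The
  mean of \<open>G q\<close> is at most \<open>C\<close> because symmetry moves \<open>G\<close>
  from \<open>q\<close> to the constant 1.\<close>

lemma norm_const_ge: assumes q: "q \<in> bounded_densities" shows "exp (- \<gamma> * C) \<le> norm_const q"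
proof -
  have b: "bd q" by (rule bounded_densities_bd[OF q])
  have 1: "(\<integral>x. G q x \<partial>M) \<le> C"
  proof -
    have "(\<integral>x. G q x \<partial>M) = bil (\<lambda>_. 1) q" by (simp add: bil_def)
    also have "\<dots> = bil q (\<lambda>_. 1)" by (rule bil_sym[OF bd_const b])
    also have "\<dots> \<le> (\<integral>x. q x * C \<partial>M)" unfolding bil_def
      by (rule integral_mono[OF bil_int[OF b bd_const]])
        (use bd_int[OF b] g_bound q in \<open>auto simp: G_def bounded_densities_def intro!: mult_left_mono\<close>)
    also have "\<dots> = C" using q by (simp add: bounded_densities_def)
    finally show ?thesis .
  qed
  define m where "m = (\<integral>x. - \<gamma> * G q x \<partial>M)"
  have i: "integrable M (\<lambda>x. - \<gamma> * G q x)" by (intro bd_int bd_mult bd_const bd_G b)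
  \<comment> \<open>The tangent line of \<open>exp\<close> at \<open>m\<close> integrates to exactly
    \<open>exp m\<close>.\<close>
  have "exp m = (\<integral>x. exp m * (1 + (- \<gamma> * G q x) - m) \<partial>M)"
    using bd_int[OF bd_G[OF b]] by (simp add: prob_space m_def)
  also have "\<dots> \<le> norm_const q" unfolding norm_const_def
  proof (rule integral_mono)
    show "integrable M (\<lambda>x. exp m * (1 + (- \<gamma> * G q x) - m))" using bd_int[OF bd_G[OF b]] by auto
    show "integrable M (\<lambda>x. exp (- \<gamma> * G q x))" by (rule bd_int[OF bd_expG[OF b]])
    fix x
    have "1 + (- \<gamma> * G q x - m) \<le> exp (- \<gamma> * G q x - m)" by (rule exp_ge_add_one_self)
    then have "exp m * (1 + (- \<gamma> * G q x - m)) \<le> exp m * exp (- \<gamma> * G q x - m)" by simp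
    also have "\<dots> = exp (- \<gamma> * G q x)" by (simp add: exp_add[symmetric])
    finally show "exp m * (1 + (- \<gamma> * G q x) - m) \<le> exp (- \<gamma> * G q x)" by (simp add: algebra_simps)
  qed
  finally have "exp m \<le> norm_const q" .
  moreover have "- \<gamma> * C \<le> m" unfolding m_def using mult_left_mono[OF 1 gam_nonneg] by simp
  ultimately show ?thesis by (meson exp_le_cancel_iff order_trans)
qed

lemma norm_const_pos: "q \<in> bounded_densities \<Longrightarrow> 0 < norm_const q"
  using norm_const_ge[of q] exp_gt_zero[of "- \<gamma> * C"] by linarith

lemma gibbs_map_bounds:
  assumes q: "q \<in> bounded_densities"
  shows "0 < gibbs_map q x" "gibbs_map q x \<le> exp (\<gamma> * C)" "gibbs_map q \<in> bounded_densities"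
proof -
  show p: "0 < gibbs_map q x" for x using norm_const_pos[OF q] by (simp add: gibbs_map_def)
  show le: "gibbs_map q x \<le> exp (\<gamma> * C)" for x
  proof -
    have "gibbs_map q x \<le> 1 / exp (- \<gamma> * C)" unfolding gibbs_map_def
      by (rule frac_le) (use norm_const_ge[OF q] G_nonneg[OF q] gam_nonneg in \<open>auto simp: mult_nonneg_nonneg\<close>)
    then show ?thesis by (simp add: exp_minus field_simps)
  qed
  have m: "gibbs_map q \<in> borel_measurable M" unfolding gibbs_map_def using bd_meas[OF bd_expG[OF bounded_densities_bd[OF q]]] by measurable
  have "(\<integral>x. gibbs_map q x \<partial>M) = 1" unfolding gibbs_map_def using norm_const_pos[OF q] by (simp add: norm_const_def)
  then show "gibbs_map q \<in> bounded_densities" using m le less_imp_le[OF p] by (auto simp: bounded_densities_def)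
qed

lemma bounded_densities_convex: assumes "q \<in> bounded_densities" "r \<in> bounded_densities" "0 \<le> t" "t \<le> 1" shows "(\<lambda>x. (1 - t) * q x + t * r x) \<in> bounded_densities"
proof -
  have "(\<integral>x. (1 - t) * q x + t * r x \<partial>M) = 1"
    using bd_int[OF bounded_densities_bd[OF assms(1)]] bd_int[OF bounded_densities_bd[OF assms(2)]] assms by (simp add: bounded_densities_def)
  moreover have "(1 - t) * q x + t * r x \<le> exp (\<gamma> * C)" for x
    by (rule convex_bound_le) (use assms in \<open>auto simp: bounded_densities_def\<close>)
  ultimately show ?thesis using assms by (auto simp: bounded_densities_def intro!: borel_measurable_add borel_measurable_times add_nonneg_nonneg mult_nonneg_nonneg)
qed

text \<open>The logarithm of \<open>gibbs_map q\<close> is affine in \<open>G q\<close>. The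
  difference of the two logarithms is thus \<open>- \<gamma> * G (q - r)\<close> up to a constant,
  and the constant disappears against a difference of probability densities.
  \<open>ln_diff_two_point\<close> does the rest.\<close>

lemma gibbs_monotone:
  assumes q: "q \<in> bounded_densities" "r \<in> bounded_densities"
  shows "\<gamma> * bil (\<lambda>x. gibbs_map q x - gibbs_map r x) (\<lambda>x. q x - r x) \<le> - ((\<integral>x. (gibbs_map q x - gibbs_map r x)\<^sup>2 \<partial>M) / exp (\<gamma> * C))"
proof -
  let ?e = "\<lambda>x. gibbs_map q x - gibbs_map r x" and ?d = "\<lambda>x. q x - r x" and ?c = "exp (\<gamma> * C)"
  note T = gibbs_map_bounds[OF q(1)] gibbs_map_bounds[OF q(2)]
  have be: "bd ?e" "bd ?d" by (intro bd_diff bounded_densities_bd T q)+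
  have e2: "bd (\<lambda>x. (?e x)\<^sup>2)" unfolding power2_eq_square by (intro bd_mult be)
  have e0: "(\<integral>x. ?e x \<partial>M) = 0"
    using T(3) T(6) bd_int[OF bounded_densities_bd[OF T(3)]] bd_int[OF bounded_densities_bd[OF T(6)]] by (simp add: bounded_densities_def)
  have ln: "ln (gibbs_map q x) - ln (gibbs_map r x) = - \<gamma> * G ?d x + (ln (norm_const r) - ln (norm_const q))" for x
  proof -
    have "\<gamma> * G ?d x = \<gamma> * G q x - \<gamma> * G r x"
      unfolding G_diff[OF bounded_densities_bd[OF q(1)] bounded_densities_bd[OF q(2)]] by (rule right_diff_distrib)
    then show ?thesis unfolding gibbs_map_def using norm_const_pos[OF q(1)] norm_const_pos[OF q(2)] by (simp add: ln_div)
  qed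
  have "(\<integral>x. (?e x)\<^sup>2 \<partial>M) / ?c = (\<integral>x. (?e x)\<^sup>2 / ?c \<partial>M)" by simp
  also have "\<dots> \<le> (\<integral>x. - \<gamma> * (?e x * G ?d x) + (ln (norm_const r) - ln (norm_const q)) * ?e x \<partial>M)"
  proof (rule integral_mono)
    show "integrable M (\<lambda>x. (?e x)\<^sup>2 / ?c)" by (intro integrable_divide bd_int e2)
    show "integrable M (\<lambda>x. - \<gamma> * (?e x * G ?d x) + (ln (norm_const r) - ln (norm_const q)) * ?e x)"
      by (intro Bochner_Integration.integrable_add integrable_mult_right bil_int be bd_int)
    fix x
    have "(?e x)\<^sup>2 / ?c \<le> ?e x * (ln (gibbs_map q x) - ln (gibbs_map r x))"
      by (rule ln_diff_two_point) (rule T)+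
    then show "(?e x)\<^sup>2 / ?c \<le> - \<gamma> * (?e x * G ?d x) + (ln (norm_const r) - ln (norm_const q)) * ?e x"
      unfolding ln by (simp add: algebra_simps)
  qed
  also have "\<dots> = - \<gamma> * bil ?e ?d + (ln (norm_const r) - ln (norm_const q)) * (\<integral>x. ?e x \<partial>M)"
  proof -
    have "integrable M (\<lambda>x. - \<gamma> * (?e x * G ?d x))" "integrable M (\<lambda>x. (ln (norm_const r) - ln (norm_const q)) * ?e x)"
      by (intro integrable_mult_right bil_int be bd_int)+
    then show ?thesis unfolding bil_def by (subst Bochner_Integration.integral_add) auto
  qed
  finally show ?thesis using e0 by simp
qed

end

locale mean_field_pos = mean_field +
  assumes psd_g: "a \<in> borel_measurable M \<Longrightarrow> (\<And>x. \<bar>a x\<bar> \<le> B) \<Longrightarrow> 0 \<le> (\<integral>x. a x * (\<integral>y. g x y * a y \<partial>M) \<partial>M)"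
begin

lemma bil_nonneg: "bd a \<Longrightarrow> 0 \<le> bil a a"
  unfolding bd_def bil_def G_def using psd_g by blast

text \<open>The increments \<open>d\<close> of the iterates and \<open>e'\<close> of their images
  satisfy \<open>d (Suc k) = (1 - t) d k + t e' k\<close>. In the energy of the right-hand side the
  cross term is negative of order \<open>t\<close> by \<open>gibbs_monotone\<close>, while
  \<open>bil_schur\<close> makes the square of \<open>e'\<close> of order \<open>t^2\<close>, so a
  small \<open>t\<close> wins. Decay of the energy alone gives no pointwise convergence; the surplus
  \<open>\<delta> * S k\<close> controls \<open>e'\<close> in L2 and supplies it.\<close>

lemma fixed_point_pos:
  assumes gpos: "0 < \<gamma>"
  shows "\<exists>q\<in>bounded_densities. \<forall>x. q x = gibbs_map q x"
proof -
  define c where "c = exp (\<gamma> * C)"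
  have c: "0 < c" by (simp add: c_def)
  \<comment> \<open>The bound 1/2 gives \<open>2 (1 - t) \<ge> 1\<close> in the cross term; the
    other bound makes the quadratic term at most half of the cross term. Writing
    \<open>C + 1\<close> keeps the denominator positive when \<open>C = 0\<close>.\<close>
  define t where "t = min (1/2) (1 / (2 * c * \<gamma> * (C + 1)))"
  have C1: "0 < C + 1" using C_nonneg by simp
  have t: "0 < t" "t \<le> 1/2" "t \<le> 1 / (2 * c * \<gamma> * (C + 1))" using c gpos C1 by (auto simp: t_def)
  have tC: "t * C \<le> 1 / (2 * c * \<gamma>)"
  proof -
    have "t * C \<le> 1 / (2 * c * \<gamma> * (C + 1)) * (C + 1)" using t C_nonneg c gpos by (intro mult_mono) auto
    then show ?thesis using C1 by simp
  qed
  define \<delta> where "\<delta> = t / (2 * c * \<gamma>)"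
  have del: "0 < \<delta>" using t c gpos by (simp add: \<delta>_def)
  define f where "f q = (\<lambda>x. (1 - t) * q x + t * gibbs_map q x)" for q
  define Q where "Q k = (f ^^ k) (\<lambda>_. 1)" for k
  have Q0: "Q 0 = (\<lambda>_. 1)" by (simp add: Q_def)
  have QS: "Q (Suc k) = (\<lambda>x. (1 - t) * Q k x + t * gibbs_map (Q k) x)" for k by (simp add: Q_def f_def)
  have QK: "Q k \<in> bounded_densities" for k
  proof (induction k)
    case 0
    have "1 \<le> exp (\<gamma> * C)" using gam_nonneg C_nonneg by simp
    then show ?case by (simp add: Q0 bounded_densities_def prob_space)
  next
    case (Suc k) then show ?case unfolding QS by (intro bounded_densities_convex gibbs_map_bounds) (use t in auto)
  qed
  note Qb = bounded_densities_bd[OF QK] and TQ = gibbs_map_bounds[OF QK] and TQb = bounded_densities_bd[OF gibbs_map_bounds(3)[OF QK]]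
  define d where "d k = (\<lambda>x. Q (Suc k) x - Q k x)" for k
  define e' where "e' k = (\<lambda>x. gibbs_map (Q (Suc k)) x - gibbs_map (Q k) x)" for k
  have db: "bd (d k)" and eb: "bd (e' k)" for k unfolding d_def e'_def by (intro bd_diff Qb TQb)+
  have dS: "d (Suc k) = (\<lambda>x. (1 - t) * d k x + t * e' k x)" for k
    unfolding d_def e'_def QS[of "Suc k"] QS[of k] by (rule ext) (simp add: algebra_simps)
  define En where "En k = bil (d k) (d k)" for k
  define S where "S k = (\<integral>x. (e' k x)\<^sup>2 \<partial>M)" for k
  have S0: "0 \<le> S k" for k unfolding S_def by (intro integral_nonneg_AE) auto
  have E0: "0 \<le> En k" for k unfolding En_def by (rule bil_nonneg[OF db])
  \<comment> \<open>The cross term contributes at most \<open>- 2 \<delta> S k\<close> and the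
    quadratic term at most \<open>\<delta> S k\<close>; the difference stays on the left.\<close>
  have step: "En (Suc k) + \<delta> * S k \<le> (1 - t)\<^sup>2 * En k" for k
  proof -
    have m: "\<gamma> * bil (e' k) (d k) \<le> - (S k / c)"
      using gibbs_monotone[OF QK QK, of "Suc k" k] unfolding e'_def d_def S_def c_def .
    have s: "bil (e' k) (e' k) \<le> C * S k" unfolding S_def by (rule bil_schur[OF eb])
    have m': "bil (e' k) (d k) \<le> - (S k / (c * \<gamma>))" using m gpos c by (simp add: field_simps)
    have "En (Suc k) = (1 - t)\<^sup>2 * En k + 2 * (1 - t) * t * bil (e' k) (d k) + t\<^sup>2 * bil (e' k) (e' k)"
      unfolding En_def dS by (rule bil_comb[OF db eb])
    also have "\<dots> \<le> (1 - t)\<^sup>2 * En k + 2 * (1 - t) * t * (- (S k / (c * \<gamma>))) + t\<^sup>2 * (C * S k)"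
      by (intro add_mono mult_left_mono m' s) (use t in auto)
    also have "\<dots> \<le> (1 - t)\<^sup>2 * En k - \<delta> * S k"
    proof -
      have "t\<^sup>2 * (C * S k) = t * (t * C) * S k" by (simp add: power2_eq_square)
      also have "\<dots> \<le> t * (1 / (2 * c * \<gamma>)) * S k" by (intro mult_right_mono mult_left_mono tC S0) (use t in auto)
      finally have 1: "t\<^sup>2 * (C * S k) \<le> \<delta> * S k" by (simp add: \<delta>_def)
      define X where "X = S k / (c * \<gamma>)"
      define Y where "Y = 2 * (1 - t) * t * X"
      have "1 * t * X \<le> Y" unfolding Y_def
        by (intro mult_right_mono) (use t S0[of k] c gpos in \<open>auto simp: X_def\<close>)
      moreover have "t * X = 2 * (\<delta> * S k)" by (simp add: \<delta>_def X_def)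
      moreover have "2 * (1 - t) * t * (- (S k / (c * \<gamma>))) = - Y" by (simp add: Y_def X_def)
      ultimately show ?thesis using 1 by simp
    qed
    finally show ?thesis by simp
  qed
  define \<rho> where "\<rho> = 1 - t"
  have rho: "0 < \<rho>" "\<rho> < 1" using t by (auto simp: \<rho>_def)
  have En_le: "En k \<le> (\<rho>\<^sup>2) ^ k * En 0" for k
  proof (induction k)
    case (Suc k)
    have "En (Suc k) \<le> \<rho>\<^sup>2 * En k" using step[of k] mult_nonneg_nonneg[OF less_imp_le[OF del] S0[of k]] unfolding \<rho>_def by linarith
    also have "\<dots> \<le> \<rho>\<^sup>2 * ((\<rho>\<^sup>2) ^ k * En 0)" by (rule mult_left_mono[OF Suc]) simp
    finally show ?case by simp
  qed simp
  \<comment> \<open>Comes from \<open>\<bar>a\<bar> \<le> (a^2 / r + r) / 2\<close> with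
    \<open>r = \<rho> ^ k\<close>, since \<open>S k\<close> is of order \<open>r^2\<close>.\<close>
  define B where "B = (En 0 / \<delta> + 1) / 2"
  have B0: "0 \<le> B" using E0[of 0] del by (simp add: B_def)
  have e1: "(\<integral>x. \<bar>e' k x\<bar> \<partial>M) \<le> B * \<rho> ^ k" for k
  proof -
    have "\<delta> * S k \<le> (\<rho>\<^sup>2) ^ k * En 0"
    proof -
      have "\<delta> * S k \<le> \<rho>\<^sup>2 * En k" using step[of k] E0[of "Suc k"] by (simp add: \<rho>_def)
      also have "\<dots> \<le> 1 * En k" using rho E0[of k] by (intro mult_right_mono) (auto simp: power2_eq_square mult_le_one)
      also have "\<dots> \<le> (\<rho>\<^sup>2) ^ k * En 0" using En_le[of k] by simp
      finally show ?thesis .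
    qed
    then have annulus_sample: "S k \<le> \<rho> ^ k * \<rho> ^ k * (En 0 / \<delta>)" using del
      by (simp add: field_simps power_mult_distrib power2_eq_square)
    have "(\<integral>x. \<bar>e' k x\<bar> \<partial>M) \<le> (\<integral>x. ((e' k x)\<^sup>2 / \<rho> ^ k + \<rho> ^ k) / 2 \<partial>M)"
    proof (rule integral_mono)
      show "integrable M (\<lambda>x. \<bar>e' k x\<bar>)" by (intro integrable_abs bd_int eb)
      show "integrable M (\<lambda>x. ((e' k x)\<^sup>2 / \<rho> ^ k + \<rho> ^ k) / 2)"
        unfolding power2_eq_square by (intro integrable_divide Bochner_Integration.integrable_add bd_int bd_mult eb bd_const)
      fix x
      have *: "a \<le> (a\<^sup>2 / r + r) / 2" if "0 < r" for a r :: real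
        using sum_squares_bound[of a r] that by (simp add: field_simps power2_eq_square)
      show "\<bar>e' k x\<bar> \<le> ((e' k x)\<^sup>2 / \<rho> ^ k + \<rho> ^ k) / 2"
        using *[of "\<rho> ^ k" "\<bar>e' k x\<bar>"] rho by simp
    qed
    also have "\<dots> = (S k / \<rho> ^ k + \<rho> ^ k) / 2"
      using bd_int[OF bd_mult[OF eb eb], of k k] unfolding S_def by (simp add: power2_eq_square prob_space)
    also have "\<dots> \<le> (\<rho> ^ k * (En 0 / \<delta>) + \<rho> ^ k) / 2"
      using annulus_sample rho by (intro divide_right_mono add_right_mono) (auto simp: divide_le_eq mult_ac)
    also have "\<dots> = B * \<rho> ^ k" by (simp add: B_def field_simps)
    finally show ?thesis .
  qed
  have aeS: "AE x in M. summable (\<lambda>k. \<bar>e' k x\<bar>)"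
  proof -
    have em: "(\<lambda>x. ennreal \<bar>e' k x\<bar>) \<in> borel_measurable M" for k using bd_meas[OF eb[of k]] by measurable
    have "(\<integral>\<^sup>+x. (\<Sum>k. ennreal \<bar>e' k x\<bar>) \<partial>M) = (\<Sum>k. \<integral>\<^sup>+x. ennreal \<bar>e' k x\<bar> \<partial>M)"
      by (rule nn_integral_suminf[OF em])
    also have "\<dots> \<le> (\<Sum>k. ennreal (B * \<rho> ^ k))"
    proof (rule suminf_le)
      fix k
      have "(\<integral>\<^sup>+x. ennreal \<bar>e' k x\<bar> \<partial>M) = ennreal (\<integral>x. \<bar>e' k x\<bar> \<partial>M)"
        by (rule nn_integral_eq_integral) (use bd_int[OF eb] in auto)
      also have "\<dots> \<le> ennreal (B * \<rho> ^ k)" by (rule ennreal_leI[OF e1])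
      finally show "(\<integral>\<^sup>+x. ennreal \<bar>e' k x\<bar> \<partial>M) \<le> ennreal (B * \<rho> ^ k)" .
    qed auto
    also have "\<dots> = ennreal (\<Sum>k. B * \<rho> ^ k)"
      by (rule suminf_ennreal2) (use B0 rho in \<open>auto intro!: summable_mult summable_geometric\<close>)
    also have "\<dots> < \<infinity>" by simp
    finally have "(\<integral>\<^sup>+x. (\<Sum>k. ennreal \<bar>e' k x\<bar>) \<partial>M) \<noteq> \<infinity>" by simp
    then have "AE x in M. (\<Sum>k. ennreal \<bar>e' k x\<bar>) \<noteq> \<infinity>"
      by (rule nn_integral_noteq_infinite[rotated]) (use em in measurable)
    then show ?thesis by eventually_elim (rule summable_suminf_not_top, auto)
  qed
  define w where "w x = lim (\<lambda>k. Q k x)" for x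
  have aew: "AE x in M. (\<lambda>k. Q k x) \<longlonglongrightarrow> w x \<and> (\<lambda>k. gibbs_map (Q k) x) \<longlonglongrightarrow> w x"
    using aeS
  proof eventually_elim
    fix x assume s: "summable (\<lambda>k. \<bar>e' k x\<bar>)"
    let ?E = "\<Sum>k. \<bar>e' k x\<bar>"
    have ds: "\<bar>d (Suc k) x\<bar> \<le> (1 - t) * \<bar>d k x\<bar> + t * \<bar>e' k x\<bar>" for k
      unfolding dS using abs_triangle_ineq[of "(1 - t) * d k x" "t * e' k x"] t by (simp add: abs_mult)
    \<comment> \<open>Summing the recursion puts the partial sum on both sides, with factors 1 and
      \<open>1 - t\<close>; solving for it leaves a division by \<open>t\<close>.\<close>
    have bnd: "(\<Sum>k<n. \<bar>d k x\<bar>) \<le> (\<bar>d 0 x\<bar> + t * ?E) / t" for n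
    proof -
      have "(\<Sum>k<Suc n. \<bar>d k x\<bar>) = \<bar>d 0 x\<bar> + (\<Sum>k<n. \<bar>d (Suc k) x\<bar>)" by (rule sum.lessThan_Suc_shift)
      also have "\<dots> \<le> \<bar>d 0 x\<bar> + (\<Sum>k<n. (1 - t) * \<bar>d k x\<bar> + t * \<bar>e' k x\<bar>)" by (intro add_left_mono sum_mono ds)
      also have "\<dots> = \<bar>d 0 x\<bar> + (1 - t) * (\<Sum>k<n. \<bar>d k x\<bar>) + t * (\<Sum>k<n. \<bar>e' k x\<bar>)"
        by (simp add: sum.distrib sum_distrib_left)
      also have "\<dots> \<le> \<bar>d 0 x\<bar> + (1 - t) * (\<Sum>k<n. \<bar>d k x\<bar>) + t * ?E"
        using sum_le_suminf[OF s, of "{..<n}"] t by (intro add_left_mono mult_left_mono) auto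
      finally have "(\<Sum>k<Suc n. \<bar>d k x\<bar>) \<le> \<bar>d 0 x\<bar> + (1 - t) * (\<Sum>k<n. \<bar>d k x\<bar>) + t * ?E" .
      then have "t * (\<Sum>k<n. \<bar>d k x\<bar>) \<le> \<bar>d 0 x\<bar> + t * ?E" by (simp add: algebra_simps)
      then show ?thesis using t by (simp add: field_simps)
    qed
    have "summable (\<lambda>k. \<bar>d k x\<bar>)" by (rule summableI_nonneg_bounded[OF _ bnd]) simp
    then have "summable (\<lambda>k. d k x)" by (rule summable_rabs_cancel)
    then have "(\<lambda>n. \<Sum>k<n. d k x) \<longlonglongrightarrow> (\<Sum>k. d k x)" by (rule summable_LIMSEQ)
    moreover have "(\<Sum>k<n. d k x) = Q n x - Q 0 x" for n unfolding d_def by (rule sum_lessThan_telescope)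
    ultimately have "(\<lambda>n. Q n x - Q 0 x) \<longlonglongrightarrow> (\<Sum>k. d k x)" by simp
    then have "(\<lambda>n. (Q n x - Q 0 x) + Q 0 x) \<longlonglongrightarrow> (\<Sum>k. d k x) + Q 0 x" by (intro tendsto_add tendsto_const)
    then have "convergent (\<lambda>n. Q n x)" by (auto simp: convergent_def)
    then have l: "(\<lambda>n. Q n x) \<longlonglongrightarrow> w x" by (simp add: convergent_LIMSEQ_iff w_def)
    \<comment> \<open>The image of an iterate is recovered from two consecutive iterates, so it has
      the same limit as they do.\<close>
    have "(\<lambda>n. (Q (Suc n) x - (1 - t) * Q n x) / t) \<longlonglongrightarrow> (w x - (1 - t) * w x) / t"
      by (intro tendsto_divide tendsto_diff tendsto_mult tendsto_const LIMSEQ_Suc[OF l] l) (use t in auto)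
    moreover have "(w x - (1 - t) * w x) / t = w x" using t by (simp add: field_simps)
    moreover have "(Q (Suc n) x - (1 - t) * Q n x) / t = gibbs_map (Q n) x" for n unfolding QS using t by simp
    ultimately have "(\<lambda>n. gibbs_map (Q n) x) \<longlonglongrightarrow> w x" by simp
    with l show "(\<lambda>k. Q k x) \<longlonglongrightarrow> w x \<and> (\<lambda>k. gibbs_map (Q k) x) \<longlonglongrightarrow> w x" ..
  qed
  have wm: "w \<in> borel_measurable M"
    unfolding w_def by (rule borel_measurable_lim_metric) (rule bd_meas[OF Qb])
  \<comment> \<open>Clipping alters the limit on a null set only and makes the bounds of
    \<open>bounded_densities\<close> hold everywhere.\<close>
  define w' where "w' x = max 0 (min (w x) c)" for x
  have w'm: "w' \<in> borel_measurable M" unfolding w'_def using wm by measurable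
  have w'b: "0 \<le> w' x" "w' x \<le> c" for x using c by (auto simp: w'_def)
  have Qc: "0 \<le> Q k x" "Q k x \<le> c" for k x using QK[of k] by (auto simp: bounded_densities_def c_def)
  have aew': "AE x in M. (\<lambda>k. Q k x) \<longlonglongrightarrow> w' x \<and> (\<lambda>k. gibbs_map (Q k) x) \<longlonglongrightarrow> w' x"
    using aew
  proof eventually_elim
    fix x assume a: "(\<lambda>k. Q k x) \<longlonglongrightarrow> w x \<and> (\<lambda>k. gibbs_map (Q k) x) \<longlonglongrightarrow> w x"
    have "0 \<le> w x" using a Qc by (intro LIMSEQ_le_const[of "\<lambda>k. Q k x"]) auto
    moreover have "w x \<le> c" using a Qc by (intro LIMSEQ_le_const2[of "\<lambda>k. Q k x"]) auto
    ultimately show "(\<lambda>k. Q k x) \<longlonglongrightarrow> w' x \<and> (\<lambda>k. gibbs_map (Q k) x) \<longlonglongrightarrow> w' x" using a by (simp add: w'_def)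
  qed
  have w'bd: "bd w'" by (rule bdI[OF w'm, of c]) (use w'b in auto)
  have "(\<lambda>k. \<integral>x. Q k x \<partial>M) \<longlonglongrightarrow> (\<integral>x. w' x \<partial>M)"
    by (rule integral_dominated_convergence[where w="\<lambda>_. c"]) (use w'm bd_meas[OF Qb] aew' Qc in auto)
  moreover have "(\<integral>x. Q k x \<partial>M) = 1" for k using QK[of k] by (simp add: bounded_densities_def)
  ultimately have "(\<lambda>k::nat. 1) \<longlonglongrightarrow> (\<integral>x. w' x \<partial>M)" by simp
  then have "(\<integral>x. w' x \<partial>M) = 1" using LIMSEQ_unique tendsto_const by blast
  then have wK: "w' \<in> bounded_densities" using w'm w'b by (simp add: bounded_densities_def c_def)
  have Gl: "(\<lambda>k. G (Q k) x) \<longlonglongrightarrow> G w' x" for x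
    unfolding G_def
  proof (rule integral_dominated_convergence[where w="\<lambda>y. g x y * c"])
    have gm: "(\<lambda>y. g x y) \<in> borel_measurable M" by (rule borel_measurable_integrable[OF g_int])
    show "(\<lambda>y. g x y * w' y) \<in> borel_measurable M" using gm w'm by measurable
    show "(\<lambda>y. g x y * Q i y) \<in> borel_measurable M" for i using gm bd_meas[OF Qb[of i]] by measurable
    show "integrable M (\<lambda>y. g x y * c)" using g_int by auto
    show "AE y in M. (\<lambda>i. g x y * Q i y) \<longlonglongrightarrow> g x y * w' y" using aew' by eventually_elim (auto intro: tendsto_mult)
    show "AE y in M. norm (g x y * Q i y) \<le> g x y * c" for i
      using Qc[of i] g_nonneg by (auto simp: abs_mult intro!: mult_left_mono)
  qed
  have Zl: "(\<lambda>k. norm_const (Q k)) \<longlonglongrightarrow> norm_const w'"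
    unfolding norm_const_def
  proof (rule integral_dominated_convergence[where w="\<lambda>_. 1"])
    show "AE x in M. (\<lambda>i. exp (- \<gamma> * G (Q i) x)) \<longlonglongrightarrow> exp (- \<gamma> * G w' x)"
      by (intro AE_I2 tendsto_exp tendsto_mult tendsto_const Gl)
    show "AE x in M. norm (exp (- \<gamma> * G (Q i) x)) \<le> 1" for i
      using G_nonneg[OF QK] gam_nonneg by (auto simp: mult_nonneg_nonneg)
  qed (use bd_meas[OF bd_expG[OF w'bd]] bd_meas[OF bd_expG[OF Qb]] in auto)
  have Tl: "(\<lambda>k. gibbs_map (Q k) x) \<longlonglongrightarrow> gibbs_map w' x" for x
    unfolding gibbs_map_def by (intro tendsto_divide tendsto_exp tendsto_mult tendsto_const Gl Zl) (use norm_const_pos[OF wK] in auto)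
  have ae: "AE x in M. gibbs_map w' x = w' x"
    using aew' by eventually_elim (use Tl LIMSEQ_unique in blast)
  \<comment> \<open>So far \<open>w'\<close> is a fixed point almost everywhere. Its image is one
    everywhere, because \<open>G\<close> does not see null sets.\<close>
  have "G (gibbs_map w') x = G w' x" for x unfolding G_def
  proof (rule integral_cong_AE)
    have gm: "(\<lambda>y. g x y) \<in> borel_measurable M" by (rule borel_measurable_integrable[OF g_int])
    show "(\<lambda>y. g x y * gibbs_map w' y) \<in> borel_measurable M" using gm bd_meas[OF bounded_densities_bd[OF gibbs_map_bounds(3)[OF wK]]] by measurable
    show "(\<lambda>y. g x y * w' y) \<in> borel_measurable M" using gm w'm by measurable
    show "AE y in M. g x y * gibbs_map w' y = g x y * w' y" using ae by eventually_elim simp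
  qed
  then have "G (gibbs_map w') = G w'" by (rule ext)
  then have "gibbs_map (gibbs_map w') = gibbs_map w'" by (simp add: gibbs_map_def[abs_def] norm_const_def)
  then show ?thesis using gibbs_map_bounds(3)[OF wK] by (intro bexI[of _ "gibbs_map w'"]) auto
qed

theorem fixed_point_exists:
  obtains q where "q \<in> borel_measurable M" "\<And>x. 0 < q x" "\<And>x. q x \<le> exp (\<gamma> * C)" "(\<integral>x. q x \<partial>M) = 1"
    "\<And>x. q x = exp (- \<gamma> * (\<integral>y. g x y * q y \<partial>M)) / (\<integral>x. exp (- \<gamma> * (\<integral>y. g x y * q y \<partial>M)) \<partial>M)"
proof -
  have "\<exists>q\<in>bounded_densities. \<forall>x. q x = gibbs_map q x"
  \<comment> \<open>The damping constant above divides by \<gamma>. For \<open>\<gamma> = 0\<close>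
    the map sends every density to 1.\<close>
  proof (cases "\<gamma> = 0")
    case True
    show ?thesis unfolding gibbs_map_def norm_const_def bounded_densities_def by (intro bexI[of _ "\<lambda>_. 1"]) (simp_all add: prob_space True)
  next
    case False then show ?thesis using gam_nonneg by (intro fixed_point_pos) simp
  qed
  then obtain q where q: "q \<in> bounded_densities" "\<And>x. q x = gibbs_map q x" by blast
  have "0 < q x" for x using gibbs_map_bounds(1)[OF q(1), of x] q(2)[of x] by simp
  moreover have "q \<in> borel_measurable M" "q x \<le> exp (\<gamma> * C)" "(\<integral>x. q x \<partial>M) = 1" for x
    using q(1) by (auto simp: bounded_densities_def)
  ultimately show thesis using q(2)[unfolded gibbs_map_def norm_const_def G_def] by (intro that[of q])
qed

end

section \<open>Ratios of partition functions and factorial moments\<close>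

text \<open>The kernel \<open>k\<close> is a bounded substitute for \<open>g\<close> from below
  whose potentials are almost those of \<open>g\<close>. The last clause says that unit masses at
  the \<open>x i\<close> minus \<open>c\<close> times \<open>M\<close> have nonnegative
  \<open>k\<close>-energy; \<open>K\<close> bounds the self-energies that this includes.\<close>

locale mean_field_psd = mean_field +
  assumes psd: "0 < \<epsilon> \<Longrightarrow> \<exists>k K. (\<lambda>p. k (fst p) (snd p)) \<in> borel_measurable (M \<Otimes>\<^sub>M M) \<and>
     (\<forall>x y. 0 \<le> k x y \<and> k x y \<le> K \<and> k x y = k y x) \<and> (\<forall>x. AE y in M. k x y \<le> g x y) \<and>
     (\<forall>x. (\<integral>y. g x y \<partial>M) - \<epsilon> \<le> (\<integral>y. k x y \<partial>M)) \<and>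
     (\<forall>n (x::nat \<Rightarrow> 'a) c. 0 \<le> c \<longrightarrow> 0 \<le> (\<Sum>i<n. \<Sum>j<n. k (x i) (x j)) - 2 * c * (\<Sum>i<n. \<integral>y. k (x i) y \<partial>M)
        + c\<^sup>2 * (\<integral>x. (\<integral>y. k x y \<partial>M) \<partial>M))"

section \<open>One- and two-particle marginals of the product measure\<close>

context mean_field begin

lemma comp_meas:
  assumes "f \<in> borel_measurable M" "i \<in> I" shows "(\<lambda>x. f (x i)) \<in> borel_measurable (MI I)"
  by (rule measurable_compose[OF _ assms(1)]) (use assms(2) in \<open>auto intro!: measurable_component_singleton\<close>)

lemma comp_distr: "i \<in> I \<Longrightarrow> distr (MI I) M (\<lambda>x. x i) = M"
  using product_prob_space.PiM_component[of "\<lambda>_. M" i I] prob_space_axioms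
  by (simp add: product_prob_space_def product_prob_space_axioms_def product_sigma_finite_def prob_space_imp_sigma_finite)

lemma comp_integral:
  fixes f :: "'a \<Rightarrow> real"
  assumes f: "f \<in> borel_measurable M" "i \<in> I" shows "(\<integral>x. f (x i) \<partial>MI I) = (\<integral>x. f x \<partial>M)"
proof -
  have "(\<integral>x. f x \<partial>distr (MI I) M (\<lambda>x. x i)) = (\<integral>x. f (x i) \<partial>MI I)"
    by (rule integral_distr) (use f in \<open>auto intro!: measurable_component_singleton\<close>)
  then show ?thesis by (simp add: comp_distr[OF f(2)])
qed

lemma comp_nn_integral:
  assumes f: "f \<in> borel_measurable M" "i \<in> I" shows "(\<integral>\<^sup>+x. f (x i) \<partial>MI I) = (\<integral>\<^sup>+x. f x \<partial>M)"
proof -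
  have "(\<integral>\<^sup>+x. f x \<partial>distr (MI I) M (\<lambda>x. x i)) = (\<integral>\<^sup>+x. f (x i) \<partial>MI I)"
    by (rule nn_integral_distr) (use f in \<open>auto intro!: measurable_component_singleton\<close>)
  then show ?thesis by (simp add: comp_distr[OF f(2)])
qed

lemma pair_nn:
  assumes I: "finite I" "i \<in> I" "j \<in> I" "i \<noteq> j"
    and f: "(\<lambda>p. f (fst p) (snd p)) \<in> borel_measurable (M \<Otimes>\<^sub>M M)"
  shows "(\<integral>\<^sup>+x. f (x i) (x j) \<partial>MI I) = (\<integral>\<^sup>+x. \<integral>\<^sup>+y. f y x \<partial>M \<partial>M)"
proof -
  have eq: "insert i (I-{i}) = I" using I by auto
  have fm: "(\<lambda>p. f (f1 p) (f2 p)) \<in> borel_measurable N"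
    if "f1 \<in> measurable N M" "f2 \<in> measurable N M" for f1 f2 and N :: "'z measure"
    using measurable_compose[OF measurable_Pair[OF that] f] by simp
  have "(\<integral>\<^sup>+x. f (x i) (x j) \<partial>MI (insert i (I-{i}))) = (\<integral>\<^sup>+x. \<integral>\<^sup>+y. f ((x(i:=y)) i) ((x(i:=y)) j) \<partial>M \<partial>MI (I-{i}))"
    by (rule pp.product_nn_integral_insert)
      (use I eq in \<open>auto intro!: fm measurable_component_singleton\<close>)
  also have "\<dots> = (\<integral>\<^sup>+x. \<integral>\<^sup>+y. f y (x j) \<partial>M \<partial>MI (I-{i}))" using I by simp
  also have "\<dots> = (\<integral>\<^sup>+x. \<integral>\<^sup>+y. f y x \<partial>M \<partial>M)"
  proof (rule comp_nn_integral)
    have "(\<lambda>(x,y). f y x) \<in> borel_measurable (M \<Otimes>\<^sub>M M)"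
      unfolding split_beta' by (rule fm) auto
    then show "(\<lambda>x. \<integral>\<^sup>+y. f y x \<partial>M) \<in> borel_measurable M" by (rule borel_measurable_nn_integral)
  qed (use I in auto)
  finally show ?thesis unfolding eq .
qed

lemma nn_g: "(\<integral>\<^sup>+y. ennreal (g y x) \<partial>M) = ennreal (U x)"
  unfolding U_def using nn_integral_eq_integral[OF g_int[of x]] by (simp add: g_nonneg g_sym[of x])

lemma pair_g:
  assumes I: "finite I" "i \<in> I" "j \<in> I" "i \<noteq> j"
  shows "integrable (MI I) (\<lambda>x. g (x i) (x j))" "(\<integral>x. g (x i) (x j) \<partial>MI I) = I0"
proof -
  have "(\<integral>\<^sup>+x. ennreal (g (x i) (x j)) \<partial>MI I) = (\<integral>\<^sup>+x. \<integral>\<^sup>+y. ennreal (g y x) \<partial>M \<partial>M)"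
    by (rule pair_nn[OF I, of "\<lambda>x y. ennreal (g x y)"]) measurable
  also have "\<dots> = (\<integral>\<^sup>+x. ennreal (U x) \<partial>M)" by (simp add: nn_g)
  also have "\<dots> = ennreal I0" unfolding I0_def by (rule nn_integral_eq_integral[OF U_int]) (simp add: U_nonneg)
  finally have *: "(\<integral>\<^sup>+x. ennreal (g (x i) (x j)) \<partial>MI I) = ennreal I0" .
  have m: "(\<lambda>x. g (x i) (x j)) \<in> borel_measurable (MI I)"
    by (rule g_measurable_compose) (use I in \<open>auto intro!: measurable_component_singleton\<close>)
  show "integrable (MI I) (\<lambda>x. g (x i) (x j))"
    by (rule integrableI_nonneg[OF m]) (use * in \<open>auto simp: g_nonneg\<close>)
  show "(\<integral>x. g (x i) (x j) \<partial>MI I) = I0"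
    by (subst integral_eq_nn_integral) (use * m in \<open>auto simp: g_nonneg I0_nonneg\<close>)
qed

section \<open>Jensen bounds for adding and for removing a particle\<close>

definition umean :: "real \<Rightarrow> nat \<Rightarrow> real" where
  "umean b n = (\<integral>x. wt b {..<n} x * (\<Sum>i<n. U (x i)) \<partial>MI {..<n}) / zpart b n"
definition wmean :: "real \<Rightarrow> nat \<Rightarrow> real" where
  "wmean b n = (\<integral>x. wt b {..<n} x * W {..<n} x \<partial>MI {..<n}) / zpart b n"

lemma zpart_eq: "zpart b n = (\<integral>x. wt b {..<n} x \<partial>MI {..<n})"
  by (simp add: zpart_def emom_def Ew_def)

lemma wt_int: "0 \<le> b \<Longrightarrow> integrable (MI I) (wt b I)"
  using wt_prod_int[of b "\<lambda>_. 1" "{}" I] by simp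

lemma wtU_int: assumes b: "0 \<le> b" shows "integrable (MI I) (\<lambda>x. wt b I x * (\<Sum>i\<in>I. U (x i)))"
proof (rule integrable_PiM_bounded[where B="exp (\<gamma> * (card I * C)) * (card I * C)"])
  fix x show "\<bar>wt b I x * (\<Sum>i\<in>I. U (x i))\<bar> \<le> exp (\<gamma> * (card I * C)) * (card I * C)"
    unfolding abs_mult by (intro mult_mono) (use wt_pos[of b I x] wt_le[OF b, of I x] sum_U_bounds[where I=I and x=x] in auto)
qed measurable

text \<open>\<open>W\<close> is unbounded, but \<open>t * exp (- t) \<le> 1\<close> at
  \<open>t = b * W\<close> bounds the weighted energy; this is where \<open>0 < b\<close>
  enters.\<close>

lemma wtW_int: assumes b: "0 < b" shows "integrable (MI I) (\<lambda>x. wt b I x * W I x)"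
proof (rule integrable_PiM_bounded[where B="exp (\<gamma> * (card I * C)) / b"])
  fix x
  have "b * W I x \<le> exp (b * W I x)" using exp_ge_add_one_self[of "b * W I x"] by linarith
  then have "W I x * exp (- (b * W I x)) \<le> 1 / b" using b by (simp add: exp_minus field_simps)
  moreover have "exp (\<gamma> * (\<Sum>i\<in>I. U (x i))) \<le> exp (\<gamma> * (card I * C))"
    using mult_left_mono[OF sum_U_bounds(2)[where I=I and x=x] gam_nonneg] by simp
  ultimately have "exp (\<gamma> * (\<Sum>i\<in>I. U (x i))) * (W I x * exp (- (b * W I x))) \<le> exp (\<gamma> * (card I * C)) * (1 / b)"
    by (intro mult_mono) (use W_nonneg[of I x] in auto)
  then have "wt b I x * W I x \<le> exp (\<gamma> * (card I * C)) / b"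
    unfolding wt_def diff_conv_add_uminus exp_add by (simp add: mult_ac)
  then show "\<bar>wt b I x * W I x\<bar> \<le> exp (\<gamma> * (card I * C)) / b"
    using wt_pos[of b I x] W_nonneg[of I x] by simp
qed measurable

lemma umean_bounds: assumes b: "0 \<le> b" shows "0 \<le> umean b n" "umean b n \<le> n * C"
proof -
  show "0 \<le> umean b n" unfolding umean_def
    by (intro divide_nonneg_pos zpart_pos b integral_nonneg_AE AE_I2 mult_nonneg_nonneg) (auto simp: wt_pos less_imp_le sum_U_bounds)
  have "(\<integral>x. wt b {..<n} x * (\<Sum>i<n. U (x i)) \<partial>MI {..<n}) \<le> (\<integral>x. wt b {..<n} x * (n * C) \<partial>MI {..<n})"
    by (rule integral_mono[OF wtU_int[OF b]])
      (use wt_int[OF b] wt_pos sum_U_bounds(2)[where I="{..<n}"] in \<open>auto simp: less_imp_le intro!: mult_left_mono\<close>)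
  then show "umean b n \<le> n * C" using zpart_pos[OF b, of n] by (simp add: umean_def zpart_eq field_simps)
qed

text \<open>Jensen's inequality in pointwise form: if \<open>m\<close> is the mean of
  \<open>t\<close>, the left side integrates to \<open>exp m\<close>. This avoids normalizing the
  weighted measures to which it is applied.\<close>

lemma exp_tangent: "exp m * (1 + t - m) \<le> exp (t::real)"
proof -
  have "1 + (t - m) \<le> exp (t - m)" by (rule exp_ge_add_one_self)
  then have "exp m * (1 + (t - m)) \<le> exp m * exp (t - m)" by simp
  then show ?thesis by (simp add: exp_add[symmetric] algebra_simps)
qed

lemma insertion_factor_le:
  assumes b: "0 \<le> b" "finite I"
  shows "exp (\<gamma> * U y - b * (\<Sum>i\<in>I. g (x i) y)) \<le> exp (\<gamma> * C)"
proof -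
  have "0 \<le> b * (\<Sum>i\<in>I. g (x i) y)" using b by (intro mult_nonneg_nonneg sum_nonneg) (auto simp: g_nonneg)
  then show ?thesis using mult_left_mono[OF U_le[of y] gam_nonneg] by simp
qed

lemma insertion_factor_meas[measurable]:
  "(\<lambda>y. exp (\<gamma> * U y - b * (\<Sum>i\<in>I. g (x i) y))) \<in> borel_measurable M"
proof -
  have "(\<lambda>y. g (x i) y) \<in> borel_measurable M" for i by (rule borel_measurable_integrable[OF g_int])
  then show ?thesis by measurable
qed

lemma insertion_factor_integrable:
  assumes b: "0 \<le> b" "finite I" and p: "\<And>x. 0 \<le> p x" "\<And>x. p x \<le> (1::real)" "p \<in> borel_measurable M"
  shows "integrable M (\<lambda>y. p y * exp (\<gamma> * U y - b * (\<Sum>i\<in>I. g (x i) y)))"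
proof (rule integrable_const_bound[of _ "exp (\<gamma> * C)"])
  have "norm (p y * exp (\<gamma> * U y - b * (\<Sum>i\<in>I. g (x i) y))) \<le> 1 * exp (\<gamma> * C)" for y
    unfolding norm_mult by (rule mult_mono) (use p insertion_factor_le[OF b] in auto)
  then show "AE y in M. norm (p y * exp (\<gamma> * U y - b * (\<Sum>i\<in>I. g (x i) y))) \<le> exp (\<gamma> * C)" by simp
qed (use p(3) in measurable)

lemma insertion_integral_meas:
  assumes p: "p \<in> borel_measurable M"
  shows "(\<lambda>x. \<integral>y. p y * exp (\<gamma> * U y - b * (\<Sum>i\<in>I. g (x i) y)) \<partial>M) \<in> borel_measurable (MI I)"
proof -
  note p[measurable]
  have [measurable]: "(\<lambda>w. fst w i) \<in> measurable (MI I \<Otimes>\<^sub>M M) M" if "i \<in> I" for i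
    using measurable_compose[OF measurable_fst measurable_component_singleton[OF that]] .
  have "(\<lambda>(x,y). p y * exp (\<gamma> * U y - b * (\<Sum>i\<in>I. g (x i) y))) \<in> borel_measurable (MI I \<Otimes>\<^sub>M M)"
    unfolding split_beta' by measurable
  then show ?thesis by (rule borel_measurable_lebesgue_integral)
qed

lemma insertion_integral_bounds:
  assumes b: "0 \<le> b" "finite I" and p: "\<And>x. 0 \<le> p x" "\<And>x. p x \<le> (1::real)" "p \<in> borel_measurable M"
  shows "0 \<le> (\<integral>y. p y * exp (\<gamma> * U y - b * (\<Sum>i\<in>I. g (x i) y)) \<partial>M)"
    "(\<integral>y. p y * exp (\<gamma> * U y - b * (\<Sum>i\<in>I. g (x i) y)) \<partial>M) \<le> (\<integral>y. p y * exp (\<gamma> * U y) \<partial>M)"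
proof -
  show "0 \<le> (\<integral>y. p y * exp (\<gamma> * U y - b * (\<Sum>i\<in>I. g (x i) y)) \<partial>M)"
    by (intro integral_nonneg_AE AE_I2 mult_nonneg_nonneg p) simp
  show "(\<integral>y. p y * exp (\<gamma> * U y - b * (\<Sum>i\<in>I. g (x i) y)) \<partial>M) \<le> (\<integral>y. p y * exp (\<gamma> * U y) \<partial>M)"
    using insertion_factor_integrable[OF b p] insertion_factor_integrable[OF b(1) _ p, of "{}"]
    by (intro integral_mono) (use p b in \<open>auto intro!: mult_left_mono mult_nonneg_nonneg sum_nonneg simp: g_nonneg\<close>)
qed

text \<open>The ratio \<open>zpart b (Suc n) / zpart b n\<close> is the mean of the insertion factor
  over \<open>M\<close> and the Gibbs law of \<open>n\<close> particles. The exponent on the left is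
  the mean of its exponent.\<close>

lemma zpart_Suc_ge: assumes b: "0 \<le> b" shows "zpart b n * exp (\<gamma> * I0 - b * umean b n) \<le> zpart b (Suc n)"
proof -
  let ?I = "{..<n}" and ?m = "\<gamma> * I0 - b * umean b n"
  let ?F = "\<lambda>x. \<integral>y. exp (\<gamma> * U y - b * (\<Sum>i\<in>?I. g (x i) y)) \<partial>M"
  have zpart: "zpart b (Suc n) = (\<integral>x. wt b ?I x * ?F x \<partial>MI ?I)"
    using wt_insert_integral[of ?I n "{}" b "\<lambda>_. 1" "\<lambda>_. 1"] b by (simp add: zpart_eq lessThan_Suc)
  have lb: "exp ?m * (1 + (\<gamma> * I0 - b * (\<Sum>i<n. U (x i))) - ?m) \<le> ?F x" for x
  proof -
    have gi: "integrable M (\<lambda>y. \<Sum>i\<in>?I. g (x i) y)" by (intro Bochner_Integration.integrable_sum g_int)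
    have "(\<integral>y. exp ?m * (1 + (\<gamma> * U y - b * (\<Sum>i\<in>?I. g (x i) y)) - ?m) \<partial>M) \<le> ?F x"
      by (rule integral_mono) (use gi U_int insertion_factor_integrable[OF b, of ?I "\<lambda>_. 1"] exp_tangent in auto)
    also have "(\<integral>y. exp ?m * (1 + (\<gamma> * U y - b * (\<Sum>i\<in>?I. g (x i) y)) - ?m) \<partial>M) =
      exp ?m * (1 + (\<gamma> * I0 - b * (\<Sum>i<n. U (x i))) - ?m)"
      using gi U_int by (simp add: prob_space I0_def[symmetric] U_def[symmetric] Bochner_Integration.integral_sum g_int)
    finally show ?thesis .
  qed
  have Fint: "integrable (MI ?I) (\<lambda>x. wt b ?I x * ?F x)"
  proof (rule integrable_PiM_bounded[where B="exp (\<gamma> * (card ?I * C)) * (\<integral>y. exp (\<gamma> * U y) \<partial>M)"])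
    show "(\<lambda>x. wt b ?I x * ?F x) \<in> borel_measurable (MI ?I)" using insertion_integral_meas[of "\<lambda>_. 1" b ?I] by (intro borel_measurable_times) auto
    fix x show "\<bar>wt b ?I x * ?F x\<bar> \<le> exp (\<gamma> * (card ?I * C)) * (\<integral>y. exp (\<gamma> * U y) \<partial>M)"
      unfolding abs_mult by (rule mult_mono) (use wt_pos[of b ?I x] wt_le[OF b, of ?I x] insertion_integral_bounds[OF b, of ?I "\<lambda>_. 1" x] in auto)
  qed
  have "(\<integral>x. exp ?m * ((1 + \<gamma> * I0 - ?m) * wt b ?I x - b * (wt b ?I x * (\<Sum>i<n. U (x i)))) \<partial>MI ?I) \<le> zpart b (Suc n)"
    unfolding zpart
  proof (rule integral_mono[OF _ Fint])
    show "integrable (MI ?I) (\<lambda>x. exp ?m * ((1 + \<gamma> * I0 - ?m) * wt b ?I x - b * (wt b ?I x * (\<Sum>i<n. U (x i)))))"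
      using wt_int[OF b, of ?I] wtU_int[OF b, of ?I] by auto
    fix x
    show "exp ?m * ((1 + \<gamma> * I0 - ?m) * wt b ?I x - b * (wt b ?I x * (\<Sum>i<n. U (x i)))) \<le> wt b ?I x * ?F x"
      using mult_left_mono[OF lb[of x], of "wt b ?I x"] wt_pos[of b ?I x] by (simp add: algebra_simps)
  qed
  also have "(\<integral>x. exp ?m * ((1 + \<gamma> * I0 - ?m) * wt b ?I x - b * (wt b ?I x * (\<Sum>i<n. U (x i)))) \<partial>MI ?I) =
     exp ?m * ((1 + \<gamma> * I0 - ?m) * zpart b n - b * (umean b n * zpart b n))"
    using wt_int[OF b, of ?I] wtU_int[OF b, of ?I] zpart_pos[OF b, of n] by (simp add: zpart_eq[symmetric] umean_def)
  finally show ?thesis by (simp add: algebra_simps)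
qed

text \<open>Puts the trivial bound in place of \<open>umean\<close>. It is too weak to give ratio 1
  in the limit, but uniform, as domination requires.\<close>

lemma zpart_Suc_ge_crude: assumes b: "0 \<le> b" shows "zpart b n \<le> exp (b * (n * C)) * zpart b (Suc n)"
proof -
  have "exp (- (b * (n * C))) \<le> exp (\<gamma> * I0 - b * umean b n)"
    using mult_left_mono[OF umean_bounds(2)[OF b, of n] b] mult_nonneg_nonneg[OF gam_nonneg I0_nonneg] by simp
  then have "zpart b n * exp (- (b * (n * C))) \<le> zpart b (Suc n)"
    using zpart_Suc_ge[OF b, of n] zpart_pos[OF b, of n] by (meson mult_left_mono less_imp_le order_trans)
  then show ?thesis by (simp add: exp_minus field_simps)
qed

lemma wt_remove: "finite I \<Longrightarrow> j \<in> I \<Longrightarrow> wt b I x * exp (b * (\<Sum>i\<in>I-{j}. g (x i) (x j)) - \<gamma> * U (x j)) = wt b (I-{j}) x"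
  using wt_insert[of "I-{j}" j b x "x j"] by (simp add: insert_absorb exp_add[symmetric])

lemma sum_off_diagonal: "finite I \<Longrightarrow> (\<Sum>j\<in>I. \<Sum>i\<in>I-{j}. g (x i) (x j)) = 2 * W I x"
  unfolding W_def by (simp add: g_sym)

lemma wt_less_integral:
  assumes b: "0 \<le> b" and I: "finite I" "j \<in> I"
  shows "integrable (MI I) (wt b (I-{j}))" "(\<integral>x. wt b (I-{j}) x \<partial>MI I) = zpart b (card I - 1)"
proof -
  have eq: "insert j (I-{j}) = I" using I by auto
  have m: "wt b (I-{j}) \<in> borel_measurable (MI I)"
  proof -
    have [measurable]: "(\<lambda>x. U (x i)) \<in> borel_measurable (MI I)" if "i \<in> I - {j}" for i
      using that by (intro comp_meas U_meas) auto
    have [measurable]: "(\<lambda>x. g (x i) (x i')) \<in> borel_measurable (MI I)" if "i \<in> I - {j}" "i' \<in> I - {j} - {i}" for i i'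
      using that by (intro g_measurable_compose measurable_component_singleton) auto
    show ?thesis unfolding wt_def W_def by measurable
  qed
  show i: "integrable (MI I) (wt b (I-{j}))"
    by (rule integrable_PiM_bounded[OF m, of "exp (\<gamma> * (card (I-{j}) * C))"]) (simp only: abs_of_pos[OF wt_pos] wt_le[OF b])
  have ind: "wt b (I-{j}) (x(j:=y)) = wt b (I-{j}) x" for x y
    by (simp add: wt_def W_def)
  have "(\<integral>x. wt b (I-{j}) x \<partial>MI (insert j (I-{j}))) = (\<integral>x. (\<integral>y. wt b (I-{j}) (x(j:=y)) \<partial>M) \<partial>MI (I-{j}))"
    by (rule pp.product_integral_insert) (use I i eq in auto)
  also have "\<dots> = (\<integral>x. wt b (I-{j}) x \<partial>MI (I-{j}))" by (simp add: ind prob_space)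
  also have "\<dots> = zpart b (card I - 1)" using Ew_empty_eq_zpart[of "I-{j}" "\<lambda>_. 1" b] I by (simp add: Ew_def)
  finally show "(\<integral>x. wt b (I-{j}) x \<partial>MI I) = zpart b (card I - 1)" unfolding eq .
qed

text \<open>Removing particle \<open>j\<close> divides the weight by its insertion factor. Averaging
  over all \<open>j\<close> expresses the mean exponent by \<open>wmean\<close> and
  \<open>umean\<close>; the 2 appears because each pair is met from both ends.\<close>

lemma zpart_pred_ge: assumes b: "0 < b"
  shows "zpart b (Suc n) * exp ((2 * b * wmean b (Suc n) - \<gamma> * umean b (Suc n)) / Suc n) \<le> zpart b n"
proof -
  let ?I = "{..<Suc n}" and ?N = "real (Suc n)"
  let ?m = "(2 * b * wmean b (Suc n) - \<gamma> * umean b (Suc n)) / Suc n"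
  let ?zpart = "zpart b (Suc n)"
  have b0: "0 \<le> b" using b by simp
  let ?t = "\<lambda>x j. b * (\<Sum>i\<in>?I-{j}. g (x i) (x j)) - \<gamma> * U (x j)"
  have st: "(\<Sum>j\<in>?I. ?t x j) = 2 * b * W ?I x - \<gamma> * (\<Sum>i\<in>?I. U (x i))" for x
    using sum_off_diagonal[of ?I x] by (simp only: sum_subtractf sum_distrib_left[symmetric]) simp
  have i: "integrable (MI ?I) (\<lambda>x. exp ?m * (?N * (1 - ?m) * wt b ?I x + (2 * b * (wt b ?I x * W ?I x) - \<gamma> * (wt b ?I x * (\<Sum>i\<in>?I. U (x i))))))"
    using wt_int[OF b0, of ?I] wtU_int[OF b0, of ?I] wtW_int[OF b, of ?I] by auto
  have "exp ?m * (?N * (1 - ?m) * ?zpart + (2 * b * (wmean b (Suc n) * ?zpart) - \<gamma> * (umean b (Suc n) * ?zpart))) =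
    (\<integral>x. exp ?m * (?N * (1 - ?m) * wt b ?I x + (2 * b * (wt b ?I x * W ?I x) - \<gamma> * (wt b ?I x * (\<Sum>i\<in>?I. U (x i))))) \<partial>MI ?I)"
    using wt_int[OF b0, of ?I] wtU_int[OF b0, of ?I] wtW_int[OF b, of ?I] zpart_pos[OF b0, of "Suc n"]
    by (simp add: zpart_eq[symmetric] umean_def wmean_def del: sum.lessThan_Suc)
  also have "\<dots> \<le> (\<integral>x. (\<Sum>j\<in>?I. wt b (?I-{j}) x) \<partial>MI ?I)"
  proof (rule integral_mono[OF i])
    show "integrable (MI ?I) (\<lambda>x. \<Sum>j\<in>?I. wt b (?I-{j}) x)"
      by (intro Bochner_Integration.integrable_sum wt_less_integral b0) auto
    fix x
    have "exp ?m * (?N * (1 - ?m) * wt b ?I x + (2 * b * (wt b ?I x * W ?I x) - \<gamma> * (wt b ?I x * (\<Sum>i\<in>?I. U (x i)))))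
       = wt b ?I x * (exp ?m * (?N * (1 - ?m) + (\<Sum>j\<in>?I. ?t x j)))" unfolding st by (simp only: algebra_simps)
    also have "?N * (1 - ?m) + (\<Sum>j\<in>?I. ?t x j) = (\<Sum>j\<in>?I. 1 + ?t x j - ?m)"
      by (simp only: sum_subtractf sum.distrib) (simp add: algebra_simps del: sum.lessThan_Suc)
    also have "wt b ?I x * (exp ?m * (\<Sum>j\<in>?I. 1 + ?t x j - ?m)) = (\<Sum>j\<in>?I. wt b ?I x * (exp ?m * (1 + ?t x j - ?m)))"
      by (simp only: sum_distrib_left)
    also have "\<dots> \<le> (\<Sum>j\<in>?I. wt b ?I x * exp (?t x j))"
      by (intro sum_mono mult_left_mono exp_tangent) (simp add: wt_pos less_imp_le)
    also have "\<dots> = (\<Sum>j\<in>?I. wt b (?I-{j}) x)"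
      by (intro sum.cong refl wt_remove) auto
    finally show "exp ?m * (?N * (1 - ?m) * wt b ?I x + (2 * b * (wt b ?I x * W ?I x) - \<gamma> * (wt b ?I x * (\<Sum>i\<in>?I. U (x i)))))
       \<le> (\<Sum>j\<in>?I. wt b (?I-{j}) x)" .
  qed
  also have "\<dots> = (\<Sum>j\<in>?I. zpart b n)"
    by (subst Bochner_Integration.integral_sum) (auto intro!: wt_less_integral b0 sum.cong simp: wt_less_integral[OF b0] simp del: sum.lessThan_Suc)
  also have "\<dots> = ?N * zpart b n" by simp
  finally have "exp ?m * (?N * (1 - ?m) * ?zpart + (2 * b * (wmean b (Suc n) * ?zpart) - \<gamma> * (umean b (Suc n) * ?zpart))) \<le> ?N * zpart b n" .
  moreover have "?N * (1 - ?m) * ?zpart + (2 * b * (wmean b (Suc n) * ?zpart) - \<gamma> * (umean b (Suc n) * ?zpart)) = ?N * ?zpart"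
    by (simp add: field_simps)
  ultimately have "?N * (?zpart * exp ?m) \<le> ?N * zpart b n" by (simp add: mult_ac)
  then show ?thesis by simp
qed

section \<open>Bounds for the mean energy under the Gibbs law\<close>

lemma W_int: assumes "finite I" shows "integrable (MI I) (W I)" "(\<integral>x. W I x \<partial>MI I) = real (card I) * (real (card I) - 1) / 2 * I0"
proof -
  show "integrable (MI I) (W I)" unfolding W_def
    by (intro Bochner_Integration.integrable_sum integrable_divide pair_g assms) auto
  have 1: "(\<integral>x. (\<Sum>j\<in>I-{i}. g (x i) (x j)) \<partial>MI I) = (\<Sum>j\<in>I-{i}. I0)" if "i \<in> I" for i
  proof -
    have "(\<integral>x. (\<Sum>j\<in>I-{i}. g (x i) (x j)) \<partial>MI I) = (\<Sum>j\<in>I-{i}. \<integral>x. g (x i) (x j) \<partial>MI I)"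
      by (rule Bochner_Integration.integral_sum, rule pair_g) (use that assms in auto)
    also have "\<dots> = (\<Sum>j\<in>I-{i}. I0)"
      by (rule sum.cong[OF refl], rule pair_g) (use that assms in auto)
    finally show ?thesis .
  qed
  have "(\<integral>x. (\<Sum>i\<in>I. \<Sum>j\<in>I-{i}. g (x i) (x j)) \<partial>MI I) = (\<Sum>i\<in>I. \<integral>x. (\<Sum>j\<in>I-{i}. g (x i) (x j)) \<partial>MI I)"
    by (rule Bochner_Integration.integral_sum, rule Bochner_Integration.integrable_sum, rule pair_g) (use assms in auto)
  also have "\<dots> = (\<Sum>i\<in>I. \<Sum>j\<in>I-{i}. I0)" by (rule sum.cong[OF refl 1])
  finally have 2: "(\<integral>x. (\<Sum>i\<in>I. \<Sum>j\<in>I-{i}. g (x i) (x j)) \<partial>MI I) = (\<Sum>i\<in>I. \<Sum>j\<in>I-{i}. I0)" .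
  have "(\<integral>x. W I x \<partial>MI I) = (\<Sum>i\<in>I. \<Sum>j\<in>I-{i}. I0) / 2" unfolding W_def integral_divide_zero 2 ..
  also have "(\<Sum>i\<in>I. \<Sum>j\<in>I-{i}. I0) = (\<Sum>i\<in>I. (real (card I) - 1) * I0)"
  proof (rule sum.cong[OF refl])
    fix i assume "i \<in> I"
    then have "card (I-{i}) = card I - 1" "1 \<le> card I" using assms by (auto simp: Suc_le_eq card_gt_0_iff)
    then show "(\<Sum>j\<in>I-{i}. I0) = (real (card I) - 1) * I0" by (simp add: of_nat_diff)
  qed
  finally show "(\<integral>x. W I x \<partial>MI I) = real (card I) * (real (card I) - 1) / 2 * I0" by simp
qed

text \<open>The weight is \<open>exp (- L)\<close> for the quantity \<open>L\<close> whose mean is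
  estimated, so it favours small \<open>L\<close>. Since
  \<open>(L - m) * (exp (- L) - exp (- m)) \<le> 0\<close>, the weighted mean does not exceed the
  mean \<open>m\<close> under the product measure.\<close>

lemma energy_upper: assumes b: "0 < b"
  shows "b * wmean b n - \<gamma> * umean b n \<le> b * (real n * (real n - 1) / 2 * I0) - \<gamma> * (n * I0)"
proof -
  let ?I = "{..<n}" let ?L = "\<lambda>x. b * W ?I x - \<gamma> * (\<Sum>i<n. U (x i))"
  interpret P: prob_space "MI ?I" by (rule prob_MI)
  have b0: "0 \<le> b" using b by simp
  have iu: "integrable (MI ?I) (\<lambda>x. U (x i))" if "i < n" for i
    by (rule integrable_PiM_bounded[of _ _ C]) (use that in \<open>auto intro!: comp_meas U_meas simp: U_nonneg U_le\<close>)
  have iL: "integrable (MI ?I) ?L"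
    using W_int(1)[of ?I] iu by (intro Bochner_Integration.integrable_diff integrable_mult_right Bochner_Integration.integrable_sum) auto
  define m where "m = (\<integral>x. ?L x \<partial>MI ?I)"
  have m: "m = b * (real n * (real n - 1) / 2 * I0) - \<gamma> * (n * I0)"
  proof -
    have su: "integrable (MI ?I) (\<lambda>x. \<Sum>i<n. U (x i))" using iu by (intro Bochner_Integration.integrable_sum) auto
    have "(\<integral>x. (\<Sum>i<n. U (x i)) \<partial>MI ?I) = (\<Sum>i<n. I0)"
      by (subst Bochner_Integration.integral_sum)
        (use iu comp_integral[OF U_meas, of _ ?I] in \<open>auto simp: I0_def simp del: sum_constant intro!: sum.cong\<close>)
    then show ?thesis unfolding m_def
      using W_int[of ?I] su by (simp add: Bochner_Integration.integral_diff)
  qed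
  have iwL: "integrable (MI ?I) (\<lambda>x. b * (wt b ?I x * W ?I x) - \<gamma> * (wt b ?I x * (\<Sum>i<n. U (x i))))"
    using wtU_int[OF b0, of ?I] wtW_int[OF b, of ?I] by auto
  have "(\<integral>x. (b * (wt b ?I x * W ?I x) - \<gamma> * (wt b ?I x * (\<Sum>i<n. U (x i)))) - m * wt b ?I x \<partial>MI ?I) \<le>
     (\<integral>x. exp (- m) * (?L x - m) \<partial>MI ?I)"
  proof (rule integral_mono)
    show "integrable (MI ?I) (\<lambda>x. (b * (wt b ?I x * W ?I x) - \<gamma> * (wt b ?I x * (\<Sum>i<n. U (x i)))) - m * wt b ?I x)"
      using iwL wt_int[OF b0, of ?I] by auto
    show "integrable (MI ?I) (\<lambda>x. exp (- m) * (?L x - m))" using iL by auto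
    fix x
    have w: "wt b ?I x = exp (- ?L x)" by (simp add: wt_def)
    have "(?L x - m) * (exp (- ?L x) - exp (- m)) \<le> 0"
      by (cases "?L x \<le> m") (auto intro: mult_nonneg_nonpos mult_nonpos_nonneg)
    then show "(b * (wt b ?I x * W ?I x) - \<gamma> * (wt b ?I x * (\<Sum>i<n. U (x i)))) - m * wt b ?I x \<le> exp (- m) * (?L x - m)"
      unfolding w by (simp add: algebra_simps)
  qed
  also have "(\<integral>x. exp (- m) * (?L x - m) \<partial>MI ?I) = 0"
    using iL by (simp add: m_def[symmetric] P.prob_space)
  also have "(\<integral>x. (b * (wt b ?I x * W ?I x) - \<gamma> * (wt b ?I x * (\<Sum>i<n. U (x i)))) - m * wt b ?I x \<partial>MI ?I) =
     (b * wmean b n - \<gamma> * umean b n - m) * zpart b n"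
    using wtU_int[OF b0, of ?I] wtW_int[OF b, of ?I] wt_int[OF b0, of ?I] zpart_pos[OF b0, of n]
    by (simp add: wmean_def umean_def zpart_eq[symmetric] algebra_simps)
  finally have "b * wmean b n - \<gamma> * umean b n - m \<le> 0" using zpart_pos[OF b0, of n] by (simp add: mult_le_0_iff)
  then show ?thesis using m by simp
qed

end

context mean_field_psd begin

text \<open>Nonnegative energy of the particles minus a charge \<open>c\<close> spread over
  \<open>M\<close>, read as a lower bound for \<open>W\<close>. Truncation costs
  \<open>\<epsilon>\<close> per particle in the potential, and the diagonal costs \<open>K\<close>
  per particle. The charge is chosen only later.\<close>

lemma energy_lower:
  assumes "0 < \<epsilon>"
  shows "\<exists>K. \<forall>b n c. 0 < b \<longrightarrow> 0 \<le> c \<longrightarrow> c * umean b n - c * \<epsilon> * n - c\<^sup>2 * I0 / 2 - n * K / 2 \<le> wmean b n"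
proof -
  obtain k K where kk: "(\<lambda>p. k (fst p) (snd p)) \<in> borel_measurable (M \<Otimes>\<^sub>M M) \<and>
     (\<forall>x y. 0 \<le> k x y \<and> k x y \<le> K \<and> k x y = k y x) \<and> (\<forall>x. AE y in M. k x y \<le> g x y) \<and>
     (\<forall>x. (\<integral>y. g x y \<partial>M) - \<epsilon> \<le> (\<integral>y. k x y \<partial>M)) \<and>
     (\<forall>n (x::nat \<Rightarrow> 'a) c. 0 \<le> c \<longrightarrow> 0 \<le> (\<Sum>i<n. \<Sum>j<n. k (x i) (x j)) - 2 * c * (\<Sum>i<n. \<integral>y. k (x i) y \<partial>M)
        + c\<^sup>2 * (\<integral>x. (\<integral>y. k x y \<partial>M) \<partial>M))"
    using psd[OF assms] by (elim exE) (rule that)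
  note k1234 = kk[THEN conjunct2] and km = kk[THEN conjunct1]
  note k234 = k1234[THEN conjunct2] and k' = k1234[THEN conjunct1, rule_format]
  note k34 = k234[THEN conjunct2] and kg = k234[THEN conjunct1, rule_format]
  note qint = k34[THEN conjunct2, rule_format] and ku = k34[THEN conjunct1, rule_format, folded U_def]
  have k: "0 \<le> k x y" "k x y \<le> K" "k x y = k y x" for x y using k' by blast+
  have kc: "(\<lambda>p. k (f1 p) (f2 p)) \<in> borel_measurable N" if "f1 \<in> measurable N M" "f2 \<in> measurable N M" for f1 f2 and N :: "'z measure"
    using measurable_compose[OF measurable_Pair[OF that] km] by simp
  have k1: "(\<lambda>y. k x y) \<in> borel_measurable M" for x by (rule kc) (auto simp: space_M)
  have annulus_exponent: "(\<integral>x. (\<integral>y. k x y \<partial>M) \<partial>M) \<le> I0"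
  proof -
    have ki: "integrable M (k x)" for x
      by (rule integrable_const_bound[of _ K]) (use k k1 in auto)
    have kU: "(\<integral>y. k x y \<partial>M) \<le> U x" for x unfolding U_def by (rule integral_mono_AE[OF ki g_int kg])
    have "(\<lambda>(x,y). k x y) \<in> borel_measurable (M \<Otimes>\<^sub>M M)" using km by (simp add: split_beta')
    then have m: "(\<lambda>x. \<integral>y. k x y \<partial>M) \<in> borel_measurable M" by (rule borel_measurable_lebesgue_integral)
    show ?thesis unfolding I0_def
      by (rule integral_mono[OF integrable_const_bound[of _ C] U_int kU])
        (use m kU U_le k in \<open>auto intro!: integral_nonneg_AE intro: order_trans\<close>)
  qed
  \<comment> \<open>The comparison is known for almost every \<open>y\<close> at each fixed
    \<open>x\<close>; the two-particle marginal turns it into a statement about random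
    configurations.\<close>
  have ae: "AE x in MI {..<n}. k (x i) (x j) \<le> g (x i) (x j)" if "i < n" "j < n" "i \<noteq> j" for i j n
  proof -
    let ?f = "\<lambda>x y. ennreal (max 0 (k x y - g x y))"
    have fm: "(\<lambda>p. ?f (fst p) (snd p)) \<in> borel_measurable (M \<Otimes>\<^sub>M M)" using km by measurable
    have "(\<integral>\<^sup>+x. ?f (x i) (x j) \<partial>MI {..<n}) = (\<integral>\<^sup>+x. \<integral>\<^sup>+y. ?f y x \<partial>M \<partial>M)"
      by (rule pair_nn[OF _ _ _ _ fm]) (use that in auto)
    also have "\<dots> = (\<integral>\<^sup>+x. 0 \<partial>M)"
    proof (rule nn_integral_cong)
      fix x
      have "AE y in M. ?f y x = 0" using kg[of x]
        by eventually_elim (simp add: k(3)[of _ x] g_sym[of _ x])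
      then show "(\<integral>\<^sup>+y. ?f y x \<partial>M) = 0" using nn_integral_cong_AE[where M=M and u="\<lambda>y. ?f y x" and v="\<lambda>_. 0"] by simp
    qed
    finally have "(\<integral>\<^sup>+x. ?f (x i) (x j) \<partial>MI {..<n}) = 0" by simp
    moreover have "(\<lambda>x. ?f (x i) (x j)) \<in> borel_measurable (MI {..<n})"
    proof -
      have p: "(\<lambda>x. (x i, x j)) \<in> measurable (MI {..<n}) (M \<Otimes>\<^sub>M M)"
        using that by (intro measurable_Pair measurable_component_singleton) auto
      show ?thesis using measurable_compose[OF p fm] by simp
    qed
    ultimately have "AE x in MI {..<n}. ?f (x i) (x j) = 0" by (simp add: nn_integral_0_iff_AE)
    then show ?thesis by eventually_elim (auto simp: ennreal_eq_0_iff)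
  qed
  have "c * umean b n - c * \<epsilon> * n - c\<^sup>2 * I0 / 2 - n * K / 2 \<le> wmean b n" if b: "0 < b" and c: "0 \<le> c" for b n c
  proof -
    let ?I = "{..<n}"
    have b0: "0 \<le> b" using b by simp
    have "AE x in MI ?I. \<forall>i<n. \<forall>j<n. i \<noteq> j \<longrightarrow> k (x i) (x j) \<le> g (x i) (x j)"
      using ae by (simp add: AE_all_countable)
    then have AEW: "AE x in MI ?I. c * (\<Sum>i<n. U (x i)) - (c * \<epsilon> * n + c\<^sup>2 * I0 / 2 + n * K / 2) \<le> W ?I x"
    proof eventually_elim
      fix x assume x: "\<forall>i<n. \<forall>j<n. i \<noteq> j \<longrightarrow> k (x i) (x j) \<le> g (x i) (x j)"
      have "(\<Sum>i<n. \<Sum>j<n. k (x i) (x j)) = (\<Sum>i<n. k (x i) (x i) + (\<Sum>j\<in>?I-{i}. k (x i) (x j)))"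
        by (intro sum.cong refl sum.remove) auto
      also have "\<dots> \<le> (\<Sum>i<n. K + (\<Sum>j\<in>?I-{i}. g (x i) (x j)))"
        by (intro sum_mono add_mono k) (use x in auto)
      also have "\<dots> = n * K + 2 * W ?I x" by (simp add: W_def sum.distrib)
      finally have 1: "(\<Sum>i<n. \<Sum>j<n. k (x i) (x j)) \<le> n * K + 2 * W ?I x" .
      have "(\<Sum>i<n. U (x i)) - n * \<epsilon> = (\<Sum>i<n. U (x i) - \<epsilon>)" by (simp add: sum_subtractf)
      also have "\<dots> \<le> (\<Sum>i<n. \<integral>y. k (x i) y \<partial>M)" by (intro sum_mono ku)
      finally have 2: "c * ((\<Sum>i<n. U (x i)) - n * \<epsilon>) \<le> c * (\<Sum>i<n. \<integral>y. k (x i) y \<partial>M)" using c by (rule mult_left_mono)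
      have 3: "c\<^sup>2 * (\<integral>x. (\<integral>y. k x y \<partial>M) \<partial>M) \<le> c\<^sup>2 * I0" using annulus_exponent by (rule mult_left_mono) simp
      show "c * (\<Sum>i<n. U (x i)) - (c * \<epsilon> * n + c\<^sup>2 * I0 / 2 + n * K / 2) \<le> W ?I x"
        using 1 2 3 qint[where n=n and x=x, OF c] by (simp add: algebra_simps)
    qed
    let ?D = "c * \<epsilon> * n + c\<^sup>2 * I0 / 2 + n * K / 2"
    have "(\<integral>x. c * (wt b ?I x * (\<Sum>i<n. U (x i))) - ?D * wt b ?I x \<partial>MI ?I) \<le> (\<integral>x. wt b ?I x * W ?I x \<partial>MI ?I)"
    proof (rule integral_mono_AE)
      show "integrable (MI ?I) (\<lambda>x. c * (wt b ?I x * (\<Sum>i<n. U (x i))) - ?D * wt b ?I x)"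
        using wtU_int[OF b0, of ?I] wt_int[OF b0, of ?I] by auto
      show "AE x in MI ?I. c * (wt b ?I x * (\<Sum>i<n. U (x i))) - ?D * wt b ?I x \<le> wt b ?I x * W ?I x"
        using AEW
      proof eventually_elim
        fix x assume "c * (\<Sum>i<n. U (x i)) - ?D \<le> W ?I x"
        then have "wt b ?I x * (c * (\<Sum>i<n. U (x i)) - ?D) \<le> wt b ?I x * W ?I x"
          by (rule mult_left_mono) (simp add: wt_pos less_imp_le)
        then show "c * (wt b ?I x * (\<Sum>i<n. U (x i))) - ?D * wt b ?I x \<le> wt b ?I x * W ?I x"
          by (simp add: algebra_simps)
      qed
    qed (rule wtW_int[OF b])
    also have "(\<integral>x. c * (wt b ?I x * (\<Sum>i<n. U (x i))) - ?D * wt b ?I x \<partial>MI ?I) = (c * umean b n - ?D) * zpart b n"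
      using wtU_int[OF b0, of ?I] wt_int[OF b0, of ?I] zpart_pos[OF b0, of n]
      by (simp add: umean_def zpart_eq[symmetric] algebra_simps)
    finally show ?thesis using zpart_pos[OF b0, of n] by (simp add: wmean_def field_simps)
  qed
  then show ?thesis by blast
qed

end

section \<open>Recursion for the moments in the number of marked particles\<close>

context mean_field begin

lemma emom_Suc_eq:
  assumes b: "0 \<le> b" and h: "\<And>x. 0 \<le> h x" "\<And>x. h x \<le> (1::real)" "h \<in> borel_measurable M" and k: "k \<le> n"
  shows "emom h b (Suc n) (Suc k) = (\<integral>x. wt b {..<n} x * (\<Prod>j\<in>{..<k}. h (x j)) *
      (\<integral>y. h y * exp (\<gamma> * U y - b * (\<Sum>i\<in>{..<n}. g (x i) y)) \<partial>M) \<partial>MI {..<n})"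
proof -
  have "emom h b (Suc n) (Suc k) = Ew h b (insert n {..<n}) (insert n {..<k})"
    using Ew_eq_emom[of "insert n {..<n}" "insert n {..<k}" h b] h k by (simp add: card_insert_if subset_insertI2)
  also have "\<dots> = (\<integral>x. wt b (insert n {..<n}) x * ((\<Prod>j\<in>{..<k}. h (x j)) * h (x n)) \<partial>MI (insert n {..<n}))"
    unfolding Ew_def using k by (simp add: mult.commute)
  also have "\<dots> = (\<integral>x. wt b {..<n} x * (\<Prod>j\<in>{..<k}. h (x j)) *
      (\<integral>y. h y * exp (\<gamma> * U y - b * (\<Sum>i\<in>{..<n}. g (x i) y)) \<partial>M) \<partial>MI {..<n})"
    by (rule wt_insert_integral) (use b h k in auto)
  finally show ?thesis .
qed

text \<open>The exponential undoes the factor \<open>exp (- \<gamma> * U)\<close> of the equilibrium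
  density, so that for the equilibrium measure the integration is against
  \<open>exp (- V) / L\<close> (see \<open>hint_lborel\<close>).\<close>

definition Hint :: "('a \<Rightarrow> real) \<Rightarrow> real" where "Hint h = (\<integral>y. h y * exp (\<gamma> * U y) \<partial>M)"
text \<open>Interaction of the observed window with the gas. It measures the error of inserting a
  particle as if there were no interaction.\<close>

definition qint :: "('a \<Rightarrow> real) \<Rightarrow> real" where "qint h = (\<integral>y. h y * U y \<partial>M)"

lemma wtH_int:
  assumes b: "0 \<le> b" and h: "\<And>x. 0 \<le> h x" "\<And>x. h x \<le> (1::real)" "h \<in> borel_measurable M" and J: "finite I" "J \<subseteq> I"
    and p: "\<And>x. 0 \<le> p x" "\<And>x. p x \<le> (1::real)" "p \<in> borel_measurable M"
  shows "integrable (MI I) (\<lambda>x. wt b I x * (\<Prod>j\<in>J. h (x j)) * (\<integral>y. p y * exp (\<gamma> * U y - b * (\<Sum>i\<in>I. g (x i) y)) \<partial>M))"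
proof (rule integrable_PiM_bounded[where B="exp (\<gamma> * (card I * C)) * Hint p"])
  show "(\<lambda>x. wt b I x * (\<Prod>j\<in>J. h (x j)) * (\<integral>y. p y * exp (\<gamma> * U y - b * (\<Sum>i\<in>I. g (x i) y)) \<partial>M)) \<in> borel_measurable (MI I)"
    by (intro borel_measurable_times wt_prod_meas insertion_integral_meas h p J)
  fix x show "\<bar>wt b I x * (\<Prod>j\<in>J. h (x j)) * (\<integral>y. p y * exp (\<gamma> * U y - b * (\<Sum>i\<in>I. g (x i) y)) \<partial>M)\<bar>
      \<le> exp (\<gamma> * (card I * C)) * Hint p"
    unfolding abs_mult[of _ "\<integral>y. p y * exp (\<gamma> * U y - b * (\<Sum>i\<in>I. g (x i) y)) \<partial>M"] Hint_def
    by (rule mult_mono[OF wt_prod_bound])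
      (use b h insertion_integral_bounds[OF b J(1) p, of x] in auto)
qed

lemma Hint_nonneg: "(\<And>x. 0 \<le> h x) \<Longrightarrow> 0 \<le> Hint h"
  unfolding Hint_def by (intro integral_nonneg_AE AE_I2 mult_nonneg_nonneg) auto

lemma qint_nonneg: "(\<And>x. 0 \<le> h x) \<Longrightarrow> 0 \<le> qint h"
  unfolding qint_def by (intro integral_nonneg_AE AE_I2 mult_nonneg_nonneg) (auto simp: U_nonneg)

lemma emom_nonneg: "(\<And>x. 0 \<le> h x) \<Longrightarrow> 0 \<le> emom h b n k" unfolding emom_def by (rule Ew_nonneg)

text \<open>By repulsion, dropping the interaction of the new particle with the old ones only
  increases the integral.\<close>

lemma emom_Suc_le:
  assumes b: "0 \<le> b" and h: "\<And>x. 0 \<le> h x" "\<And>x. h x \<le> (1::real)" "h \<in> borel_measurable M" and k: "k \<le> n"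
  shows "emom h b (Suc n) (Suc k) \<le> Hint h * emom h b n k"
proof -
  have "emom h b (Suc n) (Suc k) \<le> (\<integral>x. Hint h * (wt b {..<n} x * (\<Prod>j\<in>{..<k}. h (x j))) \<partial>MI {..<n})"
    unfolding emom_Suc_eq[OF assms]
  proof (rule integral_mono)
    show "integrable (MI {..<n}) (\<lambda>x. wt b {..<n} x * (\<Prod>j\<in>{..<k}. h (x j)) *
      (\<integral>y. h y * exp (\<gamma> * U y - b * (\<Sum>i\<in>{..<n}. g (x i) y)) \<partial>M))"
      by (rule wtH_int) (use b h k in auto)
    show "integrable (MI {..<n}) (\<lambda>x. Hint h * (wt b {..<n} x * (\<Prod>j\<in>{..<k}. h (x j))))"
      by (intro integrable_mult_right wt_prod_int) (use b h k in auto)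
    fix x
    have "0 \<le> wt b {..<n} x * (\<Prod>j\<in>{..<k}. h (x j))"
      using wt_pos[of b "{..<n}" x] prod_nonneg[of "{..<k}" "\<lambda>j. h (x j)"] h by (simp add: less_imp_le)
    then show "wt b {..<n} x * (\<Prod>j\<in>{..<k}. h (x j)) * (\<integral>y. h y * exp (\<gamma> * U y - b * (\<Sum>i\<in>{..<n}. g (x i) y)) \<partial>M)
       \<le> Hint h * (wt b {..<n} x * (\<Prod>j\<in>{..<k}. h (x j)))"
    proof -
      have le: "(\<integral>y. h y * exp (\<gamma> * U y - b * (\<Sum>i\<in>{..<n}. g (x i) y)) \<partial>M) \<le> Hint h"
        unfolding Hint_def by (rule insertion_integral_bounds) (use b h in auto)
      show ?thesis
        by (subst mult.commute[of "Hint h"], rule mult_left_mono[OF le]) fact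
    qed
  qed
  also have "\<dots> = Hint h * emom h b n k" by (simp add: emom_def Ew_def)
  finally show ?thesis .
qed

lemma emom_0: "emom h b n 0 = zpart b n" by (simp add: zpart_def emom_def Ew_def)

text \<open>Iterates \<open>emom_Suc_le\<close>. Each step also lowers the particle number in
  \<open>zpart\<close>, which \<open>zpart_Suc_ge_crude\<close> compensates; \<open>N\<close> in
  place of \<open>n\<close> gives all steps the same constant.\<close>

lemma emom_crude_bound:
  assumes b: "0 \<le> b" and h: "\<And>x. 0 \<le> h x" "\<And>x. h x \<le> (1::real)" "h \<in> borel_measurable M" and k: "k \<le> n"
    and n: "n \<le> N"
  shows "emom h b n k \<le> (Hint h * exp (b * N * C)) ^ k * zpart b n"
  using k n
proof (induction k arbitrary: n)
  case 0 then show ?case by (simp add: emom_0)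
next
  case (Suc k)
  then obtain m where m: "n = Suc m" by (cases n) auto
  have "emom h b n (Suc k) \<le> Hint h * emom h b m k" unfolding m using emom_Suc_le[OF b h, of k m] Suc.prems m by auto
  also have "\<dots> \<le> Hint h * ((Hint h * exp (b * N * C)) ^ k * zpart b m)"
    by (rule mult_left_mono[OF Suc.IH]) (use Suc.prems m Hint_nonneg[of h] h in auto)
  also have "\<dots> \<le> Hint h * ((Hint h * exp (b * N * C)) ^ k * (exp (b * N * C) * zpart b n))"
  proof (intro mult_left_mono)
    have "b * (real m * C) \<le> b * N * C" unfolding mult.assoc
      using Suc.prems m C_nonneg b by (intro mult_left_mono mult_right_mono) auto
    then have "exp (b * (m * C)) * zpart b (Suc m) \<le> exp (b * N * C) * zpart b n"
      unfolding m using zpart_pos[OF b, of "Suc m"] by (intro mult_right_mono) auto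
    then show "zpart b m \<le> exp (b * N * C) * zpart b n" using zpart_Suc_ge_crude[OF b, of m] by simp
  qed (use Hint_nonneg[of h] h in auto)
  finally show ?case by (simp add: mult_ac)
qed

text \<open>The potential at \<open>x\<close> of an inserted particle with density
  \<open>h * exp (\<gamma> * U)\<close>. To first order, the interaction lowers an inserted moment
  by \<open>b\<close> times the sum of these values over the old particles.\<close>

definition tilted_potential :: "('a \<Rightarrow> real) \<Rightarrow> 'a \<Rightarrow> real" where "tilted_potential h x = (\<integral>y. h y * exp (\<gamma> * U y) * g x y \<partial>M)"

lemma tilted_integrable:
  assumes h: "\<And>x. 0 \<le> h x" "\<And>x. h x \<le> (1::real)" "h \<in> borel_measurable M"
  shows "integrable M (\<lambda>y. h y * exp (\<gamma> * U y))" "integrable M (\<lambda>y. h y * exp (\<gamma> * U y) * g x y)" "integrable M (\<lambda>y. h y * U y)"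
    "h y * exp (\<gamma> * U y) \<le> exp (\<gamma> * C)"
proof -
  have *: "h y * exp (\<gamma> * U y) \<le> exp (\<gamma> * C)" for y
    using mult_mono[OF h(2)[of y], of "exp (\<gamma> * U y)" "exp (\<gamma> * C)"] mult_left_mono[OF U_le[of y] gam_nonneg] by simp
  then show "h y * exp (\<gamma> * U y) \<le> exp (\<gamma> * C)" .
  show "integrable M (\<lambda>y. h y * exp (\<gamma> * U y))"
    by (rule integrable_const_bound[of _ "exp (\<gamma> * C)"]) (use * h in \<open>auto intro!: borel_measurable_times\<close>)
  show "integrable M (\<lambda>y. h y * exp (\<gamma> * U y) * g x y)"
  proof (rule Bochner_Integration.integrable_bound[of _ "\<lambda>y. exp (\<gamma> * C) * g x y"])
    show "(\<lambda>y. h y * exp (\<gamma> * U y) * g x y) \<in> borel_measurable M"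
      using h(3) borel_measurable_integrable[OF g_int[of x]] by measurable
    have "h y * exp (\<gamma> * U y) * g x y \<le> exp (\<gamma> * C) * g x y" for y
      by (intro mult_right_mono *) (rule g_nonneg)
    then show "AE y in M. norm (h y * exp (\<gamma> * U y) * g x y) \<le> norm (exp (\<gamma> * C) * g x y)"
      using h g_nonneg by (auto simp: abs_mult)
  qed (use g_int in auto)
  show "integrable M (\<lambda>y. h y * U y)"
  proof (rule integrable_const_bound[of _ C])
    have "h y * U y \<le> 1 * C" for y by (rule mult_mono) (use h U_nonneg U_le in auto)
    then show "AE y in M. norm (h y * U y) \<le> C" using h U_nonneg by (auto simp: abs_mult)
  qed (use h in measurable)
qed

text \<open>For the last claim Fubini turns the mean of \<open>tilted_potential h\<close> into the
  integral of \<open>h * exp (\<gamma> * U) * U\<close>, and \<open>U \<le> C\<close> compares this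
  with \<open>qint h\<close>.\<close>

lemma tilted_potential_bounds:
  assumes h: "\<And>x. 0 \<le> h x" "\<And>x. h x \<le> (1::real)" "h \<in> borel_measurable M"
  shows "0 \<le> tilted_potential h x" "tilted_potential h x \<le> exp (\<gamma> * C) * C" "tilted_potential h \<in> borel_measurable M"
    "(\<integral>x. tilted_potential h x \<partial>M) \<le> exp (\<gamma> * C) * qint h"
proof -
  note h(3)[measurable]
  have Gn: "0 \<le> tilted_potential h x" for x unfolding tilted_potential_def
    by (intro integral_nonneg_AE AE_I2 mult_nonneg_nonneg) (use h g_nonneg in auto)
  then show "0 \<le> tilted_potential h x" .
  have "tilted_potential h x \<le> (\<integral>y. exp (\<gamma> * C) * g x y \<partial>M)" unfolding tilted_potential_def
    by (rule integral_mono[OF tilted_integrable(2)[OF h]]) (use g_int tilted_integrable(4)[OF h] g_nonneg in \<open>auto intro!: mult_right_mono\<close>)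
  also have "\<dots> \<le> exp (\<gamma> * C) * C" using g_bound by (simp add: mult_left_mono)
  finally show "tilted_potential h x \<le> exp (\<gamma> * C) * C" .
  have m: "(\<lambda>(x,y). h y * exp (\<gamma> * U y) * g x y) \<in> borel_measurable (M \<Otimes>\<^sub>M M)" by measurable
  show Gm: "tilted_potential h \<in> borel_measurable M" unfolding tilted_potential_def using m by (rule borel_measurable_lebesgue_integral)
  have n0: "0 \<le> h y * exp (\<gamma> * U y) * g x y" for x y using h g_nonneg by auto
  have "(\<integral>\<^sup>+x. tilted_potential h x \<partial>M) = (\<integral>\<^sup>+x. \<integral>\<^sup>+y. ennreal (h y * exp (\<gamma> * U y) * g x y) \<partial>M \<partial>M)"
    unfolding tilted_potential_def by (intro nn_integral_cong nn_integral_eq_integral[symmetric] tilted_integrable h AE_I2 n0)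
  also have "\<dots> = (\<integral>\<^sup>+y. \<integral>\<^sup>+x. ennreal (h y * exp (\<gamma> * U y) * g x y) \<partial>M \<partial>M)"
  proof -
    interpret MM: pair_sigma_finite M M by standard
    show ?thesis by (rule MM.Fubini'[symmetric]) (use m in measurable)
  qed
  also have "\<dots> = (\<integral>\<^sup>+y. ennreal (h y * exp (\<gamma> * U y)) * ennreal (U y) \<partial>M)"
  proof (rule nn_integral_cong)
    fix y
    have "(\<integral>\<^sup>+x. ennreal (h y * exp (\<gamma> * U y) * g x y) \<partial>M) = (\<integral>\<^sup>+x. ennreal (h y * exp (\<gamma> * U y)) * ennreal (g x y) \<partial>M)"
      using h g_nonneg by (intro nn_integral_cong) (simp add: ennreal_mult)
    also have "\<dots> = ennreal (h y * exp (\<gamma> * U y)) * (\<integral>\<^sup>+x. ennreal (g x y) \<partial>M)"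
      by (rule nn_integral_cmult) (measurable, simp add: space_M)
    finally show "(\<integral>\<^sup>+x. ennreal (h y * exp (\<gamma> * U y) * g x y) \<partial>M) = ennreal (h y * exp (\<gamma> * U y)) * ennreal (U y)"
      by (simp add: nn_g)
  qed
  also have "\<dots> \<le> (\<integral>\<^sup>+y. ennreal (exp (\<gamma> * C) * (h y * U y)) \<partial>M)"
  proof (rule nn_integral_mono)
    fix y
    have "h y * exp (\<gamma> * U y) * U y \<le> exp (\<gamma> * C) * (h y * U y)"
      using mult_left_mono[OF U_le[of y] gam_nonneg] h(1)[of y] U_nonneg[of y]
      by (simp add: mult_ac mult_left_mono mult_right_mono)
    then show "ennreal (h y * exp (\<gamma> * U y)) * ennreal (U y) \<le> ennreal (exp (\<gamma> * C) * (h y * U y))"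
      using h U_nonneg by (simp add: ennreal_mult[symmetric] ennreal_leI)
  qed
  also have "\<dots> = ennreal (exp (\<gamma> * C) * qint h)"
    unfolding qint_def using tilted_integrable(3)[OF h] h U_nonneg
    by (subst nn_integral_eq_integral) auto
  finally have *: "(\<integral>\<^sup>+x. tilted_potential h x \<partial>M) \<le> ennreal (exp (\<gamma> * C) * qint h)" .
  have "(\<integral>x. tilted_potential h x \<partial>M) = enn2real (\<integral>\<^sup>+x. tilted_potential h x \<partial>M)"
    by (rule integral_eq_nn_integral) (use Gm Gn in auto)
  also have "\<dots> \<le> enn2real (ennreal (exp (\<gamma> * C) * qint h))"
    by (rule enn2real_mono[OF *]) simp
  finally show "(\<integral>x. tilted_potential h x \<partial>M) \<le> exp (\<gamma> * C) * qint h" using qint_nonneg[of h] h by simp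
qed

text \<open>Particle \<open>i\<close> is integrated out after dropping its repulsion and, if
  \<open>i \<in> J\<close>, its factor \<open>h\<close>; in that case one mark is lost. One factor
  \<open>exp (\<gamma> * C)\<close> comes from the weight of this particle, the other from the mean
  of its tilted potential.\<close>

lemma wt_tilted_potential_le:
  assumes b: "0 \<le> b" and h: "\<And>x. 0 \<le> h x" "\<And>x. h x \<le> (1::real)" "h \<in> borel_measurable M"
    and I: "finite I" "i \<in> I" "J \<subseteq> I"
  shows "integrable (MI I) (\<lambda>x. wt b I x * (\<Prod>j\<in>J. h (x j)) * tilted_potential h (x i))"
    "(\<integral>x. wt b I x * (\<Prod>j\<in>J. h (x j)) * tilted_potential h (x i) \<partial>MI I) \<le> exp (2 * \<gamma> * C) * qint h * emom h b (card I - 1) (card (J-{i}))"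
proof -
  have eq: "insert i (I-{i}) = I" using I by auto
  note G = tilted_potential_bounds[OF h]
  have fJ: "finite J" using I finite_subset by auto
  have Gi: "integrable M (tilted_potential h)"
    by (rule integrable_const_bound[of _ "exp (\<gamma> * C) * C"]) (use G in auto)
  have m: "(\<lambda>x. wt b I x * (\<Prod>j\<in>J'. h (x j)) * tilted_potential h (x i)) \<in> borel_measurable (MI I)" if "J' \<subseteq> I" for J'
    by (intro borel_measurable_times wt_prod_meas comp_meas G h I that)
  have i: "integrable (MI I) (\<lambda>x. wt b I x * (\<Prod>j\<in>J'. h (x j)) * tilted_potential h (x i))" if "J' \<subseteq> I" for J'
  proof (rule integrable_PiM_bounded[OF m[OF that]])
    fix x show "\<bar>wt b I x * (\<Prod>j\<in>J'. h (x j)) * tilted_potential h (x i)\<bar> \<le> exp (\<gamma> * (card I * C)) * (exp (\<gamma> * C) * C)"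
      unfolding abs_mult[of _ "tilted_potential h (x i)"] by (rule mult_mono[OF wt_prod_bound]) (use b h G in auto)
  qed
  show "integrable (MI I) (\<lambda>x. wt b I x * (\<Prod>j\<in>J. h (x j)) * tilted_potential h (x i))" by (rule i[OF I(3)])
  let ?J = "J - {i}" and ?I = "I - {i}"
  \<comment> \<open>Rescales the tilted potential into the unit interval, as
    \<open>wt_insert_integral\<close> demands; the added 1 keeps \<open>B\<close> positive when
    \<open>C = 0\<close>.\<close>
  define B where "B = exp (\<gamma> * C) * C + 1"
  have B: "0 < B" using C_nonneg by (simp add: B_def add_nonneg_pos)
  have GB: "0 \<le> tilted_potential h x / B" "tilted_potential h x / B \<le> 1" "(\<lambda>x. tilted_potential h x / B) \<in> borel_measurable M" for x
  proof -
    show "0 \<le> tilted_potential h x / B" using B G(1)[of x] by simp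
    show "(\<lambda>x. tilted_potential h x / B) \<in> borel_measurable M" using G(3) by measurable
    have "tilted_potential h x \<le> B" using G(2)[of x] by (simp add: B_def)
    then show "tilted_potential h x / B \<le> 1" using B by simp
  qed
  have "(\<integral>x. wt b I x * (\<Prod>j\<in>J. h (x j)) * tilted_potential h (x i) \<partial>MI I) \<le> (\<integral>x. wt b I x * (\<Prod>j\<in>?J. h (x j)) * tilted_potential h (x i) \<partial>MI I)"
  proof (rule integral_mono[OF i i])
    fix x
    have "(\<Prod>j\<in>J. h (x j)) \<le> (\<Prod>j\<in>?J. h (x j))"
    proof (cases "i \<in> J")
      case True
      then have "(\<Prod>j\<in>J. h (x j)) = h (x i) * (\<Prod>j\<in>?J. h (x j))" by (rule prod.remove[OF fJ])
      also have "\<dots> \<le> 1 * (\<Prod>j\<in>?J. h (x j))" by (intro mult_right_mono h prod_nonneg)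
      finally show ?thesis by simp
    qed simp
    then show "wt b I x * (\<Prod>j\<in>J. h (x j)) * tilted_potential h (x i) \<le> wt b I x * (\<Prod>j\<in>?J. h (x j)) * tilted_potential h (x i)"
      by (intro mult_right_mono mult_left_mono G) (auto simp: wt_pos less_imp_le)
  qed (use I in auto)
  also have "\<dots> = B * (\<integral>x. wt b (insert i ?I) x * ((\<Prod>j\<in>?J. h (x j)) * (tilted_potential h (x i) / B)) \<partial>MI (insert i ?I))"
    unfolding eq integral_mult_right_zero[symmetric]
    by (rule Bochner_Integration.integral_cong) (use B in auto)
  also have "(\<integral>x. wt b (insert i ?I) x * ((\<Prod>j\<in>?J. h (x j)) * (tilted_potential h (x i) / B)) \<partial>MI (insert i ?I)) =
     (\<integral>x. wt b ?I x * (\<Prod>j\<in>?J. h (x j)) * (\<integral>y. tilted_potential h y / B * exp (\<gamma> * U y - b * (\<Sum>i\<in>?I. g (x i) y)) \<partial>M) \<partial>MI ?I)"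
    by (rule wt_insert_integral[where p="\<lambda>y. tilted_potential h y / B"]) (use I b h GB in auto)
  also have "B * \<dots> \<le> B * (\<integral>x. (exp (2 * \<gamma> * C) * qint h / B) * (wt b ?I x * (\<Prod>j\<in>?J. h (x j))) \<partial>MI ?I)"
  proof (rule mult_left_mono[OF integral_mono])
    show "integrable (MI ?I) (\<lambda>x. wt b ?I x * (\<Prod>j\<in>?J. h (x j)) * (\<integral>y. tilted_potential h y / B * exp (\<gamma> * U y - b * (\<Sum>i\<in>?I. g (x i) y)) \<partial>M))"
      by (rule wtH_int[where p="\<lambda>y. tilted_potential h y / B"]) (use I b h GB in auto)
    show "integrable (MI ?I) (\<lambda>x. (exp (2 * \<gamma> * C) * qint h / B) * (wt b ?I x * (\<Prod>j\<in>?J. h (x j))))"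
      by (intro integrable_mult_right wt_prod_int) (use I b h in auto)
    fix x
    have w: "0 \<le> wt b ?I x * (\<Prod>j\<in>?J. h (x j))"
      by (intro mult_nonneg_nonneg prod_nonneg) (use h wt_pos in \<open>auto simp: less_imp_le\<close>)
    have "(\<integral>y. tilted_potential h y / B * exp (\<gamma> * U y - b * (\<Sum>i\<in>?I. g (x i) y)) \<partial>M) \<le> (\<integral>y. tilted_potential h y / B * exp (\<gamma> * U y) \<partial>M)"
      by (rule insertion_integral_bounds[where p="\<lambda>y. tilted_potential h y / B"]) (use I b GB in auto)
    also have "\<dots> \<le> (\<integral>y. exp (\<gamma> * C) / B * tilted_potential h y \<partial>M)"
    proof (rule integral_mono)
      show "integrable M (\<lambda>y. tilted_potential h y / B * exp (\<gamma> * U y))" by (rule tilted_integrable[where h="\<lambda>y. tilted_potential h y / B", OF GB])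
      fix y have "tilted_potential h y / B * exp (\<gamma> * U y) \<le> tilted_potential h y / B * exp (\<gamma> * C)"
        using mult_left_mono[OF U_le[of y] gam_nonneg] GB(1)[of y] by (intro mult_left_mono) auto
      then show "tilted_potential h y / B * exp (\<gamma> * U y) \<le> exp (\<gamma> * C) / B * tilted_potential h y" by (simp add: mult_ac)
    qed (use Gi in auto)
    also have "\<dots> = exp (\<gamma> * C) / B * (\<integral>y. tilted_potential h y \<partial>M)" by simp
    also have "\<dots> \<le> exp (\<gamma> * C) / B * (exp (\<gamma> * C) * qint h)"
      by (rule mult_left_mono[OF G(4)]) (use B in auto)
    also have "\<dots> = exp (2 * \<gamma> * C) * qint h / B" 
    proof -
      have "exp (2 * \<gamma> * C) = exp (\<gamma> * C) * exp (\<gamma> * C)" by (simp add: exp_add[symmetric])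
      then show ?thesis by (simp add: mult_ac)
    qed
    finally have "(\<integral>y. tilted_potential h y / B * exp (\<gamma> * U y - b * (\<Sum>i\<in>?I. g (x i) y)) \<partial>M) \<le> exp (2 * \<gamma> * C) * qint h / B" .
    from mult_left_mono[OF this w]
    show "wt b ?I x * (\<Prod>j\<in>?J. h (x j)) * (\<integral>y. tilted_potential h y / B * exp (\<gamma> * U y - b * (\<Sum>i\<in>?I. g (x i) y)) \<partial>M)
       \<le> (exp (2 * \<gamma> * C) * qint h / B) * (wt b ?I x * (\<Prod>j\<in>?J. h (x j)))" by (simp add: mult_ac)
  qed (use B in auto)
  also have "\<dots> = exp (2 * \<gamma> * C) * qint h * Ew h b ?I ?J" using B by (simp add: Ew_def)
  also have "Ew h b ?I ?J = emom h b (card I - 1) (card (J-{i}))"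
    using Ew_eq_emom[of ?I ?J h b] I h by auto
  finally show "(\<integral>x. wt b I x * (\<Prod>j\<in>J. h (x j)) * tilted_potential h (x i) \<partial>MI I) \<le> exp (2 * \<gamma> * C) * qint h * emom h b (card I - 1) (card (J-{i}))" .
qed

text \<open>Linearizes the insertion factor by \<open>1 - t \<le> exp (- t)\<close>. Errors from the
  \<open>k\<close> marked particles lose one factor \<open>h\<close>, those from the others keep all
  \<open>k\<close>.\<close>

lemma emom_Suc_ge:
  assumes b: "0 \<le> b" and h: "\<And>x. 0 \<le> h x" "\<And>x. h x \<le> (1::real)" "h \<in> borel_measurable M" and k: "k \<le> n"
  shows "Hint h * emom h b n k - b * (exp (2 * \<gamma> * C) * qint h * (n * emom h b (n-1) k + k * emom h b (n-1) (k-1))) \<le> emom h b (Suc n) (Suc k)"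
proof -
  let ?I = "{..<n}" and ?P = "\<lambda>x. \<Prod>j\<in>{..<k}. h (x j)"
  let ?c = "exp (2 * \<gamma> * C) * qint h"
  have c0: "0 \<le> ?c" using qint_nonneg[of h] h by simp
  have s: "{..<k} \<subseteq> ?I" using k by auto
  have iG: "integrable (MI ?I) (\<lambda>x. \<Sum>i\<in>?I. wt b ?I x * ?P x * tilted_potential h (x i))"
    by (intro Bochner_Integration.integrable_sum wt_tilted_potential_le[OF b h _ _ s]) auto
  have iP: "integrable (MI ?I) (\<lambda>x. Hint h * (wt b ?I x * ?P x))"
    by (intro integrable_mult_right wt_prod_int b h s)
  have "(\<integral>x. Hint h * (wt b ?I x * ?P x) - b * (\<Sum>i\<in>?I. wt b ?I x * ?P x * tilted_potential h (x i)) \<partial>MI ?I) \<le> emom h b (Suc n) (Suc k)"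
    unfolding emom_Suc_eq[OF b h k]
  proof (rule integral_mono)
    show "integrable (MI ?I) (\<lambda>x. Hint h * (wt b ?I x * ?P x) - b * (\<Sum>i\<in>?I. wt b ?I x * ?P x * tilted_potential h (x i)))"
      using iG iP by auto
    show "integrable (MI ?I) (\<lambda>x. wt b ?I x * ?P x * (\<integral>y. h y * exp (\<gamma> * U y - b * (\<Sum>i\<in>?I. g (x i) y)) \<partial>M))"
      by (rule wtH_int[OF b h _ s h]) auto
    fix x
    have w: "0 \<le> wt b ?I x * ?P x"
      by (intro mult_nonneg_nonneg prod_nonneg) (use h wt_pos in \<open>auto simp: less_imp_le\<close>)
    have iS: "integrable M (\<lambda>y. \<Sum>i\<in>?I. h y * exp (\<gamma> * U y) * g (x i) y)"
      by (intro Bochner_Integration.integrable_sum tilted_integrable h)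
    have "Hint h - b * (\<Sum>i\<in>?I. tilted_potential h (x i)) = (\<integral>y. h y * exp (\<gamma> * U y) - b * (\<Sum>i\<in>?I. h y * exp (\<gamma> * U y) * g (x i) y) \<partial>M)"
      unfolding Hint_def tilted_potential_def using tilted_integrable[OF h] iS by (simp add: Bochner_Integration.integral_sum)
    also have "\<dots> \<le> (\<integral>y. h y * exp (\<gamma> * U y - b * (\<Sum>i\<in>?I. g (x i) y)) \<partial>M)"
    proof (rule integral_mono)
      show "integrable M (\<lambda>y. h y * exp (\<gamma> * U y) - b * (\<Sum>i\<in>?I. h y * exp (\<gamma> * U y) * g (x i) y))"
        using tilted_integrable[OF h] iS by auto
      show "integrable M (\<lambda>y. h y * exp (\<gamma> * U y - b * (\<Sum>i\<in>?I. g (x i) y)))" by (rule insertion_factor_integrable) (use b h in auto)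
      fix y
      have "1 - b * (\<Sum>i\<in>?I. g (x i) y) \<le> exp (- (b * (\<Sum>i\<in>?I. g (x i) y)))"
        using exp_ge_add_one_self[of "- (b * (\<Sum>i\<in>?I. g (x i) y))"] by simp
      then have "h y * exp (\<gamma> * U y) * (1 - b * (\<Sum>i\<in>?I. g (x i) y)) \<le> h y * exp (\<gamma> * U y) * exp (- (b * (\<Sum>i\<in>?I. g (x i) y)))"
        by (rule mult_left_mono) (use h in auto)
      also have "\<dots> = h y * exp (\<gamma> * U y - b * (\<Sum>i\<in>?I. g (x i) y))"
        by (simp add: exp_diff exp_minus field_simps)
      finally show "h y * exp (\<gamma> * U y) - b * (\<Sum>i\<in>?I. h y * exp (\<gamma> * U y) * g (x i) y)
         \<le> h y * exp (\<gamma> * U y - b * (\<Sum>i\<in>?I. g (x i) y))"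
        by (simp add: algebra_simps sum_distrib_left)
    qed
    finally have "Hint h - b * (\<Sum>i\<in>?I. tilted_potential h (x i)) \<le> (\<integral>y. h y * exp (\<gamma> * U y - b * (\<Sum>i\<in>?I. g (x i) y)) \<partial>M)" .
    from mult_left_mono[OF this w]
    show "Hint h * (wt b ?I x * ?P x) - b * (\<Sum>i\<in>?I. wt b ?I x * ?P x * tilted_potential h (x i))
       \<le> wt b ?I x * ?P x * (\<integral>y. h y * exp (\<gamma> * U y - b * (\<Sum>i\<in>?I. g (x i) y)) \<partial>M)"
      by (simp add: algebra_simps sum_distrib_left)
  qed
  moreover have "(\<integral>x. Hint h * (wt b ?I x * ?P x) - b * (\<Sum>i\<in>?I. wt b ?I x * ?P x * tilted_potential h (x i)) \<partial>MI ?I) =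
     Hint h * emom h b n k - b * (\<Sum>i\<in>?I. \<integral>x. wt b ?I x * ?P x * tilted_potential h (x i) \<partial>MI ?I)"
  proof -
    have "(\<integral>x. (\<Sum>i\<in>?I. wt b ?I x * ?P x * tilted_potential h (x i)) \<partial>MI ?I) = (\<Sum>i\<in>?I. \<integral>x. wt b ?I x * ?P x * tilted_potential h (x i) \<partial>MI ?I)"
      by (rule Bochner_Integration.integral_sum, rule wt_tilted_potential_le[OF b h _ _ s]) auto
    then show ?thesis using iG iP by (simp add: emom_def Ew_def)
  qed
  moreover have "(\<Sum>i\<in>?I. \<integral>x. wt b ?I x * ?P x * tilted_potential h (x i) \<partial>MI ?I) \<le> ?c * (n * emom h b (n-1) k + k * emom h b (n-1) (k-1))"
  proof -
    have "(\<Sum>i\<in>?I. \<integral>x. wt b ?I x * ?P x * tilted_potential h (x i) \<partial>MI ?I) \<le> (\<Sum>i\<in>?I. ?c * emom h b (n - 1) (card ({..<k}-{i})))"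
      using wt_tilted_potential_le(2)[OF b h _ _ s] by (intro sum_mono) auto
    also have "\<dots> \<le> (\<Sum>i\<in>?I. ?c * emom h b (n-1) k + (if i < k then ?c * emom h b (n-1) (k-1) else 0))"
      using c0 emom_nonneg[of h b "n-1"] h by (intro sum_mono) (auto intro!: mult_nonneg_nonneg)
    also have "\<dots> = n * (?c * emom h b (n-1) k) + (\<Sum>i\<in>?I. (if i < k then ?c * emom h b (n-1) (k-1) else 0))" by (simp add: sum.distrib)
    also have "(\<Sum>i\<in>?I. (if i < k then ?c * emom h b (n-1) (k-1) else 0)) = (\<Sum>i<k. ?c * emom h b (n-1) (k-1))"
      using k by (intro sum.mono_neutral_cong_right) auto
    finally show ?thesis by (simp add: algebra_simps)
  qed
  ultimately show ?thesis using mult_left_mono[OF _ b] by (smt (verit))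
qed

end

section \<open>The mean-field limit: mean potential and partition function ratios\<close>

locale mean_field_limit = mean_field_psd +
  fixes b :: "nat \<Rightarrow> real"
  assumes b_pos: "0 < b N" and Nb_lim: "(\<lambda>N. real N * b N) \<longlonglongrightarrow> \<gamma>"
begin

lemma b0: "0 \<le> b N" using b_pos[of N] by simp

lemma b_lim: "b \<longlonglongrightarrow> 0"
proof -
  have "(\<lambda>N. real N * b N * inverse (real N)) \<longlonglongrightarrow> \<gamma> * 0"
    by (intro tendsto_mult Nb_lim LIMSEQ_inverse_real_of_nat[THEN LIMSEQ_imp_Suc] lim_inverse_n)
  then have "(\<lambda>N. real N * b N * inverse (real N)) \<longlonglongrightarrow> 0" by simp
  then show ?thesis
    by (rule Lim_transform_eventually) (use eventually_gt_at_top[of 0] in \<open>eventually_elim, auto\<close>)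
qed

lemma Nb_shift_lim: "(\<lambda>N. real (N - j) * b N) \<longlonglongrightarrow> \<gamma>"
proof -
  have "(\<lambda>N. real N * b N - real j * b N) \<longlonglongrightarrow> \<gamma> - real j * 0"
    by (intro tendsto_diff tendsto_mult Nb_lim b_lim tendsto_const)
  then have "(\<lambda>N. real N * b N - real j * b N) \<longlonglongrightarrow> \<gamma>" by simp
  then show ?thesis
    by (rule Lim_transform_eventually)
      (use eventually_ge_at_top[of j] in \<open>eventually_elim, auto simp: algebra_simps of_nat_diff\<close>)
qed

text \<open>Mean potential per particle among \<open>N - j\<close> particles. The recursions lower
  the particle number while the coupling stays \<open>b N\<close>, so limits are taken for each
  fixed shift \<open>j\<close>.\<close>

definition Amean :: "nat \<Rightarrow> nat \<Rightarrow> real" where "Amean j N = umean (b N) (N - j) / real (N - j)"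

lemma Amean_bounds: "0 \<le> Amean j N" "Amean j N \<le> C"
  using umean_bounds[OF b0, of N "N - j"] C_nonneg
  by (cases "N - j = 0"; simp add: Amean_def divide_le_eq mult.commute)+

text \<open>\<open>energy_lower\<close> with total charge \<open>c * (N - j)\<close>, divided by the
  particle number, and then combined with \<open>energy_upper\<close>. For positive \<gamma> the
  second inequality becomes, in the limit,
  \<open>(c - 1) * A \<le> c * \<epsilon> + (c^2 - 1) * I0 / 2\<close> for every
  \<open>c \<ge> 0\<close>.\<close>

lemma Amean_le_quadratic:
  assumes "0 < \<epsilon>"
  shows "\<exists>K\<ge>0. \<forall>c j N. 0 \<le> c \<longrightarrow> j < N \<longrightarrow>
    (let p = real (N - j) * b N in
       p * (c * Amean j N - c * \<epsilon> - c\<^sup>2 * I0 / 2) - b N * K / 2 \<le> b N * wmean (b N) (N - j) / real (N - j) \<and>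
       p * (c * Amean j N - c * \<epsilon> - c\<^sup>2 * I0 / 2) - b N * K / 2 \<le> \<gamma> * Amean j N + p * I0 / 2 - \<gamma> * I0)"
proof -
  obtain K0 where K0: "\<And>b n c. 0 < b \<Longrightarrow> 0 \<le> c \<Longrightarrow> c * umean b n - c * \<epsilon> * n - c\<^sup>2 * I0 / 2 - n * K0 / 2 \<le> wmean b n"
    using energy_lower[OF assms] by blast
  define K where "K = max K0 0"
  have K: "c * umean b n - c * \<epsilon> * n - c\<^sup>2 * I0 / 2 - n * K / 2 \<le> wmean b n" if "0 < b" "0 \<le> c" for b n c
  proof -
    have "real n * K0 \<le> real n * K" by (rule mult_left_mono) (auto simp: K_def)
    then show ?thesis using K0[OF that, of n] by simp
  qed
  show ?thesis
  proof (intro exI[of _ K] conjI allI impI)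
    show "0 \<le> K" by (simp add: K_def)
    fix c j N assume c: "(0::real) \<le> c" and jN: "j < (N::nat)"
    define n where "n = real (N - j)"
    define B where "B = b N"
    have n: "1 \<le> n" using jN by (simp add: n_def)
    have B: "0 < B" by (simp add: B_def b_pos)
    have uA: "umean (b N) (N - j) = n * Amean j N" using n by (simp add: Amean_def n_def)
    have "0 \<le> c * n" using c n by simp
    from K[OF b_pos[of N] this, of "N - j"]
    have 1: "c * n * (n * Amean j N) - c * n * \<epsilon> * n - (c * n)\<^sup>2 * I0 / 2 - n * K / 2 \<le> wmean B (N - j)"
      by (simp add: uA n_def[symmetric] B_def)
    have "B * (c * n * (n * Amean j N) - c * n * \<epsilon> * n - (c * n)\<^sup>2 * I0 / 2 - n * K / 2) \<le> B * wmean B (N - j)"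
      using mult_left_mono[OF 1, of B] B by simp
    moreover have eq: "B * (c * n * (n * Amean j N) - c * n * \<epsilon> * n - (c * n)\<^sup>2 * I0 / 2 - n * K / 2)
      = n * (n * B * (c * Amean j N - c * \<epsilon> - c\<^sup>2 * I0 / 2) - B * K / 2)"
      by (simp add: algebra_simps power2_eq_square)
    ultimately have 2: "n * (n * B * (c * Amean j N - c * \<epsilon> - c\<^sup>2 * I0 / 2) - B * K / 2) \<le> B * wmean B (N - j)" by simp
    have a: "n * B * (c * Amean j N - c * \<epsilon> - c\<^sup>2 * I0 / 2) - B * K / 2 \<le> B * wmean B (N - j) / n"
      using 2 n by (simp add: field_simps)
    have 3: "B * wmean B (N - j) - \<gamma> * (n * Amean j N) \<le> B * (n * (n - 1) / 2 * I0) - \<gamma> * (n * I0)"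
      using energy_upper[OF b_pos[of N], of "N - j"] by (simp add: uA n_def[symmetric] B_def)
    have 4: "B * (n * (n - 1) / 2 * I0) \<le> B * (n * n / 2 * I0)"
      using B n I0_nonneg by (intro mult_left_mono mult_right_mono divide_right_mono) auto
    have "n * (n * B * (c * Amean j N - c * \<epsilon> - c\<^sup>2 * I0 / 2) - B * K / 2) \<le> n * (\<gamma> * Amean j N + n * B * I0 / 2 - \<gamma> * I0)"
      using 2 3 4 by (simp add: algebra_simps)
    then have "n * B * (c * Amean j N - c * \<epsilon> - c\<^sup>2 * I0 / 2) - B * K / 2 \<le> \<gamma> * Amean j N + n * B * I0 / 2 - \<gamma> * I0"
      using n by (simp add: mult_le_cancel_left)
    with a show "let p = real (N - j) * b N in
       p * (c * Amean j N - c * \<epsilon> - c\<^sup>2 * I0 / 2) - b N * K / 2 \<le> b N * wmean (b N) (N - j) / real (N - j) \<and>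
       p * (c * Amean j N - c * \<epsilon> - c\<^sup>2 * I0 / 2) - b N * K / 2 \<le> \<gamma> * Amean j N + p * I0 / 2 - \<gamma> * I0"
      by (simp add: Let_def n_def[symmetric] B_def[symmetric])
  qed
qed

text \<open>Dividing the inequality of \<open>Amean_le_quadratic\<close> by \<open>c - 1\<close>,
  for \<open>c\<close> slightly above and slightly below 1, gives an upper and a lower bound that
  both approach \<open>I0\<close>. The factor \<gamma> stays because that inequality carries no
  information in the limit for \<open>\<gamma> = 0\<close>.\<close>

lemma gamma_Amean_tendsto: "(\<lambda>N. \<gamma> * Amean j N) \<longlonglongrightarrow> \<gamma> * I0"
proof (rule LIMSEQ_I)
  fix r :: real assume r: "0 < r"
  \<comment> \<open>Chosen so that \<open>c = 1 + \<delta>\<close> and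
    \<open>c = 1 - \<delta>\<close> both leave an error of at most
    \<open>\<delta> * Q\<close>.\<close>
  define Q where "Q = \<gamma> * I0 / 2 + 2 * \<gamma> + 1"
  have Q: "1 \<le> Q" using gam_nonneg I0_nonneg by (simp add: Q_def)
  define \<delta> where "\<delta> = min (1/2) (r / (2 * Q))"
  have d: "0 < \<delta>" "\<delta> \<le> 1/2" "\<delta> * Q < r"
  proof -
    show "0 < \<delta>" "\<delta> \<le> 1/2" using r Q by (auto simp: \<delta>_def)
    have "\<delta> * Q \<le> r / (2 * Q) * Q" using Q by (intro mult_right_mono) (auto simp: \<delta>_def)
    also have "\<dots> < r" using r Q by simp
    finally show "\<delta> * Q < r" .
  qed
  \<comment> \<open>The truncation error is of order \<open>\<delta>^2\<close>, since it will be
    divided by \<open>\<bar>c - 1\<bar> = \<delta>\<close>.\<close>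
  obtain K where K0: "0 \<le> K" and K: "\<And>c j N. 0 \<le> c \<Longrightarrow> j < N \<Longrightarrow>
    (real (N - j) * b N) * (c * Amean j N - c * \<delta>\<^sup>2 - c\<^sup>2 * I0 / 2) - b N * K / 2 \<le> \<gamma> * Amean j N + (real (N - j) * b N) * I0 / 2 - \<gamma> * I0"
    using Amean_le_quadratic[of "\<delta>\<^sup>2"] d unfolding Let_def by auto
  \<comment> \<open>Collects the cost of replacing \<open>real (N - j) * b N\<close> by \<gamma>,
    with \<open>c \<le> 2\<close> and \<open>\<delta>^2 \<le> 1\<close> inserted, and the
    self-energy term.\<close>
  define err where "err N = \<bar>real (N - j) * b N - \<gamma>\<bar> * (2 * C + 2 + 5 * I0 / 2) + b N * K / 2" for N
  have "err \<longlonglongrightarrow> \<bar>\<gamma> - \<gamma>\<bar> * (2 * C + 2 + 5 * I0 / 2) + 0 * K / 2"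
    unfolding err_def by (intro tendsto_add tendsto_mult tendsto_rabs tendsto_diff Nb_shift_lim b_lim tendsto_const tendsto_divide) auto
  then have "err \<longlonglongrightarrow> 0" by simp
  then have "eventually (\<lambda>N. err N < \<delta>\<^sup>2) sequentially"
    using d by (intro order_tendstoD) auto
  then obtain N0 where N0: "\<And>N. N \<ge> N0 \<Longrightarrow> err N < \<delta>\<^sup>2" unfolding eventually_sequentially by blast
  have main: "\<bar>\<gamma> * Amean j N - \<gamma> * I0\<bar> < r" if N: "N \<ge> max N0 (Suc j)" for N
  proof -
    define p where "p = real (N - j) * b N"
    define D where "D = \<gamma> * Amean j N"
    note Ab = Amean_bounds[of j N]
    have ineq: "(c - 1) * D \<le> \<gamma> * c * \<delta>\<^sup>2 + \<gamma> * I0 * (c\<^sup>2 - 1) / 2 + err N" if c: "0 \<le> c" "c \<le> 2" for c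
    proof -
      have e1: "\<bar>p - \<gamma>\<bar> * (c * Amean j N) \<le> \<bar>p - \<gamma>\<bar> * (2 * C)" using c Ab by (intro mult_left_mono mult_mono) auto
      have e2: "\<bar>p - \<gamma>\<bar> * (c * \<delta>\<^sup>2) \<le> \<bar>p - \<gamma>\<bar> * 2"
      proof (intro mult_left_mono)
        have "\<delta>\<^sup>2 \<le> 1" using d by (simp add: power2_eq_square mult_le_one)
        then have "c * \<delta>\<^sup>2 \<le> 2 * 1" using c by (intro mult_mono) auto
        then show "c * \<delta>\<^sup>2 \<le> 2" by simp
      qed simp
      have e3: "\<bar>p - \<gamma>\<bar> * ((c\<^sup>2 + 1) * I0 / 2) \<le> \<bar>p - \<gamma>\<bar> * (5 * I0 / 2)"
      proof (intro mult_left_mono divide_right_mono mult_right_mono)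
        have "c\<^sup>2 \<le> 2\<^sup>2" using c by (intro power_mono) auto
        then show "c\<^sup>2 + 1 \<le> 5" by simp
      qed (use I0_nonneg in auto)
      have e0: "x * y \<le> \<bar>x\<bar> * y" "- (\<bar>x\<bar> * y) \<le> x * y" if "0 \<le> y" for x y :: real
        using that mult_right_mono[of x "\<bar>x\<bar>" y] mult_right_mono[of "- \<bar>x\<bar>" x y] by auto
      have f1: "- (\<bar>p - \<gamma>\<bar> * (c * Amean j N)) \<le> (p - \<gamma>) * (c * Amean j N)" using c Ab by (intro e0) auto
      have f2: "(p - \<gamma>) * (c * \<delta>\<^sup>2) \<le> \<bar>p - \<gamma>\<bar> * (c * \<delta>\<^sup>2)" using c by (intro e0) auto
      have f3: "(p - \<gamma>) * ((c\<^sup>2 + 1) * I0 / 2) \<le> \<bar>p - \<gamma>\<bar> * ((c\<^sup>2 + 1) * I0 / 2)" using I0_nonneg by (intro e0) auto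
      have k: "p * (c * Amean j N - c * \<delta>\<^sup>2 - c\<^sup>2 * I0 / 2) - b N * K / 2 \<le> D + p * I0 / 2 - \<gamma> * I0"
        using K[OF c(1), of j N] N by (simp add: p_def D_def)
      have "(c - 1) * D = p * (c * Amean j N - c * \<delta>\<^sup>2 - c\<^sup>2 * I0 / 2) - D + \<gamma> * c * \<delta>\<^sup>2 + \<gamma> * c\<^sup>2 * I0 / 2
          - (p - \<gamma>) * (c * Amean j N) + (p - \<gamma>) * (c * \<delta>\<^sup>2) + (p - \<gamma>) * (c\<^sup>2 * I0 / 2)"
      proof -
        define i where "i = I0 / 2"
        then have i: "I0 = 2 * i" by simp
        show ?thesis unfolding i D_def by (simp add: algebra_simps)
      qed
      also have "\<dots> \<le> b N * K / 2 + p * I0 / 2 - \<gamma> * I0 + \<gamma> * c * \<delta>\<^sup>2 + \<gamma> * c\<^sup>2 * I0 / 2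
          - (p - \<gamma>) * (c * Amean j N) + (p - \<gamma>) * (c * \<delta>\<^sup>2) + (p - \<gamma>) * (c\<^sup>2 * I0 / 2)"
        using k by simp
      also have "\<dots> = \<gamma> * c * \<delta>\<^sup>2 + \<gamma> * I0 * (c\<^sup>2 - 1) / 2 + b N * K / 2 - (p - \<gamma>) * (c * Amean j N) + (p - \<gamma>) * (c * \<delta>\<^sup>2) + (p - \<gamma>) * ((c\<^sup>2 + 1) * I0 / 2)"
        
      proof -
        define i where "i = I0 / 2"
        then have i: "I0 = 2 * i" by simp
        show ?thesis unfolding i by (simp add: field_simps)
      qed
      also have "\<dots> \<le> \<gamma> * c * \<delta>\<^sup>2 + \<gamma> * I0 * (c\<^sup>2 - 1) / 2 + b N * K / 2 + \<bar>p - \<gamma>\<bar> * (2 * C) + \<bar>p - \<gamma>\<bar> * 2 + \<bar>p - \<gamma>\<bar> * (5 * I0 / 2)"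
        using e1 e2 e3 f1 f2 f3 by linarith
      also have "\<dots> = \<gamma> * c * \<delta>\<^sup>2 + \<gamma> * I0 * (c\<^sup>2 - 1) / 2 + err N"
        by (simp add: err_def p_def algebra_simps)
      finally show ?thesis .
    qed
    have emom: "err N < \<delta> * \<delta>" using N0[of N] N by (simp add: power2_eq_square)
    have d2: "\<delta> * \<delta> * \<delta> \<le> \<delta> * \<delta> * 1" using d by (intro mult_left_mono) auto
    have "\<delta> * D \<le> \<gamma> * (1 + \<delta>) * \<delta>\<^sup>2 + \<gamma> * I0 * ((1+\<delta>)\<^sup>2 - 1) / 2 + err N" using ineq[of "1 + \<delta>"] d by simp
    also have "\<dots> < \<gamma> * 2 * \<delta>\<^sup>2 + \<gamma> * I0 * ((1+\<delta>)\<^sup>2 - 1) / 2 + \<delta> * \<delta>"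
      using emom d gam_nonneg by (intro add_le_less_mono add_mono mult_right_mono mult_left_mono) auto
    also have "\<dots> = \<delta> * (\<gamma> * I0 + \<delta> * Q)" by (simp add: Q_def power2_eq_square field_simps)
    finally have 1: "D - \<gamma> * I0 < \<delta> * Q" using d by simp
    have "- \<delta> * D \<le> \<gamma> * (1 - \<delta>) * \<delta>\<^sup>2 + \<gamma> * I0 * ((1-\<delta>)\<^sup>2 - 1) / 2 + err N" using ineq[of "1 - \<delta>"] d by simp
    also have "\<dots> < \<gamma> * 2 * \<delta>\<^sup>2 + \<gamma> * I0 * ((1-\<delta>)\<^sup>2 - 1) / 2 + \<delta> * \<delta>"
      using emom d gam_nonneg by (intro add_le_less_mono add_mono mult_right_mono mult_left_mono) auto
    also have "\<dots> = \<delta> * (- \<gamma> * I0 + \<delta> * Q)" by (simp add: Q_def power2_eq_square field_simps)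
    finally have "\<delta> * (- D) < \<delta> * (- \<gamma> * I0 + \<delta> * Q)" by simp
    then have "- D < - \<gamma> * I0 + \<delta> * Q" by (rule mult_left_less_imp_less) (use d in simp)
    then have 2: "\<gamma> * I0 - D < \<delta> * Q" by simp
    show ?thesis using 1 2 d(3) by (simp add: D_def abs_less_iff)
  qed
  then show "\<exists>no. \<forall>N\<ge>no. norm (\<gamma> * Amean j N - \<gamma> * I0) < r"
    unfolding real_norm_def by blast
qed

lemma b_Amean_tendsto: "(\<lambda>N. real (N - j) * b N * Amean j N) \<longlonglongrightarrow> \<gamma> * I0"
proof -
  have "(\<lambda>N. (real (N - j) * b N - \<gamma>) * Amean j N) \<longlonglongrightarrow> 0"
  proof (rule tendsto_0_le[where K=C])
    show "(\<lambda>N. real (N - j) * b N - \<gamma>) \<longlonglongrightarrow> 0" using Nb_shift_lim[of j] by (simp add: LIM_zero)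
    show "\<forall>\<^sub>F N in sequentially. norm ((real (N - j) * b N - \<gamma>) * Amean j N) \<le> norm (real (N - j) * b N - \<gamma>) * C"
      using Amean_bounds by (intro always_eventually allI) (simp add: abs_mult mult_left_mono)
  qed
  from tendsto_add[OF this gamma_Amean_tendsto[of j]] show ?thesis by (simp add: algebra_simps)
qed

text \<open>The bound for an added particle gives the upper half, the bound for a removed one the
  lower half. The exponents vanish in the limit, up to \<open>2 * \<gamma> * \<epsilon>\<close> in
  the second case: the mean potential tends to \<open>I0\<close>, and \<open>b\<close> times the
  pair energy per particle is asymptotically at least
  \<open>\<gamma> * (I0 / 2 - \<epsilon>)\<close>.\<close>

lemma zpart_ratio_tendsto: "(\<lambda>N. zpart (b N) (N - Suc j) / zpart (b N) (N - j)) \<longlonglongrightarrow> 1"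
proof (rule order_tendstoI)
  fix a :: real assume a: "1 < a"
  have "(\<lambda>N. exp (real (N - Suc j) * b N * Amean (Suc j) N - \<gamma> * I0)) \<longlonglongrightarrow> exp (\<gamma> * I0 - \<gamma> * I0)"
    by (intro tendsto_exp tendsto_diff b_Amean_tendsto tendsto_const)
  then have "\<forall>\<^sub>F N in sequentially. exp (real (N - Suc j) * b N * Amean (Suc j) N - \<gamma> * I0) < a"
    using a by (intro order_tendstoD) auto
  then show "\<forall>\<^sub>F N in sequentially. zpart (b N) (N - Suc j) / zpart (b N) (N - j) < a"
    using eventually_gt_at_top[of "Suc j"]
  proof eventually_elim
    case (elim N)
    then have s: "N - j = Suc (N - Suc j)" and n: "0 < real (N - Suc j)" by auto
    have "zpart (b N) (N - Suc j) * exp (\<gamma> * I0 - b N * umean (b N) (N - Suc j)) \<le> zpart (b N) (N - j)"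
      unfolding s by (rule zpart_Suc_ge[OF b0])
    moreover have "b N * umean (b N) (N - Suc j) = real (N - Suc j) * b N * Amean (Suc j) N" using n by (simp add: Amean_def)
    ultimately have "zpart (b N) (N - Suc j) \<le> exp (real (N - Suc j) * b N * Amean (Suc j) N - \<gamma> * I0) * zpart (b N) (N - j)"
      by (simp add: exp_diff field_simps)
    then have "zpart (b N) (N - Suc j) / zpart (b N) (N - j) \<le> exp (real (N - Suc j) * b N * Amean (Suc j) N - \<gamma> * I0)"
      using zpart_pos[OF b0, of N "N - j"] by (simp add: field_simps)
    then show ?case using elim by simp
  qed
next
  fix a :: real assume a: "a < 1"
  define \<epsilon> where "\<epsilon> = (1 - a) / (2 * (2 * \<gamma> + 1))"
  have emom: "0 < \<epsilon>" "a < 1 - 2 * \<gamma> * \<epsilon>"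
  proof -
    have "(2 * \<gamma> + 1) * \<epsilon> = (1 - a) / 2" using gam_nonneg by (simp add: \<epsilon>_def field_simps)
    moreover show "0 < \<epsilon>" using a gam_nonneg by (simp add: \<epsilon>_def)
    ultimately show "a < 1 - 2 * \<gamma> * \<epsilon>" using a by (simp add: algebra_simps)
  qed
  obtain K where K1: "\<forall>c j N. 0 \<le> c \<longrightarrow> j < N \<longrightarrow>
    (real (N - j) * b N) * (c * Amean j N - c * \<epsilon> - c\<^sup>2 * I0 / 2) - b N * K / 2 \<le> b N * wmean (b N) (N - j) / real (N - j)"
    using Amean_le_quadratic[OF emom(1)] unfolding Let_def by blast
  \<comment> \<open>With mean potential \<open>I0\<close> the lower bound
    \<open>c * I0 - c^2 * I0 / 2\<close> is largest at \<open>c = 1\<close>.\<close>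
  have K: "(real (N - j) * b N) * (Amean j N - \<epsilon> - I0 / 2) - b N * K / 2 \<le> b N * wmean (b N) (N - j) / real (N - j)" if "j < N" for N
    using K1[rule_format, OF _ that, of 1] by simp
  let ?x = "\<lambda>N. 2 * (real (N - j) * b N * Amean j N - real (N - j) * b N * (\<epsilon> + I0 / 2) - b N * K / 2) - \<gamma> * Amean j N"
  have "(\<lambda>N. exp (?x N)) \<longlonglongrightarrow> exp (2 * (\<gamma> * I0 - \<gamma> * (\<epsilon> + I0 / 2) - 0 * K / 2) - \<gamma> * I0)"
    by (intro tendsto_exp tendsto_diff tendsto_mult b_Amean_tendsto Nb_shift_lim b_lim gamma_Amean_tendsto tendsto_const tendsto_divide) auto
  moreover have "2 * (\<gamma> * I0 - \<gamma> * (\<epsilon> + I0 / 2) - 0 * K / 2) - \<gamma> * I0 = - (2 * \<gamma> * \<epsilon>)" by (simp add: algebra_simps)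
  moreover have "a < exp (- (2 * \<gamma> * \<epsilon>))" using emom(2) exp_ge_add_one_self[of "- (2 * \<gamma> * \<epsilon>)"] by linarith
  ultimately have lim: "(\<lambda>N. exp (?x N)) \<longlonglongrightarrow> exp (- (2 * \<gamma> * \<epsilon>))" and al: "a < exp (- (2 * \<gamma> * \<epsilon>))" by simp_all
  have "\<forall>\<^sub>F N in sequentially. a < exp (?x N)" by (rule order_tendstoD(1)[OF lim al])
  then show "\<forall>\<^sub>F N in sequentially. a < zpart (b N) (N - Suc j) / zpart (b N) (N - j)"
    using eventually_gt_at_top[of "Suc j"]
  proof eventually_elim
    case (elim N)
    define n where "n = N - Suc j"
    have s: "N - j = Suc n" and n: "0 < real (N - j)" using elim by (auto simp: n_def)
    have "zpart (b N) (Suc n) * exp ((2 * b N * wmean (b N) (Suc n) - \<gamma> * umean (b N) (Suc n)) / Suc n) \<le> zpart (b N) n"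
      by (rule zpart_pred_ge[OF b_pos])
    moreover have "?x N \<le> (2 * b N * wmean (b N) (Suc n) - \<gamma> * umean (b N) (Suc n)) / Suc n"
    proof -
      have eq: "(2 * b N * wmean (b N) (Suc n) - \<gamma> * umean (b N) (Suc n)) / Suc n = 2 * (b N * wmean (b N) (N - j) / real (N - j)) - \<gamma> * Amean j N"
        unfolding Amean_def s by (simp add: diff_divide_distrib)
      have ar: "2 * (p * Amean' - p * (\<epsilon>' + i) - k) - G \<le> 2 * V - G" if "p * (Amean' - \<epsilon>' - i) - k \<le> V" for p Amean' \<epsilon>' i k V G :: real
        using that by (simp add: algebra_simps)
      show ?thesis unfolding eq by (rule ar[OF K]) (use elim in simp)
    qed
    then have "exp (?x N) \<le> exp ((2 * b N * wmean (b N) (Suc n) - \<gamma> * umean (b N) (Suc n)) / Suc n)" by simp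
    then have "zpart (b N) (Suc n) * exp (?x N) \<le> zpart (b N) (Suc n) * exp ((2 * b N * wmean (b N) (Suc n) - \<gamma> * umean (b N) (Suc n)) / Suc n)"
      by (rule mult_left_mono) (simp add: zpart_pos b0 less_imp_le)
    ultimately have "zpart (b N) (Suc n) * exp (?x N) \<le> zpart (b N) n" by linarith
    then have "exp (?x N) \<le> zpart (b N) (N - Suc j) / zpart (b N) (N - j)"
      using zpart_pos[OF b0, of N "Suc n"] by (simp add: s n_def[symmetric] field_simps)
    then show ?case using elim by simp
  qed
qed

end

section \<open>Factorial moments and their alternating series\<close>

lemma binomial_over_power_tendsto: "(\<lambda>N. real (N choose k) / real N ^ k) \<longlonglongrightarrow> 1 / fact k"
proof -
  have "(\<lambda>N. (\<Prod>i<k. (real N - real i) / real N) / fact k) \<longlonglongrightarrow> (\<Prod>i<k. 1) / fact k"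
  proof (intro tendsto_divide tendsto_prod tendsto_const)
    fix i
    have "(\<lambda>N. 1 - real i * inverse (real N)) \<longlonglongrightarrow> 1 - real i * 0"
      by (intro tendsto_diff tendsto_mult tendsto_const lim_inverse_n)
    then have "(\<lambda>N. 1 - real i * inverse (real N)) \<longlonglongrightarrow> 1" by simp
    then show "(\<lambda>N. (real N - real i) / real N) \<longlonglongrightarrow> 1"
      by (rule Lim_transform_eventually)
        (use eventually_gt_at_top[of 0] in \<open>eventually_elim, auto simp: field_simps\<close>)
  qed simp
  moreover have "(\<Prod>i<k. (real N - real i) / real N) / fact k = real (N choose k) / real N ^ k" for N
    by (simp add: prod_dividef binomial_gbinomial gbinomial_prod_rev atLeast0LessThan)
  ultimately show ?thesis by simp
qed

lemma sum_Pow_card: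
  fixes f :: "nat \<Rightarrow> real"
  assumes "finite Amean"
  shows "(\<Sum>X\<in>Pow Amean. f (card X)) = (\<Sum>k\<le>card Amean. real (card Amean choose k) * f k)"
proof -
  have "(\<Sum>X\<in>Pow Amean. f (card X)) = (\<Sum>k\<le>card Amean. \<Sum>X\<in>{X \<in> Pow Amean. card X = k}. f (card X))"
    by (rule sum.group[symmetric]) (use assms in \<open>auto intro: card_mono\<close>)
  also have "\<dots> = (\<Sum>k\<le>card Amean. real (card Amean choose k) * f k)"
  proof (rule sum.cong[OF refl])
    fix k
    have "(\<Sum>X\<in>{X \<in> Pow Amean. card X = k}. f (card X)) = (\<Sum>X\<in>{X \<in> Pow Amean. card X = k}. f k)" by (rule sum.cong) auto
    also have "\<dots> = real (card {X. X \<subseteq> Amean \<and> card X = k}) * f k" by simp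
    finally show "(\<Sum>X\<in>{X \<in> Pow Amean. card X = k}. f (card X)) = real (card Amean choose k) * f k"
      using n_subsets[OF assms, of k] by simp
  qed
  finally show ?thesis .
qed

context mean_field_limit begin

text \<open>Inclusion and exclusion over the set of marked particles; by exchangeability each set
  contributes according to its size.\<close>

lemma expand_product:
  assumes h: "\<And>x. 0 \<le> h x" "\<And>x. h x \<le> (1::real)" "h \<in> borel_measurable M"
  shows "(\<integral>x. wt (b N) {..<n} x * (\<Prod>i<n. 1 - h (x i)) \<partial>MI {..<n}) = (\<Sum>k\<le>n. real (n choose k) * ((-1)^k * emom h (b N) n k))"
proof -
  have p: "(\<Prod>i<n. 1 - h (x i)) = (\<Sum>X\<in>Pow {..<n}. (-1)^card X * (\<Prod>i\<in>X. h (x i)))" for x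
  proof -
    have "(\<Prod>i<n. 1 - h (x i)) = (\<Prod>i<n. - h (x i) + 1)" by simp
    also have "\<dots> = (\<Sum>X\<in>Pow {..<n}. (\<Prod>i\<in>X. - h (x i)) * (\<Prod>i\<in>{..<n}-X. 1))" by (rule prod_add) simp
    also have "\<dots> = (\<Sum>X\<in>Pow {..<n}. (-1)^card X * (\<Prod>i\<in>X. h (x i)))"
      by (intro sum.cong refl) (simp add: prod_uminus)
    finally show ?thesis .
  qed
  have "(\<integral>x. wt (b N) {..<n} x * (\<Prod>i<n. 1 - h (x i)) \<partial>MI {..<n}) =
     (\<integral>x. (\<Sum>X\<in>Pow {..<n}. (-1)^card X * (wt (b N) {..<n} x * (\<Prod>i\<in>X. h (x i)))) \<partial>MI {..<n})"
    unfolding p by (intro Bochner_Integration.integral_cong refl) (simp add: sum_distrib_left mult_ac)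
  also have "\<dots> = (\<Sum>X\<in>Pow {..<n}. \<integral>x. (-1)^card X * (wt (b N) {..<n} x * (\<Prod>i\<in>X. h (x i))) \<partial>MI {..<n})"
    by (intro Bochner_Integration.integral_sum integrable_mult_right wt_prod_int b0 h) auto
  also have "\<dots> = (\<Sum>X\<in>Pow {..<n}. (-1)^card X * emom h (b N) n (card X))"
  proof (rule sum.cong[OF refl])
    fix X assume "X \<in> Pow {..<n}"
    then show "(\<integral>x. (-1)^card X * (wt (b N) {..<n} x * (\<Prod>i\<in>X. h (x i))) \<partial>MI {..<n}) = (-1)^card X * emom h (b N) n (card X)"
      using Ew_eq_emom[of "{..<n}" X h "b N"] h by (simp add: Ew_def)
  qed
  also have "\<dots> = (\<Sum>k\<le>n. real (n choose k) * ((-1)^k * emom h (b N) n k))"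
    using sum_Pow_card[of "{..<n}" "\<lambda>k. (-1)^k * emom h (b N) n k"] by simp
  finally show ?thesis .
qed

text \<open>In the application \<open>h N\<close> is \<open>1 - exp (- f)\<close> in rescaled
  coordinates. The first limit fixes the intensity; the second says that the window decouples from
  the gas.\<close>

context
  fixes h :: "nat \<Rightarrow> 'a \<Rightarrow> real" and lam :: real
  assumes h: "\<And>N x. 0 \<le> h N x" "\<And>N x. h N x \<le> 1" "\<And>N. h N \<in> borel_measurable M"
    and NH: "(\<lambda>N. real N * Hint (h N)) \<longlonglongrightarrow> lam" and Nq: "(\<lambda>N. real N * qint (h N)) \<longlonglongrightarrow> 0"
begin

definition crude_factor :: "nat \<Rightarrow> real" where "crude_factor N = exp (b N * N * C)"

lemma crude_factor_tendsto: "crude_factor \<longlonglongrightarrow> exp (\<gamma> * C)"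
proof -
  have "(\<lambda>N. exp (real N * b N * C)) \<longlonglongrightarrow> exp (\<gamma> * C)" by (intro tendsto_exp tendsto_mult Nb_lim tendsto_const)
  then show ?thesis by (simp add: crude_factor_def[abs_def] mult.commute)
qed

lemma zpart_le_crude_factor: assumes "n < N" shows "zpart (b N) n \<le> crude_factor N * zpart (b N) (Suc n)"
proof -
  have "b N * (real n * C) \<le> b N * N * C" unfolding mult.assoc
    using assms C_nonneg b0[of N] by (intro mult_left_mono mult_right_mono) auto
  then have "exp (b N * (n * C)) * zpart (b N) (Suc n) \<le> crude_factor N * zpart (b N) (Suc n)"
    using zpart_pos[OF b0, of N "Suc n"] unfolding crude_factor_def by (intro mult_right_mono) auto
  then show ?thesis using zpart_Suc_ge_crude[OF b0, of N n] by simp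
qed

lemma crude_factor_pos: "0 < crude_factor N" by (simp add: crude_factor_def)

text \<open>Induction on \<open>k\<close> for all shifts \<open>j\<close> at once, because unmarking
  a particle removes it from the gas. A step contributes \<open>N * Hint\<close>, tending to
  \<open>lam\<close>, and a partition function ratio, tending to 1; its error contains the factor
  \<open>N * qint\<close>.\<close>

lemma moment_limit: "(\<lambda>N. real N ^ k * emom (h N) (b N) (N - j) k / zpart (b N) (N - j)) \<longlonglongrightarrow> lam ^ k"
proof (induction k arbitrary: j)
  case 0
  have eq: "real N ^ 0 * emom (h N) (b N) (N - j) 0 / zpart (b N) (N - j) = 1" for N
    using zpart_pos[OF b0, of N "N - j"] by (simp add: emom_0)
  show ?case unfolding eq by simp
next
  case (Suc k)
  define X where "X N = (real N * Hint (h N)) * (real N ^ k * emom (h N) (b N) (N - Suc j) k / zpart (b N) (N - Suc j)) *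
     (zpart (b N) (N - Suc j) / zpart (b N) (N - j))" for N
  define err where "err N = (real N * b N) * (real N * qint (h N)) * (exp (2 * \<gamma> * C) * (crude_factor N)\<^sup>2 *
     ((real N * Hint (h N) * crude_factor N) ^ k + real k * (real N * Hint (h N) * crude_factor N) ^ (k - 1)))" for N
  have Xl: "X \<longlonglongrightarrow> lam ^ Suc k"
    using tendsto_mult[OF tendsto_mult[OF NH Suc.IH[of "Suc j"]] zpart_ratio_tendsto[of j]] by (simp add: X_def[abs_def])
  have "err \<longlonglongrightarrow> \<gamma> * 0 * (exp (2 * \<gamma> * C) * (exp (\<gamma> * C))\<^sup>2 *
     ((lam * exp (\<gamma> * C)) ^ k + real k * (lam * exp (\<gamma> * C)) ^ (k - 1)))"
    unfolding err_def by (intro tendsto_mult tendsto_add tendsto_power Nb_lim Nq NH crude_factor_tendsto tendsto_const)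
  then have el: "err \<longlonglongrightarrow> 0" by simp
  let ?r = "\<lambda>N. real N ^ Suc k * emom (h N) (b N) (N - j) (Suc k) / zpart (b N) (N - j)"
  have "\<forall>\<^sub>F N in sequentially. X N - err N \<le> ?r N \<and> ?r N \<le> X N"
    using eventually_gt_at_top[of "j + k + 2"]
  proof eventually_elim
    case (elim N)
    define n where "n = N - Suc j"
    let ?h = "h N" and ?b = "b N" and ?K = "crude_factor N"
    have s: "N - j = Suc n" and n: "k \<le> n - 1" "1 \<le> n" "n < N" "k \<le> n" using elim by (auto simp: n_def)
    have H0: "0 \<le> Hint ?h" and q0: "0 \<le> qint ?h" by (auto intro: Hint_nonneg qint_nonneg h)
    have zp: "0 < zpart ?b (Suc n)" "0 < zpart ?b n" by (auto intro: zpart_pos b0)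
    have X: "X N = real N ^ Suc k * (Hint ?h * emom ?h ?b n k) / zpart ?b (Suc n)"
      unfolding X_def s n_def[symmetric] using zp by simp
    have up: "?r N \<le> X N" unfolding X s
      by (intro divide_right_mono mult_left_mono emom_Suc_le b0 h n) (use zp in auto)
    \<comment> \<open>The error terms live on \<open>n - 1\<close> particles, two fewer than the
      \<open>Suc n\<close> of the normalization; hence the square.\<close>
    have K2: "zpart ?b (n - 1) \<le> ?K\<^sup>2 * zpart ?b (Suc n)"
    proof -
      have "zpart ?b (n - 1) \<le> ?K * zpart ?b n" using zpart_le_crude_factor[of "n - 1" N] n by simp
      also have "\<dots> \<le> ?K * (?K * zpart ?b (Suc n))" by (rule mult_left_mono[OF zpart_le_crude_factor]) (use n crude_factor_pos[of N] in auto)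
      finally show ?thesis by (simp add: power2_eq_square)
    qed
    have ek: "emom ?h ?b (n - 1) i \<le> (Hint ?h * ?K) ^ i * (?K\<^sup>2 * zpart ?b (Suc n))" if "i \<le> n - 1" for i
    proof -
      have "emom ?h ?b (n - 1) i \<le> (Hint ?h * ?K) ^ i * zpart ?b (n - 1)"
        unfolding crude_factor_def by (rule emom_crude_bound) (use that n b0 h in auto)
      also have "\<dots> \<le> (Hint ?h * ?K) ^ i * (?K\<^sup>2 * zpart ?b (Suc n))"
        by (rule mult_left_mono[OF K2]) (use H0 crude_factor_pos[of N] in auto)
      finally show ?thesis .
    qed
    let ?c = "exp (2 * \<gamma> * C) * qint ?h"
    have S: "n * emom ?h ?b (n-1) k + k * emom ?h ?b (n-1) (k-1) \<le>
       N * ((Hint ?h * ?K) ^ k * (?K\<^sup>2 * zpart ?b (Suc n))) + k * ((Hint ?h * ?K) ^ (k-1) * (?K\<^sup>2 * zpart ?b (Suc n)))"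
      by (intro add_mono mult_mono ek) (use n emom_nonneg[of ?h ?b] h in auto)
    \<comment> \<open>Of the two factors \<open>N\<close> left over, one goes to the coupling and
      one to \<open>qint\<close>. For \<open>k = 0\<close> the truncated exponent
      \<open>k - 1\<close> comes with the coefficient 0.\<close>
    have pk: "real N ^ Suc k * (N * a ^ k + k * a ^ (k-1)) = N * N * ((N * a) ^ k + k * (N * a) ^ (k-1))" for a :: real
      by (cases k) (simp_all add: algebra_simps power_mult_distrib)
    have "real N ^ Suc k * (?b * (?c * (n * emom ?h ?b (n-1) k + k * emom ?h ?b (n-1) (k-1)))) / zpart ?b (Suc n)
      \<le> real N ^ Suc k * (?b * (?c * (N * ((Hint ?h * ?K) ^ k * (?K\<^sup>2 * zpart ?b (Suc n))) + k * ((Hint ?h * ?K) ^ (k-1) * (?K\<^sup>2 * zpart ?b (Suc n)))))) / zpart ?b (Suc n)"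
      by (intro divide_right_mono mult_left_mono S) (use zp q0 b0[of N] in auto)
    also have "\<dots> = ?b * ?c * ?K\<^sup>2 * (real N ^ Suc k * (N * (Hint ?h * ?K) ^ k + k * (Hint ?h * ?K) ^ (k-1)))"
    proof -
      have "N * ((Hint ?h * ?K) ^ k * (?K\<^sup>2 * zpart ?b (Suc n))) + k * ((Hint ?h * ?K) ^ (k-1) * (?K\<^sup>2 * zpart ?b (Suc n)))
        = (N * (Hint ?h * ?K) ^ k + k * (Hint ?h * ?K) ^ (k-1)) * (?K\<^sup>2 * zpart ?b (Suc n))"
        by (simp only: distrib_right mult.assoc)
      then show ?thesis using zp by (simp add: mult_ac)
    qed
    also have "\<dots> = err N" unfolding pk err_def by (simp add: mult_ac)
    finally have E: "real N ^ Suc k * (?b * (?c * (n * emom ?h ?b (n-1) k + k * emom ?h ?b (n-1) (k-1)))) / zpart ?b (Suc n) \<le> err N" .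
    have "real N ^ Suc k * (Hint ?h * emom ?h ?b n k - ?b * (?c * (n * emom ?h ?b (n-1) k + k * emom ?h ?b (n-1) (k-1)))) / zpart ?b (Suc n) \<le> ?r N"
      unfolding s by (intro divide_right_mono mult_left_mono emom_Suc_ge b0 h n) (use zp in auto)
    then have "X N - err N \<le> ?r N" using E unfolding X by (simp only: right_diff_distrib diff_divide_distrib)
    with up show ?case by simp
  qed
  then have 1: "\<forall>\<^sub>F N in sequentially. X N - err N \<le> ?r N" "\<forall>\<^sub>F N in sequentially. ?r N \<le> X N"
    by (auto elim: eventually_mono)
  have "(\<lambda>N. X N - err N) \<longlonglongrightarrow> lam ^ Suc k" using tendsto_diff[OF Xl el] by simp
  then show ?case by (rule tendsto_sandwich[OF 1 _ Xl])
qed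

text \<open>Tannery's theorem: each term of the alternating series converges by
  \<open>moment_limit\<close>, and \<open>emom_crude_bound\<close> dominates the series by an
  exponential one, uniformly for large \<open>N\<close>.\<close>

theorem poisson_limit:
  "(\<lambda>N. (\<integral>x. wt (b N) {..<N} x * (\<Prod>i<N. 1 - h N (x i)) \<partial>MI {..<N}) / zpart (b N) N) \<longlonglongrightarrow> exp (- lam)"
proof -
  define a where "a k N = real (N choose k) * ((-1)^k * emom (h N) (b N) N k) / zpart (b N) N" for k N
  have eq: "(\<integral>x. wt (b N) {..<N} x * (\<Prod>i<N. 1 - h N (x i)) \<partial>MI {..<N}) / zpart (b N) N = (\<Sum>k. a k N)" for N
  proof -
    \<comment> \<open>The binomial coefficient vanishes for \<open>k > N\<close>, which turns the
      finite sums into series over a common index set.\<close>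
    have "(\<Sum>k. a k N) = (\<Sum>k\<le>N. a k N)" by (rule suminf_finite) (auto simp: a_def)
    then show ?thesis unfolding expand_product[OF h] by (simp add: a_def sum_divide_distrib)
  qed
  have NHK: "(\<lambda>N. real N * Hint (h N) * crude_factor N) \<longlonglongrightarrow> lam * exp (\<gamma> * C)" by (intro tendsto_mult NH crude_factor_tendsto)
  define T where "T = lam * exp (\<gamma> * C) + 1"
  have evT: "\<forall>\<^sub>F N in sequentially. real N * Hint (h N) * crude_factor N < T"
    by (rule order_tendstoD[OF NHK]) (simp add: T_def)
  have lim: "(\<lambda>N. a k N) \<longlonglongrightarrow> (- lam) ^ k / fact k" for k
  proof -
    have "(\<lambda>N. (-1)^k * ((real (N choose k) / real N ^ k) * (real N ^ k * emom (h N) (b N) (N - 0) k / zpart (b N) (N - 0))))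
       \<longlonglongrightarrow> (-1)^k * (1 / fact k * lam ^ k)"
      by (intro tendsto_mult tendsto_const binomial_over_power_tendsto moment_limit)
    moreover have "(-1)^k * (1 / fact k * lam ^ k) = (- lam) ^ k / fact k" by (simp add: power_minus[of lam])
    ultimately have "(\<lambda>N. (-1)^k * ((real (N choose k) / real N ^ k) * (real N ^ k * emom (h N) (b N) (N - 0) k / zpart (b N) (N - 0))))
       \<longlonglongrightarrow> (- lam) ^ k / fact k" by simp
    then show ?thesis
      by (rule Lim_transform_eventually) (use eventually_gt_at_top[of 0] in \<open>eventually_elim, auto simp: a_def\<close>)
  qed
  have bound: "norm (a k N) \<le> T ^ k / fact k" if N: "real N * Hint (h N) * crude_factor N < T" for k N
  proof (cases "k \<le> N")
    case False then show ?thesis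
    proof -
      have "0 \<le> real N * Hint (h N) * crude_factor N" using Hint_nonneg[of "h N"] h crude_factor_pos[of N] by auto
      then have "0 \<le> T" using N by linarith
      then show ?thesis using False by (simp add: a_def binomial_eq_0)
    qed
  next
    case True
    have H0: "0 \<le> Hint (h N)" by (auto intro: Hint_nonneg h)
    have "emom (h N) (b N) N k \<le> (Hint (h N) * crude_factor N) ^ k * zpart (b N) N"
      unfolding crude_factor_def by (rule emom_crude_bound) (use True b0 h in auto)
    then have 1: "emom (h N) (b N) N k / zpart (b N) N \<le> (Hint (h N) * crude_factor N) ^ k" using zpart_pos[OF b0, of N N] by (simp add: field_simps)
    have "real (N choose k) * fact k \<le> real N ^ k"
    proof -
      have "(N choose k) * fact k \<le> N ^ k" using binomial_fact_pow[of N k] by simp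
      then show ?thesis by (metis of_nat_fact of_nat_le_iff of_nat_mult of_nat_power)
    qed
    then have 2: "real (N choose k) \<le> real N ^ k / fact k" by (simp add: field_simps)
    have "norm (a k N) = real (N choose k) * (emom (h N) (b N) N k / zpart (b N) N)"
      using zpart_pos[OF b0, of N N] emom_nonneg[of "h N" "b N" N k] h by (simp add: a_def abs_mult power_abs)
    also have "\<dots> \<le> (real N ^ k / fact k) * (Hint (h N) * crude_factor N) ^ k"
      by (rule mult_mono[OF 2 1]) (use zpart_pos[OF b0, of N N] emom_nonneg[of "h N" "b N" N k] h in \<open>auto simp: less_imp_le\<close>)
    also have "\<dots> = (real N * Hint (h N) * crude_factor N) ^ k / fact k" by (simp add: power_mult_distrib)
    also have "\<dots> \<le> T ^ k / fact k"
      by (intro divide_right_mono power_mono) (use N H0 crude_factor_pos[of N] in auto)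
    finally show ?thesis .
  qed
  have "(\<lambda>N. \<Sum>k. a k N) \<longlonglongrightarrow> (\<Sum>k. (- lam) ^ k / fact k)"
  proof (rule tannerys_theorem[THEN conjunct2, THEN conjunct2])
    show "\<forall>\<^sub>F (k, N) in at_top \<times>\<^sub>F sequentially. norm (a k N) \<le> T ^ k / fact k"
      unfolding eventually_prod_filter
      by (rule exI[of _ "\<lambda>_. True"], rule exI, rule conjI[OF _ conjI[OF evT]]) (auto intro: bound[simplified])
    show "summable (\<lambda>k. T ^ k / fact k)" using summable_exp[of T] by (simp add: field_simps)
  qed (use lim in auto)
  moreover have "(\<Sum>k. (- lam) ^ k / fact k) = exp (- lam)"
    by (simp add: exp_def field_simps)
  ultimately show ?thesis unfolding eq by simp
qed

end
end

section \<open>The Riesz kernel as a superposition of Gaussians\<close>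

text \<open>On the shell between radii \<open>k\<close> and \<open>k + 1\<close> the integrand is at
  most \<open>exp (- (k powr \<alpha>))\<close>, while the volume grows polynomially. The series
  converges because \<open>k^2\<close> times its terms tends to 0.\<close>

lemma nn_integral_exp_norm_powr_finite:
  assumes a: "0 < \<alpha>"
  shows "(\<integral>\<^sup>+x. ennreal (exp (- (norm (x::real^'n) powr \<alpha>))) \<partial>lborel) < \<infinity>"
proof -
  let ?n = "CARD('n)"
  let ?V = "unit_ball_vol (real ?n)"
  define c where "c k = exp (- (real k powr \<alpha>)) * (?V * (real k + 1) ^ ?n)" for k :: nat
  have c0: "0 \<le> c k" for k by (simp add: c_def)
  have "(\<lambda>k::nat. exp (- (real k powr \<alpha>)) * (real k + 1) powr (real ?n) * (real k)^2) \<longlonglongrightarrow> 0"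
    using a by real_asymp
  then have "(\<lambda>k::nat. exp (- (real k powr \<alpha>)) * (real k + 1) ^ ?n * (real k)^2) \<longlonglongrightarrow> 0"
    by (simp add: powr_realpow add_pos_nonneg)
  then have "\<forall>\<^sub>F k in sequentially. exp (- (real k powr \<alpha>)) * (real k + 1) ^ ?n * (real k)^2 < 1"
    by (rule order_tendstoD) simp
  then have ev: "\<forall>\<^sub>F k in sequentially. norm (c k) \<le> ?V * (1 / (real k)^2)"
    using eventually_gt_at_top[of 0]
  proof eventually_elim
    case (elim k)
    then have "exp (- (real k powr \<alpha>)) * (real k + 1) ^ ?n \<le> 1 / (real k)^2" by (simp add: field_simps)
    then have "?V * (exp (- (real k powr \<alpha>)) * (real k + 1) ^ ?n) \<le> ?V * (1 / (real k)^2)" by (intro mult_left_mono) auto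
    then show ?case by (simp add: c_def mult_ac)
  qed
  have sc: "summable c"
    by (rule summable_comparison_test_ev[OF ev]) (intro summable_mult, use inverse_power_summable[of 2] in \<open>simp add: inverse_eq_divide\<close>)
  have "(\<integral>\<^sup>+x. ennreal (exp (- (norm (x::real^'n) powr \<alpha>))) \<partial>lborel)
     \<le> (\<integral>\<^sup>+x. (\<Sum>k. ennreal (exp (- (real k powr \<alpha>))) * indicator (cball 0 (real k + 1)) (x::real^'n)) \<partial>lborel)"
  proof (rule nn_integral_mono)
    fix x :: "real^'n"
    define k where "k = nat \<lfloor>norm x\<rfloor>"
    have "real k = of_int \<lfloor>norm x\<rfloor>" by (simp add: k_def)
    then have k: "real k \<le> norm x" "norm x \<le> real k + 1" by linarith+
    have "exp (- (norm x powr \<alpha>)) \<le> exp (- (real k powr \<alpha>))" using k a by (simp add: powr_mono2)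
    then have "ennreal (exp (- (norm x powr \<alpha>))) \<le> ennreal (exp (- (real k powr \<alpha>))) * indicator (cball 0 (real k + 1)) x"
      using k by (simp add: ennreal_leI)
    also have "\<dots> \<le> (\<Sum>k. ennreal (exp (- (real k powr \<alpha>))) * indicator (cball 0 (real k + 1)) x)"
    proof -
      have *: "F k \<le> suminf F" for F :: "nat \<Rightarrow> ennreal" using sum_le_suminf[of F "{k}"] by simp
      show ?thesis by (rule *[where F="\<lambda>k. ennreal (exp (- (real k powr \<alpha>))) * indicator (cball 0 (real k + 1)) x"])
    qed
    finally show "ennreal (exp (- (norm x powr \<alpha>))) \<le> (\<Sum>k. ennreal (exp (- (real k powr \<alpha>))) * indicator (cball 0 (real k + 1)) x)" .
  qed
  also have "\<dots> = (\<Sum>k. \<integral>\<^sup>+x. ennreal (exp (- (real k powr \<alpha>))) * indicator (cball 0 (real k + 1)) (x::real^'n) \<partial>lborel)"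
    by (rule nn_integral_suminf, rule borel_measurable_times_ennreal, rule borel_measurable_const, rule borel_measurable_indicator) simp
  also have "\<dots> = (\<Sum>k. ennreal (c k))"
  proof (rule suminf_cong)
    fix k
    have "(\<integral>\<^sup>+x. ennreal (exp (- (real k powr \<alpha>))) * indicator (cball 0 (real k + 1)) (x::real^'n) \<partial>lborel)
      = ennreal (exp (- (real k powr \<alpha>))) * emeasure lborel (cball (0::real^'n) (real k + 1))"
      by (rule nn_integral_cmult_indicator) simp
    also have "emeasure lborel (cball (0::real^'n) (real k + 1)) = ennreal (?V * (real k + 1) ^ ?n)"
      by (subst emeasure_cball) auto
    also have "ennreal (exp (- (real k powr \<alpha>))) * \<dots> = ennreal (c k)"
      unfolding c_def by (rule ennreal_mult[symmetric]) auto
    finally show "(\<integral>\<^sup>+x. ennreal (exp (- (real k powr \<alpha>))) * indicator (cball 0 (real k + 1)) (x::real^'n) \<partial>lborel) = ennreal (c k)" .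
  qed
  also have "\<dots> = ennreal (\<Sum>k. c k)" by (rule suminf_ennreal2[OF c0 sc])
  also have "\<dots> < \<infinity>" by simp
  finally show ?thesis .
qed

lemma nn_integral_lborel_affine:
  fixes t :: "'a::euclidean_space"
  assumes "f \<in> borel_measurable borel" "c \<noteq> 0"
  shows "(\<integral>\<^sup>+x. f x \<partial>lborel) = ennreal (\<bar>c\<bar> ^ DIM('a)) * (\<integral>\<^sup>+x. f (t + c *\<^sub>R x) \<partial>lborel)"
  by (subst lborel_affine[OF assms(2), of t])
    (simp add: nn_integral_density nn_integral_distr assms nn_integral_cmult)

lemma nn_integral_lborel_pos:
  fixes f :: "'a::euclidean_space \<Rightarrow> real"
  assumes "f \<in> borel_measurable borel" "\<And>x. 0 < f x"
  shows "0 < (\<integral>\<^sup>+x. ennreal (f x) \<partial>lborel)"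
proof (rule ccontr)
  assume "\<not> ?thesis"
  then have "(\<integral>\<^sup>+x. ennreal (f x) \<partial>lborel) = 0" by simp
  then have "AE x in (lborel :: 'a measure). ennreal (f x) = 0"
    using assms by (subst (asm) nn_integral_0_iff_AE) auto
  then have "AE x in (lborel :: 'a measure). False"
    by eventually_elim (metis assms(2) ennreal_eq_0_iff not_le)
  then have "emeasure (lborel :: 'a measure) UNIV = 0" by (simp add: AE_iff_null null_sets_def)
  then show False by (simp add: emeasure_lborel_UNIV)
qed

definition gauss_int :: "'n::finite itself \<Rightarrow> real \<Rightarrow> ennreal" where
  "gauss_int _ a = (\<integral>\<^sup>+z. ennreal (exp (- (a * (norm (z::real^'n))\<^sup>2))) \<partial>lborel)"

lemma gauss_int_1: "gauss_int TYPE('n::finite) 1 < \<infinity>"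
  using nn_integral_exp_norm_powr_finite[of 2, where 'n='n] by (simp add: gauss_int_def)

lemma gauss_int_scale:
  assumes "0 < a"
  shows "gauss_int TYPE('n::finite) (a\<^sup>2) = ennreal (1 / a ^ CARD('n)) * gauss_int TYPE('n) 1"
proof -
  have "gauss_int TYPE('n) 1 = ennreal (a ^ CARD('n)) * gauss_int TYPE('n) (a\<^sup>2)"
    unfolding gauss_int_def
    using nn_integral_lborel_affine[of "\<lambda>z::real^'n. ennreal (exp (- (1 * (norm z)\<^sup>2)))" a 0] assms
    by (simp add: power_mult_distrib)
  then have "ennreal (1 / a ^ CARD('n)) * gauss_int TYPE('n) 1 = (ennreal (1 / a ^ CARD('n)) * ennreal (a ^ CARD('n))) * gauss_int TYPE('n) (a\<^sup>2)"
    by (simp add: mult.assoc)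
  also have "ennreal (1 / a ^ CARD('n)) * ennreal (a ^ CARD('n)) = 1"
    using assms by (simp add: ennreal_mult[symmetric])
  finally show ?thesis by simp
qed

lemma gauss_int_bounds: assumes "0 < a" shows "0 < gauss_int TYPE('n::finite) a" "gauss_int TYPE('n) a < \<infinity>"
proof -
  show "0 < gauss_int TYPE('n) a" unfolding gauss_int_def by (rule nn_integral_lborel_pos) auto
  have "a = (sqrt a)\<^sup>2" using assms by simp
  then show "gauss_int TYPE('n) a < \<infinity>"
    using gauss_int_scale[of "sqrt a", where 'n='n] gauss_int_1[where 'n='n] assms
    by (metis ennreal_mult_less_top ennreal_less_top infinity_ennreal_def real_sqrt_gt_zero)
qed

lemma gauss_translate: "(\<integral>\<^sup>+z. ennreal (exp (- (a * (norm (z - x))\<^sup>2))) \<partial>lborel) = gauss_int TYPE('n::finite) a" for x :: "real^'n"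
  using nn_integral_lborel_affine[of "\<lambda>z::real^'n. ennreal (exp (- (a * (norm (z - x))\<^sup>2)))" 1 x]
  by (simp add: gauss_int_def)

text \<open>The parallelogram identity makes a Gaussian kernel a convolution square.\<close>

lemma gauss_convolution:
  fixes x y :: "real^'n"
  shows "(\<integral>\<^sup>+z. ennreal (exp (- (2 * a * (norm (x - z))\<^sup>2))) * ennreal (exp (- (2 * a * (norm (y - z))\<^sup>2))) \<partial>lborel)
    = ennreal (exp (- (a * (norm (x - y))\<^sup>2))) * gauss_int TYPE('n) (4 * a)"
proof -
  have id: "2 * (norm (x - z))\<^sup>2 + 2 * (norm (y - z))\<^sup>2 = (norm (x - y))\<^sup>2 + 4 * (norm (z - (1/2) *\<^sub>R (x + y)))\<^sup>2" for z
    unfolding power2_norm_eq_inner by (simp add: inner_diff_left inner_diff_right inner_add_left inner_add_right inner_commute algebra_simps)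
  have "exp (- (2 * a * (norm (x - z))\<^sup>2)) * exp (- (2 * a * (norm (y - z))\<^sup>2)) =
    exp (- (a * (norm (x - y))\<^sup>2)) * exp (- (4 * a * (norm (z - (1/2) *\<^sub>R (x + y)))\<^sup>2))" for z
  proof -
    have "- (2 * a * (norm (x - z))\<^sup>2) + - (2 * a * (norm (y - z))\<^sup>2) = - a * (2 * (norm (x - z))\<^sup>2 + 2 * (norm (y - z))\<^sup>2)"
      by (simp add: algebra_simps)
    also have "\<dots> = - (a * (norm (x - y))\<^sup>2) + - (4 * a * (norm (z - (1/2) *\<^sub>R (x + y)))\<^sup>2)"
      unfolding id by (simp add: algebra_simps)
    finally show ?thesis by (simp only: exp_add[symmetric])
  qed
  then have "(\<integral>\<^sup>+z. ennreal (exp (- (2 * a * (norm (x - z))\<^sup>2))) * ennreal (exp (- (2 * a * (norm (y - z))\<^sup>2))) \<partial>lborel)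
    = (\<integral>\<^sup>+z. ennreal (exp (- (a * (norm (x - y))\<^sup>2))) * ennreal (exp (- (4 * a * (norm (z - (1/2) *\<^sub>R (x + y)))\<^sup>2))) \<partial>lborel)"
    by (simp add: ennreal_mult[symmetric])
  also have "\<dots> = ennreal (exp (- (a * (norm (x - y))\<^sup>2))) * gauss_int TYPE('n) (4 * a)"
    by (subst nn_integral_cmult) (auto simp: gauss_translate[of "4 * a"])
  finally show ?thesis .
qed

text \<open>With \<open>A = UNIV\<close>, the substitution \<open>\<tau> \<rightarrow> \<tau> - ln r\<close> gives \<open>mellin s UNIV r = r\<^sup>-\<^sup>s mellin s UNIV 1\<close>; a set \<open>A\<close>
  selects the Gaussians of width \<open>exp (- \<tau>)\<close> with \<open>\<tau> \<in> A\<close>.\<close>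

definition mellin :: "real \<Rightarrow> real set \<Rightarrow> real \<Rightarrow> ennreal" where
  "mellin s A r = (\<integral>\<^sup>+\<tau>. indicator A \<tau> * ennreal (exp (s * \<tau>) * exp (- (exp (2 * \<tau>) * r\<^sup>2))) \<partial>lborel)"

text \<open>Under \<open>u = exp (2 * \<tau>)\<close> the normalizing constant is
  \<open>Gamma (s / 2) / 2\<close>; it makes the part for \<open>UNIV\<close> equal to the Riesz
  kernel, diagonal included. \<open>{..T}\<close> keeps the wide Gaussians, a bounded kernel, and
  \<open>{T<..}\<close> holds the singularity.\<close>

definition riesz_part :: "real \<Rightarrow> real set \<Rightarrow> real^'n \<Rightarrow> real^'n \<Rightarrow> ennreal" where
  "riesz_part s A x y = mellin s A (norm (x - y)) / mellin s UNIV 1"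

section \<open>Splitting the Riesz kernel by scale\<close>

lemma nn_integral_exp_atMost:
  assumes "0 < s"
  shows "(\<integral>\<^sup>+\<tau>. indicator {..T} \<tau> * ennreal (exp (s * \<tau>)) \<partial>lborel) = ennreal (exp (s * T) / s)"
proof -
  have "(\<integral>\<^sup>+\<tau>. indicator {..T} \<tau> * ennreal (exp (s * \<tau>)) \<partial>lborel) =
    (\<integral>\<^sup>+\<tau>. indicator {..T} (-\<tau>) * ennreal (exp (s * (-\<tau>))) \<partial>lborel)"
    using nn_integral_lborel_affine[of "\<lambda>\<tau>. indicator {..T} \<tau> * ennreal (exp (s * \<tau>))" "-1" 0] by simp
  also have "\<dots> = (\<integral>\<^sup>+\<tau>. ennreal (exp (- s * \<tau>)) * indicator {-T..} \<tau> \<partial>lborel)"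
    by (intro nn_integral_cong) (auto simp: indicator_def)
  also have "\<dots> = ennreal (0 - (- (exp (- s * (-T)) / s)))"
  proof (rule nn_integral_FTC_atLeast[where F="\<lambda>\<tau>. - (exp (- s * \<tau>) / s)"])
    show "((\<lambda>\<tau>. - (exp (- s * \<tau>) / s)) has_real_derivative exp (- s * x)) (at x)" for x
      using assms by (auto intro!: derivative_eq_intros)
    show "((\<lambda>\<tau>. - (exp (- s * \<tau>) / s)) \<longlongrightarrow> 0) at_top" using assms by real_asymp
  qed auto
  finally show ?thesis by simp
qed

lemma nn_integral_exp_greaterThan:
  assumes "0 < s"
  shows "(\<integral>\<^sup>+\<tau>. indicator {T<..} \<tau> * ennreal (exp (- s * \<tau>)) \<partial>lborel) \<le> ennreal (exp (- s * T) / s)"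
proof -
  have "(\<integral>\<^sup>+\<tau>. indicator {T<..} \<tau> * ennreal (exp (- s * \<tau>)) \<partial>lborel) \<le> (\<integral>\<^sup>+\<tau>. ennreal (exp (- s * \<tau>)) * indicator {T..} \<tau> \<partial>lborel)"
    by (intro nn_integral_mono) (auto simp: indicator_def)
  also have "\<dots> = ennreal (0 - (- (exp (- s * T) / s)))"
  proof (rule nn_integral_FTC_atLeast[where F="\<lambda>\<tau>. - (exp (- s * \<tau>) / s)"])
    show "((\<lambda>\<tau>. - (exp (- s * \<tau>) / s)) has_real_derivative exp (- s * x)) (at x)" for x
      using assms by (auto intro!: derivative_eq_intros)
    show "((\<lambda>\<tau>. - (exp (- s * \<tau>) / s)) \<longlongrightarrow> 0) at_top" using assms by real_asymp
  qed auto
  finally show ?thesis by simp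
qed

lemma mellin_split: "mellin s UNIV r = mellin s {..T} r + mellin s {T<..} r"
  unfolding mellin_def by (subst nn_integral_add[symmetric]) (auto intro!: nn_integral_cong simp: indicator_def)

lemma mellin_atMost_le:
  assumes "0 < s" shows "mellin s {..T} r \<le> ennreal (exp (s * T) / s)"
proof -
  have "mellin s {..T} r \<le> (\<integral>\<^sup>+\<tau>. indicator {..T} \<tau> * ennreal (exp (s * \<tau>)) \<partial>lborel)"
    unfolding mellin_def by (intro nn_integral_mono mult_left_mono ennreal_leI) auto
  then show ?thesis using nn_integral_exp_atMost[OF assms] by simp
qed

text \<open>For negative \<tau> the factor \<open>exp (s * \<tau>)\<close> is integrable; for
  positive \<tau> the double exponential beats it.\<close>

lemma mellin_one: assumes "0 < s" shows "0 < mellin s UNIV 1" "mellin s UNIV 1 < \<infinity>"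
proof -
  show "0 < mellin s UNIV 1" unfolding mellin_def
    using nn_integral_lborel_pos[of "\<lambda>\<tau>::real. exp (s * \<tau>) * exp (- (exp (2 * \<tau>) * 1\<^sup>2))"] by simp
  \<comment> \<open>An integer with \<open>s + 1 \<le> m\<close>: then
    \<open>(y / m) ^ m \<le> exp y\<close> at \<open>y = exp (2 * \<tau>)\<close> leaves decay at
    least like \<open>exp (- \<tau>)\<close>.\<close>
  define m where "m = nat \<lceil>s\<rceil> + 1"
  have m: "s + 1 \<le> real m" using assms unfolding m_def by linarith
  have "mellin s {0<..} 1 \<le> (\<integral>\<^sup>+\<tau>. ennreal (real m ^ m) * (indicator {0<..} \<tau> * ennreal (exp (- 1 * \<tau>))) \<partial>lborel)"
    unfolding mellin_def
  proof (intro nn_integral_mono)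
    fix \<tau> :: real
    have "exp (s * \<tau>) * exp (- (exp (2 * \<tau>) * 1\<^sup>2)) \<le> real m ^ m * exp (- 1 * \<tau>)" if t: "0 < \<tau>"
    proof -
      let ?y = "exp (2 * \<tau>)"
      have "(?y / m) ^ m \<le> (1 + ?y / m) ^ m" using m assms by (intro power_mono) auto
      also have "\<dots> \<le> exp ?y" by (rule exp_ge_one_plus_x_over_n_power_n) (use m assms in \<open>auto intro: order_trans[of _ 0]\<close>)
      finally have "?y ^ m / m ^ m \<le> exp ?y" by (simp add: power_divide)
      then have "exp (- ?y) \<le> real m ^ m / ?y ^ m" using m assms by (simp add: exp_minus field_simps)
      also have "\<dots> = real m ^ m * exp (- (2 * m * \<tau>))" by (simp add: exp_minus exp_of_nat_mult[symmetric] field_simps)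
      finally have "exp (s * \<tau>) * exp (- ?y) \<le> exp (s * \<tau>) * (real m ^ m * exp (- (2 * m * \<tau>)))" by simp
      also have "\<dots> = real m ^ m * exp ((s - 2 * m) * \<tau>)" 
      proof -
        have "(s - 2 * m) * \<tau> = s * \<tau> + - (2 * m * \<tau>)" by (simp add: algebra_simps)
        then show ?thesis by (simp only: exp_add mult_ac)
      qed
      also have "\<dots> \<le> real m ^ m * exp (- 1 * \<tau>)"
      proof -
        have "(s - 2 * m) * \<tau> \<le> (- 1) * \<tau>" using m t assms by (intro mult_right_mono) auto
        then show ?thesis by (intro mult_left_mono) auto
      qed
      finally show ?thesis by simp
    qed
    then show "indicator {0<..} \<tau> * ennreal (exp (s * \<tau>) * exp (- (exp (2 * \<tau>) * 1\<^sup>2))) \<le> ennreal (real m ^ m) * (indicator {0<..} \<tau> * ennreal (exp (- 1 * \<tau>)))"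
    proof (cases "0 < \<tau>")
      case True
      then have "ennreal (exp (s * \<tau>) * exp (- (exp (2 * \<tau>) * 1\<^sup>2))) \<le> ennreal (real m ^ m * exp (- 1 * \<tau>))"
        by (intro ennreal_leI) fact
      also have "\<dots> = ennreal (real m ^ m) * ennreal (exp (- 1 * \<tau>))" by (simp add: ennreal_mult)
      finally show ?thesis using True by simp
    qed simp
  qed
  also have "\<dots> = ennreal (real m ^ m) * (\<integral>\<^sup>+\<tau>. indicator {0<..} \<tau> * ennreal (exp (- 1 * \<tau>)) \<partial>lborel)"
    by (rule nn_integral_cmult) measurable
  also have "\<dots> \<le> ennreal (real m ^ m) * ennreal (exp (- 1 * 0) / 1)" by (intro mult_left_mono nn_integral_exp_greaterThan) auto
  also have "\<dots> < \<infinity>" by (simp add: ennreal_mult_less_top less_top[symmetric])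
  finally show "mellin s UNIV 1 < \<infinity>"
    using mellin_atMost_le[OF assms, of 0 1] by (subst mellin_split[of s 1 0]) (simp add: order.strict_trans1)
qed

lemma mellin_scale:
  assumes "0 < r" shows "mellin s UNIV r = ennreal (r powr (- s)) * mellin s UNIV 1"
proof -
  have "mellin s UNIV r = (\<integral>\<^sup>+\<tau>. ennreal (exp (s * (- ln r + \<tau>)) * exp (- (exp (2 * (- ln r + \<tau>)) * r\<^sup>2))) \<partial>lborel)"
    unfolding mellin_def
    using nn_integral_lborel_affine[of "\<lambda>\<tau>. ennreal (exp (s * \<tau>) * exp (- (exp (2 * \<tau>) * r\<^sup>2)))" 1 "- ln r"] by simp
  also have "\<dots> = (\<integral>\<^sup>+\<tau>. ennreal (r powr (- s)) * (indicator UNIV \<tau> * ennreal (exp (s * \<tau>) * exp (- (exp (2 * \<tau>) * 1\<^sup>2)))) \<partial>lborel)"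
  proof (rule nn_integral_cong)
    fix \<tau> :: real
    have "exp (2 * (- ln r + \<tau>)) * r\<^sup>2 = exp (2 * \<tau>)"
      using assms by (simp add: exp_add exp_diff exp_double distrib_left power2_eq_square)
    moreover have "exp (s * (- ln r + \<tau>)) = r powr (- s) * exp (s * \<tau>)"
      using assms by (simp add: powr_def exp_add[symmetric] algebra_simps)
    ultimately show "ennreal (exp (s * (- ln r + \<tau>)) * exp (- (exp (2 * (- ln r + \<tau>)) * r\<^sup>2))) =
      ennreal (r powr (- s)) * (indicator UNIV \<tau> * ennreal (exp (s * \<tau>) * exp (- (exp (2 * \<tau>) * 1\<^sup>2))))"
      by (simp add: ennreal_mult[symmetric] mult_ac)
  qed
  also have "\<dots> = ennreal (r powr (- s)) * mellin s UNIV 1" unfolding mellin_def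
    by (rule nn_integral_cmult) measurable
  finally show ?thesis .
qed

text \<open>At distance 0 the Gaussian factor is 1 at every scale and
  \<open>exp (s * \<tau>)\<close> is not integrable at infinity. This reproduces the infinite
  diagonal of \<open>riesz\<close>.\<close>

lemma mellin_zero: assumes "0 < s" shows "mellin s UNIV 0 = \<infinity>"
proof (rule ccontr)
  assume "mellin s UNIV 0 \<noteq> \<infinity>"
  then obtain B where B: "0 \<le> B" "mellin s UNIV 0 = ennreal B" by (cases "mellin s UNIV 0") auto
  have *: "exp (s * T) / s \<le> B" for T
  proof -
    have "ennreal (exp (s * T) / s) = mellin s {..T} 0" unfolding mellin_def using nn_integral_exp_atMost[OF assms] by simp
    also have "\<dots> \<le> mellin s UNIV 0" unfolding mellin_split[of s 0 T] by simp
    finally show ?thesis using B by simp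
  qed
  have "\<forall>\<^sub>F T in at_top. B < exp (s * T) / s"
  proof -
    have "filterlim (\<lambda>T. exp (s * T) / s) at_top at_top" using assms by real_asymp
    then show ?thesis by (simp add: filterlim_at_top_dense)
  qed
  then obtain T where "B < exp (s * T) / s" using eventually_happens'[OF trivial_limit_at_top_linorder] by blast
  then show False using *[of T] by simp
qed

lemma riesz_part_UNIV:
  assumes "0 < s" shows "riesz_part s UNIV x y = riesz s x y"
proof (cases "x = y")
  case True
  then show ?thesis using mellin_zero[OF assms] mellin_one[OF assms]
    by (simp add: riesz_part_def riesz_def ennreal_top_divide less_top[symmetric])
next
  case False
  have "riesz_part s UNIV x y = ennreal (norm (x - y) powr (- s)) * (mellin s UNIV 1 / mellin s UNIV 1)"
    unfolding riesz_part_def using False by (subst mellin_scale) (auto simp: ennreal_times_divide)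
  also have "mellin s UNIV 1 / mellin s UNIV 1 = 1"
    using mellin_one[OF assms] by (intro ennreal_divide_self) auto
  finally show ?thesis using False by (simp add: riesz_def norm_minus_commute)
qed

lemma riesz_part_split:
  "0 < s \<Longrightarrow> riesz s x y = riesz_part s {..T} x y + riesz_part s {T<..} x y"
  unfolding riesz_part_UNIV[symmetric] riesz_part_def
  by (subst mellin_split[of s "norm (x - y)" T]) (rule add_divide_distrib_ennreal)

lemma riesz_part_sym: "riesz_part s A x y = riesz_part s A y x"
  by (simp add: riesz_part_def norm_minus_commute)

lemma riesz_part_atMost_le:
  assumes "0 < s"
  shows "riesz_part s {..T} x y \<le> ennreal (exp (s * T) / s / enn2real (mellin s UNIV 1))"
proof -
  obtain c where c: "0 < c" "mellin s UNIV 1 = ennreal c"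
    using mellin_one[OF assms] by (cases "mellin s UNIV 1") auto
  show ?thesis unfolding riesz_part_def c
    using divide_right_mono_ennreal[OF mellin_atMost_le[OF assms, of T "norm (x - y)"], of "ennreal c"] c assms
    by (simp add: divide_ennreal)
qed

lemma riesz_part_measurable[measurable]:
  assumes [measurable]: "A \<in> sets borel"
  shows "(\<lambda>p. riesz_part s A (fst p) (snd p)) \<in> borel_measurable (borel \<Otimes>\<^sub>M borel)"
proof -
  have "(\<lambda>(p, \<tau>). indicator A \<tau> * ennreal (exp (s * \<tau>) * exp (- (exp (2 * \<tau>) * (norm (fst p - snd p))\<^sup>2))))
    \<in> borel_measurable ((borel \<Otimes>\<^sub>M (borel :: (real^'n) measure)) \<Otimes>\<^sub>M (lborel :: real measure))"
    unfolding split_beta' by measurable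
  then have "(\<lambda>p. mellin s A (norm (fst p - snd p))) \<in> borel_measurable (borel \<Otimes>\<^sub>M (borel :: (real^'n) measure))"
    unfolding mellin_def by (rule lborel.borel_measurable_nn_integral)
  then show ?thesis unfolding riesz_part_def by measurable
qed

text \<open>A Gaussian of width \<open>exp (- \<tau>)\<close> has mass of order
  \<open>exp (- n * \<tau>)\<close> in dimension \<open>n\<close>. Against a bounded density the
  scales beyond \<open>T\<close> therefore add up to the integral of
  \<open>exp (- (n - s) * \<tau>)\<close>, which converges because \<open>s < n\<close>.\<close>

lemma riesz_part_greaterThan_integral:
  fixes x :: "real^'n"
  assumes s: "0 < s" "s < real CARD('n)" and r: "\<And>y. \<rho> y \<le> D" "\<rho> \<in> borel_measurable borel"
  shows "(\<integral>\<^sup>+y. riesz_part s {T<..} x y \<partial>density lborel \<rho>)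
    \<le> D * gauss_int TYPE('n) 1 * ennreal (exp (- (real CARD('n) - s) * T) / (real CARD('n) - s)) / mellin s UNIV 1"
proof -
  let ?n = "real CARD('n)"
  let ?f = "\<lambda>y \<tau>. indicator {T<..} \<tau> * ennreal (exp (s * \<tau>) * exp (- (exp (2 * \<tau>) * (norm (x - y))\<^sup>2)))"
  have m1: "(\<lambda>(y, \<tau>). ?f y \<tau>) \<in> borel_measurable (lborel \<Otimes>\<^sub>M lborel)"
    unfolding split_beta' by measurable
  have m2: "(\<lambda>y. riesz_part s {T<..} x y) \<in> borel_measurable borel"
  proof -
    have "(\<lambda>y. (x, y)) \<in> measurable borel (borel \<Otimes>\<^sub>M borel)" by measurable
    from measurable_compose[OF this riesz_part_measurable[of "{T<..}" s]] show ?thesis by simp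
  qed
  have "(\<integral>\<^sup>+y. riesz_part s {T<..} x y \<partial>density lborel \<rho>) = (\<integral>\<^sup>+y. \<rho> y * riesz_part s {T<..} x y \<partial>lborel)"
    by (rule nn_integral_density) (use r m2 in auto)
  also have "\<dots> \<le> (\<integral>\<^sup>+y. (D / mellin s UNIV 1) * mellin s {T<..} (norm (x - y)) \<partial>lborel)"
    unfolding riesz_part_def by (intro nn_integral_mono) (simp add: ennreal_times_divide ennreal_divide_times mult_right_mono divide_right_mono_ennreal r)
  also have "\<dots> = (D / mellin s UNIV 1) * (\<integral>\<^sup>+y. mellin s {T<..} (norm (x - y)) \<partial>lborel)"
  proof (rule nn_integral_cmult)
    show "(\<lambda>y. mellin s {T<..} (norm (x - y))) \<in> borel_measurable lborel"
      unfolding mellin_def by (rule lborel.borel_measurable_nn_integral[OF m1])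
  qed
  also have "(\<integral>\<^sup>+y. mellin s {T<..} (norm (x - y)) \<partial>lborel) = (\<integral>\<^sup>+\<tau>. \<integral>\<^sup>+y. ?f y \<tau> \<partial>lborel \<partial>lborel)"
    unfolding mellin_def by (rule lborel_pair.Fubini'[symmetric, OF m1])
  also have "\<dots> = (\<integral>\<^sup>+\<tau>. gauss_int TYPE('n) 1 * (indicator {T<..} \<tau> * ennreal (exp (- (?n - s) * \<tau>))) \<partial>lborel)"
  proof (rule nn_integral_cong)
    fix \<tau> :: real
    have "(\<integral>\<^sup>+y. ?f y \<tau> \<partial>lborel) = (\<integral>\<^sup>+y. indicator {T<..} \<tau> * ennreal (exp (s * \<tau>)) * ennreal (exp (- (exp (2 * \<tau>) * (norm (y - x))\<^sup>2))) \<partial>lborel)"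
      by (simp add: ennreal_mult mult.assoc norm_minus_commute)
    also have "\<dots> = indicator {T<..} \<tau> * ennreal (exp (s * \<tau>)) * gauss_int TYPE('n) (exp (2 * \<tau>))"
      by (subst nn_integral_cmult) (auto simp: gauss_translate[of "exp (2 * \<tau>)"])
    also have "gauss_int TYPE('n) (exp (2 * \<tau>)) = ennreal (1 / exp \<tau> ^ CARD('n)) * gauss_int TYPE('n) 1"
      unfolding exp_double by (rule gauss_int_scale) simp
    also have "indicator {T<..} \<tau> * ennreal (exp (s * \<tau>)) * (ennreal (1 / exp \<tau> ^ CARD('n)) * gauss_int TYPE('n) 1)
      = gauss_int TYPE('n) 1 * (indicator {T<..} \<tau> * (ennreal (exp (s * \<tau>)) * ennreal (1 / exp \<tau> ^ CARD('n))))"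
      by (simp add: mult_ac)
    also have "ennreal (exp (s * \<tau>)) * ennreal (1 / exp \<tau> ^ CARD('n)) = ennreal (exp (- (?n - s) * \<tau>))"
      by (simp add: ennreal_mult[symmetric] exp_of_nat_mult[symmetric] exp_diff algebra_simps)
    finally show "(\<integral>\<^sup>+y. ?f y \<tau> \<partial>lborel) = gauss_int TYPE('n) 1 * (indicator {T<..} \<tau> * ennreal (exp (- (?n - s) * \<tau>)))" .
  qed
  also have "\<dots> = gauss_int TYPE('n) 1 * (\<integral>\<^sup>+\<tau>. indicator {T<..} \<tau> * ennreal (exp (- (?n - s) * \<tau>)) \<partial>lborel)"
    by (rule nn_integral_cmult) measurable
  also have "D / mellin s UNIV 1 * \<dots> \<le> D / mellin s UNIV 1 * (gauss_int TYPE('n) 1 * ennreal (exp (- (?n - s) * T) / (?n - s)))"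
    by (intro mult_left_mono nn_integral_exp_greaterThan) (use s in auto)
  also have "\<dots> = D * gauss_int TYPE('n) 1 * ennreal (exp (- (?n - s) * T) / (?n - s)) / mellin s UNIV 1"
    by (simp add: ennreal_divide_times ennreal_times_divide mult_ac)
  finally show ?thesis .
qed

section \<open>Positive semidefiniteness of superpositions\<close>

lemma two_mult_le_ennreal: "2 * (a * b) \<le> a * a + b * (b::ennreal)"
proof (cases a; cases b)
  fix r t :: real assume "0 \<le> r" "a = ennreal r" "0 \<le> t" "b = ennreal t"
  then show ?thesis using sum_squares_bound[of r t]
    by (simp add: ennreal_mult[symmetric] ennreal_plus[symmetric] power2_eq_square mult.assoc ennreal_leI numeral_mult_ennreal del: ennreal_plus)
qed (auto simp: ennreal_top_mult ennreal_mult_top)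

text \<open>Energies may be infinite, so nonnegativity of the energy of \<open>m1 - m2\<close> is
  stated without subtraction. Tonelli turns each energy into an integral over \<open>p\<close> of a
  product of two averages of \<open>f p\<close>, to which \<open>two_mult_le_ennreal\<close>
  applies.\<close>

lemma superposition_psd:
  assumes N: "sigma_finite_measure N" and m1: "sigma_finite_measure m1" and m2: "sigma_finite_measure m2"
    and sets: "sets m1 = sets borel" "sets m2 = sets borel"
    and f: "(\<lambda>(p,x). f p x) \<in> borel_measurable (N \<Otimes>\<^sub>M borel)" and w: "w \<in> borel_measurable N"
    and k: "\<And>x y. k x y = (\<integral>\<^sup>+p. w p * (f p x * f p y) \<partial>N)"
  shows "2 * (\<integral>\<^sup>+x. \<integral>\<^sup>+y. k x y \<partial>m2 \<partial>m1) \<le> (\<integral>\<^sup>+x. \<integral>\<^sup>+y. k x y \<partial>m1 \<partial>m1) + (\<integral>\<^sup>+x. \<integral>\<^sup>+y. k x y \<partial>m2 \<partial>m2)"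
proof -
  have F: "(\<lambda>p. \<integral>\<^sup>+x. f p x \<partial>m) \<in> borel_measurable N" if "sigma_finite_measure m" "sets m = sets borel" for m
  proof -
    interpret sigma_finite_measure m by fact
    show ?thesis by (rule borel_measurable_nn_integral) (use f that in \<open>simp cong: measurable_cong_sets sets_pair_measure_cong\<close>)
  qed
  have rep: "(\<integral>\<^sup>+x. \<integral>\<^sup>+y. k x y \<partial>m' \<partial>m) = (\<integral>\<^sup>+p. w p * ((\<integral>\<^sup>+x. f p x \<partial>m) * (\<integral>\<^sup>+x. f p x \<partial>m')) \<partial>N)"
    if m: "sigma_finite_measure m" "sets m = sets borel" and m': "sigma_finite_measure m'" "sets m' = sets borel" for m m'
  proof -
    interpret m: sigma_finite_measure m by fact
    interpret m': sigma_finite_measure m' by fact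
    interpret N: sigma_finite_measure N by fact
    interpret P: pair_sigma_finite N m by standard
    interpret P': pair_sigma_finite N m' by standard
    have fm: "(\<lambda>z. f (a z) (b z)) \<in> borel_measurable L" if "a \<in> measurable L N" "b \<in> measurable L borel" for a b and L :: "'z measure"
      using measurable_compose[OF measurable_Pair[OF that] f] by simp
    have b1: "measurable L m = measurable L borel" "measurable L m' = measurable L borel" for L :: "'z measure"
      by (rule measurable_cong_sets[OF refl m(2)], rule measurable_cong_sets[OF refl m'(2)])
    have sm: "fst \<in> measurable (N \<Otimes>\<^sub>M m) N" "snd \<in> measurable (N \<Otimes>\<^sub>M m) borel"
      "fst \<in> measurable (N \<Otimes>\<^sub>M m') N" "snd \<in> measurable (N \<Otimes>\<^sub>M m') borel"
      using measurable_snd[of N m] measurable_snd[of N m'] m m' by (auto simp: b1)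
    have fx: "(\<lambda>p. f p x) \<in> borel_measurable N" for x by (rule fm) auto
    have fp: "(\<lambda>x. f p x) \<in> borel_measurable m" "(\<lambda>x. f p x) \<in> borel_measurable m'" if p: "p \<in> space N" for p
    proof -
      have fb: "(\<lambda>x. f p x) \<in> borel_measurable borel" using fm[of "\<lambda>_. p" borel "\<lambda>x. x"] p by simp
      show "(\<lambda>x. f p x) \<in> borel_measurable m" unfolding measurable_cong_sets[OF m(2) refl] by (rule fb)
      show "(\<lambda>x. f p x) \<in> borel_measurable m'" unfolding measurable_cong_sets[OF m'(2) refl] by (rule fb)
    qed
    have "(\<integral>\<^sup>+x. \<integral>\<^sup>+y. k x y \<partial>m' \<partial>m) = (\<integral>\<^sup>+x. \<integral>\<^sup>+p. w p * (f p x * (\<integral>\<^sup>+y. f p y \<partial>m')) \<partial>N \<partial>m)"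
    proof (rule nn_integral_cong)
      fix x
      have "(\<integral>\<^sup>+y. k x y \<partial>m') = (\<integral>\<^sup>+y. \<integral>\<^sup>+p. w p * f p x * f p y \<partial>N \<partial>m')" unfolding k by (simp add: mult.assoc)
      also have "\<dots> = (\<integral>\<^sup>+p. \<integral>\<^sup>+y. w p * f p x * f p y \<partial>m' \<partial>N)"
        by (rule P'.Fubini', unfold split_beta')
          (intro borel_measurable_times_ennreal fm sm measurable_compose[OF sm(3) w] measurable_compose[OF sm(3) fx])
      also have "\<dots> = (\<integral>\<^sup>+p. w p * (f p x * (\<integral>\<^sup>+y. f p y \<partial>m')) \<partial>N)"
        by (rule nn_integral_cong, subst nn_integral_cmult[OF fp(2)]) (simp_all add: mult.assoc)
      finally show "(\<integral>\<^sup>+y. k x y \<partial>m') = (\<integral>\<^sup>+p. w p * (f p x * (\<integral>\<^sup>+y. f p y \<partial>m')) \<partial>N)" .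
    qed
    also have "\<dots> = (\<integral>\<^sup>+x. \<integral>\<^sup>+p. w p * (\<integral>\<^sup>+y. f p y \<partial>m') * f p x \<partial>N \<partial>m)" by (simp add: mult_ac)
    also have "\<dots> = (\<integral>\<^sup>+p. \<integral>\<^sup>+x. w p * (\<integral>\<^sup>+y. f p y \<partial>m') * f p x \<partial>m \<partial>N)"
      by (rule P.Fubini', unfold split_beta')
        (intro borel_measurable_times_ennreal fm sm measurable_compose[OF sm(1) w] measurable_compose[OF sm(1) F[OF m']])
    also have "\<dots> = (\<integral>\<^sup>+p. w p * ((\<integral>\<^sup>+x. f p x \<partial>m) * (\<integral>\<^sup>+x. f p x \<partial>m')) \<partial>N)"
      by (rule nn_integral_cong, subst nn_integral_cmult[OF fp(1)]) (simp_all add: mult_ac)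
    finally show ?thesis .
  qed
  let ?F1 = "\<lambda>p. \<integral>\<^sup>+x. f p x \<partial>m1" and ?F2 = "\<lambda>p. \<integral>\<^sup>+x. f p x \<partial>m2"
  note Fm = F[OF m1 sets(1)] F[OF m2 sets(2)]
  have "2 * (\<integral>\<^sup>+x. \<integral>\<^sup>+y. k x y \<partial>m2 \<partial>m1) = (\<integral>\<^sup>+p. 2 * (w p * (?F1 p * ?F2 p)) \<partial>N)"
    unfolding rep[OF m1 sets(1) m2 sets(2)] using w Fm by (intro nn_integral_cmult[symmetric]) auto
  also have "\<dots> \<le> (\<integral>\<^sup>+p. w p * (?F1 p * ?F1 p) + w p * (?F2 p * ?F2 p) \<partial>N)"
  proof (rule nn_integral_mono)
    fix p
    have "w p * (2 * (?F1 p * ?F2 p)) \<le> w p * (?F1 p * ?F1 p + ?F2 p * ?F2 p)"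
      by (intro mult_left_mono two_mult_le_ennreal) auto
    then show "2 * (w p * (?F1 p * ?F2 p)) \<le> w p * (?F1 p * ?F1 p) + w p * (?F2 p * ?F2 p)"
      by (simp add: distrib_left mult_ac)
  qed
  also have "\<dots> = (\<integral>\<^sup>+p. w p * (?F1 p * ?F1 p) \<partial>N) + (\<integral>\<^sup>+p. w p * (?F2 p * ?F2 p) \<partial>N)"
    using w Fm by (intro nn_integral_add) auto
  also have "\<dots> = (\<integral>\<^sup>+x. \<integral>\<^sup>+y. k x y \<partial>m1 \<partial>m1) + (\<integral>\<^sup>+x. \<integral>\<^sup>+y. k x y \<partial>m2 \<partial>m2)"
    unfolding rep[OF m1 sets(1) m1 sets(1)] rep[OF m2 sets(2) m2 sets(2)] ..
  finally show ?thesis .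
qed

text \<open>The parameter is \<open>p = (\<tau>, z)\<close> and \<open>f p\<close> a Gaussian
  centred at \<open>z\<close>. By \<open>gauss_convolution\<close>, integrating out \<open>z\<close>
  returns the Gaussian of \<open>x - y\<close> times a mass, which the weight \<open>W\<close>
  divides out.\<close>

lemma riesz_part_psd:
  fixes m1 m2 :: "(real^'n) measure"
  assumes A: "A \<in> sets borel" and m1: "sigma_finite_measure m1" and m2: "sigma_finite_measure m2"
    and sets: "sets m1 = sets borel" "sets m2 = sets borel"
  shows "2 * (\<integral>\<^sup>+x. \<integral>\<^sup>+y. riesz_part s A x y \<partial>m2 \<partial>m1)
    \<le> (\<integral>\<^sup>+x. \<integral>\<^sup>+y. riesz_part s A x y \<partial>m1 \<partial>m1) + (\<integral>\<^sup>+x. \<integral>\<^sup>+y. riesz_part s A x y \<partial>m2 \<partial>m2)"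
proof -
  note A[measurable]
  define W where "W p = indicator A (fst p) * ennreal (exp (s * fst p)) / gauss_int TYPE('n) (4 * exp (2 * fst p)) / mellin s UNIV 1"
    for p :: "real \<times> (real^'n)"
  define f where "f p x = ennreal (exp (- (2 * exp (2 * fst p) * (norm (x - snd p))\<^sup>2)))" for p :: "real \<times> (real^'n)" and x :: "real^'n"
  have gm: "(\<lambda>\<tau>. gauss_int TYPE('n) (4 * exp (2 * \<tau>))) \<in> borel_measurable borel"
  proof -
    have "(\<lambda>(\<tau>, z). ennreal (exp (- (4 * exp (2 * \<tau>) * (norm (z::real^'n))\<^sup>2)))) \<in> borel_measurable (borel \<Otimes>\<^sub>M lborel)"
      unfolding split_beta' by measurable
    then show ?thesis unfolding gauss_int_def by (rule lborel.borel_measurable_nn_integral)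
  qed
  show ?thesis
  proof (rule superposition_psd[where N="lborel \<Otimes>\<^sub>M lborel" and w=W and f=f])
    show "sigma_finite_measure (lborel \<Otimes>\<^sub>M lborel :: (real \<times> (real^'n)) measure)" by (rule lborel_pair.sigma_finite_measure_axioms)
    show "(\<lambda>(p, x). f p x) \<in> borel_measurable ((lborel \<Otimes>\<^sub>M lborel) \<Otimes>\<^sub>M borel)"
      unfolding split_beta' f_def by measurable
    have [measurable]: "(\<lambda>p. gauss_int TYPE('n) (4 * exp (2 * fst p))) \<in> borel_measurable (lborel \<Otimes>\<^sub>M lborel :: (real \<times> (real^'n)) measure)"
      by (rule measurable_compose[OF _ gm]) auto
    show W: "W \<in> borel_measurable (lborel \<Otimes>\<^sub>M lborel)" unfolding W_def by measurable
    fix x y :: "real^'n"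
    have "(\<integral>\<^sup>+p. W p * (f p x * f p y) \<partial>(lborel \<Otimes>\<^sub>M lborel)) = (\<integral>\<^sup>+\<tau>. \<integral>\<^sup>+z. W (\<tau>, z) * (f (\<tau>, z) x * f (\<tau>, z) y) \<partial>lborel \<partial>lborel)"
    proof (rule lborel.nn_integral_fst[symmetric])
      show "(\<lambda>p. W p * (f p x * f p y)) \<in> borel_measurable (lborel \<Otimes>\<^sub>M lborel)" using W unfolding f_def by measurable
    qed
    also have "\<dots> = (\<integral>\<^sup>+\<tau>. (indicator A \<tau> * ennreal (exp (s * \<tau>) * exp (- (exp (2 * \<tau>) * (norm (x - y))\<^sup>2)))) / mellin s UNIV 1 \<partial>lborel)"
    proof (rule nn_integral_cong)
      fix \<tau> :: real
      let ?W = "indicator A \<tau> * ennreal (exp (s * \<tau>)) / gauss_int TYPE('n) (4 * exp (2 * \<tau>)) / mellin s UNIV 1"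
      note gb = gauss_int_bounds[of "4 * exp (2 * \<tau>)", where 'n='n]
      have "(\<integral>\<^sup>+z. W (\<tau>, z) * (f (\<tau>, z) x * f (\<tau>, z) y) \<partial>lborel) = ?W * (\<integral>\<^sup>+z. f (\<tau>, z) x * f (\<tau>, z) y \<partial>lborel)"
        unfolding W_def fst_conv by (rule nn_integral_cmult) (unfold f_def fst_conv snd_conv, measurable)
      also have "(\<integral>\<^sup>+z. f (\<tau>, z) x * f (\<tau>, z) y \<partial>lborel) = ennreal (exp (- (exp (2 * \<tau>) * (norm (x - y))\<^sup>2))) * gauss_int TYPE('n) (4 * exp (2 * \<tau>))"
        unfolding f_def fst_conv snd_conv by (rule gauss_convolution)
      also have "?W * \<dots> = (indicator A \<tau> * ennreal (exp (s * \<tau>)) * ennreal (exp (- (exp (2 * \<tau>) * (norm (x - y))\<^sup>2)))) *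
        (gauss_int TYPE('n) (4 * exp (2 * \<tau>)) / gauss_int TYPE('n) (4 * exp (2 * \<tau>))) / mellin s UNIV 1"
        by (simp add: ennreal_times_divide ennreal_divide_times mult_ac)
      also have "gauss_int TYPE('n) (4 * exp (2 * \<tau>)) / gauss_int TYPE('n) (4 * exp (2 * \<tau>)) = 1"
        using gb by (intro ennreal_divide_self) auto
      finally show "(\<integral>\<^sup>+z. W (\<tau>, z) * (f (\<tau>, z) x * f (\<tau>, z) y) \<partial>lborel) =
        (indicator A \<tau> * ennreal (exp (s * \<tau>) * exp (- (exp (2 * \<tau>) * (norm (x - y))\<^sup>2)))) / mellin s UNIV 1"
        by (simp add: ennreal_mult mult.assoc)
    qed
    also have "\<dots> = riesz_part s A x y"
      unfolding riesz_part_def mellin_def by (rule nn_integral_divide) measurable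
    finally show "riesz_part s A x y = (\<integral>\<^sup>+p. W p * (f p x * f p y) \<partial>(lborel \<Otimes>\<^sub>M lborel))" by simp
  qed (use m1 m2 sets in auto)
qed

section \<open>Existence of Poisson processes\<close>

text \<open>The largest sigma-algebra making \<open>X\<close> measurable: a function on it is
  measurable exactly when its composition with \<open>X\<close> is. It allows a process to be moved
  to the type of its values.\<close>

lemma final_measure_space:
  fixes P :: "'w measure" and X :: "'w \<Rightarrow> 'v"
  defines "N \<equiv> measure_of UNIV {B. X -` B \<inter> space P \<in> sets P} (\<lambda>_. 0)"
  shows "X \<in> measurable P N" "f \<in> borel_measurable N \<longleftrightarrow> (\<lambda>w. f (X w)) \<in> borel_measurable P"
proof -
  let ?S = "{B. X -` B \<inter> space P \<in> sets P}"
  have sa: "sigma_algebra UNIV ?S"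
  proof (rule sigma_algebra_iff2[THEN iffD2], intro conjI allI ballI impI)
    show "?S \<subseteq> Pow UNIV" by simp
    show "{} \<in> ?S" by simp
    fix s assume "s \<in> ?S"
    then have "space P - (X -` s \<inter> space P) \<in> sets P" by blast
    moreover have "space P - (X -` s \<inter> space P) = X -` (UNIV - s) \<inter> space P" by auto
    ultimately show "UNIV - s \<in> ?S" by simp
  next
    fix A :: "nat \<Rightarrow> 'v set" assume "range A \<subseteq> ?S"
    then have "(\<Union>i. X -` A i \<inter> space P) \<in> sets P" by (intro sets.countable_UN) auto
    moreover have "(\<Union>i. X -` A i \<inter> space P) = X -` (\<Union>i. A i) \<inter> space P" by auto
    ultimately show "\<Union> (range A) \<in> ?S" by simp
  qed
  have sN: "sets N = ?S" unfolding N_def using sa by (rule sigma_algebra.sets_measure_of_eq)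
  have spN: "space N = UNIV" unfolding N_def by (rule space_measure_of) simp
  show "X \<in> measurable P N" by (rule measurableI) (auto simp: spN sN)
  show "f \<in> borel_measurable N \<longleftrightarrow> (\<lambda>w. f (X w)) \<in> borel_measurable P"
    unfolding measurable_def spN sN by (simp add: vimage_def Int_def)
qed

text \<open>Fixes the type of the sample space: the law of \<Xi> becomes the probability measure,
  and the process becomes the identity on the range of \<Xi>.\<close>

lemma poisson_process_on_measures:
  fixes P :: "'w measure" and \<Xi> :: "'w \<Rightarrow> (real^'n) measure"
  assumes "poisson_process P \<Xi> \<theta>"
    and mI: "\<And>f. f \<in> test_functions \<Longrightarrow> (\<lambda>w. exp (- (\<integral>x. f x \<partial>\<Xi> w))) \<in> borel_measurable P"
  shows "\<exists>(\<Omega> :: (real^'n) measure measure) \<Xi>'. poisson_process \<Omega> \<Xi>' \<theta>"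
proof -
  let ?N = "measure_of UNIV {B. \<Xi> -` B \<inter> space P \<in> sets P} (\<lambda>_. 0)"
  note fin = final_measure_space[where X=\<Xi> and P=P]
  let ?\<Omega> = "distr P ?N \<Xi>"
  have pp: "prob_space P" "\<And>w. w \<in> space P \<Longrightarrow> sets (\<Xi> w) = sets borel"
    "\<And>w A. w \<in> space P \<Longrightarrow> A \<in> sets borel \<Longrightarrow> bounded A \<Longrightarrow> emeasure (\<Xi> w) A \<in> \<nat>"
    "\<And>A. A \<in> sets borel \<Longrightarrow> (\<lambda>w. emeasure (\<Xi> w) A) \<in> borel_measurable P"
    "\<And>f. f \<in> test_functions \<Longrightarrow> laplace_functional P \<Xi> f = exp (\<integral>x. (exp (- f x) - 1) * \<theta> x \<partial>lborel)"
    using assms(1) unfolding poisson_process_def point_process_def by auto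
  \<comment> \<open>\<open>point_process\<close> constrains every sample point and the new space is
    all of \<open>UNIV\<close>, so measures outside the range are sent to the zero measure.\<close>
  define \<Xi>' where "\<Xi>' m = (if m \<in> \<Xi> ` space P then m else null_measure borel)" for m
  have X': "\<Xi>' (\<Xi> w) = \<Xi> w" if "w \<in> space P" for w using that by (simp add: \<Xi>'_def)
  have m1: "(\<lambda>m. emeasure (\<Xi>' m) A) \<in> borel_measurable ?N" if "A \<in> sets borel" for A
    unfolding fin(2) using pp(4)[OF that] by (rule measurable_cong[THEN iffD1, rotated]) (simp add: X')
  have m2: "(\<lambda>m. exp (- (\<integral>x. f x \<partial>\<Xi>' m))) \<in> borel_measurable ?N" if "f \<in> test_functions" for f
    unfolding fin(2) using mI[OF that] by (rule measurable_cong[THEN iffD1, rotated]) (simp add: X')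
  have "poisson_process ?\<Omega> \<Xi>' \<theta>"
    unfolding poisson_process_def point_process_def
  proof (intro conjI ballI impI)
    show "prob_space ?\<Omega>" by (rule prob_space.prob_space_distr[OF pp(1) fin(1)])
    fix m show "sets (\<Xi>' m) = sets borel" using pp(2) by (auto simp: \<Xi>'_def)
  next
    fix m A assume "A \<in> sets borel" "bounded (A :: (real^'n) set)"
    then show "emeasure (\<Xi>' m) A \<in> \<nat>" using pp(3) by (auto simp: \<Xi>'_def)
  next
    fix A :: "(real^'n) set" assume "A \<in> sets borel"
    then show "(\<lambda>m. emeasure (\<Xi>' m) A) \<in> borel_measurable ?\<Omega>" using m1[of A] by simp
  next
    fix f :: "real^'n \<Rightarrow> real" assume f: "f \<in> test_functions"
    have "laplace_functional ?\<Omega> \<Xi>' f = (\<integral>w. exp (- (\<integral>x. f x \<partial>\<Xi>' (\<Xi> w))) \<partial>P)"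
      unfolding laplace_functional_def by (rule integral_distr[OF fin(1) m2[OF f]])
    also have "\<dots> = laplace_functional P \<Xi> f"
      unfolding laplace_functional_def by (intro Bochner_Integration.integral_cong refl) (simp add: X')
    finally show "laplace_functional ?\<Omega> \<Xi>' f = exp (\<integral>x. (exp (- f x) - 1) * \<theta> x \<partial>lborel)" using pp(5)[OF f] by simp
  qed
  then show ?thesis by blast
qed

lemma poisson_pgf:
  assumes "0 < (lam::real)" "0 \<le> c"
  shows "(\<integral>\<^sup>+n. ennreal (c ^ n) \<partial>measure_pmf (poisson_pmf lam)) = ennreal (exp (lam * (c - 1)))"
proof -
  have "(\<integral>\<^sup>+n. ennreal (c ^ n) \<partial>measure_pmf (poisson_pmf lam)) = (\<Sum>n. ennreal (pmf (poisson_pmf lam) n) * ennreal (c ^ n))"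
    by (simp add: nn_integral_measure_pmf nn_integral_count_space_nat)
  also have "\<dots> = (\<Sum>n. ennreal (exp (- lam) * ((lam * c) ^ n /\<^sub>R fact n)))"
    using assms by (intro suminf_cong) (simp add: ennreal_mult[symmetric] power_mult_distrib field_simps)
  also have "\<dots> = ennreal (\<Sum>n. exp (- lam) * ((lam * c) ^ n /\<^sub>R fact n))"
    by (rule suminf_ennreal2) (use assms in simp, intro summable_mult summable_exp_generic)
  also have "(\<Sum>n. exp (- lam) * ((lam * c) ^ n /\<^sub>R fact n)) = exp (- lam) * exp (lam * c)"
    by (subst suminf_mult[OF summable_exp_generic]) (simp add: exp_def)
  also have "\<dots> = exp (lam * (c - 1))" by (simp add: exp_add[symmetric] algebra_simps)
  finally show ?thesis .
qed

lemma (in product_prob_space) nn_integral_PiM_prod_finite: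
  assumes "finite J" "J \<subseteq> I" "\<And>i. i \<in> J \<Longrightarrow> f i \<in> borel_measurable (M i)"
  shows "(\<integral>\<^sup>+x. (\<Prod>i\<in>J. f i (x i)) \<partial>PiM I M) = (\<Prod>i\<in>J. \<integral>\<^sup>+x. f i x \<partial>M i)"
proof -
  have c: "(\<lambda>x. f i (x i)) \<in> borel_measurable (PiM J M)" if "i \<in> J" for i
    by (rule measurable_compose[OF _ assms(3)]) (use that in \<open>auto intro!: measurable_component_singleton\<close>)
  have "(\<Prod>i\<in>J. \<integral>\<^sup>+x. f i x \<partial>M i) = (\<integral>\<^sup>+x. (\<Prod>i\<in>J. f i (x i)) \<partial>PiM J M)"
    by (rule product_nn_integral_prod[symmetric]) (use assms in auto)
  also have "\<dots> = (\<integral>\<^sup>+x. (\<Prod>i\<in>J. f i (x i)) \<partial>distr (PiM I M) (PiM J M) (\<lambda>x. restrict x J))"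
    by (simp add: distr_PiM_restrict_finite assms)
  also have "\<dots> = (\<integral>\<^sup>+x. (\<Prod>i\<in>J. f i (restrict x J i)) \<partial>PiM I M)"
    by (rule nn_integral_distr) (use assms c in \<open>auto intro!: measurable_restrict_subset borel_measurable_prod_ennreal\<close>)
  also have "\<dots> = (\<integral>\<^sup>+x. (\<Prod>i\<in>J. f i (x i)) \<partial>PiM I M)" by simp
  finally show ?thesis by simp
qed

section \<open>Construction from independent Poisson samples on annuli\<close>

locale poisson_construction =
  fixes \<theta> :: "real^'n \<Rightarrow> real"
  assumes th_meas[measurable]: "\<theta> \<in> borel_measurable borel" and th_pos: "\<And>x. 0 < \<theta> x"
    and th_int: "\<And>r. integrable lborel (\<lambda>x. \<theta> x * indicator (cball 0 r) x)"
begin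

text \<open>Half-open annuli partition the space into sets of finite mass, and a bounded set meets
  only finitely many of them.\<close>

definition annulus :: "nat \<Rightarrow> (real^'n) set" where "annulus k = {x. real k \<le> norm x \<and> norm x < real (Suc k)}"

lemma annulus_meas[measurable]: "annulus k \<in> sets borel" unfolding annulus_def by measurable

lemma annulus_disjoint: "x \<in> annulus k \<Longrightarrow> x \<in> annulus l \<Longrightarrow> k = l"
  unfolding annulus_def by auto

lemma annulus_integrable: "integrable lborel (\<lambda>x. \<theta> x * indicator (annulus k) x)"
  by (rule Bochner_Integration.integrable_bound[OF th_int[of "real (Suc k)"]])
    (use th_pos in \<open>auto simp: annulus_def indicator_def less_imp_le\<close>)

definition lam :: "nat \<Rightarrow> real" where "lam k = (\<integral>x. \<theta> x * indicator (annulus k) x \<partial>lborel)"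

text \<open>\<theta> is strictly positive and the annulus contains a ball of radius 1/2. The rate
  has to be positive to normalize \<open>annulus_law\<close> and to be a parameter of
  \<open>poisson_pmf\<close>.\<close>

lemma lam_pos: "0 < lam k"
proof -
  have 0: "0 \<le> lam k" unfolding lam_def by (intro integral_nonneg_AE AE_I2) (use th_pos in \<open>auto simp: indicator_def less_imp_le\<close>)
  moreover have "lam k \<noteq> 0"
  proof
    assume "lam k = 0"
    then have "AE x in lborel. \<theta> x * indicator (annulus k) x = 0"
      unfolding lam_def using integral_nonneg_eq_0_iff_AE[OF annulus_integrable[of k]] th_pos by (auto simp: indicator_def less_imp_le)
    then have "AE x in lborel. x \<notin> annulus k" by eventually_elim (use th_pos in \<open>auto simp: indicator_def less_le split: if_splits\<close>)
    then have n: "emeasure lborel (annulus k) = 0" using AE_iff_null_sets[of "annulus k" lborel] by auto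
    obtain v :: "real^'n" where v: "norm v = 1" using vector_choose_size[of 1] by auto
    let ?B = "ball ((real k + 1/2) *\<^sub>R v) (1/2)"
    have "?B \<subseteq> annulus k"
    proof
      fix x assume "x \<in> ?B"
      then have d: "norm (x - (real k + 1/2) *\<^sub>R v) < 1/2" by (simp add: dist_norm norm_minus_commute)
      have nv: "norm ((real k + 1/2) *\<^sub>R v) = real k + 1/2" using v by simp
      have "\<bar>norm x - (real k + 1/2)\<bar> < 1/2" using norm_triangle_ineq3[of x "(real k + 1/2) *\<^sub>R v"] d nv by simp
      then have "- (1/2) < norm x - (real k + 1/2)" "norm x - (real k + 1/2) < 1/2" by linarith+
      then show "x \<in> annulus k" unfolding annulus_def by simp
    qed
    then have "emeasure lborel ?B \<le> emeasure lborel (annulus k)" by (intro emeasure_mono) auto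
    moreover have "emeasure lborel ?B > 0" by (subst emeasure_ball) (auto simp: unit_ball_vol_pos)
    ultimately show False using n by simp
  qed
  ultimately show ?thesis by simp
qed

definition annulus_law :: "nat \<Rightarrow> (real^'n) measure" where "annulus_law k = density lborel (\<lambda>x. ennreal (\<theta> x * indicator (annulus k) x / lam k))"

lemma sets_annulus_law[simp, measurable_cong]: "sets (annulus_law k) = sets borel" by (simp add: annulus_law_def)

lemma annulus_law_prob: "prob_space (annulus_law k)"
proof (rule prob_spaceI)
  have "emeasure (annulus_law k) (space (annulus_law k)) = (\<integral>\<^sup>+x. ennreal (\<theta> x * indicator (annulus k) x / lam k) \<partial>lborel)"
    unfolding annulus_law_def by (subst emeasure_density) auto
  also have "\<dots> = ennreal (\<integral>x. \<theta> x * indicator (annulus k) x / lam k \<partial>lborel)"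
    by (rule nn_integral_eq_integral) (use annulus_integrable lam_pos[of k] th_pos in \<open>auto simp: indicator_def less_imp_le\<close>)
  also have "\<dots> = 1" using lam_pos[of k] by (simp add: lam_def)
  finally show "emeasure (annulus_law k) (space (annulus_law k)) = 1" .
qed

text \<open>A Poisson number together with an infinite i.i.d. sequence, of which only that many
  terms will be used; this avoids configuration spaces of varying dimension.\<close>

definition annulus_sample :: "nat \<Rightarrow> (nat \<times> (nat \<Rightarrow> real^'n)) measure" where
  "annulus_sample k = measure_pmf (poisson_pmf (lam k)) \<Otimes>\<^sub>M PiM UNIV (\<lambda>_::nat. annulus_law k)"

sublocale nuP: product_prob_space "\<lambda>_::nat. annulus_law k" UNIV for k
  by (intro product_prob_space.intro product_prob_space_axioms.intro product_sigma_finite.intro prob_space_imp_sigma_finite annulus_law_prob)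

lemma nuP_prob: "prob_space (PiM UNIV (\<lambda>_::nat. annulus_law k))" by (intro prob_space_PiM annulus_law_prob)

lemma annulus_sample_prob: "prob_space (annulus_sample k)"
proof -
  interpret A: prob_space "PiM UNIV (\<lambda>_::nat. annulus_law k)" by (rule nuP_prob)
  interpret pair_prob_space "measure_pmf (poisson_pmf (lam k))" "PiM UNIV (\<lambda>_::nat. annulus_law k)" by unfold_locales
  show ?thesis unfolding annulus_sample_def by (rule prob_space_axioms)
qed

sublocale SP: product_prob_space annulus_sample UNIV
  by (intro product_prob_space.intro product_prob_space_axioms.intro product_sigma_finite.intro prob_space_imp_sigma_finite annulus_sample_prob)

abbreviation "PP \<equiv> PiM UNIV annulus_sample"

lemma annulus_sample_measurableI:
  assumes "\<And>n. (\<lambda>x. F (n, x)) \<in> measurable (PiM UNIV (\<lambda>_::nat. borel)) L"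
  shows "F \<in> measurable (annulus_sample k) L"
proof -
  have "F \<in> measurable (count_space UNIV \<Otimes>\<^sub>M PiM UNIV (\<lambda>_::nat. borel)) L"
    by (rule measurable_pair_measure_countable1) (use assms in auto)
  moreover have "sets (annulus_sample k) = sets (count_space UNIV \<Otimes>\<^sub>M PiM UNIV (\<lambda>_::nat. borel))"
    unfolding annulus_sample_def by (intro sets_pair_measure_cong sets_PiM_cong) auto
  ultimately show ?thesis using measurable_cong_sets by blast
qed

text \<open>Points are indexed by pairs (annulus, number of the point within the annulus); the membership condition in
  \<open>pts\<close> holds almost surely and is there to make every configuration locally finite.\<close>

definition pts :: "(nat \<Rightarrow> nat \<times> (nat \<Rightarrow> real^'n)) \<Rightarrow> (nat \<times> nat) set" where
  "pts w = {p. snd p < fst (w (fst p)) \<and> snd (w (fst p)) (snd p) \<in> annulus (fst p)}"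
definition pos :: "(nat \<Rightarrow> nat \<times> (nat \<Rightarrow> real^'n)) \<Rightarrow> nat \<times> nat \<Rightarrow> real^'n" where
  "pos w p = snd (w (fst p)) (snd p)"
definition Xi :: "(nat \<Rightarrow> nat \<times> (nat \<Rightarrow> real^'n)) \<Rightarrow> (real^'n) measure" where
  "Xi w = distr (count_space (pts w)) borel (pos w)"

lemma pts_finite:
  assumes "bounded B"
  shows "\<exists>m. \<forall>w. {p \<in> pts w. pos w p \<in> B} \<subseteq> Sigma {..<m} (\<lambda>k. {..<fst (w k)})"
proof -
  obtain r where r: "\<And>x. x \<in> B \<Longrightarrow> norm x \<le> r" using assms unfolding bounded_iff by blast
  obtain m where m: "r < real m" using reals_Archimedean2 by blast
  have "{p \<in> pts w. pos w p \<in> B} \<subseteq> Sigma {..<m} (\<lambda>k. {..<fst (w k)})" for w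
  proof
    fix p assume "p \<in> {p \<in> pts w. pos w p \<in> B}"
    then have p: "snd p < fst (w (fst p))" "pos w p \<in> annulus (fst p)" "pos w p \<in> B" by (auto simp: pts_def pos_def)
    have "real (fst p) < real m" using p(2) r[OF p(3)] m unfolding annulus_def by auto
    then show "p \<in> Sigma {..<m} (\<lambda>k. {..<fst (w k)})" using p by (cases p) auto
  qed
  then show ?thesis by blast
qed

lemma Xi_sets: "sets (Xi w) = sets borel" by (simp add: Xi_def)

lemma Xi_emeasure: "B \<in> sets borel \<Longrightarrow> emeasure (Xi w) B = (\<integral>\<^sup>+p. indicator (pts w) p * indicator B (pos w p) \<partial>count_space UNIV)"
proof -
  assume B: "B \<in> sets borel"
  have "emeasure (Xi w) B = (\<integral>\<^sup>+x. indicator B x \<partial>Xi w)" using B by (simp add: Xi_sets)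
  also have "\<dots> = (\<integral>\<^sup>+p. indicator B (pos w p) \<partial>count_space (pts w))"
    unfolding Xi_def by (rule nn_integral_distr) (use B in auto)
  also have "\<dots> = (\<integral>\<^sup>+p. indicator (pts w) p * indicator B (pos w p) \<partial>count_space UNIV)"
    by (subst nn_integral_count_space_indicator) (auto simp: mult.commute)
  finally show ?thesis .
qed

text \<open>A countable sum over annuli of finite sums, from which measurability in \<open>w\<close>
  can be read off.\<close>

lemma Xi_emeasure_sum:
  assumes B: "B \<in> sets borel"
  shows "emeasure (Xi w) B = (\<Sum>k. \<Sum>i<fst (w k). indicator (B \<inter> annulus k) (snd (w k) i))"
proof -
  have "emeasure (Xi w) B = (\<integral>\<^sup>+k. \<integral>\<^sup>+i. indicator (pts w) (k,i) * indicator B (pos w (k,i)) \<partial>count_space UNIV \<partial>count_space UNIV)"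
    unfolding Xi_emeasure[OF B] by (rule nn_integral_fst_count_space[symmetric])
  also have "\<dots> = (\<Sum>k. \<integral>\<^sup>+i. indicator (pts w) (k,i) * indicator B (pos w (k,i)) \<partial>count_space UNIV)"
    by (rule nn_integral_count_space_nat)
  also have "\<dots> = (\<Sum>k. \<Sum>i<fst (w k). indicator (B \<inter> annulus k) (snd (w k) i))"
  proof (rule suminf_cong)
    fix k
    have "(\<integral>\<^sup>+i. indicator (pts w) (k,i) * indicator B (pos w (k,i)) \<partial>count_space UNIV) = (\<Sum>i. indicator (pts w) (k,i) * indicator B (pos w (k,i)))"
      by (rule nn_integral_count_space_nat)
    also have "\<dots> = (\<Sum>i<fst (w k). indicator (pts w) (k,i) * indicator B (pos w (k,i)))"
      by (rule suminf_finite) (auto simp: pts_def)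
    also have "\<dots> = (\<Sum>i<fst (w k). indicator (B \<inter> annulus k) (snd (w k) i))"
      by (rule sum.cong) (auto simp: pts_def pos_def indicator_def)
    finally show "(\<integral>\<^sup>+i. indicator (pts w) (k,i) * indicator B (pos w (k,i)) \<partial>count_space UNIV) = (\<Sum>i<fst (w k). indicator (B \<inter> annulus k) (snd (w k) i))" .
  qed
  finally show ?thesis .
qed

lemma Xi_emeasure_measurable:
  assumes B[measurable]: "B \<in> sets borel"
  shows "(\<lambda>w. emeasure (Xi w) B) \<in> borel_measurable PP"
  unfolding Xi_emeasure_sum[OF B]
proof (rule borel_measurable_suminf_order)
  fix k
  have "(\<lambda>v. \<Sum>i<fst v. indicator (B \<inter> annulus k) (snd v i) :: ennreal) \<in> borel_measurable (annulus_sample k)"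
    by (rule annulus_sample_measurableI) (auto intro!: borel_measurable_sum borel_measurable_indicator' measurable_component_singleton)
  then show "(\<lambda>w. \<Sum>i<fst (w k). indicator (B \<inter> annulus k) (snd (w k) i) :: ennreal) \<in> borel_measurable PP"
    by (rule measurable_compose[OF measurable_component_singleton[of k UNIV annulus_sample], rotated]) simp
qed

lemma Xi_emeasure_nat:
  assumes B: "B \<in> sets borel" "bounded B"
  shows "emeasure (Xi w) B \<in> \<nat>"
proof -
  obtain m where m: "\<And>w. {p \<in> pts w. pos w p \<in> B} \<subseteq> Sigma {..<m} (\<lambda>k. {..<fst (w k)})" using pts_finite[OF B(2)] by blast
  have f: "finite {p \<in> pts w. pos w p \<in> B}" by (rule finite_subset[OF m]) auto
  have "emeasure (Xi w) B = emeasure (count_space (pts w)) (pos w -` B \<inter> pts w)"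
    unfolding Xi_def using B by (subst emeasure_distr) auto
  also have "\<dots> = of_nat (card {p \<in> pts w. pos w p \<in> B})"
    using f by (subst emeasure_count_space) (auto simp: vimage_def Int_def conj_commute)
  finally show ?thesis by simp
qed

context
  fixes f :: "real^'n \<Rightarrow> real"
  assumes f: "f \<in> test_functions"
begin

lemma test_function_props: "f \<in> borel_measurable borel" "0 \<le> f x" "\<exists>m. \<forall>x. f x \<noteq> 0 \<longrightarrow> norm x < real m"
proof -
  show "f \<in> borel_measurable borel" "0 \<le> f x" using f by (auto simp: test_functions_def intro: borel_measurable_continuous_onI)
  have "bounded (closure {x. f x \<noteq> 0})" using f compact_imp_bounded by (auto simp: test_functions_def)
  then obtain r where r: "\<And>x. x \<in> closure {x. f x \<noteq> 0} \<Longrightarrow> norm x \<le> r" unfolding bounded_iff by blast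
  obtain m where "r < real m" using reals_Archimedean2 by blast
  then show "\<exists>m. \<forall>x. f x \<noteq> 0 \<longrightarrow> norm x < real m" using r closure_subset by (metis (mono_tags, lifting) le_less_trans mem_Collect_eq subsetD)
qed

definition psi :: "nat \<Rightarrow> real^'n \<Rightarrow> real" where "psi k x = exp (- (f x * indicator (annulus k) x))"
definition annulus_factor :: "nat \<Rightarrow> nat \<times> (nat \<Rightarrow> real^'n) \<Rightarrow> ennreal" where "annulus_factor k v = (\<Prod>i<fst v. ennreal (psi k (snd v i)))"

lemma psi_meas: "psi k \<in> borel_measurable borel" unfolding psi_def using test_function_props(1) by measurable

lemma Xi_integral:
  assumes m: "\<And>x. f x \<noteq> 0 \<Longrightarrow> norm x < real m"
  shows "(\<integral>x. f x \<partial>Xi w) = (\<Sum>k<m. \<Sum>i<fst (w k). f (snd (w k) i) * indicator (annulus k) (snd (w k) i))"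
proof -
  let ?S = "Sigma {..<m} (\<lambda>k. {..<fst (w k)})"
  let ?A = "{p. p \<in> pts w \<and> f (pos w p) \<noteq> 0}"
  have sub: "?A \<subseteq> ?S"
  proof
    fix p assume "p \<in> ?A"
    then have p: "snd p < fst (w (fst p))" "pos w p \<in> annulus (fst p)" "f (pos w p) \<noteq> 0" by (auto simp: pts_def pos_def)
    have "real (fst p) < real m" using p(2) m[OF p(3)] unfolding annulus_def by auto
    then show "p \<in> ?S" using p by (cases p) auto
  qed
  have "(\<integral>x. f x \<partial>Xi w) = (\<integral>p. f (pos w p) \<partial>count_space (pts w))"
    unfolding Xi_def by (rule integral_distr) (use test_function_props(1) in auto)
  also have "\<dots> = (\<Sum>p | p \<in> pts w \<and> f (pos w p) \<noteq> 0. f (pos w p))"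
    by (rule lebesgue_integral_count_space_finite_support) (rule finite_subset[OF sub], auto)
  also have "\<dots> = (\<Sum>p\<in>?S. f (pos w p) * indicator (annulus (fst p)) (pos w p))"
    by (rule sum.mono_neutral_cong_left[OF _ sub]) (auto simp: pts_def pos_def indicator_def)
  also have "\<dots> = (\<Sum>k<m. \<Sum>i<fst (w k). f (snd (w k) i) * indicator (annulus k) (snd (w k) i))"
    by (subst sum.Sigma) (auto simp: pos_def split_beta')
  finally show ?thesis .
qed

text \<open>Only the annuli below \<open>m\<close> meet the support of \<open>f\<close>, so the
  exponential is a finite product of functions of independent samples.\<close>

lemma exp_Xi:
  assumes m: "\<And>x. f x \<noteq> 0 \<Longrightarrow> norm x < real m"
  shows "ennreal (exp (- (\<integral>x. f x \<partial>Xi w))) = (\<Prod>k<m. annulus_factor k (w k))"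
proof -
  have "exp (- (\<integral>x. f x \<partial>Xi w)) = (\<Prod>k<m. \<Prod>i<fst (w k). psi k (snd (w k) i))"
  proof -
    have "exp (- (\<integral>x. f x \<partial>Xi w)) = exp (\<Sum>k<m. \<Sum>i<fst (w k). - (f (snd (w k) i) * indicator (annulus k) (snd (w k) i)))"
      using Xi_integral[OF m, of w] by (simp add: sum_negf)
    then show ?thesis by (simp only: exp_sum finite_lessThan psi_def)
  qed
  then show ?thesis by (simp add: annulus_factor_def prod_ennreal psi_def prod_nonneg)
qed

lemma annulus_factor_meas: "annulus_factor k \<in> borel_measurable (annulus_sample k)"
  unfolding annulus_factor_def
  by (rule annulus_sample_measurableI) (auto intro!: borel_measurable_prod_ennreal measurable_compose[OF measurable_component_singleton] measurable_compose[OF psi_meas])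

definition annulus_exponent :: "nat \<Rightarrow> real" where "annulus_exponent k = (\<integral>x. (exp (- f x) - 1) * \<theta> x * indicator (annulus k) x \<partial>lborel)"

lemma annulus_exponent_integrable: "integrable lborel (\<lambda>x. (exp (- f x) - 1) * \<theta> x * indicator (annulus k) x)"
proof (rule Bochner_Integration.integrable_bound[OF annulus_integrable[of k]])
  show "(\<lambda>x. (exp (- f x) - 1) * \<theta> x * indicator (annulus k) x) \<in> borel_measurable lborel" using test_function_props(1) by measurable
  have "\<bar>exp (- f x) - 1\<bar> \<le> 1" for x using test_function_props(2)[of x] by (simp add: abs_le_iff)
  then have "\<bar>exp (- f x) - 1\<bar> * \<bar>\<theta> x * indicator (annulus k) x\<bar> \<le> 1 * \<bar>\<theta> x * indicator (annulus k) x\<bar>" for x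
    by (intro mult_right_mono) auto
  then show "AE x in lborel. norm ((exp (- f x) - 1) * \<theta> x * indicator (annulus k) x) \<le> norm (\<theta> x * indicator (annulus k) x)"
    by (simp add: abs_mult mult.assoc)
qed

lemma annulus_law_psi: "(\<integral>\<^sup>+x. ennreal (psi k x) \<partial>annulus_law k) = ennreal (1 + annulus_exponent k / lam k)"
proof -
  have "(\<integral>\<^sup>+x. ennreal (psi k x) \<partial>annulus_law k) = (\<integral>\<^sup>+x. ennreal (\<theta> x * indicator (annulus k) x / lam k) * ennreal (psi k x) \<partial>lborel)"
    unfolding annulus_law_def by (rule nn_integral_density) (use psi_meas in measurable)
  also have "\<dots> = (\<integral>\<^sup>+x. ennreal ((\<theta> x * indicator (annulus k) x + (exp (- f x) - 1) * \<theta> x * indicator (annulus k) x) / lam k) \<partial>lborel)"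
    using lam_pos[of k] th_pos by (intro nn_integral_cong) (auto simp: psi_def indicator_def ennreal_mult[symmetric] less_imp_le algebra_simps)
  also have "\<dots> = ennreal (\<integral>x. (\<theta> x * indicator (annulus k) x + (exp (- f x) - 1) * \<theta> x * indicator (annulus k) x) / lam k \<partial>lborel)"
  proof (rule nn_integral_eq_integral)
    show "integrable lborel (\<lambda>x. (\<theta> x * indicator (annulus k) x + (exp (- f x) - 1) * \<theta> x * indicator (annulus k) x) / lam k)"
      by (intro integrable_divide Bochner_Integration.integrable_add annulus_integrable annulus_exponent_integrable)
    show "AE x in lborel. 0 \<le> (\<theta> x * indicator (annulus k) x + (exp (- f x) - 1) * \<theta> x * indicator (annulus k) x) / lam k"
      using lam_pos[of k] th_pos by (auto simp: indicator_def less_imp_le algebra_simps)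
  qed
  also have "(\<integral>x. (\<theta> x * indicator (annulus k) x + (exp (- f x) - 1) * \<theta> x * indicator (annulus k) x) / lam k \<partial>lborel) = 1 + annulus_exponent k / lam k"
    using annulus_integrable[of k] annulus_exponent_integrable[of k] lam_pos[of k] by (simp add: lam_def[symmetric] annulus_exponent_def[symmetric] add_divide_distrib)
  finally show ?thesis .
qed

text \<open>The Poisson generating function at \<open>c = 1 + annulus_exponent k / lam k\<close>,
  the mean of \<open>psi k\<close> under \<open>annulus_law k\<close>: here
  \<open>lam k * (c - 1)\<close> is \<open>annulus_exponent k\<close>.\<close>

lemma annulus_factor_integral: "(\<integral>\<^sup>+v. annulus_factor k v \<partial>annulus_sample k) = ennreal (exp (annulus_exponent k))"
proof -
  interpret A: prob_space "PiM UNIV (\<lambda>_::nat. annulus_law k)" by (rule nuP_prob)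
  interpret pair_prob_space "measure_pmf (poisson_pmf (lam k))" "PiM UNIV (\<lambda>_::nat. annulus_law k)" by unfold_locales
  have c0: "0 \<le> 1 + annulus_exponent k / lam k"
  proof -
    have "0 \<le> (\<integral>x. \<theta> x * indicator (annulus k) x + (exp (- f x) - 1) * \<theta> x * indicator (annulus k) x \<partial>lborel)"
      by (intro integral_nonneg_AE AE_I2) (use th_pos in \<open>auto simp: indicator_def less_imp_le algebra_simps\<close>)
    then have "0 \<le> lam k + annulus_exponent k" using annulus_integrable[of k] annulus_exponent_integrable[of k] by (simp add: lam_def annulus_exponent_def)
    then show ?thesis using lam_pos[of k] by (simp add: field_simps)
  qed
  have "(\<integral>\<^sup>+v. annulus_factor k v \<partial>annulus_sample k) = (\<integral>\<^sup>+n. \<integral>\<^sup>+x. annulus_factor k (n, x) \<partial>PiM UNIV (\<lambda>_::nat. annulus_law k) \<partial>measure_pmf (poisson_pmf (lam k)))"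
    unfolding annulus_sample_def by (rule sigma_finite_measure.nn_integral_fst[OF prob_space_imp_sigma_finite[OF nuP_prob], symmetric]) (use annulus_factor_meas[of k] in \<open>simp add: annulus_sample_def\<close>)
  also have "\<dots> = (\<integral>\<^sup>+n. ennreal ((1 + annulus_exponent k / lam k) ^ n) \<partial>measure_pmf (poisson_pmf (lam k)))"
  proof (rule nn_integral_cong)
    fix n
    have "(\<integral>\<^sup>+x. annulus_factor k (n, x) \<partial>PiM UNIV (\<lambda>_::nat. annulus_law k)) = (\<integral>\<^sup>+x. (\<Prod>i<n. ennreal (psi k (x i))) \<partial>PiM UNIV (\<lambda>_::nat. annulus_law k))"
      by (simp add: annulus_factor_def)
    also have "\<dots> = (\<Prod>i<n. \<integral>\<^sup>+x. ennreal (psi k x) \<partial>annulus_law k)"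
      by (rule nuP.nn_integral_PiM_prod_finite) (use psi_meas in \<open>auto\<close>)
    finally show "(\<integral>\<^sup>+x. annulus_factor k (n, x) \<partial>PiM UNIV (\<lambda>_::nat. annulus_law k)) = ennreal ((1 + annulus_exponent k / lam k) ^ n)"
      using c0 by (simp add: annulus_law_psi ennreal_power)
  qed
  also have "\<dots> = ennreal (exp (lam k * ((1 + annulus_exponent k / lam k) - 1)))" by (rule poisson_pgf[OF lam_pos c0])
  finally show ?thesis using lam_pos[of k] by simp
qed

lemma exp_Xi_meas: "(\<lambda>w. exp (- (\<integral>x. f x \<partial>Xi w))) \<in> borel_measurable PP"
proof -
  obtain m where m: "\<And>x. f x \<noteq> 0 \<Longrightarrow> norm x < real m" using test_function_props(3) by blast
  have "(\<lambda>w. \<Prod>k<m. annulus_factor k (w k)) \<in> borel_measurable PP"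
  proof (rule borel_measurable_prod_ennreal)
    fix k show "(\<lambda>w. annulus_factor k (w k)) \<in> borel_measurable PP"
      by (rule measurable_compose[OF _ annulus_factor_meas]) (auto intro!: measurable_component_singleton)
  qed
  then have "(\<lambda>w. enn2real (\<Prod>k<m. annulus_factor k (w k))) \<in> borel_measurable PP" by measurable
  moreover have "enn2real (\<Prod>k<m. annulus_factor k (w k)) = exp (- (\<integral>x. f x \<partial>Xi w))" for w
    using arg_cong[OF exp_Xi[OF m, of w], of enn2real] by simp
  ultimately show ?thesis by simp
qed

lemma laplace_Xi: "laplace_functional PP Xi f = exp (\<integral>x. (exp (- f x) - 1) * \<theta> x \<partial>lborel)"
proof -
  obtain m where m: "\<And>x. f x \<noteq> 0 \<Longrightarrow> norm x < real m" using test_function_props(3) by blast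
  have "(\<integral>\<^sup>+w. ennreal (exp (- (\<integral>x. f x \<partial>Xi w))) \<partial>PP) = (\<integral>\<^sup>+w. (\<Prod>k<m. annulus_factor k (w k)) \<partial>PP)"
    by (simp add: exp_Xi[OF m])
  also have "\<dots> = (\<Prod>k<m. \<integral>\<^sup>+v. annulus_factor k v \<partial>annulus_sample k)"
    by (rule SP.nn_integral_PiM_prod_finite) (use annulus_factor_meas in auto)
  also have "\<dots> = ennreal (exp (\<Sum>k<m. annulus_exponent k))" by (simp add: annulus_factor_integral prod_ennreal exp_sum)
  finally have 1: "(\<integral>\<^sup>+w. ennreal (exp (- (\<integral>x. f x \<partial>Xi w))) \<partial>PP) = ennreal (exp (\<Sum>k<m. annulus_exponent k))" .
  have "laplace_functional PP Xi f = exp (\<Sum>k<m. annulus_exponent k)"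
    unfolding laplace_functional_def by (subst integral_eq_nn_integral) (use 1 exp_Xi_meas in auto)
  also have "(\<Sum>k<m. annulus_exponent k) = (\<integral>x. (\<Sum>k<m. (exp (- f x) - 1) * \<theta> x * indicator (annulus k) x) \<partial>lborel)"
    unfolding annulus_exponent_def by (rule Bochner_Integration.integral_sum[symmetric]) (rule annulus_exponent_integrable)
  also have "\<dots> = (\<integral>x. (exp (- f x) - 1) * \<theta> x \<partial>lborel)"
  proof (rule Bochner_Integration.integral_cong[OF refl])
    fix x
    show "(\<Sum>k<m. (exp (- f x) - 1) * \<theta> x * indicator (annulus k) x) = (exp (- f x) - 1) * \<theta> x"
    proof (cases "f x = 0")
      case False
      define j where "j = nat \<lfloor>norm x\<rfloor>"
      have "real j = of_int \<lfloor>norm x\<rfloor>" by (simp add: j_def)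
      then have j: "real j \<le> norm x" "norm x < real j + 1" by linarith+
      have jm: "j < m" using j m[OF False] by simp
      have xj: "x \<in> annulus j" using j by (simp add: annulus_def)
      have "(\<Sum>k<m. (exp (- f x) - 1) * \<theta> x * indicator (annulus k) x) = (\<Sum>k<m. if k = j then (exp (- f x) - 1) * \<theta> x else 0)"
      proof (rule sum.cong[OF refl])
        fix k
        show "(exp (- f x) - 1) * \<theta> x * indicator (annulus k) x = (if k = j then (exp (- f x) - 1) * \<theta> x else 0)"
          using xj annulus_disjoint[of x k j] by (cases "x \<in> annulus k") auto
      qed
      then show ?thesis using jm by simp
    qed simp
  qed
  finally show ?thesis .
qed

end

theorem poisson_process_exists: "\<exists>(\<Omega> :: (real^'n) measure measure) \<Xi>. poisson_process \<Omega> \<Xi> \<theta>"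
proof (rule poisson_process_on_measures[of PP Xi])
  show "poisson_process PP Xi \<theta>"
    unfolding poisson_process_def point_process_def
    using Xi_sets Xi_emeasure_nat Xi_emeasure_measurable laplace_Xi by (auto intro: prob_space_PiM annulus_sample_prob)
qed (rule exp_Xi_meas)

end

section \<open>The extreme-value scaling\<close>

lemma orthogonal_matrix_inner:
  fixes Q :: "real^'n^'n"
  assumes "orthogonal_matrix Q"
  shows "(Q *v x) \<bullet> (Q *v y) = x \<bullet> y" "norm (Q *v x) = norm x"
proof -
  have "orthogonal_transformation (\<lambda>x. Q *v x)" using assms by (simp add: orthogonal_transformation_matrix)
  then show "(Q *v x) \<bullet> (Q *v y) = x \<bullet> y" "norm (Q *v x) = norm x"
    by (simp_all add: orthogonal_transformation_def orthogonal_transformation_norm)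
qed

text \<open>Uniqueness of translation-invariant measures. With \<open>?\<mu>\<close> the image
  measure and \<open>B\<close> the unit ball, Fubini for
  \<open>indicator B y * indicator A (x + y)\<close> gives
  \<open>?\<mu> A * lborel B = lborel A * ?\<mu> B\<close>. The ball is its own preimage, so its two
  measures agree and cancel.\<close>

lemma lborel_distr_orthogonal:
  fixes Q :: "real^'n^'n"
  assumes Q: "orthogonal_matrix Q"
  shows "distr lborel borel (\<lambda>x. Q *v x) = lborel"
proof (rule measure_eqI)
  let ?\<mu> = "distr lborel borel (\<lambda>x. Q *v x)" and ?B = "ball (0::real^'n) 1"
  have m[measurable]: "(\<lambda>x. Q *v x) \<in> borel_measurable borel"
    by (intro borel_measurable_continuous_onI linear_continuous_on[OF matrix_vector_mul_bounded_linear])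
  have QQ: "Q *v (transpose Q *v x) = x" for x
    using Q by (simp add: matrix_vector_mul_assoc orthogonal_matrix_def del: transpose_matrix_vector)
  have nd: "(\<integral>\<^sup>+x. f x \<partial>?\<mu>) = (\<integral>\<^sup>+x. f (Q *v x) \<partial>lborel)" if "f \<in> borel_measurable borel" for f :: "real^'n \<Rightarrow> ennreal"
    by (rule nn_integral_distr) (use that in auto)
  have inv: "(\<integral>\<^sup>+x. f (x + y) \<partial>?\<mu>) = (\<integral>\<^sup>+x. f x \<partial>?\<mu>)" if f[measurable]: "f \<in> borel_measurable borel" for f :: "real^'n \<Rightarrow> ennreal" and y
  proof -
    have "(\<integral>\<^sup>+x. f (x + y) \<partial>?\<mu>) = (\<integral>\<^sup>+x. f (Q *v (transpose Q *v y + 1 *\<^sub>R x)) \<partial>lborel)"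
      by (subst nd) (simp_all add: matrix_vector_right_distrib QQ add.commute del: transpose_matrix_vector)
    also have "\<dots> = (\<integral>\<^sup>+x. f (Q *v x) \<partial>lborel)"
      using nn_integral_lborel_affine[of "\<lambda>x. f (Q *v x)" 1 "transpose Q *v y"] by simp
    finally show ?thesis by (simp add: nd)
  qed
  have sf: "sigma_finite_measure ?\<mu>"
  proof
    have "(\<lambda>x. Q *v x) -` cball 0 (real n) = cball 0 (real n)" for n
      using orthogonal_matrix_inner(2)[OF Q] by auto
    then have "emeasure ?\<mu> (cball 0 (real n)) \<noteq> \<infinity>" for n
      using emeasure_bounded_finite[OF bounded_cball, of "0::real^'n" "real n"] by (simp add: emeasure_distr)
    moreover have "(\<Union>n. cball 0 (real n)) = (UNIV :: (real^'n) set)" by (auto simp: real_arch_simple)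
    ultimately show "\<exists>A. countable A \<and> A \<subseteq> sets ?\<mu> \<and> \<Union> A = space ?\<mu> \<and> (\<forall>a\<in>A. emeasure ?\<mu> a \<noteq> \<infinity>)"
      by (intro exI[of _ "range (\<lambda>n. cball 0 (real n))"]) auto
  qed
  interpret \<mu>: sigma_finite_measure ?\<mu> by (rule sf)
  interpret P: pair_sigma_finite lborel ?\<mu> by standard
  have muB: "emeasure ?\<mu> ?B = emeasure lborel ?B"
  proof -
    have "(\<lambda>x. Q *v x) -` ?B = ?B" using orthogonal_matrix_inner(2)[OF Q] by auto
    then show ?thesis by (simp add: emeasure_distr)
  qed
  have B: "emeasure lborel ?B \<noteq> 0" "emeasure lborel ?B \<noteq> \<infinity>"
  proof -
    have "unit_ball_vol (real CARD('n)) \<noteq> 0" using unit_ball_vol_pos[of "real CARD('n)"] by linarith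
    then show "emeasure lborel ?B \<noteq> 0" by (simp add: emeasure_ball)
    show "emeasure lborel ?B \<noteq> \<infinity>" using emeasure_bounded_finite[OF bounded_ball, of "0::real^'n" 1] by auto
  qed
  fix A assume "A \<in> sets ?\<mu>"
  then have A[measurable]: "A \<in> sets borel" by simp
  let ?i = "indicator :: (real^'n) set \<Rightarrow> _ \<Rightarrow> ennreal"
  have Bs: "?B \<in> sets borel" by (rule borel_open) simp
  have ind: "(\<lambda>x. ?i S (h x)) \<in> borel_measurable N" if "h \<in> borel_measurable N" "S \<in> sets borel" for h S and N :: "'z measure"
    by (rule measurable_compose[OF that(1) borel_measurable_indicator[OF that(2)]])
  have "emeasure ?\<mu> A * emeasure lborel ?B = (\<integral>\<^sup>+y. ?i ?B y * emeasure ?\<mu> A \<partial>lborel)"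
    by (subst nn_integral_multc) (auto simp: mult.commute intro!: borel_measurable_indicator)
  also have "\<dots> = (\<integral>\<^sup>+y. \<integral>\<^sup>+x. ?i ?B y * ?i A (x + y) \<partial>?\<mu> \<partial>lborel)"
  proof (rule nn_integral_cong)
    fix y
    have "(\<integral>\<^sup>+x. ?i ?B y * ?i A (x + y) \<partial>?\<mu>) = ?i ?B y * (\<integral>\<^sup>+x. ?i A (x + y) \<partial>?\<mu>)"
      by (rule nn_integral_cmult, rule ind) auto
    also have "(\<integral>\<^sup>+x. ?i A (x + y) \<partial>?\<mu>) = emeasure ?\<mu> A" by (subst inv) (auto intro!: borel_measurable_indicator)
    finally show "?i ?B y * emeasure ?\<mu> A = (\<integral>\<^sup>+x. ?i ?B y * ?i A (x + y) \<partial>?\<mu>)" by simp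
  qed
  also have "\<dots> = (\<integral>\<^sup>+x. \<integral>\<^sup>+y. ?i ?B y * ?i A (x + y) \<partial>lborel \<partial>?\<mu>)"
    by (rule P.Fubini'[symmetric], unfold split_beta', intro borel_measurable_times_ennreal ind Bs A) measurable
  also have "\<dots> = (\<integral>\<^sup>+x. \<integral>\<^sup>+y. ?i ?B (y - x) * ?i A y \<partial>lborel \<partial>?\<mu>)"
  proof (rule nn_integral_cong)
    fix x
    show "(\<integral>\<^sup>+y. ?i ?B y * ?i A (x + y) \<partial>lborel) = (\<integral>\<^sup>+y. ?i ?B (y - x) * ?i A y \<partial>lborel)"
    proof -
      have "(\<lambda>y. ?i ?B (y - x) * ?i A y) \<in> borel_measurable borel"
        by (intro borel_measurable_times_ennreal ind Bs A) measurable
      from nn_integral_lborel_affine[OF this, of 1 x] show ?thesis by simp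
    qed
  qed
  also have "\<dots> = (\<integral>\<^sup>+y. \<integral>\<^sup>+x. ?i ?B (y - x) * ?i A y \<partial>?\<mu> \<partial>lborel)"
    by (rule P.Fubini', unfold split_beta', intro borel_measurable_times_ennreal ind Bs A) measurable
  also have "\<dots> = (\<integral>\<^sup>+y. emeasure ?\<mu> ?B * ?i A y \<partial>lborel)"
  proof (rule nn_integral_cong)
    fix y
    have "(\<integral>\<^sup>+x. ?i ?B (y - x) \<partial>?\<mu>) = (\<integral>\<^sup>+x. ?i ?B (x + - y) \<partial>?\<mu>)"
      by (intro nn_integral_cong) (simp add: indicator_def dist_norm norm_minus_commute)
    also have "\<dots> = emeasure ?\<mu> ?B" by (subst inv) (auto intro!: borel_measurable_indicator)
    finally show "(\<integral>\<^sup>+x. ?i ?B (y - x) * ?i A y \<partial>?\<mu>) = emeasure ?\<mu> ?B * ?i A y"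
      by (subst nn_integral_multc) (auto intro!: ind)
  qed
  also have "\<dots> = emeasure lborel A * emeasure lborel ?B"
    unfolding muB by (subst nn_integral_cmult) (auto simp: mult.commute intro!: borel_measurable_indicator)
  finally have *: "emeasure ?\<mu> A * emeasure lborel ?B = emeasure lborel A * emeasure lborel ?B" .
  have "emeasure ?\<mu> A * emeasure lborel ?B / emeasure lborel ?B = emeasure lborel A * emeasure lborel ?B / emeasure lborel ?B"
    unfolding * ..
  then show "emeasure ?\<mu> A = emeasure lborel A" using B by (simp add: ennreal_mult_divide_eq)
qed simp

lemma integral_lborel_similarity:
  fixes Q :: "real^'n^'n" and G :: "real^'n \<Rightarrow> real"
  assumes Q: "orthogonal_matrix Q" and c: "c \<noteq> 0" and G: "G \<in> borel_measurable borel"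
  shows "(\<integral>x. G x \<partial>lborel) = (\<integral>y. \<bar>c\<bar> ^ CARD('n) * G (t + c *\<^sub>R (Q *v y)) \<partial>lborel)"
proof -
  have m: "(\<lambda>x. Q *v x) \<in> measurable lborel borel"
    by (simp, rule borel_measurable_continuous_onI) (simp add: linear_continuous_on linear_linear)
  have m2: "(\<lambda>x. t + c *\<^sub>R x) \<in> borel_measurable borel" by measurable
  have "(\<integral>x. G x \<partial>lborel) = (\<integral>x. G x \<partial>density (distr lborel borel (\<lambda>x. t + c *\<^sub>R x)) (\<lambda>_. ennreal (\<bar>c\<bar>^CARD('n))))"
    using lborel_affine[OF c, of t] by simp
  also have "\<dots> = (\<integral>x. \<bar>c\<bar>^CARD('n) * G x \<partial>distr lborel borel (\<lambda>x. t + c *\<^sub>R x))"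
    using G by (subst integral_real_density) auto
  also have "\<dots> = (\<integral>x. \<bar>c\<bar>^CARD('n) * G (t + c *\<^sub>R x) \<partial>lborel)"
    using G by (subst integral_distr) auto
  also have "\<dots> = (\<integral>x. \<bar>c\<bar>^CARD('n) * G (t + c *\<^sub>R x) \<partial>distr lborel borel (\<lambda>x. Q *v x))"
    by (simp add: lborel_distr_orthogonal[OF Q])
  also have "\<dots> = (\<integral>y. \<bar>c\<bar> ^ CARD('n) * G (t + c *\<^sub>R (Q *v y)) \<partial>lborel)"
    by (rule integral_distr[OF m]) (use G m2 in measurable)
  finally show ?thesis .
qed

section \<open>Asymptotics of the scaling sequence\<close>

lemma powr_second_order:
  fixes a :: real
  obtains d K where "0 < d" "0 \<le> K" "\<And>b. \<bar>b\<bar> < d \<Longrightarrow> \<bar>(1 - b) powr a - 1 + a * b\<bar> \<le> K * b\<^sup>2"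
proof -
  have "((\<lambda>b. ((1 - b) powr a - 1 + a * b) / b\<^sup>2) \<longlongrightarrow> a * (a - 1) / 2) (at 0)"
    by real_asymp
  then have "\<forall>\<^sub>F b in at 0. dist (((1 - b) powr a - 1 + a * b) / b\<^sup>2) (a * (a - 1) / 2) < 1"
    by (rule tendstoD) simp
  then obtain d where d: "0 < d" "\<And>b. b \<noteq> 0 \<Longrightarrow> \<bar>b\<bar> < d \<Longrightarrow> \<bar>((1 - b) powr a - 1 + a * b) / b\<^sup>2 - a * (a - 1) / 2\<bar> < 1"
    unfolding eventually_at by (auto simp: dist_real_def)
  show thesis
  proof (rule that[of d "\<bar>a * (a - 1) / 2\<bar> + 1"])
    fix b :: real assume b: "\<bar>b\<bar> < d"
    show "\<bar>(1 - b) powr a - 1 + a * b\<bar> \<le> (\<bar>a * (a - 1) / 2\<bar> + 1) * b\<^sup>2"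
    proof (cases "b = 0")
      case False
      have "\<bar>((1 - b) powr a - 1 + a * b) / b\<^sup>2\<bar> \<le> \<bar>a * (a - 1) / 2\<bar> + 1" using d(2)[OF False b] by linarith
      then have "\<bar>(1 - b) powr a - 1 + a * b\<bar> / b\<^sup>2 \<le> \<bar>a * (a - 1) / 2\<bar> + 1" by simp
      then show ?thesis using False by (simp add: divide_le_eq)
    qed simp
  qed (use d in auto)
qed

context
  fixes \<alpha> L :: real and n :: nat
  assumes al: "0 < \<alpha>" and L: "0 < L"
begin

text \<open>The relative correction in \<open>eta\<close> as a function of the real variable
  \<open>x = ln N\<close>, so that limits can be taken along the reals.\<close>

definition corr :: "real \<Rightarrow> real" where
  "corr x = (real n * (\<alpha> - 1) / \<alpha>\<^sup>2 * ln x + ln (\<alpha> ^ n * L) / \<alpha>) / x"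

lemma eta_corr: "eta \<alpha> L n N = ln (real N) powr (1 / \<alpha>) * (1 - corr (ln (real N)))"
  unfolding eta_def corr_def by (simp add: add_divide_distrib)

text \<open>\<open>corr\<close> is of order at most \<open>ln x / x\<close>, so even
  \<open>x\<close> times its square vanishes; this removes the second-order term in the expansion of
  \<open>eta powr \<alpha>\<close>.\<close>

lemma corr_tendsto: "(corr \<longlongrightarrow> 0) at_top" "((\<lambda>x. x * (corr x)\<^sup>2) \<longlongrightarrow> 0) at_top"
proof -
  define P Q where "P = real n * (\<alpha> - 1) / \<alpha>\<^sup>2" and "Q = ln (\<alpha> ^ n * L) / \<alpha>"
  have l: "((\<lambda>x::real. ln x / x) \<longlongrightarrow> 0) at_top" "((\<lambda>x::real. (ln x)\<^sup>2 / x) \<longlongrightarrow> 0) at_top" "((\<lambda>x::real. 1 / x) \<longlongrightarrow> 0) at_top"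
    by real_asymp+
  have c: "corr = (\<lambda>x. P * (ln x / x) + Q * (1 / x))"
    unfolding corr_def P_def Q_def by (rule ext) (simp add: add_divide_distrib)
  have "((\<lambda>x. P * (ln x / x) + Q * (1 / x)) \<longlongrightarrow> P * 0 + Q * 0) at_top" by (intro tendsto_intros l)
  then show "(corr \<longlongrightarrow> 0) at_top" by (simp add: c)
  have "((\<lambda>x. P\<^sup>2 * ((ln x)\<^sup>2 / x) + 2 * P * Q * (ln x / x) + Q\<^sup>2 * (1 / x)) \<longlongrightarrow> P\<^sup>2 * 0 + 2 * P * Q * 0 + Q\<^sup>2 * 0) at_top"
    by (intro tendsto_intros l)
  then have "((\<lambda>x. P\<^sup>2 * ((ln x)\<^sup>2 / x) + 2 * P * Q * (ln x / x) + Q\<^sup>2 * (1 / x)) \<longlongrightarrow> 0) at_top" by simp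
  moreover have "\<forall>\<^sub>F x in at_top. P\<^sup>2 * ((ln x)\<^sup>2 / x) + 2 * P * Q * (ln x / x) + Q\<^sup>2 * (1 / x) = x * (corr x)\<^sup>2"
    using eventually_gt_at_top[of 0] unfolding c by eventually_elim (simp add: field_simps power2_eq_square)
  ultimately show "((\<lambda>x. x * (corr x)\<^sup>2) \<longlongrightarrow> 0) at_top" by (rule Lim_transform_eventually)
qed

definition eta_x :: "real \<Rightarrow> real" where "eta_x x = x powr (1 / \<alpha>) * (1 - corr x)"

lemma eta_x_powr: "\<forall>\<^sub>F x in at_top. 0 < eta_x x \<and> 0 < x \<and> corr x < 1 \<and> eta_x x powr \<alpha> = x * (1 - corr x) powr \<alpha>"
proof -
  have "\<forall>\<^sub>F x in at_top. corr x < 1" by (rule order_tendstoD[OF corr_tendsto(1)]) simp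
  then show ?thesis using eventually_gt_at_top[of 0]
  proof eventually_elim
    case (elim x)
    then show ?case using al by (auto simp: eta_x_def powr_mult powr_powr)
  qed
qed

lemma eta_x_powr_tendsto: "filterlim (\<lambda>x. eta_x x powr \<alpha>) at_top at_top"
proof -
  have "((\<lambda>x. (1 - corr x) powr \<alpha>) \<longlongrightarrow> (1 - 0) powr \<alpha>) at_top" by (intro tendsto_intros corr_tendsto) auto
  then have "filterlim (\<lambda>x. (1 - corr x) powr \<alpha> * x) at_top at_top"
    by (intro filterlim_tendsto_pos_mult_at_top[where c=1] filterlim_ident) auto
  then show ?thesis
    by (rule filterlim_mono_eventually) (auto intro!: eventually_mono[OF eta_x_powr] simp: mult.commute)
qed

text \<open>This limit dictates the form of \<open>eta\<close>. With \<open>N = exp x\<close> the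
  expression is \<open>N\<close> times the Jacobian of the rescaling times
  \<open>exp (- V) / L\<close> at radius \<open>eta\<close>. Expanding,
  \<open>eta powr \<alpha> = x - \<alpha> * x * corr x + R x\<close>: the middle term produces the
  power of \<open>x\<close> and the constant \<open>\<alpha> ^ n * L\<close> that the Jacobian and
  \<open>L\<close> divide out, and \<open>R\<close> vanishes.\<close>

lemma normalization_lim:
  "((\<lambda>x. exp x * (inverse \<alpha> * eta_x x powr (1 - \<alpha>)) ^ n * exp (- (eta_x x powr \<alpha>)) / L) \<longlongrightarrow> 1) at_top"
proof -
  define R where "R x = x * ((1 - corr x) powr \<alpha> - 1 + \<alpha> * corr x)" for x
  have R0: "(R \<longlongrightarrow> 0) at_top"
  proof -
    obtain d K where d: "0 < d" "0 \<le> K" "\<And>b. \<bar>b\<bar> < d \<Longrightarrow> \<bar>(1 - b) powr \<alpha> - 1 + \<alpha> * b\<bar> \<le> K * b\<^sup>2" by (rule powr_second_order[of \<alpha>]) (rule that)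
    have "\<forall>\<^sub>F x in at_top. dist (corr x) 0 < d" by (rule tendstoD[OF corr_tendsto(1) d(1)])
    then have "\<forall>\<^sub>F x in at_top. norm (R x) \<le> norm (x * (corr x)\<^sup>2) * K" using eventually_gt_at_top[of 0]
    proof eventually_elim
      case (elim x)
      then have "\<bar>(1 - corr x) powr \<alpha> - 1 + \<alpha> * corr x\<bar> \<le> K * (corr x)\<^sup>2" by (intro d(3)) (simp add: dist_real_def)
      then have "x * \<bar>(1 - corr x) powr \<alpha> - 1 + \<alpha> * corr x\<bar> \<le> x * (K * (corr x)\<^sup>2)" using elim by (intro mult_left_mono) auto
      then show ?case using elim by (simp add: R_def abs_mult mult_ac)
    qed
    then show ?thesis by (rule tendsto_0_le[OF corr_tendsto(2)])
  qed
  have "((\<lambda>x. exp (real n * (1 - \<alpha>) * ln (1 - corr x) - R x)) \<longlongrightarrow> exp (real n * (1 - \<alpha>) * ln (1 - 0) - 0)) at_top"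
    by (intro tendsto_intros corr_tendsto R0) auto
  then have lim: "((\<lambda>x. exp (real n * (1 - \<alpha>) * ln (1 - corr x) - R x)) \<longlongrightarrow> 1) at_top" by simp
  show ?thesis
  proof (rule Lim_transform_eventually[OF lim])
    show "\<forall>\<^sub>F x in at_top. exp (real n * (1 - \<alpha>) * ln (1 - corr x) - R x) =
      exp x * (inverse \<alpha> * eta_x x powr (1 - \<alpha>)) ^ n * exp (- (eta_x x powr \<alpha>)) / L"
      using eta_x_powr
    proof eventually_elim
      case (elim x)
      then have e: "0 < eta_x x" "0 < x" "corr x < 1" and ep: "eta_x x powr \<alpha> = x * (1 - corr x) powr \<alpha>" by auto
      have le: "ln (eta_x x) = ln x / \<alpha> + ln (1 - corr x)" unfolding eta_x_def using e al by (simp add: ln_mult ln_powr)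
      have a: "(inverse \<alpha> * eta_x x powr (1 - \<alpha>)) ^ n = exp (real n * ((1 - \<alpha>) * ln (eta_x x) - ln \<alpha>))"
      proof -
        have "inverse \<alpha> * eta_x x powr (1 - \<alpha>) = exp ((1 - \<alpha>) * ln (eta_x x) - ln \<alpha>)"
          using e al by (simp add: powr_def exp_diff exp_add field_simps)
        then show ?thesis by (simp add: exp_of_nat_mult)
      qed
      have Lx: "L = exp (ln L)" using L by simp
      have xc: "x * corr x = real n * (\<alpha> - 1) / \<alpha>\<^sup>2 * ln x + (real n * ln \<alpha> + ln L) / \<alpha>"
        using e al L unfolding corr_def by (simp add: ln_mult ln_realpow)
      have "real n * (1 - \<alpha>) * ln (1 - corr x) - R x = x + real n * ((1 - \<alpha>) * ln (eta_x x) - ln \<alpha>) - eta_x x powr \<alpha> - ln L"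
      proof -
        have "\<alpha> * (x * corr x) = real n * (\<alpha> - 1) * (ln x / \<alpha>) + (real n * ln \<alpha> + ln L)"
          unfolding xc using al by (simp add: field_simps power2_eq_square)
        then have "R x = eta_x x powr \<alpha> - x + (real n * (\<alpha> - 1) * (ln x / \<alpha>) + (real n * ln \<alpha> + ln L))"
          unfolding R_def ep by (simp add: algebra_simps)
        moreover define y where "y = ln x / \<alpha>"
        ultimately have "R x = eta_x x powr \<alpha> - x + (real n * (\<alpha> - 1) * y + (real n * ln \<alpha> + ln L))" by simp
        then show ?thesis unfolding le y_def[symmetric] by (simp add: algebra_simps)
      qed
      moreover have "exp (X + A - E - l) = exp X * exp A * exp (- E) / exp l" for X A E l :: real
        by (simp add: exp_add exp_diff exp_minus field_simps)
      ultimately have "exp (real n * (1 - \<alpha>) * ln (1 - corr x) - R x) = exp x * exp (real n * ((1 - \<alpha>) * ln (eta_x x) - ln \<alpha>)) * exp (- (eta_x x powr \<alpha>)) / exp (ln L)"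
        by (simp only:)
      then show ?case unfolding a using L by simp
    qed
  qed
qed

lemma ln_nat_top: "filterlim (\<lambda>N::nat. ln (real N)) at_top sequentially" by real_asymp

lemma eta_lim: "filterlim (\<lambda>N. eta \<alpha> L n N powr \<alpha>) at_top sequentially"
  using filterlim_compose[OF eta_x_powr_tendsto ln_nat_top] by (simp add: eta_corr eta_x_def)

lemma eta_pos: "\<forall>\<^sub>F N in sequentially. 0 < eta \<alpha> L n N"
proof -
  have "\<forall>\<^sub>F N in sequentially. 0 < eta_x (ln (real N))"
    using eventually_compose_filterlim[OF eta_x_powr ln_nat_top] by (rule eventually_mono) auto
  then show ?thesis by (simp add: eta_corr eta_x_def)
qed

lemma eta_normalization:
  "(\<lambda>N. real N * (inverse \<alpha> * eta \<alpha> L n N powr (1 - \<alpha>)) ^ n * exp (- (eta \<alpha> L n N powr \<alpha>)) / L) \<longlonglongrightarrow> 1"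
proof -
  have "(\<lambda>N. exp (ln (real N)) * (inverse \<alpha> * eta \<alpha> L n N powr (1 - \<alpha>)) ^ n * exp (- (eta \<alpha> L n N powr \<alpha>)) / L) \<longlonglongrightarrow> 1"
    using filterlim_compose[OF normalization_lim ln_nat_top] by (simp add: eta_corr eta_x_def)
  then show ?thesis
    by (rule Lim_transform_eventually) (use eventually_gt_at_top[of 0] in \<open>eventually_elim, auto\<close>)
qed

text \<open>The radial case, which bounds the exponent from below uniformly over the support of a
  test function.\<close>

lemma powr_first_order_lim: "((\<lambda>t. t * ((1 - r / (\<alpha> * t)) powr \<alpha> - 1)) \<longlongrightarrow> - r) at_top"
proof -
  have "((\<lambda>t. t * ((1 + A / t) powr \<alpha> - 1)) \<longlongrightarrow> \<alpha> * A) at_top" for A :: real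
  proof -
    have "((\<lambda>h. (1 + A * h) powr \<alpha>) has_real_derivative \<alpha> * A) (at 0)"
      by (auto intro!: derivative_eq_intros)
    then have "((\<lambda>h. ((1 + A * h) powr \<alpha> - 1) / h) \<longlongrightarrow> \<alpha> * A) (at 0)" by (simp add: has_field_derivative_iff)
    moreover have "filterlim (\<lambda>t::real. inverse t) (at 0) at_top"
      by (rule filterlim_mono[OF filterlim_inverse_at_right_top]) (auto simp: at_within_le_at)
    ultimately have "((\<lambda>t. ((1 + A * inverse t) powr \<alpha> - 1) / inverse t) \<longlongrightarrow> \<alpha> * A) at_top" by (rule filterlim_compose)
    then show ?thesis by (simp add: field_simps)
  qed
  from this[of "- r / \<alpha>"] show ?thesis using al by simp
qed

text \<open>A derivative at 0 in \<open>h = 1 / t\<close>. The squared norm is a quadratic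
  polynomial in \<open>h\<close>, and its power \<open>\<alpha> / 2\<close> is differentiated
  instead of the norm.\<close>

lemma norm_powr_first_order:
  fixes v w :: "real^'n"
  assumes v: "norm v = 1"
  shows "((\<lambda>t. t * (norm (v + (inverse \<alpha> * inverse t) *\<^sub>R w) powr \<alpha> - 1)) \<longlongrightarrow> v \<bullet> w) at_top"
proof -
  define A B where "A = 2 * (v \<bullet> w) / \<alpha>" and "B = (norm w)\<^sup>2 / \<alpha>\<^sup>2"
  have nrm: "norm (v + (inverse \<alpha> * h) *\<^sub>R w) powr \<alpha> = (1 + A * h + B * h\<^sup>2) powr (\<alpha> / 2)" for h
  proof -
    have sq: "(norm (v + (inverse \<alpha> * h) *\<^sub>R w))\<^sup>2 = 1 + A * h + B * h\<^sup>2"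
    proof -
      have "v \<bullet> v = 1" using v by (simp add: norm_eq_1)
      then show ?thesis using al unfolding power2_norm_eq_inner A_def B_def
        by (simp add: inner_add_left inner_add_right inner_commute power2_norm_eq_inner field_simps power2_eq_square)
    qed
    have "x powr \<alpha> = (x\<^sup>2) powr (\<alpha> / 2)" if "0 \<le> x" for x :: real
      using that by (cases "x = 0") (simp_all add: powr_powr flip: powr_numeral)
    then show ?thesis unfolding sq[symmetric] by simp
  qed
  have "((\<lambda>h. (1 + A * h + B * h\<^sup>2) powr (\<alpha> / 2)) has_real_derivative (\<alpha> / 2) * A) (at 0)"
    by (auto intro!: derivative_eq_intros)
  moreover have "(\<alpha> / 2) * A = v \<bullet> w" using al by (simp add: A_def)
  ultimately have "((\<lambda>h. ((1 + A * h + B * h\<^sup>2) powr (\<alpha> / 2) - 1) / h) \<longlongrightarrow> v \<bullet> w) (at 0)" by (simp add: has_field_derivative_iff)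
  moreover have "filterlim (\<lambda>t::real. inverse t) (at 0) at_top"
    by (rule filterlim_mono[OF filterlim_inverse_at_right_top]) (auto simp: at_within_le_at)
  ultimately have "((\<lambda>t. ((1 + A * inverse t + B * (inverse t)\<^sup>2) powr (\<alpha> / 2) - 1) / inverse t) \<longlongrightarrow> v \<bullet> w) at_top"
    by (rule filterlim_compose)
  moreover have "(X - 1) / inverse t = t * (X - 1)" for X t :: real by (simp add: divide_inverse mult.commute)
  ultimately show ?thesis unfolding nrm by simp
qed

end

section \<open>The rescaled one-particle intensity\<close>

locale extreme_scaling =
  fixes \<alpha> L :: real and n :: nat and k :: "'n::finite" and \<upsilon> :: "real^'n" and \<psi> :: "real^'n^'n"
  assumes n: "n = CARD('n)" and al: "0 < \<alpha>" and L: "0 < L" and v: "norm \<upsilon> = 1" and rot: "rotation_matrix \<psi>" and psik: "\<psi> *v axis k 1 = \<upsilon>"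
begin

abbreviation "et \<equiv> eta \<alpha> L n"
abbreviation "phi N \<equiv> rescaling \<alpha> (et N) \<upsilon> \<psi>"

definition cN :: "nat \<Rightarrow> real" where "cN N = et N * (inverse \<alpha> * et N powr (- \<alpha>))"

lemma orth: "orthogonal_matrix \<psi>" using rot by (simp add: rotation_matrix_def)

lemma phi_affine: "phi N y = et N *\<^sub>R \<upsilon> + cN N *\<^sub>R (\<psi> *v y)"
  by (simp add: rescaling_def cN_def scaleR_add_right)

lemma cN_pos: "0 < et N \<Longrightarrow> 0 < cN N" using al by (simp add: cN_def)

lemma inv_phi: assumes "0 < et N" shows "inv (phi N) x = (1 / cN N) *\<^sub>R (transpose \<psi> *v (x - et N *\<^sub>R \<upsilon>))" "inv (phi N) (phi N y) = y"
proof -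
  have QQ: "\<psi> *v (transpose \<psi> *v x) = x" "transpose \<psi> *v (\<psi> *v x) = x" for x
    using orth by (simp_all add: matrix_vector_mul_assoc orthogonal_matrix_def del: transpose_matrix_vector)
  have c: "cN N \<noteq> 0" using cN_pos[OF assms] by simp
  have l: "(1 / cN N) *\<^sub>R (transpose \<psi> *v (phi N y - et N *\<^sub>R \<upsilon>)) = y" for y
    unfolding phi_affine using c by (simp add: matrix_vector_mult_scaleR QQ del: transpose_matrix_vector)
  have r: "phi N ((1 / cN N) *\<^sub>R (transpose \<psi> *v (x - et N *\<^sub>R \<upsilon>))) = x" for x
    unfolding phi_affine using c by (simp add: matrix_vector_mult_scaleR QQ del: transpose_matrix_vector)
  have i: "inj (phi N)" by (rule inj_on_inverseI[where g="\<lambda>x. (1 / cN N) *\<^sub>R (transpose \<psi> *v (x - et N *\<^sub>R \<upsilon>))"]) (rule l)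
  show "inv (phi N) x = (1 / cN N) *\<^sub>R (transpose \<psi> *v (x - et N *\<^sub>R \<upsilon>))" by (rule inv_f_eq[OF i r])
  show "inv (phi N) (phi N y) = y" by (rule inv_f_f[OF i])
qed

lemma inv_phi_meas: assumes "0 < et N" shows "inv (phi N) \<in> borel_measurable borel"
proof -
  have "inv (phi N) = (\<lambda>x. (1 / cN N) *\<^sub>R (transpose \<psi> *v (x - et N *\<^sub>R \<upsilon>)))" using inv_phi(1)[OF assms] by (rule ext)
  moreover have "(\<lambda>x. (1 / cN N) *\<^sub>R (transpose \<psi> *v (x - et N *\<^sub>R \<upsilon>))) \<in> borel_measurable borel"
    by (intro borel_measurable_continuous_onI continuous_intros continuous_on_compose2[OF linear_continuous_on[OF matrix_vector_mul_bounded_linear]]) auto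
  ultimately show ?thesis by simp
qed

lemma norm_phi_ge:
  assumes "0 < et N" "norm y \<le> R"
  shows "et N * (1 - R / (\<alpha> * et N powr \<alpha>)) \<le> norm (phi N y)"
proof -
  have "norm (\<upsilon> + (inverse \<alpha> * et N powr (- \<alpha>)) *\<^sub>R (\<psi> *v y)) \<ge> norm \<upsilon> - norm ((inverse \<alpha> * et N powr (- \<alpha>)) *\<^sub>R (\<psi> *v y))"
    by (rule norm_diff_ineq)
  moreover have "norm ((inverse \<alpha> * et N powr (- \<alpha>)) *\<^sub>R (\<psi> *v y)) \<le> R / (\<alpha> * et N powr \<alpha>)"
  proof -
    have "norm ((inverse \<alpha> * et N powr (- \<alpha>)) *\<^sub>R (\<psi> *v y)) = inverse (\<alpha> * et N powr \<alpha>) * norm y"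
      using al by (simp add: orthogonal_matrix_inner[OF orth] powr_minus abs_mult)
    also have "\<dots> \<le> inverse (\<alpha> * et N powr \<alpha>) * R" using al assms by (intro mult_left_mono) auto
    finally show ?thesis by (simp add: divide_inverse mult.commute)
  qed
  ultimately have "1 - R / (\<alpha> * et N powr \<alpha>) \<le> norm (\<upsilon> + (inverse \<alpha> * et N powr (- \<alpha>)) *\<^sub>R (\<psi> *v y))" using v by simp
  then have "et N * (1 - R / (\<alpha> * et N powr \<alpha>)) \<le> et N * norm (\<upsilon> + (inverse \<alpha> * et N powr (- \<alpha>)) *\<^sub>R (\<psi> *v y))"
    using assms by (intro mult_left_mono) auto
  then show ?thesis unfolding rescaling_def using assms by simp
qed

lemma ratio_lim: "(\<lambda>N. R / (\<alpha> * et N powr \<alpha>)) \<longlonglongrightarrow> 0"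
proof -
  have "(\<lambda>N. inverse (et N powr \<alpha>)) \<longlonglongrightarrow> 0"
    using filterlim_compose[OF tendsto_inverse_0_at_top] eta_lim[OF al L, of n] tendsto_inverse_0_at_top by blast
  then have "(\<lambda>N. (R / \<alpha>) * inverse (et N powr \<alpha>)) \<longlonglongrightarrow> (R / \<alpha>) * 0" by (intro tendsto_intros)
  then show ?thesis by (simp add: field_simps)
qed

lemma et_tendsto: "filterlim et at_top sequentially"
proof -
  have "filterlim (\<lambda>N. (et N powr \<alpha>) powr (1 / \<alpha>)) at_top sequentially"
    using al by (intro filterlim_compose[OF _ eta_lim[OF al L]]) real_asymp
  then show ?thesis
    by (rule filterlim_mono_eventually) (use eta_pos[OF al L, of n] al in \<open>auto elim!: eventually_mono simp: powr_powr\<close>)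
qed

text \<open>The part of space seen by a compactly supported test function leaves every ball, and far
  out the potential of the gas is small.\<close>

lemma phi_far: "\<forall>\<^sub>F N in sequentially. \<forall>y. norm y \<le> R \<longrightarrow> B \<le> norm (phi N y)"
proof -
  have "\<forall>\<^sub>F N in sequentially. R / (\<alpha> * et N powr \<alpha>) < 1 / 2" by (rule order_tendstoD[OF ratio_lim]) simp
  moreover have "\<forall>\<^sub>F N in sequentially. 2 * \<bar>B\<bar> \<le> et N" using et_tendsto by (simp add: filterlim_at_top)
  ultimately show ?thesis using eta_pos[OF al L, of n]
  proof eventually_elim
    case (elim N)
    show ?case
    proof (intro allI impI)
      fix y :: "real^'n" assume y: "norm y \<le> R"
      have "et N * (1/2) \<le> et N * (1 - R / (\<alpha> * et N powr \<alpha>))" using elim by (intro mult_left_mono) auto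
      then show "B \<le> norm (phi N y)" using norm_phi_ge[OF elim(3) y] elim(2) by linarith
    qed
  qed
qed

text \<open>After the change of variables the prefactor \<open>Cn\<close> tends to 1 by
  \<open>eta_normalization\<close>, and \<open>D N y\<close>, the increase of \<open>V\<close> over
  its value at radius \<open>et N\<close>, tends to \<open>axis k 1 \<bullet> y\<close>. Domination
  comes from the lower bound \<open>Dlb\<close> on the support of \<open>F\<close>.\<close>

lemma intensity_limit:
  fixes F :: "real^'n \<Rightarrow> real"
  assumes F: "F \<in> borel_measurable borel" "\<And>y. 0 \<le> F y" "\<And>y. F y \<le> 1" "\<And>y. F y \<noteq> 0 \<Longrightarrow> norm y \<le> R"
  shows "(\<lambda>N. real N * (\<integral>x. F (inv (phi N) x) * (exp (- (norm x powr \<alpha>)) / L) \<partial>lborel)) \<longlonglongrightarrow> (\<integral>y. F y * exp (- (axis k 1 \<bullet> y)) \<partial>lborel)"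
proof -
  note ep = eta_pos[OF al L, of n]
  define Cn where "Cn N = real N * (inverse \<alpha> * et N powr (1 - \<alpha>)) ^ n * exp (- (et N powr \<alpha>)) / L" for N
  have Cn: "Cn \<longlonglongrightarrow> 1" unfolding Cn_def by (rule eta_normalization[OF al L])
  define D where "D N y = et N powr \<alpha> * (norm (\<upsilon> + (inverse \<alpha> * inverse (et N powr \<alpha>)) *\<^sub>R (\<psi> *v y)) powr \<alpha> - 1)" for N y
  have D: "(\<lambda>N. D N y) \<longlonglongrightarrow> axis k 1 \<bullet> y" for y
  proof -
    have "\<upsilon> \<bullet> (\<psi> *v y) = axis k 1 \<bullet> y" unfolding psik[symmetric] by (rule orthogonal_matrix_inner[OF orth])
    then show ?thesis unfolding D_def
      using filterlim_compose[OF norm_powr_first_order[OF al L v, of "\<psi> *v y"] eta_lim[OF al L, of n]] by simp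
  qed
  have Dm: "D N \<in> borel_measurable borel" for N
  proof -
    have [measurable]: "(\<lambda>y. \<psi> *v y) \<in> borel_measurable borel"
      by (intro borel_measurable_continuous_onI linear_continuous_on[OF matrix_vector_mul_bounded_linear])
    show ?thesis unfolding D_def by measurable
  qed
  have eq: "real N * (\<integral>x. F (inv (phi N) x) * (exp (- (norm x powr \<alpha>)) / L) \<partial>lborel) = (\<integral>y. Cn N * (F y * exp (- D N y)) \<partial>lborel)"
    if e: "0 < et N" for N
  proof -
    have m: "(\<lambda>x. F (inv (phi N) x) * (exp (- (norm x powr \<alpha>)) / L)) \<in> borel_measurable borel"
      by (intro borel_measurable_times measurable_compose[OF inv_phi_meas[OF e] F(1)]) measurable
    have c: "cN N = inverse \<alpha> * et N powr (1 - \<alpha>)" using e by (simp add: cN_def powr_diff powr_minus field_simps)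
    have "(\<integral>x. F (inv (phi N) x) * (exp (- (norm x powr \<alpha>)) / L) \<partial>lborel) =
      (\<integral>y. \<bar>cN N\<bar> ^ n * (F (inv (phi N) (et N *\<^sub>R \<upsilon> + cN N *\<^sub>R (\<psi> *v y))) * (exp (- (norm (et N *\<^sub>R \<upsilon> + cN N *\<^sub>R (\<psi> *v y)) powr \<alpha>)) / L)) \<partial>lborel)"
      unfolding n by (rule integral_lborel_similarity[OF orth _ m[unfolded n]]) (use cN_pos[OF e] in \<open>simp add: n\<close>)
    also have "\<dots> = (\<integral>y. \<bar>cN N\<bar> ^ n * (F y * (exp (- (norm (phi N y) powr \<alpha>)) / L)) \<partial>lborel)"
      unfolding phi_affine[symmetric] inv_phi(2)[OF e] ..
    finally have 1: "real N * (\<integral>x. F (inv (phi N) x) * (exp (- (norm x powr \<alpha>)) / L) \<partial>lborel) =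
      (\<integral>y. real N * (\<bar>cN N\<bar> ^ n * (F y * (exp (- (norm (phi N y) powr \<alpha>)) / L))) \<partial>lborel)"
      by (simp only: integral_mult_right_zero)
    show ?thesis unfolding 1
    proof (rule Bochner_Integration.integral_cong[OF refl])
      fix y
      have "norm (phi N y) powr \<alpha> = et N powr \<alpha> * norm (\<upsilon> + (inverse \<alpha> * inverse (et N powr \<alpha>)) *\<^sub>R (\<psi> *v y)) powr \<alpha>"
        unfolding rescaling_def using e by (simp add: powr_mult powr_minus)
      also have "\<dots> = et N powr \<alpha> + D N y" by (simp add: D_def algebra_simps)
      finally have "exp (- (norm (phi N y) powr \<alpha>)) = exp (- (et N powr \<alpha>)) * exp (- D N y)" by (simp add: exp_add[symmetric])
      then show "real N * (\<bar>cN N\<bar> ^ n * (F y * (exp (- (norm (phi N y) powr \<alpha>)) / L))) = Cn N * (F y * exp (- D N y))"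
        using cN_pos[OF e] unfolding Cn_def c[symmetric] by simp
    qed
  qed
  define R' where "R' = max R 0"
  have R': "0 \<le> R'" "\<And>y. F y \<noteq> 0 \<Longrightarrow> norm y \<le> R'" using F(4) by (auto simp: R'_def le_max_iff_disj)
  have lb: "\<forall>\<^sub>F N in sequentially. - R' - 1 < et N powr \<alpha> * ((1 - R' / (\<alpha> * et N powr \<alpha>)) powr \<alpha> - 1)"
    by (rule order_tendstoD[OF filterlim_compose[OF powr_first_order_lim[OF al L, of R'] eta_lim[OF al L, of n]]]) simp
  have small: "\<forall>\<^sub>F N in sequentially. R' / (\<alpha> * et N powr \<alpha>) < 1" by (rule order_tendstoD[OF ratio_lim]) simp
  have Dlb: "\<forall>\<^sub>F N in sequentially. \<forall>y. F y \<noteq> 0 \<longrightarrow> - R' - 1 \<le> D N y"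
    using lb small ep
  proof eventually_elim
    case (elim N)
    show ?case
    proof (intro allI impI)
      fix y assume "F y \<noteq> 0"
      then have y: "norm y \<le> R'" by (rule R')
      have "et N * (1 - R' / (\<alpha> * et N powr \<alpha>)) \<le> norm (phi N y)" by (rule norm_phi_ge[OF elim(3) y])
      also have "norm (phi N y) = et N * norm (\<upsilon> + (inverse \<alpha> * inverse (et N powr \<alpha>)) *\<^sub>R (\<psi> *v y))"
        unfolding rescaling_def using elim by (simp add: powr_minus)
      finally have "1 - R' / (\<alpha> * et N powr \<alpha>) \<le> norm (\<upsilon> + (inverse \<alpha> * inverse (et N powr \<alpha>)) *\<^sub>R (\<psi> *v y))"
        using elim by simp
      then have "(1 - R' / (\<alpha> * et N powr \<alpha>)) powr \<alpha> \<le> norm (\<upsilon> + (inverse \<alpha> * inverse (et N powr \<alpha>)) *\<^sub>R (\<psi> *v y)) powr \<alpha>"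
        using elim al by (intro powr_mono2) auto
      then have "et N powr \<alpha> * ((1 - R' / (\<alpha> * et N powr \<alpha>)) powr \<alpha> - 1) \<le> D N y"
        unfolding D_def by (intro mult_left_mono) auto
      then show "- R' - 1 \<le> D N y" using elim by linarith
    qed
  qed
  have Cn2: "\<forall>\<^sub>F N in sequentially. Cn N < 2" by (rule order_tendstoD[OF Cn]) simp
  \<comment> \<open>The dominating function is valid only from \<open>N0\<close> on, hence the
    shifted sequences below.\<close>
  obtain N0 where N0: "\<And>N. N \<ge> N0 \<Longrightarrow> (\<forall>y. F y \<noteq> 0 \<longrightarrow> - R' - 1 \<le> D N y) \<and> Cn N < 2 \<and> 0 < et N"
    using eventually_conj[OF Dlb eventually_conj[OF Cn2 ep]] unfolding eventually_sequentially by blast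
  have Cn0: "0 \<le> Cn N" for N unfolding Cn_def using L al by simp
  have "(\<lambda>N. \<integral>y. Cn (N + N0) * (F y * exp (- D (N + N0) y)) \<partial>lborel) \<longlonglongrightarrow> (\<integral>y. 1 * (F y * exp (- (axis k 1 \<bullet> y))) \<partial>lborel)"
  proof (rule integral_dominated_convergence[where w="\<lambda>y. 2 * exp (R' + 1) * indicator (cball 0 R') y"])
    show "(\<lambda>y. 1 * (F y * exp (- (axis k 1 \<bullet> y)))) \<in> borel_measurable lborel" using F(1) by measurable
    show "(\<lambda>y. Cn (i + N0) * (F y * exp (- D (i + N0) y))) \<in> borel_measurable lborel" for i using F(1) Dm by measurable
    show "integrable lborel (\<lambda>y::real^'n. 2 * exp (R' + 1) * indicator (cball 0 R') y)"
      by (intro integrable_mult_right integrable_real_indicator) (use emeasure_bounded_finite[OF bounded_cball, of "0::real^'n" R'] in auto)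
    show "AE y in lborel. (\<lambda>i. Cn (i + N0) * (F y * exp (- D (i + N0) y))) \<longlonglongrightarrow> 1 * (F y * exp (- (axis k 1 \<bullet> y)))"
      by (intro AE_I2 tendsto_intros LIMSEQ_ignore_initial_segment[OF Cn] LIMSEQ_ignore_initial_segment[OF D])
    show "AE y in lborel. norm (Cn (i + N0) * (F y * exp (- D (i + N0) y))) \<le> 2 * exp (R' + 1) * indicator (cball 0 R') y" for i
    proof (intro AE_I2)
      fix y
      show "norm (Cn (i + N0) * (F y * exp (- D (i + N0) y))) \<le> 2 * exp (R' + 1) * indicator (cball 0 R') y"
      proof (cases "F y = 0")
        case False
        have nn: "- R' - 1 \<le> D (i + N0) y" "Cn (i + N0) < 2" using N0[of "i + N0"] False by auto
        have "Cn (i + N0) * (F y * exp (- D (i + N0) y)) \<le> 2 * (1 * exp (R' + 1))"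
          using nn F(2,3)[of y] Cn0[of "i + N0"] by (intro mult_mono) auto
        then show ?thesis using R'(2)[OF False] F(2)[of y] Cn0[of "i + N0"] by (simp add: abs_mult)
      qed simp
    qed
  qed
  moreover have "real (N + N0) * (\<integral>x. F (inv (phi (N + N0)) x) * (exp (- (norm x powr \<alpha>)) / L) \<partial>lborel) =
      (\<integral>y. Cn (N + N0) * (F y * exp (- D (N + N0) y)) \<partial>lborel)" for N
    using N0[of "N + N0"] by (intro eq) simp
  ultimately have "(\<lambda>N. real (N + N0) * (\<integral>x. F (inv (phi (N + N0)) x) * (exp (- (norm x powr \<alpha>)) / L) \<partial>lborel)) \<longlonglongrightarrow> (\<integral>y. F y * exp (- (axis k 1 \<bullet> y)) \<partial>lborel)"
    by (simp only: mult_1)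
  then show ?thesis by (rule LIMSEQ_offset)
qed

end

section \<open>Bounded densities and the equilibrium measure\<close>

lemma riesz_off_diagonal: "x \<noteq> y \<Longrightarrow> riesz s x y = ennreal (norm (x - y) powr (- s))"
  by (simp add: riesz_def norm_minus_commute)

lemma riesz_measurable:
  assumes "0 < s"
  shows "(\<lambda>p. riesz s (fst p) (snd p :: real^'n)) \<in> borel_measurable (borel \<Otimes>\<^sub>M borel)"
  using riesz_part_measurable[of UNIV s] by (simp add: riesz_part_UNIV[OF assms])

text \<open>A bounded density cannot concentrate on the singularity of the kernel. The locale is
  used twice, for the reference measure and for the equilibrium measure.\<close>

locale bounded_density =
  fixes s d :: real and \<rho> :: "real^'n \<Rightarrow> ennreal"
  assumes s0: "0 < s" and sn: "s < real CARD('n)"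
    and rho_meas[measurable]: "\<rho> \<in> borel_measurable borel" and rho_le: "\<And>x. \<rho> x \<le> ennreal d"
    and rho_int: "(\<integral>\<^sup>+x. \<rho> x \<partial>lborel) = 1"
begin

definition Mr :: "(real^'n) measure" where "Mr = density lborel \<rho>"
text \<open>Real-valued version of \<open>riesz\<close>. On the diagonal it is 0 (from
  \<open>0 powr (- s) = 0\<close>) instead of infinite, which \<open>Mr\<close> does not see because
  it has no atoms.\<close>

definition gs :: "real^'n \<Rightarrow> real^'n \<Rightarrow> real" where "gs x y = norm (x - y) powr (- s)"

lemma Mr_sets[simp, measurable_cong]: "sets Mr = sets borel" by (simp add: Mr_def)
lemma Mr_space[simp]: "space Mr = UNIV" by (simp add: Mr_def)

lemma Mr_prob: "prob_space Mr"
  by (rule prob_spaceI) (simp add: Mr_def emeasure_density rho_int)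

sublocale Mr: prob_space Mr by (rule Mr_prob)

lemma Mr_ae: "AE y in Mr. y \<noteq> x"
proof -
  have "AE y in lborel. y \<noteq> x" by (rule AE_lborel_singleton)
  then show ?thesis unfolding Mr_def by (subst AE_density) auto
qed

lemma riesz_meas1: "(\<lambda>y. riesz s x y) \<in> borel_measurable borel"
proof -
  have "(\<lambda>y. (x, y)) \<in> measurable borel (borel \<Otimes>\<^sub>M borel)" by measurable
  from measurable_compose[OF this riesz_measurable[OF s0]] show ?thesis by simp
qed

lemma part_meas1: "A \<in> sets borel \<Longrightarrow> (\<lambda>y. riesz_part s A x y) \<in> borel_measurable borel" for x :: "real^'n"
proof -
  assume A: "A \<in> sets borel"
  have "(\<lambda>y. (x, y)) \<in> measurable borel (borel \<Otimes>\<^sub>M borel)" by measurable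
  from measurable_compose[OF this riesz_part_measurable[OF A]] show ?thesis by simp
qed

lemma ae_gs: "AE y in Mr. riesz s x y = ennreal (gs x y)"
  using Mr_ae[of x] by eventually_elim (simp add: riesz_off_diagonal gs_def)

text \<open>The narrow Gaussians contribute a constant times \<open>exp (- (n - s) * T)\<close> with
  \<open>n\<close> the dimension, uniformly in \<open>x\<close>.\<close>

lemma tail_potential_small:
  assumes "0 < \<epsilon>" shows "\<exists>T. \<forall>x. (\<integral>\<^sup>+y. riesz_part s {T<..} x y \<partial>Mr) \<le> ennreal \<epsilon>"
proof -
  let ?n = "real CARD('n)"
  obtain c where c: "0 < c" "mellin s UNIV 1 = ennreal c"
    using mellin_one[OF s0] by (cases "mellin s UNIV 1") auto
  obtain w where w: "0 \<le> w" "gauss_int TYPE('n) 1 = ennreal w"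
    using gauss_int_1[where 'n='n] by (cases "gauss_int TYPE('n) 1") auto
  define d' where "d' = max d 0"
  have d': "0 \<le> d'" "\<And>x. \<rho> x \<le> ennreal d'" using rho_le by (auto simp: d'_def intro: order_trans ennreal_leI)
  have "((\<lambda>T. exp (- (?n - s) * T)) \<longlongrightarrow> 0) at_top" using sn by real_asymp
  then have "((\<lambda>T. d' * w / (?n - s) / c * exp (- (?n - s) * T)) \<longlongrightarrow> d' * w / (?n - s) / c * 0) at_top"
    by (intro tendsto_intros)
  then have "\<forall>\<^sub>F T in at_top. d' * w / (?n - s) / c * exp (- (?n - s) * T) < \<epsilon>"
    using assms by (intro order_tendstoD) auto
  then obtain T where T: "d' * w / (?n - s) / c * exp (- (?n - s) * T) < \<epsilon>"
    using eventually_happens'[OF trivial_limit_at_top_linorder] by blast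
  have "(\<integral>\<^sup>+y. riesz_part s {T<..} x y \<partial>Mr) \<le> ennreal \<epsilon>" for x
  proof -
    have "(\<integral>\<^sup>+y. riesz_part s {T<..} x y \<partial>Mr)
      \<le> ennreal d' * gauss_int TYPE('n) 1 * ennreal (exp (- (?n - s) * T) / (?n - s)) / mellin s UNIV 1"
      unfolding Mr_def by (rule riesz_part_greaterThan_integral[OF s0 sn d'(2) rho_meas])
    also have "\<dots> = ennreal (d' * w * (exp (- (?n - s) * T) / (?n - s)) / c)"
    proof -
      have "ennreal a * ennreal b * ennreal x / ennreal c = ennreal (a * b * x / c)" if "0 \<le> a" "0 \<le> b" "0 \<le> x" for a b x
        using that c by (simp add: ennreal_mult[symmetric] divide_ennreal)
      then show ?thesis unfolding c w using d' w sn by simp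
    qed
    also have "\<dots> \<le> ennreal \<epsilon>" using T by (intro ennreal_leI) (simp add: field_simps)
    finally show ?thesis .
  qed
  then show ?thesis by blast
qed

lemma potential_split: "(\<integral>\<^sup>+y. riesz s x y \<partial>Mr) = (\<integral>\<^sup>+y. riesz_part s {..T} x y \<partial>Mr) + (\<integral>\<^sup>+y. riesz_part s {T<..} x y \<partial>Mr)"
proof -
  have "(\<integral>\<^sup>+y. riesz s x y \<partial>Mr) = (\<integral>\<^sup>+y. riesz_part s {..T} x y + riesz_part s {T<..} x y \<partial>Mr)"
    by (simp add: riesz_part_split[OF s0, of _ _ T])
  also have "\<dots> = (\<integral>\<^sup>+y. riesz_part s {..T} x y \<partial>Mr) + (\<integral>\<^sup>+y. riesz_part s {T<..} x y \<partial>Mr)"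
    using part_meas1[of "{..T}" x] part_meas1[of "{T<..}" x] by (intro nn_integral_add) auto
  finally show ?thesis .
qed

lemma potential_bounded: "\<exists>C\<ge>0. \<forall>x. (\<integral>\<^sup>+y. riesz s x y \<partial>Mr) \<le> ennreal C"
proof -
  obtain T where T: "\<And>x. (\<integral>\<^sup>+y. riesz_part s {T<..} x y \<partial>Mr) \<le> ennreal 1" using tail_potential_small[of 1] by auto
  define K where "K = exp (s * T) / s / enn2real (mellin s UNIV 1)"
  have K0: "0 \<le> K" using s0 by (simp add: K_def)
  have "(\<integral>\<^sup>+y. riesz s x y \<partial>Mr) \<le> ennreal (K + 1)" for x
  proof -
    have "(\<integral>\<^sup>+y. riesz_part s {..T} x y \<partial>Mr) \<le> (\<integral>\<^sup>+y. ennreal K \<partial>Mr)"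
      unfolding K_def by (intro nn_integral_mono riesz_part_atMost_le[OF s0])
    also have "\<dots> = ennreal K" using Mr.emeasure_space_1 by simp
    finally show ?thesis unfolding potential_split[of x T] using T[of x] K0 by (simp add: add_mono)
  qed
  then show ?thesis using K0 by (intro exI[of _ "K + 1"]) auto
qed

definition Cb :: real where "Cb = (SOME C. 0 \<le> C \<and> (\<forall>x. (\<integral>\<^sup>+y. riesz s x y \<partial>Mr) \<le> ennreal C))"

lemma Cb: "0 \<le> Cb" "(\<integral>\<^sup>+y. riesz s x y \<partial>Mr) \<le> ennreal Cb"
  using someI_ex[OF potential_bounded] unfolding Cb_def by auto

lemma gs_meas[measurable]: "(\<lambda>p. gs (fst p) (snd p)) \<in> borel_measurable (Mr \<Otimes>\<^sub>M Mr)"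
  unfolding gs_def by measurable

lemma gs_meas1: "gs x \<in> borel_measurable borel"
  unfolding gs_def by measurable

lemma gs_nonneg: "0 \<le> gs x y" by (simp add: gs_def)
lemma gs_sym: "gs x y = gs y x" by (simp add: gs_def norm_minus_commute)

lemma nn_gs: "(\<integral>\<^sup>+y. ennreal (gs x y) \<partial>Mr) = (\<integral>\<^sup>+y. riesz s x y \<partial>Mr)"
  by (rule nn_integral_cong_AE) (use ae_gs[of x] in \<open>eventually_elim, simp\<close>)

lemma gs_int: "integrable Mr (gs x)"
proof (rule integrableI_nonneg)
  show "gs x \<in> borel_measurable Mr" using gs_meas1[of x] by simp
  show "(\<integral>\<^sup>+y. ennreal (gs x y) \<partial>Mr) < \<infinity>" unfolding nn_gs using Cb(2)[of x] by (rule order.strict_trans1) simp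
qed (simp add: gs_nonneg)

lemma potential_eq: "(\<integral>\<^sup>+y. riesz s x y \<partial>Mr) = ennreal (\<integral>y. gs x y \<partial>Mr)"
  unfolding nn_gs[symmetric] by (rule nn_integral_eq_integral[OF gs_int]) (simp add: gs_nonneg)

lemma gs_bound: "(\<integral>y. gs x y \<partial>Mr) \<le> Cb"
  using Cb(1) Cb(2)[of x] unfolding potential_eq by simp

lemma mean_field: assumes "0 \<le> \<gamma>" shows "mean_field Mr gs Cb \<gamma>"
  by unfold_locales (use gs_nonneg gs_sym gs_int gs_bound assms in auto)

section \<open>Positive semidefiniteness and truncation for a bounded density\<close>

lemma nonneg_energy:
  assumes f: "f \<in> borel_measurable borel" "\<And>x. 0 \<le> f x" "\<And>x. \<bar>f x\<bar> \<le> B"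
    and h: "h \<in> borel_measurable borel" "\<And>x. 0 \<le> h x" "\<And>x. \<bar>h x\<bar> \<le> B'"
  shows "(\<integral>\<^sup>+x. \<integral>\<^sup>+y. riesz s x y \<partial>density Mr (\<lambda>y. ennreal (h y)) \<partial>density Mr (\<lambda>x. ennreal (f x))) = ennreal (mean_field.bil Mr gs f h)"
proof -
  interpret mean_field Mr gs Cb 0 by (rule mean_field) simp
  note [measurable] = f(1) h(1)
  have b: "bd f" "bd h" by (rule bdI[of _ B], use f in auto) (rule bdI[of _ B'], use h in auto)
  have in1: "(\<integral>\<^sup>+y. riesz s x y \<partial>density Mr (\<lambda>y. ennreal (h y))) = ennreal (G h x)" for x
  proof -
    have "(\<integral>\<^sup>+y. riesz s x y \<partial>density Mr (\<lambda>y. ennreal (h y))) = (\<integral>\<^sup>+y. ennreal (h y) * riesz s x y \<partial>Mr)"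
      by (rule nn_integral_density) (use riesz_meas1[of x] in auto)
    also have "\<dots> = (\<integral>\<^sup>+y. ennreal (gs x y * h y) \<partial>Mr)"
      by (rule nn_integral_cong_AE, rule eventually_mono[OF ae_gs[of x]]) (simp add: ennreal_mult mult.commute h gs_nonneg)
    also have "\<dots> = ennreal (G h x)" unfolding G_def
      by (rule nn_integral_eq_integral[OF g_bd_int[OF b(2)]]) (simp add: h gs_nonneg)
    finally show ?thesis .
  qed
  have G0: "0 \<le> G h x" for x unfolding G_def by (intro integral_nonneg_AE AE_I2 mult_nonneg_nonneg) (simp_all add: gs_nonneg h)
  have Gm: "G h \<in> borel_measurable Mr" by (rule bd_meas[OF bd_G[OF b(2)]])
  have "(\<integral>\<^sup>+x. \<integral>\<^sup>+y. riesz s x y \<partial>density Mr (\<lambda>y. ennreal (h y)) \<partial>density Mr (\<lambda>x. ennreal (f x))) = (\<integral>\<^sup>+x. ennreal (f x) * ennreal (G h x) \<partial>Mr)"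
    unfolding in1 by (rule nn_integral_density) (use Gm in auto)
  also have "\<dots> = (\<integral>\<^sup>+x. ennreal (f x * G h x) \<partial>Mr)" using f G0 by (intro nn_integral_cong) (simp add: ennreal_mult)
  also have "\<dots> = ennreal (bil f h)" unfolding bil_def
    by (rule nn_integral_eq_integral[OF bil_int[OF b]]) (simp add: f G0)
  finally show ?thesis .
qed

lemma sigma_density: assumes "f \<in> borel_measurable borel" shows "sigma_finite_measure (density Mr (\<lambda>x. ennreal (f x)))"
  by (rule sigma_finite_measure.sigma_finite_iff_density_finite[THEN iffD2]) (use Mr.sigma_finite_measure_axioms assms in auto)

lemma riesz_psd:
  fixes m1 m2 :: "(real^'n) measure"
  assumes "sigma_finite_measure m1" "sigma_finite_measure m2" "sets m1 = sets borel" "sets m2 = sets borel"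
  shows "2 * (\<integral>\<^sup>+x. \<integral>\<^sup>+y. riesz s x y \<partial>m2 \<partial>m1)
    \<le> (\<integral>\<^sup>+x. \<integral>\<^sup>+y. riesz s x y \<partial>m1 \<partial>m1) + (\<integral>\<^sup>+x. \<integral>\<^sup>+y. riesz s x y \<partial>m2 \<partial>m2)"
  using riesz_part_psd[of UNIV m1 m2 s] assms by (simp add: riesz_part_UNIV[OF s0])

text \<open>The positive and negative parts \<open>P\<close> and \<open>N\<close> of a bounded
  function are densities of two measures; \<open>riesz_psd\<close> for these is nonnegativity of
  \<open>bil P P - 2 * bil N P + bil N N\<close>.\<close>

lemma mean_field_pos: assumes g: "0 \<le> \<gamma>" shows "mean_field_pos Mr gs Cb \<gamma>"
proof -
  interpret m: mean_field Mr gs Cb 0 by (rule mean_field) simp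
  interpret mean_field Mr gs Cb \<gamma> by (rule mean_field[OF g])
  show ?thesis
  proof unfold_locales
    fix a B assume a: "a \<in> borel_measurable Mr" "\<And>x. \<bar>a x\<bar> \<le> (B::real)"
    define P N where "P x = max 0 (a x)" and "N x = max 0 (- a x)" for x
    have am[measurable]: "a \<in> borel_measurable borel" using a by simp
    have PN: "P \<in> borel_measurable borel" "N \<in> borel_measurable borel" unfolding P_def N_def by measurable
    have PNb: "\<bar>P x\<bar> \<le> B" "\<bar>N x\<bar> \<le> B" "0 \<le> P x" "0 \<le> N x" for x using a(2)[of x] by (auto simp: P_def N_def)
    have b: "m.bd P" "m.bd N" by (rule m.bdI[of _ B], use PN PNb in auto)+
    have n0: "0 \<le> m.bil f h" if "\<And>x. 0 \<le> f x" "\<And>x. 0 \<le> h x" for f h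
      unfolding m.bil_def m.G_def by (intro integral_nonneg_AE AE_I2 mult_nonneg_nonneg that gs_nonneg)
    let ?m1 = "density Mr (\<lambda>x. ennreal (N x))" and ?m2 = "density Mr (\<lambda>x. ennreal (P x))"
    have "2 * ennreal (m.bil N P) \<le> ennreal (m.bil N N) + ennreal (m.bil P P)"
      unfolding nonneg_energy[OF PN(2) PNb(4,2) PN(1) PNb(3,1), symmetric] nonneg_energy[OF PN(2) PNb(4,2) PN(2) PNb(4,2), symmetric]
        nonneg_energy[OF PN(1) PNb(3,1) PN(1) PNb(3,1), symmetric]
      by (rule riesz_psd) (auto intro: sigma_density PN)
    moreover have "2 * ennreal (m.bil N P) = ennreal (2 * m.bil N P)" by (simp add: ennreal_mult n0 PNb)
    ultimately have 1: "2 * m.bil N P \<le> m.bil N N + m.bil P P"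
      using n0[OF PNb(4) PNb(4)] n0[OF PNb(3) PNb(3)] by (simp add: ennreal_plus[symmetric] del: ennreal_plus)
    have ae: "a = (\<lambda>x. 1 * P x + (-1) * N x)" by (rule ext) (auto simp: P_def N_def max_def)
    have "m.bil a a = m.bil P P - 2 * m.bil N P + m.bil N N"
      using m.bil_comb[OF b, of 1 "-1"] by (subst ae, subst ae) simp
    then show "0 \<le> (\<integral>x. a x * (\<integral>y. gs x y * a y \<partial>Mr) \<partial>Mr)" using 1 unfolding m.bil_def m.G_def by simp
  qed
qed

text \<open>\<open>riesz_part_psd\<close> with \<open>m1\<close> the sum of unit masses at the
  \<open>x i\<close> and \<open>m2\<close> equal to \<open>c\<close> times \<open>Mr\<close>. Point
  masses have finite energy here because the truncated kernel is bounded on the diagonal.\<close>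

lemma part_quadratic:
  fixes x :: "nat \<Rightarrow> real^'n" and T :: real
  assumes c: "0 \<le> c"
  defines "k \<equiv> \<lambda>x y. enn2real (riesz_part s {..T} x y)"
  shows "0 \<le> (\<Sum>i<n. \<Sum>j<n. k (x i) (x j)) - 2 * c * (\<Sum>i<n. \<integral>y. k (x i) y \<partial>Mr) + c\<^sup>2 * (\<integral>x. (\<integral>y. k x y \<partial>Mr) \<partial>Mr)"
proof -
  let ?k = "riesz_part s {..T} :: real^'n \<Rightarrow> real^'n \<Rightarrow> ennreal"
  define K where "K = exp (s * T) / s / enn2real (mellin s UNIV 1)"
  have K0: "0 \<le> K" using s0 by (simp add: K_def)
  have kK: "?k x y \<le> ennreal K" for x y unfolding K_def by (rule riesz_part_atMost_le[OF s0])
  have kf: "?k x y < \<infinity>" for x y using kK[of x y] by (rule order.strict_trans1) simp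
  have ke: "?k x y = ennreal (k x y)" for x y unfolding k_def using kf[of x y] by simp
  have k0: "0 \<le> k x y" for x y by (simp add: k_def)
  have kKr: "k x y \<le> K" for x y using kK[of x y] K0 unfolding ke by simp
  have km1: "(\<lambda>y. k x y) \<in> borel_measurable borel" for x
    unfolding k_def using part_meas1[of "{..T}" x] by measurable
  have ki: "integrable Mr (k x)" for x by (rule Mr.integrable_const_bound[of _ K]) (use k0 kKr km1 in auto)
  have km: "(\<lambda>(x,y). k x y) \<in> borel_measurable (Mr \<Otimes>\<^sub>M Mr)"
  proof -
    have "(\<lambda>p. ?k (fst p) (snd p)) \<in> borel_measurable (Mr \<Otimes>\<^sub>M Mr)"
      by (rule measurable_cong_sets[THEN equalityD1, THEN subsetD, OF sets_pair_measure_cong refl riesz_part_measurable]) auto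
    then show ?thesis unfolding k_def split_beta' by measurable
  qed
  define Uk where "Uk x = (\<integral>y. k x y \<partial>Mr)" for x
  have Ukm[measurable]: "Uk \<in> borel_measurable borel" unfolding Uk_def using Mr.borel_measurable_lebesgue_integral[OF km] by simp
  have Uk0: "0 \<le> Uk x" for x unfolding Uk_def by (intro integral_nonneg_AE AE_I2 k0)
  have UkK: "Uk x \<le> K" for x
    unfolding Uk_def using integral_mono[OF ki[of x], of "\<lambda>_. K"] kKr Mr.prob_space by simp
  have Uki: "integrable Mr Uk" by (rule Mr.integrable_const_bound[of _ K]) (use Uk0 UkK in auto)
  have nnUk: "(\<integral>\<^sup>+y. ?k x y \<partial>Mr) = ennreal (Uk x)" for x
    unfolding ke Uk_def by (rule nn_integral_eq_integral[OF ki]) (simp add: k0)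
  let ?m1 = "distr (count_space {..<n}) borel x" and ?m2 = "density Mr (\<lambda>_. ennreal c)"
  have nn1: "(\<integral>\<^sup>+y. f y \<partial>?m1) = (\<Sum>i<n. f (x i))" if "f \<in> borel_measurable borel" for f
    using that by (subst nn_integral_distr) (auto simp: nn_integral_count_space_finite)
  have nn2: "(\<integral>\<^sup>+y. f y \<partial>?m2) = ennreal c * (\<integral>\<^sup>+y. f y \<partial>Mr)" if "f \<in> borel_measurable borel" for f
    using that by (subst nn_integral_density) (auto intro!: nn_integral_cmult)
  have pm: "?k x \<in> borel_measurable borel" for x using part_meas1[of "{..T}" x] by simp
  have f1: "finite_measure ?m1" by (rule finite_measureI) (simp add: emeasure_distr)
  have "2 * (\<integral>\<^sup>+x. \<integral>\<^sup>+y. ?k x y \<partial>?m2 \<partial>?m1) \<le> (\<integral>\<^sup>+x. \<integral>\<^sup>+y. ?k x y \<partial>?m1 \<partial>?m1) + (\<integral>\<^sup>+x. \<integral>\<^sup>+y. ?k x y \<partial>?m2 \<partial>?m2)"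
    by (rule riesz_part_psd) (auto intro: sigma_density finite_measure.axioms(1)[OF f1])
  moreover have "(\<integral>\<^sup>+x. \<integral>\<^sup>+y. ?k x y \<partial>?m2 \<partial>?m1) = ennreal (c * (\<Sum>i<n. Uk (x i)))"
    by (simp add: nn2 pm nnUk nn1 ennreal_mult[symmetric] c Uk0 sum_ennreal sum_distrib_left)
  moreover have "(\<integral>\<^sup>+x. \<integral>\<^sup>+y. ?k x y \<partial>?m1 \<partial>?m1) = ennreal (\<Sum>i<n. \<Sum>j<n. k (x i) (x j))"
  proof -
    have "(\<lambda>y. ?k y (x j)) \<in> borel_measurable borel" for j using part_meas1[of "{..T}" "x j"] by (simp add: riesz_part_sym[of s "{..T}" _ "x j"])
    then have "(\<lambda>y. \<Sum>j<n. ?k y (x j)) \<in> borel_measurable borel" by measurable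
    note nm = this
    have "(\<integral>\<^sup>+x. \<integral>\<^sup>+y. ?k x y \<partial>?m1 \<partial>?m1) = (\<integral>\<^sup>+y. (\<Sum>j<n. ?k y (x j)) \<partial>?m1)"
      by (intro nn_integral_cong nn1 pm)
    also have "\<dots> = (\<Sum>i<n. \<Sum>j<n. ?k (x i) (x j))" by (rule nn1[OF nm])
    finally show ?thesis by (simp add: ke sum_ennreal k0 sum_nonneg)
  qed
  moreover have "(\<integral>\<^sup>+x. \<integral>\<^sup>+y. ?k x y \<partial>?m2 \<partial>?m2) = ennreal (c * (c * (\<integral>x. Uk x \<partial>Mr)))"
  proof -
    have "(\<integral>\<^sup>+x. ennreal (Uk x) \<partial>Mr) = ennreal (\<integral>x. Uk x \<partial>Mr)" by (rule nn_integral_eq_integral[OF Uki]) (simp add: Uk0)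
    moreover have "0 \<le> (\<integral>x. Uk x \<partial>Mr)" by (intro integral_nonneg_AE AE_I2 Uk0)
    ultimately show ?thesis by (simp add: nn2 pm nnUk nn_integral_cmult ennreal_mult c)
  qed
  ultimately have "2 * ennreal (c * (\<Sum>i<n. Uk (x i))) \<le> ennreal (\<Sum>i<n. \<Sum>j<n. k (x i) (x j)) + ennreal (c * (c * (\<integral>x. Uk x \<partial>Mr)))" by simp
  moreover have "2 * ennreal (c * (\<Sum>i<n. Uk (x i))) = ennreal (2 * (c * (\<Sum>i<n. Uk (x i))))" using c by (simp add: ennreal_mult sum_nonneg Uk0)
  moreover have "0 \<le> (\<Sum>i<n. \<Sum>j<n. k (x i) (x j))" "0 \<le> c * (c * (\<integral>x. Uk x \<partial>Mr))"
    using c by (auto intro!: sum_nonneg mult_nonneg_nonneg integral_nonneg_AE simp: k0 Uk0)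
  ultimately have "2 * (c * (\<Sum>i<n. Uk (x i))) \<le> (\<Sum>i<n. \<Sum>j<n. k (x i) (x j)) + c * (c * (\<integral>x. Uk x \<partial>Mr))"
    by (simp add: ennreal_plus[symmetric] del: ennreal_plus)
  then show ?thesis unfolding Uk_def[symmetric] by (simp add: power2_eq_square mult_ac)
qed

lemma part_le_gs: "AE y in Mr. enn2real (riesz_part s {..T} x y) \<le> gs x y"
  using ae_gs[of x]
proof eventually_elim
  fix y assume "riesz s x y = ennreal (gs x y)"
  moreover have "riesz_part s {..T} x y \<le> riesz s x y" unfolding riesz_part_split[OF s0, of x y T] by simp
  ultimately have "riesz_part s {..T} x y \<le> ennreal (gs x y)" by simp
  from enn2real_mono[OF this] show "enn2real (riesz_part s {..T} x y) \<le> gs x y" using gs_nonneg by simp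
qed

lemma part_integral_ge:
  assumes T: "\<And>x. (\<integral>\<^sup>+y. riesz_part s {T<..} x y \<partial>Mr) \<le> ennreal \<epsilon>" and "0 < \<epsilon>"
  shows "(\<integral>y. gs x y \<partial>Mr) - \<epsilon> \<le> (\<integral>y. enn2real (riesz_part s {..T} x y) \<partial>Mr)"
proof -
  let ?k = "\<lambda>y. enn2real (riesz_part s {..T} x y)"
  have fin: "riesz_part s {..T} x y \<noteq> top" for y
    using riesz_part_atMost_le[OF s0, of T x y] by (auto simp: top_unique)
  have km: "?k \<in> borel_measurable borel" using part_meas1[of "{..T}" x] by measurable
  have ki: "integrable Mr ?k"
    by (rule Bochner_Integration.integrable_bound[OF gs_int[of x]])
      (use km part_le_gs[of T x] gs_nonneg[of x] in \<open>auto elim!: eventually_mono\<close>)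
  have "ennreal (\<integral>y. gs x y \<partial>Mr) = (\<integral>\<^sup>+y. riesz_part s {..T} x y \<partial>Mr) + (\<integral>\<^sup>+y. riesz_part s {T<..} x y \<partial>Mr)"
    unfolding potential_eq[symmetric] by (rule potential_split)
  also have "\<dots> \<le> (\<integral>\<^sup>+y. ennreal (?k y) \<partial>Mr) + ennreal \<epsilon>" using fin T[of x] by (intro add_mono) (auto simp: less_top)
  also have "(\<integral>\<^sup>+y. ennreal (?k y) \<partial>Mr) = ennreal (\<integral>y. ?k y \<partial>Mr)" by (rule nn_integral_eq_integral[OF ki]) simp
  also have "ennreal (\<integral>y. ?k y \<partial>Mr) + ennreal \<epsilon> = ennreal ((\<integral>y. ?k y \<partial>Mr) + \<epsilon>)"
    using assms(2) by (simp add: integral_nonneg_AE)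
  finally have "(\<integral>y. gs x y \<partial>Mr) \<le> (\<integral>y. ?k y \<partial>Mr) + \<epsilon>"
    using assms(2) by (subst (asm) ennreal_le_iff) (auto intro!: add_nonneg_nonneg integral_nonneg_AE)
  then show ?thesis by simp
qed

lemma mean_field_psd: assumes g: "0 \<le> \<gamma>" shows "mean_field_psd Mr gs Cb \<gamma>"
proof -
  interpret mean_field Mr gs Cb \<gamma> by (rule mean_field[OF g])
  show ?thesis
  proof unfold_locales
    fix \<epsilon> :: real assume e: "0 < \<epsilon>"
    obtain T where T: "\<And>x. (\<integral>\<^sup>+y. riesz_part s {T<..} x y \<partial>Mr) \<le> ennreal \<epsilon>" using tail_potential_small[OF e] by blast
    let ?k = "\<lambda>x y. enn2real (riesz_part s {..T} x (y::real^'n))"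
    define K where "K = exp (s * T) / s / enn2real (mellin s UNIV 1)"
    have K0: "0 \<le> K" using s0 by (simp add: K_def)
    have kK: "?k x y \<le> K" for x y
      using enn2real_mono[OF riesz_part_atMost_le[OF s0, of T x y]] K0 unfolding K_def by simp
    have km: "(\<lambda>p. ?k (fst p) (snd p)) \<in> borel_measurable (Mr \<Otimes>\<^sub>M Mr)"
    proof -
      have "(\<lambda>p. riesz_part s {..T} (fst p) (snd p)) \<in> borel_measurable (Mr \<Otimes>\<^sub>M Mr)"
        by (rule measurable_cong_sets[THEN equalityD1, THEN subsetD, OF sets_pair_measure_cong refl riesz_part_measurable]) auto
      then show ?thesis by measurable
    qed
    show "\<exists>k K. (\<lambda>p. k (fst p) (snd p)) \<in> borel_measurable (Mr \<Otimes>\<^sub>M Mr) \<and>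
     (\<forall>x y. 0 \<le> k x y \<and> k x y \<le> K \<and> k x y = k y x) \<and> (\<forall>x. AE y in Mr. k x y \<le> gs x y) \<and>
     (\<forall>x. (\<integral>y. gs x y \<partial>Mr) - \<epsilon> \<le> (\<integral>y. k x y \<partial>Mr)) \<and>
     (\<forall>n (x::nat \<Rightarrow> real^'n) c. 0 \<le> c \<longrightarrow> 0 \<le> (\<Sum>i<n. \<Sum>j<n. k (x i) (x j)) - 2 * c * (\<Sum>i<n. \<integral>y. k (x i) y \<partial>Mr)
        + c\<^sup>2 * (\<integral>x. (\<integral>y. k x y \<partial>Mr) \<partial>Mr))"
      by (intro exI[of _ ?k] exI[of _ K] conjI allI impI km kK part_le_gs part_integral_ge[OF T e] part_quadratic)
        (simp_all add: riesz_part_sym[of s "{..T}"])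
  qed
qed

text \<open>The narrow scales contribute at most half of \<epsilon> everywhere. For the wide ones,
  the kernel is bounded and little mass lies outside a large ball, while on the ball the kernel is
  small when seen from far away.\<close>

lemma potential_vanishes:
  assumes e: "0 < \<epsilon>"
  shows "\<exists>R. \<forall>x. R \<le> norm x \<longrightarrow> (\<integral>y. gs x y \<partial>Mr) \<le> \<epsilon>"
proof -
  obtain T where T: "\<And>x. (\<integral>\<^sup>+y. riesz_part s {T<..} x y \<partial>Mr) \<le> ennreal (\<epsilon> / 2)" using tail_potential_small[of "\<epsilon> / 2"] e by auto
  let ?k = "\<lambda>x y. enn2real (riesz_part s {..T} x (y::real^'n))"
  define K where "K = exp (s * T) / s / enn2real (mellin s UNIV 1)"
  have K0: "0 \<le> K" using s0 by (simp add: K_def)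
  have kK: "?k x y \<le> K" for x y
    using enn2real_mono[OF riesz_part_atMost_le[OF s0, of T x y]] K0 unfolding K_def by simp
  have km: "?k x \<in> borel_measurable borel" for x using part_meas1[of "{..T}" x] by measurable
  have "(\<lambda>r. Mr.prob (cball 0 (real r))) \<longlonglongrightarrow> Mr.prob (\<Union>r. cball 0 (real r))"
    by (rule Mr.finite_Lim_measure_incseq) (auto simp: incseq_def)
  moreover have "(\<Union>r. cball 0 (real r)) = (UNIV :: (real^'n) set)" by (auto simp: real_arch_simple)
  ultimately have lim: "(\<lambda>r. Mr.prob (cball 0 (real r))) \<longlonglongrightarrow> 1" using Mr.prob_space by simp
  have "\<forall>\<^sub>F r in sequentially. 1 - \<epsilon> / (4 * (K + 1)) < Mr.prob (cball 0 (real r))"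
    by (rule order_tendstoD[OF lim]) (use e K0 in simp)
  then obtain r :: nat where r: "1 - \<epsilon> / (4 * (K + 1)) < Mr.prob (cball 0 (real r))"
    using eventually_happens'[OF sequentially_bot] by blast
  have "((\<lambda>t. t powr (- s)) \<longlongrightarrow> 0) at_top" using s0 by real_asymp
  then have "\<forall>\<^sub>F t in at_top. t powr (- s) < \<epsilon> / 4" using e by (intro order_tendstoD) auto
  then obtain t0 where t0: "\<And>t. t0 \<le> t \<Longrightarrow> t powr (- s) < \<epsilon> / 4" unfolding eventually_at_top_linorder by blast
  show ?thesis
  proof (intro exI allI impI)
    fix x :: "real^'n" assume x: "r + max t0 1 \<le> norm x"
    have kb: "AE y in Mr. ?k x y \<le> \<epsilon> / 4 + K * indicator (- cball 0 (real r)) y"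
      using part_le_gs[of T x]
    proof eventually_elim
      fix y assume y: "?k x y \<le> gs x y"
      show "?k x y \<le> \<epsilon> / 4 + K * indicator (- cball 0 (real r)) y"
      proof (cases "y \<in> cball 0 (real r)")
        case True
        then have "t0 \<le> norm (x - y)" using x norm_triangle_ineq2[of x y] by simp
        then have "gs x y < \<epsilon> / 4" unfolding gs_def by (rule t0)
        then show ?thesis using y True by simp
      next
        case False then show ?thesis using kK[of x y] e by simp
      qed
    qed
    have ki: "integrable Mr (?k x)" by (rule Mr.integrable_const_bound[of _ K]) (use kK km in auto)
    have "(\<integral>y. gs x y \<partial>Mr) \<le> (\<integral>y. ?k x y \<partial>Mr) + \<epsilon> / 2" using part_integral_ge[OF T, of x] e by simp
    also have "(\<integral>y. ?k x y \<partial>Mr) \<le> (\<integral>y. \<epsilon> / 4 + K * indicator (- cball 0 (real r)) y \<partial>Mr)"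
      by (rule integral_mono_AE[OF ki _ kb]) (auto intro!: Mr.integrable_const integrable_real_indicator simp: less_top[symmetric])
    also have "\<dots> = \<epsilon> / 4 + K * Mr.prob (- cball 0 (real r))"
      using Mr.prob_space by (subst Bochner_Integration.integral_add) (auto intro!: integrable_real_indicator simp: less_top[symmetric])
    also have "Mr.prob (- cball 0 (real r)) = 1 - Mr.prob (cball 0 (real r))"
      using Mr.prob_compl[of "cball 0 (real r)"] by (simp add: Compl_eq_Diff_UNIV)
    also have "K * (1 - Mr.prob (cball 0 (real r))) \<le> K * (\<epsilon> / (4 * (K + 1)))" using r K0 by (intro mult_left_mono) auto
    also have "K * (\<epsilon> / (4 * (K + 1))) \<le> (K + 1) * (\<epsilon> / (4 * (K + 1)))" using e K0 by (intro mult_right_mono) auto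
    also have "(K + 1) * (\<epsilon> / (4 * (K + 1))) = \<epsilon> / 4" using K0 by (simp add: field_simps)
    finally show "(\<integral>y. gs x y \<partial>Mr) \<le> \<epsilon>" by simp
  qed
qed

end

section \<open>Relative entropy and the minimizer of the free energy\<close>

lemma rel_entropy_density:
  assumes M: "prob_space M" and f: "f \<in> borel_measurable M" "\<And>x. 0 \<le> f x"
  shows "rel_entropy (density M (\<lambda>x. ennreal (f x))) M =
    (if integrable (density M (\<lambda>x. ennreal (f x))) (\<lambda>x. ln (f x)) then ereal (\<integral>x. ln (f x) \<partial>density M (\<lambda>x. ennreal (f x))) else \<infinity>)"
proof -
  interpret prob_space M by fact
  let ?N = "density M (\<lambda>x. ennreal (f x))"
  have ac: "absolutely_continuous M ?N" by (rule absolutely_continuousI_density) (use f in measurable)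
  have "AE x in M. ennreal (f x) = RN_deriv M ?N x"
    by (rule RN_deriv_unique) (use f in auto)
  then have "AE x in ?N. ennreal (f x) = RN_deriv M ?N x" by (rule absolutely_continuous_AE[OF _ ac, rotated]) simp
  then have ae: "AE x in ?N. entropy_density (exp 1) M ?N x = ln (f x)"
  proof eventually_elim
    fix x assume "ennreal (f x) = RN_deriv M ?N x"
    then have "enn2real (RN_deriv M ?N x) = f x" using f(2)[of x] by (metis enn2real_ennreal)
    then show "entropy_density (exp 1) M ?N x = ln (f x)" by (simp add: entropy_density_def log_def)
  qed
  have m1: "entropy_density (exp 1) M ?N \<in> borel_measurable ?N" unfolding entropy_density_def comp_def by measurable
  have m2: "(\<lambda>x. ln (f x)) \<in> borel_measurable ?N" using f by measurable
  have "integrable ?N (entropy_density (exp 1) M ?N) \<longleftrightarrow> integrable ?N (\<lambda>x. ln (f x))"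
    by (rule integrable_cong_AE[OF m1 m2 ae])
  moreover have "KL_divergence (exp 1) M ?N = (\<integral>x. ln (f x) \<partial>?N)"
    unfolding KL_divergence_def by (rule integral_cong_AE[OF m1 m2 ae])
  ultimately show ?thesis using ac by (simp add: rel_entropy_def)
qed

lemma (in prob_space) gibbs_inequality:
  assumes D: "D \<in> borel_measurable M" "\<And>x. 0 \<le> D x" and p: "prob_space (density M (\<lambda>x. ennreal (D x)))"
    and i: "integrable (density M (\<lambda>x. ennreal (D x))) (\<lambda>x. ln (D x))"
  shows "0 \<le> (\<integral>x. ln (D x) \<partial>density M (\<lambda>x. ennreal (D x)))"
    "(\<integral>x. ln (D x) \<partial>density M (\<lambda>x. ennreal (D x))) = 0 \<Longrightarrow> density M (\<lambda>x. ennreal (D x)) = M"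
proof -
  interpret information_space M "exp 1" by unfold_locales simp
  let ?N = "density M (\<lambda>x. ennreal (D x))"
  have lnD: "(\<lambda>x. ln (D x)) \<in> borel_measurable M" using D by measurable
  have int: "integrable M (\<lambda>x. D x * log (exp 1) (D x))"
    using i integrable_real_density[OF D(1) _ lnD] D(2) by (simp add: log_def)
  have KL: "KL_divergence (exp 1) M ?N = (\<integral>x. ln (D x) \<partial>?N)"
  proof -
    have "KL_divergence (exp 1) M ?N = (\<integral>x. D x * log (exp 1) (D x) \<partial>M)" by (rule KL_density) (use D in auto)
    also have "\<dots> = (\<integral>x. ln (D x) \<partial>?N)" using integral_real_density[OF D(1) _ lnD] D(2) by (simp add: log_def)
    finally show ?thesis .
  qed
  have ae: "AE x in M. 0 \<le> D x" using D by auto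
  show "0 \<le> (\<integral>x. ln (D x) \<partial>?N)" using KL_nonneg[OF p D(1) ae int] by (simp add: KL)
  show "(\<integral>x. ln (D x) \<partial>?N) = 0 \<Longrightarrow> ?N = M" using KL_eq_0_iff_eq[OF p D(1) ae int] by (simp add: KL)
qed

lemma exp_neg_ennreal: "0 \<le> t \<Longrightarrow> exp_neg (ennreal t) = ennreal (exp (- t))"
  by (simp add: exp_neg_def)

lemma exp_neg_confine: "exp_neg (confine \<alpha> x) = ennreal (exp (- (norm x powr \<alpha>)))"
  unfolding confine_def by (rule exp_neg_ennreal) simp

text \<open>The value of the free energy at \<open>\<mu>\<close> is \<open>- ln l - \<gamma> / 2 * \<integral>U d\<mu>\<close>; at any other probability measure it is larger
  by at least the relative entropy with respect to \<open>\<mu>\<close>.\<close>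

theorem equilibrium_measure:
  assumes s: "0 < s" "s < real CARD('n)" and g: "0 \<le> \<gamma>" and a: "0 < \<alpha>"
  obtains L d :: real and U :: "real^'n::finite \<Rightarrow> real" where
    "0 < L" "L_const TYPE('n) s \<alpha> \<gamma> = L"
    "bounded_density s d (\<lambda>x. ennreal (exp (- \<gamma> * U x - norm x powr \<alpha>) / L))"
    "\<And>x. U x = (\<integral>y. norm (x - y) powr (- s) \<partial>density lborel (\<lambda>x. ennreal (exp (- \<gamma> * U x - norm x powr \<alpha>) / L)))"
proof -
  let ?w = "\<lambda>x::real^'n. exp (- (norm x powr \<alpha>))"
  obtain z0 where z0: "0 < z0" "(\<integral>\<^sup>+x. ennreal (?w x) \<partial>lborel) = ennreal z0"
    using nn_integral_exp_norm_powr_finite[OF a, where 'n='n] nn_integral_lborel_pos[of ?w]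
    by (cases "\<integral>\<^sup>+x. ennreal (?w x) \<partial>lborel") auto
  define \<rho>0 where "\<rho>0 x = ennreal (?w x / z0)" for x :: "real^'n"
  have rho0_m[measurable]: "\<rho>0 \<in> borel_measurable borel" unfolding \<rho>0_def by measurable
  have rho0_int: "(\<integral>\<^sup>+x. \<rho>0 x \<partial>lborel) = 1"
  proof -
    have "(\<integral>\<^sup>+x. \<rho>0 x \<partial>lborel) = (\<integral>\<^sup>+x. ennreal (?w x) / ennreal z0 \<partial>lborel)"
      unfolding \<rho>0_def using z0 by (intro nn_integral_cong) (simp add: divide_ennreal)
    also have "\<dots> = ennreal z0 / ennreal z0" by (subst nn_integral_divide) (auto simp: z0)
    finally show ?thesis using z0 by simp
  qed
  have rho0_le: "\<rho>0 x \<le> ennreal (1 / z0)" for x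
    unfolding \<rho>0_def using z0 by (intro ennreal_leI divide_right_mono) auto
  \<comment> \<open>The reference measure \<open>mu0\<close>, relative to which the fixed point is
    constructed.\<close>
  interpret b0: bounded_density s "1 / z0" \<rho>0
    by unfold_locales (use s rho0_le rho0_int in auto)
  let ?M0 = "b0.Mr"
  have M0: "mu0 \<alpha> = ?M0"
    unfolding mu0_def b0.Mr_def exp_neg_confine z0(2) \<rho>0_def
    by (intro density_cong AE_I2) (use z0 in \<open>auto simp: divide_ennreal\<close>)
  interpret mp: mean_field_pos ?M0 b0.gs b0.Cb \<gamma> by (rule b0.mean_field_pos[OF g])
  have "\<exists>q. q \<in> borel_measurable ?M0 \<and> (\<forall>x. 0 < q x \<and> q x \<le> exp (\<gamma> * b0.Cb)) \<and> (\<integral>x. q x \<partial>?M0) = 1 \<and>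
    (\<forall>x. q x = exp (- \<gamma> * (\<integral>y. b0.gs x y * q y \<partial>?M0)) / (\<integral>x. exp (- \<gamma> * (\<integral>y. b0.gs x y * q y \<partial>?M0)) \<partial>?M0))"
  proof (rule mp.fixed_point_exists)
    fix q assume 1: "q \<in> borel_measurable ?M0" "\<And>x. 0 < q x" "\<And>x. q x \<le> exp (\<gamma> * b0.Cb)" "(\<integral>x. q x \<partial>?M0) = 1"
      and 2: "\<And>x. q x = exp (- \<gamma> * (\<integral>y. b0.gs x y * q y \<partial>?M0)) / (\<integral>x. exp (- \<gamma> * (\<integral>y. b0.gs x y * q y \<partial>?M0)) \<partial>?M0)"
    show ?thesis
    proof (intro exI[of _ q] conjI allI)
      fix x show "q x = exp (- \<gamma> * (\<integral>y. b0.gs x y * q y \<partial>?M0)) / (\<integral>x. exp (- \<gamma> * (\<integral>y. b0.gs x y * q y \<partial>?M0)) \<partial>?M0)" by (rule 2)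
    qed (rule 1)+
  qed
  then obtain q where qall: "q \<in> borel_measurable ?M0 \<and> (\<forall>x. 0 < q x \<and> q x \<le> exp (\<gamma> * b0.Cb)) \<and> (\<integral>x. q x \<partial>?M0) = 1 \<and>
    (\<forall>x. q x = exp (- \<gamma> * (\<integral>y. b0.gs x y * q y \<partial>?M0)) / (\<integral>x. exp (- \<gamma> * (\<integral>y. b0.gs x y * q y \<partial>?M0)) \<partial>?M0))"
    by (elim exE) (rule that)
  note q5 = qall[THEN conjunct2, THEN conjunct2, THEN conjunct2, rule_format]
  have q: "q \<in> borel_measurable ?M0" "0 < q x" "q x \<le> exp (\<gamma> * b0.Cb)" "(\<integral>x. q x \<partial>?M0) = 1" for x
    using qall[THEN conjunct1] qall[THEN conjunct2, THEN conjunct1] qall[THEN conjunct2, THEN conjunct2, THEN conjunct1] by blast+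
  have qm[measurable]: "q \<in> borel_measurable borel" using q(1) by simp
  have q0: "0 \<le> q x" for x using q(2)[of x] by simp
  define U where "U x = (\<integral>y. b0.gs x y * q y \<partial>?M0)" for x
  define l where "l = (\<integral>x. exp (- \<gamma> * U x) \<partial>?M0)"
  have qU: "q x = exp (- \<gamma> * U x) / l" for x using q5[of x] unfolding U_def[symmetric] l_def .
  have l: "0 < l" using q(2)[of undefined] unfolding qU by (simp add: zero_less_divide_iff)
  define \<mu> where "\<mu> = density ?M0 (\<lambda>x. ennreal (q x))"
  have qbd: "mp.bd q" by (rule mp.bdI[of _ "exp (\<gamma> * b0.Cb)"]) (use q q0 in auto)
  have pmu: "prob_space \<mu>"
  proof (rule prob_spaceI)
    have "emeasure \<mu> (space \<mu>) = (\<integral>\<^sup>+x. ennreal (q x) \<partial>?M0)" unfolding \<mu>_def by (subst emeasure_density) auto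
    also have "\<dots> = ennreal (\<integral>x. q x \<partial>?M0)" by (rule nn_integral_eq_integral[OF mp.bd_int[OF qbd]]) (simp add: q0)
    finally show "emeasure \<mu> (space \<mu>) = 1" using q(4) by simp
  qed
  \<comment> \<open>\<open>l\<close> normalizes with respect to \<open>mu0\<close>, and
    \<open>z0\<close> normalizes \<open>mu0\<close> with respect to Lebesgue measure.\<close>
  define L where "L = l * z0"
  have L: "0 < L" using l z0 by (simp add: L_def)
  define \<rho> where "\<rho> x = ennreal (exp (- \<gamma> * U x - norm x powr \<alpha>) / L)" for x
  have mu_rho: "\<mu> = density lborel \<rho>"
  proof -
    have "\<mu> = density lborel (\<lambda>x. \<rho>0 x * ennreal (q x))" unfolding \<mu>_def b0.Mr_def by (rule density_density_eq) auto
    also have "(\<lambda>x. \<rho>0 x * ennreal (q x)) = \<rho>"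
    proof (rule ext)
      fix x
      have "?w x / z0 * q x = exp (- \<gamma> * U x - norm x powr \<alpha>) / L"
        unfolding qU L_def by (simp add: exp_diff exp_minus field_simps)
      then show "\<rho>0 x * ennreal (q x) = \<rho> x" unfolding \<rho>0_def \<rho>_def using z0 q0 by (simp add: ennreal_mult[symmetric])
    qed
    finally show ?thesis .
  qed
  have Um[measurable]: "U \<in> borel_measurable borel"
    using mp.bd_meas[OF mp.bd_G[OF qbd]] unfolding mp.G_def U_def by simp
  have rhom[measurable]: "\<rho> \<in> borel_measurable borel" unfolding \<rho>_def by measurable
  have rint: "(\<integral>\<^sup>+x. \<rho> x \<partial>lborel) = 1"
    using prob_space.emeasure_space_1[OF pmu] unfolding mu_rho by (simp add: emeasure_density)
  have rle: "\<rho> x \<le> ennreal (exp (\<gamma> * b0.Cb) / z0)" for x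
  proof -
    have "exp (- \<gamma> * U x - norm x powr \<alpha>) / L = q x * (?w x / z0)"
      unfolding qU L_def by (simp add: exp_diff exp_minus field_simps)
    also have "\<dots> \<le> exp (\<gamma> * b0.Cb) * (1 / z0)" using q(3) q0 z0 by (intro mult_mono divide_right_mono) auto
    finally show ?thesis unfolding \<rho>_def by (intro ennreal_leI) simp
  qed
  \<comment> \<open>The equilibrium density inherits a bound from the fixed point, so its potential
    is bounded and vanishes at infinity as well.\<close>
  interpret b: bounded_density s "exp (\<gamma> * b0.Cb) / z0" \<rho>
    by unfold_locales (use s rle rint in auto)
  have bM: "b.Mr = \<mu>" by (simp add: b.Mr_def mu_rho)
  have Ub: "U x = (\<integral>y. b0.gs x y \<partial>\<mu>)" for x
    unfolding U_def \<mu>_def using b0.gs_meas1[of x] by (subst integral_real_density) (auto simp: q0 mult.commute)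
  have pot: "potential s \<mu> x = ennreal (U x)" for x
    unfolding potential_def Ub using b.potential_eq[of x] unfolding bM .
  have U0: "0 \<le> U x" for x unfolding Ub by (intro integral_nonneg_AE AE_I2 b0.gs_nonneg)
  have UC: "U x \<le> b.Cb" for x unfolding Ub using b.gs_bound[of x] unfolding bM .
  have mu_s[simp]: "sets \<mu> = sets borel" by (simp add: \<mu>_def)
  have Ui: "integrable \<nu> U" if "prob_space \<nu>" "sets \<nu> = sets borel" for \<nu>
  proof -
    interpret prob_space \<nu> by fact
    have "U \<in> borel_measurable \<nu>" using that(2) Um by (simp cong: measurable_cong_sets)
    then show ?thesis by (intro integrable_const_bound[of _ b.Cb]) (use U0 UC in auto)
  qed
  have lnq: "ln (q x) = - \<gamma> * U x - ln l" for x unfolding qU using l by (simp add: ln_div)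
  let ?J = "\<integral>x. U x \<partial>\<mu>"
  have energy_mu: "(\<integral>\<^sup>+x. (\<integral>\<^sup>+z. riesz s x z \<partial>\<mu>) \<partial>\<mu>) = ennreal ?J"
    unfolding potential_def[symmetric] pot by (rule nn_integral_eq_integral[OF Ui[OF pmu]]) (simp_all add: U0)
  have J0: "0 \<le> ?J" by (intro integral_nonneg_AE AE_I2 U0)
  define Fmu where "Fmu = - (\<gamma> / 2) * ?J - ln l"
  have lnq_int: "integrable \<nu> (\<lambda>x. ln (q x))" "(\<integral>x. ln (q x) \<partial>\<nu>) = - \<gamma> * (\<integral>x. U x \<partial>\<nu>) - ln l"
    if "prob_space \<nu>" "sets \<nu> = sets borel" for \<nu>
  proof -
    interpret prob_space \<nu> by fact
    show "integrable \<nu> (\<lambda>x. ln (q x))" "(\<integral>x. ln (q x) \<partial>\<nu>) = - \<gamma> * (\<integral>x. U x \<partial>\<nu>) - ln l"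
      unfolding lnq using Ui[OF that] by (auto simp: prob_space)
  qed
  have Fmu: "free_energy s \<alpha> \<gamma> \<mu> = ereal Fmu"
  proof -
    have "rel_entropy \<mu> (mu0 \<alpha>) = ereal (\<integral>x. ln (q x) \<partial>\<mu>)"
      unfolding M0 using rel_entropy_density[OF b0.Mr_prob q(1) q0] lnq_int(1)[OF pmu mu_s] by (simp add: \<mu>_def)
    then show ?thesis unfolding free_energy_def energy_mu lnq_int(2)[OF pmu mu_s] Fmu_def
      using J0 by (simp add: enn2ereal_ennreal algebra_simps)
  qed
  have main: "ereal Fmu \<le> free_energy s \<alpha> \<gamma> \<nu> \<and> (free_energy s \<alpha> \<gamma> \<nu> = ereal Fmu \<longrightarrow> \<nu> = \<mu>)"
    if annulus_law: "\<nu> \<in> borel_prob_measures" for \<nu>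
  proof (cases "free_energy s \<alpha> \<gamma> \<nu> = \<infinity>")
    case True then show ?thesis by simp
  next
    case False
    have pnu: "prob_space \<nu>" and snu: "sets \<nu> = sets borel" using annulus_law by (auto simp: borel_prob_measures_def)
    interpret annulus_law: prob_space \<nu> by (rule pnu)
    have E0: "0 \<le> ereal (\<gamma> / 2) * enn2ereal (\<integral>\<^sup>+x. (\<integral>\<^sup>+z. riesz s x z \<partial>\<nu>) \<partial>\<nu>)" using g by simp
    have "rel_entropy \<nu> (mu0 \<alpha>) \<noteq> \<infinity>" using False E0 unfolding free_energy_def by auto
    then have ac: "absolutely_continuous ?M0 \<nu>" and ie: "integrable \<nu> (entropy_density (exp 1) ?M0 \<nu>)"
      unfolding rel_entropy_def M0 by (auto split: if_splits)
    obtain f where f: "f \<in> borel_measurable ?M0" "AE x in ?M0. RN_deriv ?M0 \<nu> x = ennreal (f x)" "\<And>x. 0 \<le> f x"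
      using b0.Mr.real_RN_deriv[OF annulus_law.finite_measure_axioms ac] snu by (metis b0.Mr_sets)
    have nuf: "\<nu> = density ?M0 (\<lambda>x. ennreal (f x))"
    proof -
      have "\<nu> = density ?M0 (RN_deriv ?M0 \<nu>)" using b0.Mr.density_RN_deriv[OF ac] snu by simp
      also have "\<dots> = density ?M0 (\<lambda>x. ennreal (f x))" by (rule density_cong) (use f in auto)
      finally show ?thesis .
    qed
    have re: "rel_entropy \<nu> (mu0 \<alpha>) = (if integrable \<nu> (\<lambda>x. ln (f x)) then ereal (\<integral>x. ln (f x) \<partial>\<nu>) else \<infinity>)"
      unfolding M0 using rel_entropy_density[OF b0.Mr_prob f(1,3)] unfolding nuf[symmetric] .
    have il: "integrable \<nu> (\<lambda>x. ln (f x))" using re \<open>rel_entropy \<nu> (mu0 \<alpha>) \<noteq> \<infinity>\<close> by (auto split: if_splits)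
    have re': "rel_entropy \<nu> (mu0 \<alpha>) = ereal (\<integral>x. ln (f x) \<partial>\<nu>)" using re il by simp
    define D where "D x = f x / q x" for x
    have fm[measurable]: "f \<in> borel_measurable borel" using f(1) by simp
    have D: "D \<in> borel_measurable \<mu>" "\<And>x. 0 \<le> D x"
    proof -
      have "D \<in> borel_measurable borel" unfolding D_def by measurable
      then show "D \<in> borel_measurable \<mu>" by (simp cong: measurable_cong_sets)
    qed (use f q0 in \<open>auto simp: D_def\<close>)
    have nuD: "\<nu> = density \<mu> (\<lambda>x. ennreal (D x))"
    proof -
      have "density \<mu> (\<lambda>x. ennreal (D x)) = density ?M0 (\<lambda>x. ennreal (q x) * ennreal (D x))"
        unfolding \<mu>_def by (rule density_density_eq) (use D in \<open>auto simp: \<mu>_def\<close>)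
      also have "(\<lambda>x. ennreal (q x) * ennreal (D x)) = (\<lambda>x. ennreal (f x))"
      proof (rule ext)
        fix x show "ennreal (q x) * ennreal (D x) = ennreal (f x)"
          using q(2)[of x] D(2)[of x] by (simp add: ennreal_mult[symmetric] D_def)
      qed
      finally show ?thesis using nuf by simp
    qed
    have fpos: "AE x in \<nu>. 0 < f x" unfolding nuf using f(1) by (subst AE_density) auto
    have lnDae: "AE x in \<nu>. ln (D x) = ln (f x) - ln (q x)"
      using fpos
    proof eventually_elim
      fix x assume "0 < f x"
      then show "ln (D x) = ln (f x) - ln (q x)" using q(2)[of x] by (simp add: D_def ln_div)
    qed
    have mnu: "h \<in> borel_measurable \<nu>" if "h \<in> borel_measurable borel" for h :: "real^'n \<Rightarrow> real"
      using that snu by (simp cong: measurable_cong_sets)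
    have lnDm: "(\<lambda>x. ln (D x)) \<in> borel_measurable \<nu>" "(\<lambda>x. ln (f x) - ln (q x)) \<in> borel_measurable \<nu>"
    proof -
      have "(\<lambda>x. ln (D x)) \<in> borel_measurable borel" "(\<lambda>x. ln (f x) - ln (q x)) \<in> borel_measurable borel"
        unfolding D_def by measurable
      then show "(\<lambda>x. ln (D x)) \<in> borel_measurable \<nu>" "(\<lambda>x. ln (f x) - ln (q x)) \<in> borel_measurable \<nu>" by (auto intro: mnu)
    qed
    have iD: "integrable \<nu> (\<lambda>x. ln (D x))"
      using integrable_cong_AE[OF lnDm lnDae] il lnq_int(1)[OF pnu snu] by simp
    have vD: "(\<integral>x. ln (D x) \<partial>\<nu>) = (\<integral>x. ln (f x) \<partial>\<nu>) - (- \<gamma> * (\<integral>x. U x \<partial>\<nu>) - ln l)"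
      using integral_cong_AE[OF lnDm lnDae] il lnq_int[OF pnu snu] by simp
    interpret mu: prob_space \<mu> by (rule pmu)
    have K0: "0 \<le> (\<integral>x. ln (D x) \<partial>\<nu>)" and K1: "(\<integral>x. ln (D x) \<partial>\<nu>) = 0 \<Longrightarrow> \<nu> = \<mu>"
      using mu.gibbs_inequality[OF D] pnu iD unfolding nuD[symmetric] by auto
    let ?U = "\<integral>x. U x \<partial>\<nu>" and ?K = "\<integral>x. ln (D x) \<partial>\<nu>"
    have entropy: "rel_entropy \<nu> (mu0 \<alpha>) = ereal (?K - \<gamma> * ?U - ln l)" unfolding re' vD by simp
    \<comment> \<open>The entropy relative to \<open>mu0\<close> is the divergence \<open>?K\<close>
      from \<mu> plus the term \<open>- \<gamma> * ?U - ln l\<close>. What remains after subtracting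
      \<open>Fmu + ?K\<close> is \<open>\<gamma> / 2\<close> times the energy of
      \<open>\<nu> - \<mu>\<close>, nonnegative by \<open>riesz_psd\<close>. For
      \<open>\<gamma> = 0\<close> the energy of \<nu> may be infinite, but it is multiplied by
      0.\<close>
    have "\<exists>F. free_energy s \<alpha> \<gamma> \<nu> = ereal F \<and> Fmu + ?K \<le> F"
    proof (cases "\<gamma> = 0")
      case True
      then show ?thesis unfolding free_energy_def entropy Fmu_def by (simp flip: zero_ereal_def)
    next
      case gne: False
      then have gp: "0 < \<gamma>" using g by simp
      have "(\<integral>\<^sup>+x. (\<integral>\<^sup>+z. riesz s x z \<partial>\<nu>) \<partial>\<nu>) \<noteq> \<infinity>"
        using False gp unfolding free_energy_def entropy by auto
      then obtain J where J: "0 \<le> J" "(\<integral>\<^sup>+x. (\<integral>\<^sup>+z. riesz s x z \<partial>\<nu>) \<partial>\<nu>) = ennreal J"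
        by (cases "\<integral>\<^sup>+x. (\<integral>\<^sup>+z. riesz s x z \<partial>\<nu>) \<partial>\<nu>") auto
      have cross: "(\<integral>\<^sup>+x. (\<integral>\<^sup>+z. riesz s x z \<partial>\<mu>) \<partial>\<nu>) = ennreal ?U"
        unfolding potential_def[symmetric] pot by (rule nn_integral_eq_integral[OF Ui[OF pnu snu]]) (simp add: U0)
      have U0': "0 \<le> ?U" by (intro integral_nonneg_AE AE_I2 U0)
      have "2 * ennreal ?U \<le> ennreal J + ennreal ?J"
        using b.riesz_psd[of \<nu> \<mu>] annulus_law.sigma_finite_measure_axioms mu.sigma_finite_measure_axioms snu
        unfolding cross J energy_mu by simp
      moreover have "2 * ennreal ?U = ennreal (2 * ?U)" using U0' by (simp add: ennreal_mult)
      ultimately have "2 * ?U \<le> J + ?J" using J(1) J0 by (simp add: ennreal_plus[symmetric] del: ennreal_plus)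
      then have "\<gamma> / 2 * (2 * ?U) \<le> \<gamma> / 2 * (J + ?J)" using g by (intro mult_left_mono) auto
      then have "Fmu + ?K \<le> \<gamma> / 2 * J + (?K - \<gamma> * ?U - ln l)" unfolding Fmu_def by (simp add: algebra_simps)
      moreover have "free_energy s \<alpha> \<gamma> \<nu> = ereal (\<gamma> / 2 * J + (?K - \<gamma> * ?U - ln l))"
        unfolding free_energy_def entropy J(2) using J(1) by (simp add: enn2ereal_ennreal)
      ultimately show ?thesis by blast
    qed
    then obtain F where F: "free_energy s \<alpha> \<gamma> \<nu> = ereal F" "Fmu + ?K \<le> F" by blast
    have "ereal Fmu \<le> free_energy s \<alpha> \<gamma> \<nu>" using F(2) K0 unfolding F(1) by simp
    moreover have "\<nu> = \<mu>" if "free_energy s \<alpha> \<gamma> \<nu> = ereal Fmu"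
    proof -
      have "F = Fmu" using that unfolding F(1) by simp
      then show ?thesis using F(2) K0 by (intro K1) linarith
    qed
    ultimately show ?thesis by blast
  qed
  have mu_in: "\<mu> \<in> borel_prob_measures" using pmu by (simp add: borel_prob_measures_def)
  have "mu_min s \<alpha> \<gamma> = \<mu>"
    unfolding mu_min_def
  proof (rule the_equality)
    show "is_arg_min (free_energy s \<alpha> \<gamma>) (\<lambda>\<mu>. \<mu> \<in> borel_prob_measures) \<mu>"
      unfolding is_arg_min_def
    proof (intro conjI notI mu_in)
      assume "\<exists>y :: (real^'n) measure. y \<in> borel_prob_measures \<and> free_energy s \<alpha> \<gamma> y < free_energy s \<alpha> \<gamma> \<mu>"
      then obtain y :: "(real^'n) measure" where y: "y \<in> borel_prob_measures" "free_energy s \<alpha> \<gamma> y < ereal Fmu" unfolding Fmu by blast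
      show False using main[OF y(1), THEN conjunct1] y(2) by simp
    qed
    fix \<nu> :: "(real^'n) measure" assume "is_arg_min (free_energy s \<alpha> \<gamma>) (\<lambda>\<mu>. \<mu> \<in> borel_prob_measures) \<nu>"
    then have annulus_law: "\<nu> \<in> borel_prob_measures" and le: "\<not> free_energy s \<alpha> \<gamma> \<mu> < free_energy s \<alpha> \<gamma> \<nu>"
      using mu_in unfolding is_arg_min_def by blast+
    have "free_energy s \<alpha> \<gamma> \<nu> = ereal Fmu"
      using le main[OF annulus_law, THEN conjunct1] unfolding Fmu by (simp add: not_less)
    then show "\<nu> = \<mu>" by (rule main[OF annulus_law, THEN conjunct2, rule_format])
  qed
  then have "L_const TYPE('n) s \<alpha> \<gamma> = enn2real (\<integral>\<^sup>+x. exp_neg (ennreal \<gamma> * ennreal (U x) + confine \<alpha> x) \<partial>lborel)"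
    by (simp add: L_const_def pot)
  also have "(\<integral>\<^sup>+x. exp_neg (ennreal \<gamma> * ennreal (U x) + confine \<alpha> x) \<partial>lborel) = (\<integral>\<^sup>+x. ennreal L * \<rho> x \<partial>lborel)"
  proof (rule nn_integral_cong)
    fix x
    have "ennreal \<gamma> * ennreal (U x) + confine \<alpha> x = ennreal (\<gamma> * U x + norm x powr \<alpha>)"
      unfolding confine_def using g U0 by (simp add: ennreal_mult)
    also have "exp_neg \<dots> = ennreal (exp (- (\<gamma> * U x + norm x powr \<alpha>)))" by (rule exp_neg_ennreal) (use g U0 in simp)
    also have "\<dots> = ennreal L * \<rho> x" unfolding \<rho>_def using L by (simp add: ennreal_mult[symmetric])
    finally show "exp_neg (ennreal \<gamma> * ennreal (U x) + confine \<alpha> x) = ennreal L * \<rho> x" .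
  qed
  also have "\<dots> = ennreal L" by (subst nn_integral_cmult) (auto simp: rint)
  finally have Lc: "L_const TYPE('n) s \<alpha> \<gamma> = L" using L by simp
  have rho: "\<rho> = (\<lambda>x. ennreal (exp (- \<gamma> * U x - norm x powr \<alpha>) / L))" by (rule ext) (rule \<rho>_def)
  show thesis
  proof (rule that[OF L Lc])
    show "bounded_density s (exp (\<gamma> * b0.Cb) / z0) (\<lambda>x. ennreal (exp (- \<gamma> * U x - norm x powr \<alpha>) / L))"
      using b.bounded_density_axioms unfolding rho .
    fix x
    have "U x = (\<integral>y. b0.gs x y \<partial>density lborel \<rho>)" using Ub[of x] unfolding mu_rho .
    then show "U x = (\<integral>y. norm (x - y) powr (- s) \<partial>density lborel (\<lambda>x. ennreal (exp (- \<gamma> * U x - norm x powr \<alpha>) / L)))"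
      unfolding rho b0.gs_def .
  qed
qed

section \<open>The Gibbs measure\<close>

lemma PiM_density_lborel:
  fixes \<rho> :: "'b::euclidean_space \<Rightarrow> ennreal" and I :: "'i set"
  assumes r[measurable]: "\<rho> \<in> borel_measurable borel" and p: "prob_space (density lborel \<rho>)" and I: "finite I"
  shows "PiM I (\<lambda>_. density lborel \<rho>) = density (PiM I (\<lambda>_. lborel)) (\<lambda>x. \<Prod>i\<in>I. \<rho> (x i))"
proof -
  interpret l: product_sigma_finite "\<lambda>_::'i. lborel :: 'b measure" by unfold_locales
  interpret d: product_sigma_finite "\<lambda>_::'i. density lborel \<rho>"
    by (intro product_sigma_finite.intro prob_space_imp_sigma_finite p)
  have c: "(\<lambda>x. \<rho> (x i)) \<in> borel_measurable (PiM I (\<lambda>_. lborel))" if "i \<in> I" for i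
    by (rule measurable_compose[OF _ r]) (use measurable_component_singleton[OF that, of "\<lambda>_. lborel :: 'b measure"] in simp)
  show ?thesis
  proof (rule d.PiM_eqI[OF I, symmetric])
    show "sets (density (PiM I (\<lambda>_. lborel)) (\<lambda>x. \<Prod>i\<in>I. \<rho> (x i))) = sets (PiM I (\<lambda>_. density lborel \<rho>))"
      by (simp, rule sets_PiM_cong) auto
    fix A :: "'i \<Rightarrow> 'b set" assume A: "\<And>i. i \<in> I \<Longrightarrow> A i \<in> sets (density lborel \<rho>)"
    then have A': "\<And>i. i \<in> I \<Longrightarrow> A i \<in> sets borel" by simp
    have "emeasure (density (PiM I (\<lambda>_. lborel)) (\<lambda>x. \<Prod>i\<in>I. \<rho> (x i))) (Pi\<^sub>E I A) =
      (\<integral>\<^sup>+x. (\<Prod>i\<in>I. \<rho> (x i)) * indicator (Pi\<^sub>E I A) x \<partial>PiM I (\<lambda>_. lborel))"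
      by (rule emeasure_density) (use A' I c in \<open>auto intro!: sets_PiM_I_finite borel_measurable_prod_ennreal\<close>)
    also have "\<dots> = (\<integral>\<^sup>+x. (\<Prod>i\<in>I. \<rho> (x i) * indicator (A i) (x i)) \<partial>PiM I (\<lambda>_. lborel))"
    proof (rule nn_integral_cong)
      fix x assume "x \<in> space (PiM I (\<lambda>_. lborel :: 'b measure))"
      then have "indicator (Pi\<^sub>E I A) x = (\<Prod>i\<in>I. indicator (A i) (x i) :: ennreal)"
        using I by (auto simp: space_PiM PiE_def Pi_iff indicator_def)
      then show "(\<Prod>i\<in>I. \<rho> (x i)) * indicator (Pi\<^sub>E I A) x = (\<Prod>i\<in>I. \<rho> (x i) * indicator (A i) (x i))"
        by (simp add: prod.distrib)
    qed
    also have "\<dots> = (\<Prod>i\<in>I. \<integral>\<^sup>+x. \<rho> x * indicator (A i) x \<partial>lborel)"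
      by (rule l.product_nn_integral_prod[OF I]) (use A' in measurable)
    also have "\<dots> = (\<Prod>i\<in>I. emeasure (density lborel \<rho>) (A i))"
      using A' by (intro prod.cong) (auto simp: emeasure_density)
    finally show "emeasure (density (PiM I (\<lambda>_. lborel)) (\<lambda>x. \<Prod>i\<in>I. \<rho> (x i))) (Pi\<^sub>E I A) = (\<Prod>i\<in>I. emeasure (density lborel \<rho>) (A i))" .
  qed
qed

text \<open>Coincidences of particles are the configurations on which \<open>riesz\<close> and
  \<open>gs\<close> disagree; by Fubini they are a null set because points are.\<close>

lemma AE_PiM_lborel_distinct:
  fixes i j :: 'i
  assumes I: "finite I" "i \<in> I" "j \<in> I" "i \<noteq> j"
  shows "AE x in PiM I (\<lambda>_. lborel :: 'b::euclidean_space measure). x i \<noteq> x j"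
proof -
  interpret l: product_sigma_finite "\<lambda>_::'i. lborel :: 'b measure" by unfold_locales
  let ?P = "PiM I (\<lambda>_. lborel :: 'b measure)"
  let ?f = "\<lambda>x :: 'i \<Rightarrow> 'b. indicator {x. x i = x j} x :: ennreal"
  have eq: "insert i (I - {i}) = I" using I by auto
  have c: "(\<lambda>x. x i) \<in> borel_measurable ?P" "(\<lambda>x. x j) \<in> borel_measurable ?P"
    using measurable_component_singleton[OF I(2), of "\<lambda>_. lborel :: 'b measure"] measurable_component_singleton[OF I(3), of "\<lambda>_. lborel :: 'b measure"] by simp_all
  have S: "{x \<in> space ?P. x i = x j} \<in> sets ?P"
  proof -
    have "{x \<in> space ?P. x i - x j = 0} \<in> sets ?P"
      using measurable_sets[OF borel_measurable_diff[OF c], of "{0}"] by (simp add: vimage_def Int_def conj_commute)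
    then show ?thesis by simp
  qed
  have m: "?f \<in> borel_measurable ?P"
    using S by (subst borel_measurable_indicator_iff) (simp add: Int_def conj_commute)
  have "(\<integral>\<^sup>+x. ?f x \<partial>PiM (insert i (I - {i})) (\<lambda>_. lborel :: 'b measure)) = (\<integral>\<^sup>+x. \<integral>\<^sup>+y. ?f (x(i := y)) \<partial>lborel \<partial>PiM (I - {i}) (\<lambda>_. lborel))"
  proof -
    have "finite (I - {i})" "i \<notin> I - {i}" "?f \<in> borel_measurable (PiM (insert i (I - {i})) (\<lambda>_. lborel :: 'b measure))" using I m eq by auto
    from l.product_nn_integral_insert[OF this] show ?thesis by simp
  qed
  also have "\<dots> = (\<integral>\<^sup>+x. 0 \<partial>PiM (I - {i}) (\<lambda>_. lborel :: 'b measure))"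
  proof (rule nn_integral_cong)
    fix x :: "'i \<Rightarrow> 'b"
    have "(\<integral>\<^sup>+y. ?f (x(i := y)) \<partial>lborel) = (\<integral>\<^sup>+y. indicator {x j} y \<partial>lborel)"
      using I by (intro nn_integral_cong) (auto simp: indicator_def)
    then show "(\<integral>\<^sup>+y. ?f (x(i := y)) \<partial>lborel) = 0" by simp
  qed
  finally have "(\<integral>\<^sup>+x. ?f x \<partial>?P) = 0" unfolding eq by simp
  then have "AE x in ?P. ?f x = 0" using m by (simp add: nn_integral_0_iff_AE)
  then show ?thesis by eventually_elim (auto simp: indicator_def split: if_splits)
qed

lemma (in mean_field) W_lessThan: "W {..<N} x = (\<Sum>j<N. \<Sum>i<j. g (x i) (x j))"
proof (induction N)
  case 0 then show ?case by (simp add: W_def)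
next
  case (Suc N)
  have "W {..<Suc N} x = W {..<N} x + (\<Sum>i<N. g (x i) (x N))"
    using W_insert[of "{..<N}" N x "x N"] by (simp add: lessThan_Suc)
  then show ?case using Suc by simp
qed

lemma exp_neg_measurable[measurable]: "exp_neg \<in> borel_measurable borel"
  unfolding exp_neg_def by measurable

lemma boltzmann_measurable:
  assumes "0 < s"
  shows "boltzmann s \<alpha> b N \<in> borel_measurable (lebesgue_config N :: (nat \<Rightarrow> real^'n) measure)"
proof -
  have c: "(\<lambda>x. x i) \<in> measurable (lebesgue_config N) (borel :: (real^'n) measure)" if "i < N" for i
    using measurable_component_singleton[of i "{..<N}" "\<lambda>_. lborel :: (real^'n) measure"] that by simp
  have r: "(\<lambda>x. riesz s (x i) (x j)) \<in> borel_measurable (lebesgue_config N :: (nat \<Rightarrow> real^'n) measure)" if "i < N" "j < N" for i j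
    using measurable_compose[OF measurable_Pair[OF c[OF that(1)] c[OF that(2)]] riesz_measurable[OF assms]] by simp
  have f: "(\<lambda>x. confine \<alpha> (x j)) \<in> borel_measurable (lebesgue_config N :: (nat \<Rightarrow> real^'n) measure)" if "j < N" for j
    using c[OF that] unfolding confine_def by measurable
  show ?thesis unfolding boltzmann_def
    by (rule measurable_compose[OF _ exp_neg_measurable], intro borel_measurable_add borel_measurable_times_ennreal borel_measurable_const borel_measurable_sum r f) auto
qed

locale gibbs_setting = bounded_density s d \<rho>
  for s d :: real and \<rho> :: "real^'n::finite \<Rightarrow> ennreal" +
  fixes \<gamma> \<alpha> L :: real and Uf :: "real^'n \<Rightarrow> real"
  assumes gam: "0 \<le> \<gamma>" and Lp: "0 < L" and alp: "0 < \<alpha>"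
    and rho: "\<And>x. \<rho> x = ennreal (exp (- \<gamma> * Uf x - norm x powr \<alpha>) / L)"
    and Uf: "\<And>x. Uf x = (\<integral>y. norm (x - y) powr (- s) \<partial>density lborel \<rho>)"
begin

sublocale mf: mean_field_psd Mr gs Cb \<gamma> by (rule mean_field_psd[OF gam])

lemma U_Uf: "mf.U x = Uf x"
proof -
  have "mf.U x = (\<integral>y. gs x y \<partial>Mr)" by (rule mf.U_def)
  also have "\<dots> = Uf x" unfolding gs_def Mr_def by (rule Uf[symmetric])
  finally show ?thesis .
qed

text \<open>Solving the equilibrium equation for \<open>exp (- V)\<close> gives
  \<open>L * \<rho> * exp (\<gamma> * Uf)\<close> at each particle. The factors \<rho> build the
  product measure and the exponentials enter \<open>mf.wt\<close>.\<close>

lemma boltzmann_ae: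
  assumes b: "0 \<le> b"
  shows "AE x in lebesgue_config N. boltzmann s \<alpha> b N x = ennreal (L ^ N * mf.wt b {..<N} x) * (\<Prod>i<N. \<rho> (x i))"
proof -
  have "AE x in lebesgue_config N. i < N \<longrightarrow> j < N \<longrightarrow> i \<noteq> j \<longrightarrow> x i \<noteq> (x j :: real^'n)" for i j
  proof (cases "i < N \<and> j < N \<and> i \<noteq> j")
    case True then show ?thesis using AE_PiM_lborel_distinct[of "{..<N}" i j, where 'b="real^'n"] by simp
  qed auto
  then have "AE x in lebesgue_config N. \<forall>i j. i < N \<longrightarrow> j < N \<longrightarrow> i \<noteq> j \<longrightarrow> x i \<noteq> (x j :: real^'n)"
    by (simp add: AE_all_countable)
  then show ?thesis
  proof eventually_elim
    fix x :: "nat \<Rightarrow> real^'n" assume x: "\<forall>i j. i < N \<longrightarrow> j < N \<longrightarrow> i \<noteq> j \<longrightarrow> x i \<noteq> x j"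
    have "(\<Sum>j<N. \<Sum>i<j. riesz s (x i) (x j)) = (\<Sum>j<N. \<Sum>i<j. ennreal (gs (x i) (x j)))"
      using x by (intro sum.cong refl) (auto simp: riesz_off_diagonal gs_def)
    also have "\<dots> = ennreal (mf.W {..<N} x)" unfolding mf.W_lessThan by (simp add: sum_ennreal gs_nonneg sum_nonneg)
    finally have 1: "(\<Sum>j<N. \<Sum>i<j. riesz s (x i) (x j)) = ennreal (mf.W {..<N} x)" .
    let ?V = "\<Sum>j<N. norm (x j) powr \<alpha>"
    have 2: "(\<Sum>j<N. confine \<alpha> (x j)) = ennreal ?V" unfolding confine_def by (simp add: sum_ennreal)
    have V0: "0 \<le> ?V" by (intro sum_nonneg) simp
    have "boltzmann s \<alpha> b N x = exp_neg (ennreal (b * mf.W {..<N} x + ?V))"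
      unfolding boltzmann_def 1 2 using b mf.W_nonneg[of "{..<N}" x] V0 by (simp add: ennreal_mult)
    also have "\<dots> = ennreal (exp (- (b * mf.W {..<N} x + ?V)))"
      using b mf.W_nonneg[of "{..<N}" x] V0 by (intro exp_neg_ennreal) simp
    also have "exp (- (b * mf.W {..<N} x + ?V)) = (L ^ N * mf.wt b {..<N} x) * (\<Prod>i<N. exp (- \<gamma> * Uf (x i) - norm (x i) powr \<alpha>) / L)"
    proof -
      have "(\<Prod>i<N. exp (- \<gamma> * Uf (x i) - norm (x i) powr \<alpha>) / L) = exp (\<Sum>i<N. - \<gamma> * Uf (x i) - norm (x i) powr \<alpha>) / L ^ N"
        by (simp add: prod_dividef exp_sum)
      also have "(\<Sum>i<N. - \<gamma> * Uf (x i) - norm (x i) powr \<alpha>) = - \<gamma> * (\<Sum>i<N. Uf (x i)) - ?V"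
        by (simp add: sum_subtractf sum_distrib_left sum_negf)
      finally show ?thesis using Lp unfolding mf.wt_def U_Uf by (simp add: exp_add[symmetric])
    qed
    also have "ennreal \<dots> = ennreal (L ^ N * mf.wt b {..<N} x) * ennreal (\<Prod>i<N. exp (- \<gamma> * Uf (x i) - norm (x i) powr \<alpha>) / L)"
      by (rule ennreal_mult) (use Lp mf.wt_pos[of b "{..<N}" x] in \<open>auto intro!: prod_nonneg simp: less_imp_le\<close>)
    also have "ennreal (\<Prod>i<N. exp (- \<gamma> * Uf (x i) - norm (x i) powr \<alpha>) / L) = (\<Prod>i<N. \<rho> (x i))"
      unfolding rho using Lp by (intro prod_ennreal[symmetric]) auto
    finally show "boltzmann s \<alpha> b N x = ennreal (L ^ N * mf.wt b {..<N} x) * (\<Prod>i<N. \<rho> (x i))" .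
  qed
qed

lemma config_eq: "PiM {..<N} (\<lambda>_. Mr) = density (lebesgue_config N) (\<lambda>x. \<Prod>i<N. \<rho> (x i))"
  unfolding Mr_def by (rule PiM_density_lborel[OF rho_meas Mr_prob[unfolded Mr_def]]) simp

lemma config_sets: "sets (PiM {..<N} (\<lambda>_. Mr)) = sets (lebesgue_config N)"
  by (rule sets_PiM_cong) auto

lemma boltzmann_integral:
  assumes b: "0 \<le> b" and F: "F \<in> borel_measurable (lebesgue_config N)" "\<And>x. 0 \<le> F x" "\<And>x. F x \<le> 1"
  shows "(\<integral>\<^sup>+x. ennreal (F x) * boltzmann s \<alpha> b N x \<partial>lebesgue_config N) = ennreal (L ^ N * (\<integral>x. mf.wt b {..<N} x * F x \<partial>PiM {..<N} (\<lambda>_. Mr)))"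
proof -
  let ?R = "\<lambda>x. \<Prod>i<N. \<rho> (x i)"
  let ?M = "PiM {..<N} (\<lambda>_. Mr)"
  have Fm: "F \<in> borel_measurable ?M" using F(1) by (simp add: measurable_cong_sets[OF config_sets refl])
  have wm: "mf.wt b {..<N} \<in> borel_measurable (lebesgue_config N)"
    using mf.wt_meas[of b "{..<N}"] by (simp add: measurable_cong_sets[OF config_sets refl])
  have c: "(\<lambda>x. \<rho> (x i)) \<in> borel_measurable (lebesgue_config N)" if "i < N" for i
    by (rule measurable_compose[OF _ rho_meas]) (use measurable_component_singleton[of i "{..<N}" "\<lambda>_. lborel :: (real^'n) measure"] that in simp)
  have Rm: "?R \<in> borel_measurable (lebesgue_config N)" by (rule borel_measurable_prod_ennreal) (simp add: c)
  have w0: "0 \<le> mf.wt b {..<N} x" for x using mf.wt_pos[of b "{..<N}" x] by simp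
  have "(\<integral>\<^sup>+x. ennreal (F x) * boltzmann s \<alpha> b N x \<partial>lebesgue_config N) =
    (\<integral>\<^sup>+x. ?R x * ennreal (L ^ N * (mf.wt b {..<N} x * F x)) \<partial>lebesgue_config N)"
  proof (rule nn_integral_cong_AE, rule eventually_mono[OF boltzmann_ae[OF b, of N]])
    fix x assume *: "boltzmann s \<alpha> b N x = ennreal (L ^ N * mf.wt b {..<N} x) * ?R x"
    have "ennreal (L ^ N * (mf.wt b {..<N} x * F x)) = ennreal (F x) * ennreal (L ^ N * mf.wt b {..<N} x)"
      using F w0 Lp by (subst ennreal_mult[symmetric]) (auto simp: mult_ac)
    then show "ennreal (F x) * boltzmann s \<alpha> b N x = ?R x * ennreal (L ^ N * (mf.wt b {..<N} x * F x))"
      unfolding * by (simp add: mult_ac)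
  qed
  also have "\<dots> = (\<integral>\<^sup>+x. ennreal (L ^ N * (mf.wt b {..<N} x * F x)) \<partial>?M)"
    unfolding config_eq by (rule nn_integral_density[symmetric]) (use Rm wm F(1) in measurable)
  also have "\<dots> = ennreal (\<integral>x. L ^ N * (mf.wt b {..<N} x * F x) \<partial>?M)"
  proof (rule nn_integral_eq_integral)
    have "integrable ?M (\<lambda>x. mf.wt b {..<N} x * F x)"
    proof (rule mf.integrable_PiM_bounded[where B="exp (\<gamma> * (card {..<N} * Cb))"])
      show "(\<lambda>x. mf.wt b {..<N} x * F x) \<in> borel_measurable ?M" using Fm mf.wt_meas by measurable
      fix x have "mf.wt b {..<N} x * F x \<le> exp (\<gamma> * (card {..<N} * Cb)) * 1"
        by (intro mult_mono mf.wt_le b F) (use F in auto)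
      then show "\<bar>mf.wt b {..<N} x * F x\<bar> \<le> exp (\<gamma> * (card {..<N} * Cb))" using w0[of x] F(2)[of x] by simp
    qed
    then show "integrable ?M (\<lambda>x. L ^ N * (mf.wt b {..<N} x * F x))" by simp
    show "AE x in ?M. 0 \<le> L ^ N * (mf.wt b {..<N} x * F x)" using w0 F Lp by simp
  qed
  finally show ?thesis by simp
qed

lemma gibbs_Z_eq: assumes b: "0 \<le> b" shows "gibbs_Z TYPE('n) s \<alpha> b N = ennreal (L ^ N * mf.zpart b N)"
  using boltzmann_integral[OF b, of "\<lambda>_. 1" N] by (simp add: gibbs_Z_def mf.zpart_eq)

text \<open>The power of \<open>L\<close> cancels between the integral and \<open>gibbs_Z\<close>,
  which leaves a quotient of mean-field quantities.\<close>

lemma gibbs_integral: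
  assumes b: "0 \<le> b" and F: "F \<in> borel_measurable (lebesgue_config N)" "\<And>x. 0 \<le> F x" "\<And>x. F x \<le> 1"
  shows "(\<integral>x. F x \<partial>gibbs s \<alpha> b N) = (\<integral>x. mf.wt b {..<N} x * F x \<partial>PiM {..<N} (\<lambda>_. Mr)) / mf.zpart b N"
proof -
  let ?Z = "gibbs_Z TYPE('n) s \<alpha> b N" and ?z = "L ^ N * mf.zpart b N"
  have z: "0 < ?z" using Lp mf.zpart_pos[OF b, of N] by simp
  have bm: "boltzmann s \<alpha> b N \<in> borel_measurable (lebesgue_config N :: (nat \<Rightarrow> real^'n) measure)" by (rule boltzmann_measurable[OF s0])
  have i0: "0 \<le> (\<integral>x. mf.wt b {..<N} x * F x \<partial>PiM {..<N} (\<lambda>_. Mr))"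
    by (intro integral_nonneg_AE AE_I2 mult_nonneg_nonneg F) (simp add: mf.wt_pos less_imp_le)
  have "(\<integral>\<^sup>+x. ennreal (F x) \<partial>gibbs s \<alpha> b N) = (\<integral>\<^sup>+x. boltzmann s \<alpha> b N x / ?Z * ennreal (F x) \<partial>lebesgue_config N)"
    unfolding gibbs_def by (rule nn_integral_density) (use bm F(1) in measurable)
  also have "\<dots> = (\<integral>\<^sup>+x. ennreal (F x) * boltzmann s \<alpha> b N x / ?Z \<partial>lebesgue_config N)"
    by (simp add: ennreal_times_divide mult.commute)
  also have "\<dots> = (\<integral>\<^sup>+x. ennreal (F x) * boltzmann s \<alpha> b N x \<partial>lebesgue_config N) / ?Z"
    by (rule nn_integral_divide) (use bm F(1) in measurable)
  also have "\<dots> = ennreal (L ^ N * (\<integral>x. mf.wt b {..<N} x * F x \<partial>PiM {..<N} (\<lambda>_. Mr)) / ?z)"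
    unfolding boltzmann_integral[OF b F] gibbs_Z_eq[OF b] using z i0 Lp by (subst divide_ennreal) auto
  also have "L ^ N * (\<integral>x. mf.wt b {..<N} x * F x \<partial>PiM {..<N} (\<lambda>_. Mr)) / ?z = (\<integral>x. mf.wt b {..<N} x * F x \<partial>PiM {..<N} (\<lambda>_. Mr)) / mf.zpart b N"
    using Lp by simp
  finally have 1: "(\<integral>\<^sup>+x. ennreal (F x) \<partial>gibbs s \<alpha> b N) = ennreal ((\<integral>x. mf.wt b {..<N} x * F x \<partial>PiM {..<N} (\<lambda>_. Mr)) / mf.zpart b N)" .
  have Fg: "F \<in> borel_measurable (gibbs s \<alpha> b N)" using F(1) by (simp add: gibbs_def)
  show ?thesis using Fg F(2) i0 mf.zpart_pos[OF b, of N] 1 by (subst integral_eq_nn_integral) auto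
qed

lemma sum_dirac_integral:
  fixes f :: "real^'n \<Rightarrow> real"
  assumes "f \<in> borel_measurable borel"
  shows "(\<integral>x. f x \<partial>sum_dirac N y) = (\<Sum>j<N. f (y j))"
  unfolding sum_dirac_def using assms by (subst integral_distr) (auto simp: lebesgue_integral_count_space_finite)

lemma hint_lborel:
  assumes h: "h \<in> borel_measurable borel"
  shows "mf.Hint h = (\<integral>x. h x * (exp (- (norm x powr \<alpha>)) / L) \<partial>lborel)"
proof -
  have Um: "Uf \<in> borel_measurable borel" using mf.U_meas ext[of mf.U Uf, OF U_Uf] by simp
  have MrL: "Mr = density lborel (\<lambda>x. ennreal (exp (- \<gamma> * Uf x - norm x powr \<alpha>) / L))"
    unfolding Mr_def by (rule arg_cong[where f="density lborel"]) (rule ext, rule rho)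
  have "mf.Hint h = (\<integral>x. h x * exp (\<gamma> * Uf x) \<partial>Mr)" by (simp only: mf.Hint_def U_Uf)
  also have "\<dots> = (\<integral>x. (exp (- \<gamma> * Uf x - norm x powr \<alpha>) / L) * (h x * exp (\<gamma> * Uf x)) \<partial>lborel)"
    unfolding MrL using h Um Lp by (subst integral_real_density) auto
  also have "\<dots> = (\<integral>x. h x * (exp (- (norm x powr \<alpha>)) / L) \<partial>lborel)"
    by (intro Bochner_Integration.integral_cong refl) (simp add: exp_diff exp_minus field_simps)
  finally show ?thesis .
qed

end

section \<open>The Poisson limit of the rescaled configuration\<close>

theorem theorem1p7:
  fixes s \<gamma> \<alpha> :: real
    and \<beta> :: "nat \<Rightarrow> real"
    and k :: "'n::finite"
    and \<upsilon> :: "real ^ 'n"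
    and \<psi> :: "real ^ 'n ^ 'n"
    and \<eta> :: "nat \<Rightarrow> real"
    and \<phi> :: "nat \<Rightarrow> real ^ 'n \<Rightarrow> real ^ 'n"
  assumes "0 < s" and "s < real CARD('n)" and "0 \<le> \<gamma>" and "0 < \<alpha>"
    and "\<And>N. 0 < \<beta> N"
    and "(\<lambda>N. real N * \<beta> N) \<longlonglongrightarrow> \<gamma>"
    and "norm \<upsilon> = 1"
    and "rotation_matrix \<psi>" and "\<psi> *v axis k 1 = \<upsilon>"
  defines "\<eta> \<equiv> eta \<alpha> (L_const TYPE('n) s \<alpha> \<gamma>) CARD('n)"
    and "\<phi> \<equiv> \<lambda>N. rescaling \<alpha> (\<eta> N) \<upsilon> \<psi>"
  shows "\<exists>(\<Omega> :: (real ^ 'n) measure measure) \<Xi>.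
    poisson_process \<Omega> \<Xi> (\<lambda>x. exp (- (axis k 1 \<bullet> x))) \<and>
    converges_in_distribution
      (\<lambda>N. gibbs s \<alpha> (\<beta> N) N) (\<lambda>N x. sum_dirac N (\<lambda>j. inv (\<phi> N) (x j))) \<Omega> \<Xi>"
proof -
  obtain L d :: real and U :: "real^'n \<Rightarrow> real" where L: "0 < L" "L_const TYPE('n) s \<alpha> \<gamma> = L"
    and bd: "bounded_density s d (\<lambda>x. ennreal (exp (- \<gamma> * U x - norm x powr \<alpha>) / L))"
    and U: "\<And>x. U x = (\<integral>y. norm (x - y) powr (- s) \<partial>density lborel (\<lambda>x. ennreal (exp (- \<gamma> * U x - norm x powr \<alpha>) / L)))"
    by (rule equilibrium_measure[OF assms(1-4)]) (rule that)
  define \<rho> where "\<rho> x = ennreal (exp (- \<gamma> * U x - norm x powr \<alpha>) / L)" for x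
  interpret g: gibbs_setting s d \<rho> \<gamma> \<alpha> L U
  proof (intro gibbs_setting.intro gibbs_setting_axioms.intro assms L)
    show "bounded_density s d \<rho>" using bd unfolding \<rho>_def[abs_def] .
    show "\<rho> x = ennreal (exp (- \<gamma> * U x - norm x powr \<alpha>) / L)" for x by (rule \<rho>_def)
    show "U x = (\<integral>y. norm (x - y) powr (- s) \<partial>density lborel \<rho>)" for x using U[of x] unfolding \<rho>_def[abs_def] .
  qed
  interpret lim: mean_field_limit g.Mr g.gs g.Cb \<gamma> \<beta>
    by (intro mean_field_limit.intro mean_field_limit_axioms.intro g.mean_field_psd assms)
  interpret sc: extreme_scaling \<alpha> L "CARD('n)" k \<upsilon> \<psi>
    by unfold_locales (use assms L in auto)
  interpret pc: poisson_construction "\<lambda>x. exp (- (axis k 1 \<bullet> x))"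
  proof
    show "integrable lborel (\<lambda>x. exp (- (axis k 1 \<bullet> x)) * indicator (cball 0 r) (x::real^'n))" for r
    proof -
      have "integrable lborel (\<lambda>x. indicator (cball 0 r) (x::real^'n) *\<^sub>R exp (- (axis k 1 \<bullet> x)))"
        by (rule borel_integrable_compact) (auto intro!: continuous_intros)
      then show ?thesis by (simp add: mult.commute)
    qed
  qed auto
  obtain \<Omega> :: "(real^'n) measure measure" and \<Xi> where P: "poisson_process \<Omega> \<Xi> (\<lambda>x. exp (- (axis k 1 \<bullet> x)))"
    using pc.poisson_process_exists by blast
  have et: "\<eta> N = eta \<alpha> L CARD('n) N" for N by (simp add: \<eta>_def L)
  have phi: "\<phi> N = rescaling \<alpha> (eta \<alpha> L CARD('n) N) \<upsilon> \<psi>" for N by (simp add: \<phi>_def et)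
  note ep = eta_pos[OF assms(4) L(1), of "CARD('n)"]
  have "(\<lambda>N. laplace_functional (gibbs s \<alpha> (\<beta> N) N) (\<lambda>x. sum_dirac N (\<lambda>j. inv (\<phi> N) (x j))) f) \<longlonglongrightarrow> laplace_functional \<Omega> \<Xi> f"
    if f: "f \<in> test_functions" for f
  proof -
    \<comment> \<open>The Laplace functional of the configuration is the mean of the product of
      \<open>1 - F\<close> over the rescaled particles.\<close>
    define F where "F y = 1 - exp (- f y)" for y
    have fm[measurable]: "f \<in> borel_measurable borel" and f0: "\<And>y. 0 \<le> f y"
      using f by (auto simp: test_functions_def intro: borel_measurable_continuous_onI)
    have "bounded (closure {x. f x \<noteq> 0})" using f compact_imp_bounded by (auto simp: test_functions_def)
    then obtain R where R: "\<And>x. x \<in> closure {x. f x \<noteq> 0} \<Longrightarrow> norm x \<le> R" unfolding bounded_iff by blast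
    have FR: "norm y \<le> R" if "F y \<noteq> 0" for y
    proof (rule R)
      have "f y \<noteq> 0" using that by (auto simp: F_def)
      then show "y \<in> closure {x. f x \<noteq> 0}" by (intro subsetD[OF closure_subset]) simp
    qed
    have Fm: "F \<in> borel_measurable borel" unfolding F_def by measurable
    have F01: "0 \<le> F y" "F y \<le> 1" for y using f0[of y] by (auto simp: F_def)
    \<comment> \<open>\<open>eta\<close> is positive only eventually; before that \<phi> is constant
      and \<open>inv\<close> carries no meaning, so \<open>h N\<close> is set to 0.\<close>
    define h where "h N x = (if 0 < eta \<alpha> L CARD('n) N then F (inv (\<phi> N) x) else 0)" for N x
    have hm: "h N \<in> borel_measurable borel" for N
    proof (cases "0 < eta \<alpha> L CARD('n) N")
      case True
      then have "h N = (\<lambda>x. F (inv (\<phi> N) x))" by (auto simp: h_def)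
      then show ?thesis using measurable_compose[OF sc.inv_phi_meas[OF True] Fm] by (simp add: phi)
    qed (simp add: h_def[abs_def])
    have h01: "0 \<le> h N x" "h N x \<le> 1" for N x using F01 by (auto simp: h_def)
    define lam where "lam = (\<integral>y. F y * exp (- (axis k 1 \<bullet> y)) \<partial>lborel)"
    have NH: "(\<lambda>N. real N * g.mf.Hint (h N)) \<longlonglongrightarrow> lam"
    proof -
      have "(\<lambda>N. real N * (\<integral>x. F (inv (\<phi> N) x) * (exp (- (norm x powr \<alpha>)) / L) \<partial>lborel)) \<longlonglongrightarrow> lam"
        unfolding phi lam_def by (rule sc.intensity_limit[OF Fm F01 FR])
      moreover have "\<forall>\<^sub>F N in sequentially. real N * (\<integral>x. F (inv (\<phi> N) x) * (exp (- (norm x powr \<alpha>)) / L) \<partial>lborel) = real N * g.mf.Hint (h N)"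
        using ep by eventually_elim (simp add: g.hint_lborel[OF hm] h_def)
      ultimately show ?thesis by (rule Lim_transform_eventually)
    qed
    have far: "\<forall>\<^sub>F N in sequentially. \<forall>x. h N x \<noteq> 0 \<longrightarrow> B \<le> norm x" for B
      using ep sc.phi_far[of R B]
    proof eventually_elim
      case (elim N)
      show ?case
      proof (intro allI impI)
        fix x assume "h N x \<noteq> 0"
        then have y: "norm (inv (\<phi> N) x) \<le> R" using FR by (simp add: h_def split: if_splits)
        have "\<phi> N (inv (\<phi> N) x) = x"
        proof -
          have "surj (\<phi> N)"
          proof (rule surjI)
            fix z
            have "eta \<alpha> L CARD('n) N *\<^sub>R \<upsilon> + sc.cN N *\<^sub>R (\<psi> *v ((1 / sc.cN N) *\<^sub>R (transpose \<psi> *v (z - eta \<alpha> L CARD('n) N *\<^sub>R \<upsilon>)))) = z"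
            proof -
              have "\<psi> *v (transpose \<psi> *v w) = w" for w
                using sc.orth by (simp add: matrix_vector_mul_assoc orthogonal_matrix_def del: transpose_matrix_vector)
              then show ?thesis using sc.cN_pos[OF elim(1)] by (simp add: matrix_vector_mult_scaleR del: transpose_matrix_vector)
            qed
            then show "\<phi> N ((1 / sc.cN N) *\<^sub>R (transpose \<psi> *v (z - eta \<alpha> L CARD('n) N *\<^sub>R \<upsilon>))) = z"
              unfolding phi sc.phi_affine .
          qed
          then show ?thesis by (rule surj_f_inv_f)
        qed
        then show "B \<le> norm x" using elim(2)[rule_format, OF y] unfolding phi[symmetric] by simp
      qed
    qed
    \<comment> \<open>On the support of \<open>h N\<close> the potential is at most \<epsilon> and
      \<open>exp (\<gamma> * U)\<close> at least 1. Hence \<open>qint\<close> is at most \<epsilon>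
      times \<open>Hint\<close>, and \<open>N * Hint\<close> stays bounded.\<close>
    have Nq: "(\<lambda>N. real N * g.mf.qint (h N)) \<longlonglongrightarrow> 0"
    proof (rule LIMSEQ_I)
      fix r :: real assume r: "0 < r"
      define \<epsilon> where "\<epsilon> = r / (2 * (\<bar>lam\<bar> + 1))"
      have e: "0 < \<epsilon>" using r by (simp add: \<epsilon>_def)
      obtain R0 where R0: "\<And>x. R0 \<le> norm x \<Longrightarrow> (\<integral>y. g.gs x y \<partial>g.Mr) \<le> \<epsilon>" using g.potential_vanishes[OF e] by blast
      have "\<forall>\<^sub>F N in sequentially. real N * g.mf.Hint (h N) < \<bar>lam\<bar> + 1" by (rule order_tendstoD[OF NH]) simp
      then have "\<forall>\<^sub>F N in sequentially. norm (real N * g.mf.qint (h N) - 0) < r"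
        using far[of R0]
      proof eventually_elim
        case (elim N)
        have q0: "0 \<le> g.mf.qint (h N)" by (rule g.mf.qint_nonneg) (rule h01)
        have hm': "h N \<in> borel_measurable g.Mr" using hm by simp
        have "g.mf.qint (h N) \<le> (\<integral>x. \<epsilon> * (h N x * exp (\<gamma> * g.mf.U x)) \<partial>g.Mr)"
          unfolding g.mf.qint_def
        proof (rule integral_mono)
          show "integrable g.Mr (\<lambda>x. h N x * g.mf.U x)" by (rule g.mf.tilted_integrable(3)[OF h01 hm'])
          show "integrable g.Mr (\<lambda>x. \<epsilon> * (h N x * exp (\<gamma> * g.mf.U x)))"
            by (rule integrable_mult_right) (rule g.mf.tilted_integrable(1)[OF h01 hm'])
          fix x
          show "h N x * g.mf.U x \<le> \<epsilon> * (h N x * exp (\<gamma> * g.mf.U x))"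
          proof (cases "h N x = 0")
            case False
            then have "g.mf.U x \<le> \<epsilon>" using elim(2) R0[of x] unfolding g.mf.U_def by blast
            have "g.mf.U x \<le> \<epsilon> * exp (\<gamma> * g.mf.U x)"
            proof -
              have "\<epsilon> * 1 \<le> \<epsilon> * exp (\<gamma> * g.mf.U x)"
                by (rule mult_left_mono) (use e assms(3) g.mf.U_nonneg[of x] in simp_all)
              then show ?thesis using \<open>g.mf.U x \<le> \<epsilon>\<close> by linarith
            qed
            then have "h N x * g.mf.U x \<le> h N x * (\<epsilon> * exp (\<gamma> * g.mf.U x))" by (rule mult_left_mono) (rule h01)
            then show ?thesis by (simp add: mult_ac)
          qed simp
        qed
        also have "\<dots> = \<epsilon> * g.mf.Hint (h N)" by (simp add: g.mf.Hint_def)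
        finally have "real N * g.mf.qint (h N) \<le> real N * (\<epsilon> * g.mf.Hint (h N))" by (rule mult_left_mono) simp
        also have "\<dots> = \<epsilon> * (real N * g.mf.Hint (h N))" by simp
        also have "\<dots> \<le> \<epsilon> * (\<bar>lam\<bar> + 1)" using elim(1) e by (intro mult_left_mono) auto
        also have "\<dots> = r / 2"
        proof -
          have "\<bar>lam\<bar> + 1 \<noteq> 0" by linarith
          then show ?thesis unfolding \<epsilon>_def by (simp add: field_simps)
        qed
        finally show ?case using r q0 by simp
      qed
      then show "\<exists>no. \<forall>N\<ge>no. norm (real N * g.mf.qint (h N) - 0) < r" unfolding eventually_sequentially .
    qed
    have hmM: "h N \<in> borel_measurable g.Mr" for N using hm by simp
    have main: "(\<lambda>N. (\<integral>x. g.mf.wt (\<beta> N) {..<N} x * (\<Prod>i<N. 1 - h N (x i)) \<partial>PiM {..<N} (\<lambda>_. g.Mr)) / g.mf.zpart (\<beta> N) N) \<longlonglongrightarrow> exp (- lam)"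
      by (rule lim.poisson_limit[OF h01 hmM NH Nq])
    have "\<forall>\<^sub>F N in sequentially. (\<integral>x. g.mf.wt (\<beta> N) {..<N} x * (\<Prod>i<N. 1 - h N (x i)) \<partial>PiM {..<N} (\<lambda>_. g.Mr)) / g.mf.zpart (\<beta> N) N =
      laplace_functional (gibbs s \<alpha> (\<beta> N) N) (\<lambda>x. sum_dirac N (\<lambda>j. inv (\<phi> N) (x j))) f"
      using ep
    proof eventually_elim
      case (elim N)
      have F': "exp (- (\<integral>y. f y \<partial>sum_dirac N (\<lambda>j. inv (\<phi> N) (x j)))) = (\<Prod>i<N. 1 - h N (x i))" for x
        unfolding g.sum_dirac_integral[OF fm] using elim by (simp add: h_def F_def exp_sum sum_negf[symmetric])
      have c: "(\<lambda>x. h N (x i)) \<in> borel_measurable (lebesgue_config N)" if "i < N" for i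
        by (rule measurable_compose[OF _ hm]) (use measurable_component_singleton[of i "{..<N}" "\<lambda>_. lborel :: (real^'n) measure"] that in simp)
      have "laplace_functional (gibbs s \<alpha> (\<beta> N) N) (\<lambda>x. sum_dirac N (\<lambda>j. inv (\<phi> N) (x j))) f = (\<integral>x. (\<Prod>i<N. 1 - h N (x i)) \<partial>gibbs s \<alpha> (\<beta> N) N)"
        unfolding laplace_functional_def F' ..
      also have "\<dots> = (\<integral>x. g.mf.wt (\<beta> N) {..<N} x * (\<Prod>i<N. 1 - h N (x i)) \<partial>PiM {..<N} (\<lambda>_. g.Mr)) / g.mf.zpart (\<beta> N) N"
      proof (rule g.gibbs_integral)
        show "0 \<le> \<beta> N" using assms(5)[of N] by simp
        show "(\<lambda>x. \<Prod>i<N. 1 - h N (x i)) \<in> borel_measurable (lebesgue_config N)"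
          by (intro borel_measurable_prod borel_measurable_diff borel_measurable_const c) auto
        show "0 \<le> (\<Prod>i<N. 1 - h N (x i))" "(\<Prod>i<N. 1 - h N (x i)) \<le> 1" for x
          using h01 by (auto intro!: prod_nonneg prod_le_1)
      qed
      finally show ?case by simp
    qed
    from Lim_transform_eventually[OF main this]
    have "(\<lambda>N. laplace_functional (gibbs s \<alpha> (\<beta> N) N) (\<lambda>x. sum_dirac N (\<lambda>j. inv (\<phi> N) (x j))) f) \<longlonglongrightarrow> exp (- lam)" .
    moreover have "laplace_functional \<Omega> \<Xi> f = exp (- lam)"
    proof -
      have "laplace_functional \<Omega> \<Xi> f = exp (\<integral>x. (exp (- f x) - 1) * exp (- (axis k 1 \<bullet> x)) \<partial>lborel)"
        using P f by (auto simp: poisson_process_def)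
      also have "(\<integral>x. (exp (- f x) - 1) * exp (- (axis k 1 \<bullet> x)) \<partial>lborel) = (\<integral>x. - (F x * exp (- (axis k 1 \<bullet> x))) \<partial>lborel)"
        by (intro Bochner_Integration.integral_cong refl) (simp add: F_def algebra_simps)
      also have "\<dots> = - lam" by (simp add: lam_def)
      finally show ?thesis .
    qed
    ultimately show ?thesis by simp
  qed
  then show ?thesis using P unfolding converges_in_distribution_def by blast
qed

end
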